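(* Let $\nu$ be a probability measure on $\mathbb{R}$ with $\nu\{0\}=0$. Then $$T^\nu:=\inf\{t>0:\ \ell^0[0,t]=\ell^\nu[0,t]\}$$ is a minimal unbiased shift.
   Context: Let $\Omega$ be the set of continuous functions $\omega:\mathbb{R}\to\mathbb{R}$ with the Kolmogorov product $\sigma$-algebra $\mathcal{A}$, let $B=(B_t)_{t\in\mathbb{R}}$ be the identity (coordinate process) on $\Omega$, and let $\mathbb{P}_0$ be the law of a two-sided standard Brownian motion with $B_0=0$. Put $\mathbb{P}_x:=\mathbb{P}_0\{B+x\in\cdot\}$ for $x\in\mathbb{R}$, and $(\theta_t\omega)_s:=\omega_{t+s}$ for $s,t\in\mathbb{R}$. Random times. A random time is a measurable function $T$ of $B$ with values in $\mathbb{R}$ (a time given by a formula that may be infinite on a $\mathbb{P}_0$-null set is understood up to that null set). $T$ is an unbiased shift if, under $\mathbb{P}_0$, $(B_{T+t}-B_T)_{t\in\mathbb{R}}$ is a two-sided standard Brownian motion independent of $B_T$. An unbiased shift $T$ is a minimal unbiased shift if $\mathbb{P}_0\{T\ge0\}=1$ and any other unbiased shift $S$ such that $\mathbb{P}_0\{0\le S\le T\}=1$ and $\mathbb{P}_0\{B_T\in\cdot\}=\mathbb{P}_0\{B_S\in\cdot\}$ satisfies $\mathbb{P}_0\{S=T\}=1$. Local times. $\ell^x$ denotes the random measure on $\mathbb{R}$ associated with the local time of $B$ at $x\in\mathbb{R}$: for all measurable $f:\mathbb{R}^2\to[0,\infty)$, $\int f(B_s,s)\,ds=\iint f(x,s)\,\ell^x(ds)\,dx$,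 $\mathbb{P}_0$-a.s. A version is fixed such that: $\ell^0$ is $\mathbb{P}_x$-a.e. diffuse (atomless) for every $x$; $\ell^0(\theta_t\omega,C-t)=\ell^0(\omega,C)$ for all Borel $C\subset\mathbb{R}$ and $t\in\mathbb{R}$, $\mathbb{P}_x$-a.s. for every $x$; $\ell^y(\omega,\cdot)=\ell^0(\omega-y,\cdot)$ for all $\omega,y$; and $\int \mathbf{1}\{B_t\neq x\}\,\ell^x(\omega,dt)=0$ for all $\omega,x$. For a locally finite measure $\nu$ on $\mathbb{R}$, $\ell^\nu(\omega,\cdot):=\int\ell^x(\omega,\cdot)\,\nu(dx)$. *)

theory Defs
  imports "HOL-Probability.Probability"
begin

text \<open>
  Paths are total functions; the space of this measure is the set of continuous ones, with the
  trace of the Kolmogorov product sigma-algebra. Only its space and sigma-algebra matter.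
\<close>

definition path_space :: "(real \<Rightarrow> real) measure" where
  "path_space = restrict_space (\<Pi>\<^sub>M t\<in>UNIV. borel) {\<omega>. continuous_on UNIV \<omega>}"

definition shift_path :: "real \<Rightarrow> (real \<Rightarrow> real) \<Rightarrow> real \<Rightarrow> real" where
  "shift_path t \<omega> = (\<lambda>s. \<omega> (t + s))"

definition two_sided_BM :: "'a measure \<Rightarrow> (real \<Rightarrow> 'a \<Rightarrow> real) \<Rightarrow> bool" where
  "two_sided_BM M X \<longleftrightarrow>
     prob_space M \<and>
     (\<forall>t. X t \<in> borel_measurable M) \<and>
     (\<forall>w\<in>space M. continuous_on UNIV (\<lambda>t. X t w)) \<and>
     (AE w in M. X 0 w = 0) \<and>
     (\<forall>s t. s < t \<longrightarrow>
        distributed M lborel (\<lambda>w. X t w - X s w) (normal_density 0 (sqrt (t - s)))) \<and>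
     (\<forall>(t :: nat \<Rightarrow> real) n. (\<forall>i<n. t i < t (Suc i)) \<longrightarrow>
        prob_space.indep_vars M (\<lambda>_. borel) (\<lambda>i w. X (t (Suc i)) w - X (t i) w) {..<n})"

text \<open>This determines \<open>P0\<close> uniquely: it is the law of two-sided Brownian motion started at 0.\<close>

definition BM_law :: "(real \<Rightarrow> real) measure \<Rightarrow> bool" where
  "BM_law P0 \<longleftrightarrow>
     space P0 = space path_space \<and> sets P0 = sets path_space \<and> two_sided_BM P0 (\<lambda>t \<omega>. \<omega> t)"

definition BM_from :: "(real \<Rightarrow> real) measure \<Rightarrow> real \<Rightarrow> (real \<Rightarrow> real) measure" where
  "BM_from P0 x = distr P0 path_space (\<lambda>\<omega> s. \<omega> s + x)"

text \<open>
  The library's \<open>indep_var\<close> requires both random variables to have the same value type;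
  the following is its characterisation \<open>indep_var_eq\<close> without that restriction.
\<close>

definition indep_rvs ::
    "'a measure \<Rightarrow> 'b measure \<Rightarrow> ('a \<Rightarrow> 'b) \<Rightarrow> 'c measure \<Rightarrow> ('a \<Rightarrow> 'c) \<Rightarrow> bool" where
  "indep_rvs M S X T Y \<longleftrightarrow>
     X \<in> measurable M S \<and> Y \<in> measurable M T \<and>
     prob_space.indep_set M
       (sigma_sets (space M) {X -` A \<inter> space M | A. A \<in> sets S})
       (sigma_sets (space M) {Y -` A \<inter> space M | A. A \<in> sets T})"

definition unbiased_shift :: "(real \<Rightarrow> real) measure \<Rightarrow> ((real \<Rightarrow> real) \<Rightarrow> real) \<Rightarrow> bool" where
  "unbiased_shift P0 T \<longleftrightarrow>
     T \<in> borel_measurable path_space \<and>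
     two_sided_BM P0 (\<lambda>t \<omega>. \<omega> (T \<omega> + t) - \<omega> (T \<omega>)) \<and>
     indep_rvs P0 path_space (\<lambda>\<omega> t. \<omega> (T \<omega> + t) - \<omega> (T \<omega>)) borel (\<lambda>\<omega>. \<omega> (T \<omega>))"

definition minimal_unbiased_shift ::
    "(real \<Rightarrow> real) measure \<Rightarrow> ((real \<Rightarrow> real) \<Rightarrow> real) \<Rightarrow> bool" where
  "minimal_unbiased_shift P0 T \<longleftrightarrow>
     unbiased_shift P0 T \<and>
     (AE \<omega> in P0. 0 \<le> T \<omega>) \<and>
     (\<forall>S. unbiased_shift P0 S \<and>
          (AE \<omega> in P0. 0 \<le> S \<omega> \<and> S \<omega> \<le> T \<omega>) \<and>
          distr P0 borel (\<lambda>\<omega>. \<omega> (T \<omega>)) = distr P0 borel (\<lambda>\<omega>. \<omega> (S \<omega>))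
        \<longrightarrow> (AE \<omega> in P0. S \<omega> = T \<omega>))"

text \<open>
  A time given by a formula, possibly infinite or non-measurable on a null set, is understood up
  to null sets: it must agree almost surely with some real-valued random time, and all
  such random times must be minimal unbiased shifts.
\<close>

definition minimal_unbiased_shift_AE ::
    "(real \<Rightarrow> real) measure \<Rightarrow> ((real \<Rightarrow> real) \<Rightarrow> ereal) \<Rightarrow> bool" where
  "minimal_unbiased_shift_AE P0 \<tau> \<longleftrightarrow>
     (\<exists>T\<in>borel_measurable path_space. AE \<omega> in P0. \<tau> \<omega> = ereal (T \<omega>)) \<and>
     (\<forall>T\<in>borel_measurable path_space.
        (AE \<omega> in P0. \<tau> \<omega> = ereal (T \<omega>)) \<longrightarrow> minimal_unbiased_shift P0 T)"

text \<open>A kernel from paths to the real line, locally finite almost everywhere.\<close>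

definition random_measure ::
    "(real \<Rightarrow> real) measure \<Rightarrow> ((real \<Rightarrow> real) \<Rightarrow> real measure) \<Rightarrow> bool" where
  "random_measure P0 \<xi> \<longleftrightarrow>
     (\<forall>\<omega>\<in>space path_space. sets (\<xi> \<omega>) = sets borel) \<and>
     (\<forall>C\<in>sets borel. (\<lambda>\<omega>. emeasure (\<xi> \<omega>) C) \<in> borel_measurable path_space) \<and>
     (\<forall>x. AE \<omega> in BM_from P0 x. \<forall>C. compact C \<longrightarrow> emeasure (\<xi> \<omega>) C < \<infinity>)"

text \<open>
  \<open>L x \<omega>\<close> is the local time measure at level \<open>x\<close>. The clauses are: the occupation time formula,
  diffuseness, shift invariance, compatibility of levels, and support in the level set. The
  exceptional null sets may depend on \<open>f\<close>, respectively on \<open>t\<close> and \<open>C\<close>. The set \<open>C - t\<close> is the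
  preimage of \<open>C\<close> under \<open>s \<mapsto> s + t\<close>.
\<close>

definition local_time ::
    "(real \<Rightarrow> real) measure \<Rightarrow> (real \<Rightarrow> (real \<Rightarrow> real) \<Rightarrow> real measure) \<Rightarrow> bool" where
  "local_time P0 L \<longleftrightarrow>
     (\<forall>x. random_measure P0 (L x)) \<and>
     (\<forall>f :: real \<times> real \<Rightarrow> real. f \<in> borel_measurable borel \<and> (\<forall>z. 0 \<le> f z) \<longrightarrow>
        (AE \<omega> in P0. (\<integral>\<^sup>+ s. f (\<omega> s, s) \<partial>lborel) = (\<integral>\<^sup>+ x. (\<integral>\<^sup>+ s. f (x, s) \<partial>L x \<omega>) \<partial>lborel))) \<and>
     (\<forall>x. AE \<omega> in BM_from P0 x. \<forall>s. emeasure (L 0 \<omega>) {s} = 0) \<and>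
     (\<forall>t. \<forall>C\<in>sets borel. \<forall>x. AE \<omega> in BM_from P0 x.
        emeasure (L 0 (shift_path t \<omega>)) {s. s + t \<in> C} = emeasure (L 0 \<omega>) C) \<and>
     (\<forall>\<omega>\<in>space path_space. \<forall>y. L y \<omega> = L 0 (\<lambda>s. \<omega> s - y)) \<and>
     (\<forall>\<omega>\<in>space path_space. \<forall>x. (\<integral>\<^sup>+ t. indicator {t. \<omega> t \<noteq> x} t \<partial>L x \<omega>) = 0)"

definition mixed_local_time ::
    "(real \<Rightarrow> (real \<Rightarrow> real) \<Rightarrow> real measure) \<Rightarrow> real measure \<Rightarrow> (real \<Rightarrow> real) \<Rightarrow> real set \<Rightarrow> ennreal" where
  "mixed_local_time L \<nu> \<omega> C = (\<integral>\<^sup>+ x. emeasure (L x \<omega>) C \<partial>\<nu>)"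

text \<open>The infimum is taken in the extended reals, so that it is \<open>\<infinity>\<close> if there is no such \<open>t\<close>.\<close>

definition T_nu ::
    "(real \<Rightarrow> (real \<Rightarrow> real) \<Rightarrow> real measure) \<Rightarrow> real measure \<Rightarrow> (real \<Rightarrow> real) \<Rightarrow> ereal" where
  "T_nu L \<nu> \<omega> =
     Inf {ereal t | t. 0 < t \<and> emeasure (L 0 \<omega>) {0..t} = mixed_local_time L \<nu> \<omega> {0..t}}"

end

theory Submission
  imports Defs
begin

text \<open>
  Start Brownian motion from Lebesgue measure. The resulting infinite measure on paths is invariant
  under shifts, and by the occupation time formula the Palm measures of the local times \<open>\<ell>\<^sup>0\<close>
  and \<open>\<ell>\<^sup>\<nu>\<close> with respect to it are the laws of Brownian motion started in 0 and started
  from \<open>\<nu>\<close>.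

  Let \<open>F\<close> be the continuous function \<open>\<ell>\<^sup>0[0,t] - \<ell>\<^sup>\<nu>[0,t]\<close>, extended to negative times as
  a difference of distribution functions. Matching each point \<open>s\<close> of \<open>\<ell>\<^sup>0\<close> with the first time
  after \<open>s\<close> at which \<open>F\<close> drops below \<open>F s\<close> transports \<open>\<ell>\<^sup>0\<close>, restricted to the points that have
  a match, to \<open>\<ell>\<^sup>\<nu>\<close> restricted to the points that are reached. By the Palm formulas this is an
  identity between the law of the path shifted by \<open>T\<^sup>\<nu>\<close> on \<open>{T\<^sup>\<nu> < \<infinity>}\<close> and Brownian motion
  started from \<open>\<nu>\<close>, restricted to the paths for which 0 is reached.

  If \<open>T\<^sup>\<nu> = \<infinity>\<close>, then \<open>F\<close> is bounded from below on the positive half-line. The probability of this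
  shift invariant event does not depend on the starting level: by Brownian scaling and continuity of
  translation in \<open>L\<^sup>1\<close>, applied to the occupation density, long occupation measures at two levels
  are asymptotically indistinguishable. On this event the points of \<open>\<ell>\<^sup>\<nu>\<close> that are
  not reached have finite total mass, so they are almost surely absent by conservativity of the
  shift. Hence both sides of the identity have full mass, \<open>T\<^sup>\<nu>\<close> is almost surely finite, and it is
  an unbiased shift.

  A further unbiased shift \<open>S \<le> T\<^sup>\<nu>\<close> with the same distribution of \<open>B\<^sub>S\<close> also transports
  \<open>\<ell>\<^sup>0\<close> to \<open>\<ell>\<^sup>\<nu>\<close>. Since \<open>F\<close> returns to the level \<open>F s\<close> at the match of \<open>s\<close>, mass balance on
  the interval between them forces the two transports to agree.
\<close>

section \<open>Path space and kernels\<close>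

text \<open>The obstacle is null sets. Shift invariance of the local time is given only almost
  surely for each fixed time and set, while the matching needs it at uncountably many random times.
  The Palm formula bridges this: what holds almost surely at each fixed time holds, for the measure
  started from Lebesgue, at local-time almost every point of almost every path, and such statements
  can be carried back. To remain within countably many conditions, events about \<open>F\<close> are
  encoded with rational offsets and recovered by continuity.

  The assumption that \<nu> does not charge 0 makes \<ell>^0 and \<ell>^\<nu> mutually singular,
  since they live on different level sets. Singularity yields that from \<ell>^0-almost every point
  \<open>F\<close> does not even touch its level before it passes below it. Hence the first zero of
  \<open>F\<close> after time 0, which defines T^\<nu>, is almost surely the first passage below 0,
  which is the time that the matching handles. The same assumption gives T^\<nu> > 0, because the
  path at that time has law \<nu>.\<close>

lemma space_path_space: "space path_space = {\<omega>. continuous_on UNIV \<omega>}"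
  by (simp add: path_space_def space_restrict_space space_PiM)

lemma path_continuous: "\<omega> \<in> space path_space \<Longrightarrow> continuous_on A \<omega>"
  using continuous_on_subset by (auto simp: space_path_space)

lemma measurable_eval: "(\<lambda>\<omega>. \<omega> t) \<in> borel_measurable path_space"
  unfolding path_space_def by (rule measurable_restrict_space1) simp

lemma measurable_path_spaceI:
  assumes "\<And>t. (\<lambda>w. X w t) \<in> borel_measurable M"
    and "\<And>w. w \<in> space M \<Longrightarrow> continuous_on UNIV (X w)"
  shows "X \<in> measurable M path_space"
  unfolding path_space_def
proof (rule measurable_restrict_space2)
  show "X \<in> space M \<rightarrow> {\<omega>. continuous_on UNIV \<omega>}"
    using assms(2) by auto
  show "X \<in> measurable M (\<Pi>\<^sub>M t\<in>UNIV. borel)"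
    by (rule measurable_PiM_single') (auto simp: assms(1))
qed

text \<open>Joint measurability comes from continuity of the paths: the time is rounded down to a
  grid of mesh 1/(n+1), which leaves countably many values, and then n tends to infinity.\<close>

lemma measurable_eval_pair:
  "(\<lambda>p. fst p (snd p)) \<in> borel_measurable (path_space \<Otimes>\<^sub>M borel)"
proof (rule borel_measurable_LIMSEQ_real)
  define u where "u n p = fst p (real_of_int \<lfloor>real (Suc n) * snd p\<rfloor> / real (Suc n))"
    for n and p :: "(real \<Rightarrow> real) \<times> real"
  note measurable_eval [measurable]
  show "u n \<in> borel_measurable (path_space \<Otimes>\<^sub>M borel)" for n
    unfolding u_def
    by (rule measurable_compose_countable[where g="\<lambda>p. \<lfloor>real (Suc n) * snd p\<rfloor>"]) measurable
  show "(\<lambda>n. u n p) \<longlonglongrightarrow> fst p (snd p)"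
    if p0: "p \<in> space (path_space \<Otimes>\<^sub>M borel)" for p
  proof -
    obtain \<omega> t where p: "p = (\<omega>, t)" and c: "continuous_on UNIV \<omega>"
      using p0 by (cases p) (auto simp: space_pair_measure space_path_space)
    have "(\<lambda>n. real_of_int \<lfloor>real (Suc n) * t\<rfloor> / real (Suc n)) \<longlonglongrightarrow> t"
    proof (rule tendsto_sandwich)
      show "(\<lambda>n. t - 1 / real (Suc n)) \<longlonglongrightarrow> t"
        using tendsto_diff[OF tendsto_const[of t] LIMSEQ_inverse_real_of_nat]
        by (simp add: inverse_eq_divide)
      show "(\<lambda>_::nat. t) \<longlonglongrightarrow> t" by simp
      have "t - 1 / N \<le> real_of_int \<lfloor>N * t\<rfloor> / N" if "0 < N" for N :: real
      proof -
        have "(t - 1 / N) * N = N * t - 1" using that by (simp add: field_simps)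
        also have "\<dots> \<le> real_of_int \<lfloor>N * t\<rfloor>" by linarith
        finally show ?thesis using that by (simp add: pos_le_divide_eq)
      qed
      then show "\<forall>\<^sub>F n in sequentially. t - 1 / real (Suc n)
          \<le> real_of_int \<lfloor>real (Suc n) * t\<rfloor> / real (Suc n)"
        by (intro always_eventually allI) (simp del: of_nat_Suc)
      have "real_of_int \<lfloor>N * t\<rfloor> / N \<le> t" if "0 < N" for N :: real
        using that by (metis mult.commute of_int_floor_le pos_divide_le_eq)
      then show "\<forall>\<^sub>F n in sequentially. real_of_int \<lfloor>real (Suc n) * t\<rfloor> / real (Suc n) \<le> t"
        by (intro always_eventually allI) (simp del: of_nat_Suc)
    qed
    then show ?thesis
      unfolding u_def p fst_conv snd_conv
      by (rule isCont_tendsto_compose[rotated]) (use c in \<open>simp add: continuous_on_eq_continuous_at\<close>)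
  qed
qed

lemma measurable_eval_at:
  assumes "f \<in> measurable M path_space" "g \<in> borel_measurable M"
  shows "(\<lambda>x. f x (g x)) \<in> borel_measurable M"
  using measurable_compose[OF measurable_Pair[OF assms] measurable_eval_pair] by simp

section \<open>Vertical translations and time shifts of paths\<close>

definition raise :: "real \<Rightarrow> (real \<Rightarrow> real) \<Rightarrow> real \<Rightarrow> real" where
  "raise x \<omega> = (\<lambda>s. \<omega> s + x)"

lemma raise_simps [simp]:
  "raise x \<omega> s = \<omega> s + x" "raise x (raise y \<omega>) = raise (x + y) \<omega>" "raise 0 \<omega> = \<omega>"
  by (auto simp: raise_def)

lemma shift_path_simps [simp]:
  "shift_path t \<omega> s = \<omega> (t + s)" "shift_path t (shift_path s \<omega>) = shift_path (s + t) \<omega>"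
  "shift_path 0 \<omega> = \<omega>" "shift_path t (raise x \<omega>) = raise x (shift_path t \<omega>)"
  by (auto simp: shift_path_def raise_def add.assoc)

lemma raise_in_space [simp]: "\<omega> \<in> space path_space \<Longrightarrow> raise x \<omega> \<in> space path_space"
  by (auto simp: space_path_space raise_def intro!: continuous_intros)

lemma shift_in_space [simp]: "\<omega> \<in> space path_space \<Longrightarrow> shift_path x \<omega> \<in> space path_space"
  by (auto simp: space_path_space shift_path_def intro!: continuous_on_compose2[of UNIV \<omega>] continuous_intros)

lemma measurable_raise [measurable (raw)]:
  assumes "f \<in> measurable M path_space" "g \<in> borel_measurable M"
  shows "(\<lambda>x. raise (g x) (f x)) \<in> measurable M path_space"
proof (rule measurable_path_spaceI)
  note assms [measurable]
  show "(\<lambda>w. raise (g w) (f w) t) \<in> borel_measurable M" for t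
    using measurable_eval_at[OF assms(1), of "\<lambda>_. t"] by simp
  show "continuous_on UNIV (raise (g w) (f w))" if "w \<in> space M" for w
    using raise_in_space[OF measurable_space[OF assms(1) that]] by (simp add: space_path_space)
qed

lemma measurable_shift_path [measurable (raw)]:
  assumes "f \<in> measurable M path_space" "g \<in> borel_measurable M"
  shows "(\<lambda>x. shift_path (g x) (f x)) \<in> measurable M path_space"
proof (rule measurable_path_spaceI)
  note assms [measurable]
  show "(\<lambda>w. shift_path (g w) (f w) t) \<in> borel_measurable M" for t
    using measurable_eval_at[OF assms(1), of "\<lambda>w. g w + t"] by simp
  show "continuous_on UNIV (shift_path (g w) (f w))" if "w \<in> space M" for w
    using shift_in_space[OF measurable_space[OF assms(1) that]] by (simp add: space_path_space)
qed

text \<open>Finiteness is tested on one sequence of intervals that exhausts the line, the same for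
  all points, so that monotone class arguments can be run on the truncations to these
  intervals.\<close>

definition lf_kernel :: "'a measure \<Rightarrow> ('a \<Rightarrow> real measure) \<Rightarrow> bool" where
  "lf_kernel M \<kappa> \<longleftrightarrow>
     (\<forall>x\<in>space M. sets (\<kappa> x) = sets borel \<and> (\<forall>n::nat. emeasure (\<kappa> x) {- real n..real n} < \<infinity>)) \<and>
     (\<forall>C\<in>sets borel. (\<lambda>x. emeasure (\<kappa> x) C) \<in> borel_measurable M)"

lemma lf_kernelD:
  assumes "lf_kernel M \<kappa>"
  shows "x \<in> space M \<Longrightarrow> sets (\<kappa> x) = sets borel"
    "x \<in> space M \<Longrightarrow> emeasure (\<kappa> x) {- real n..real n} < \<infinity>"
    "C \<in> sets borel \<Longrightarrow> (\<lambda>x. emeasure (\<kappa> x) C) \<in> borel_measurable M"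
  using assms by (auto simp: lf_kernel_def)

lemma lf_kernel_finite_Icc:
  assumes "lf_kernel M \<kappa>" "x \<in> space M"
  shows "emeasure (\<kappa> x) {a..b} < \<infinity>"
proof -
  obtain n :: nat where n: "max \<bar>a\<bar> \<bar>b\<bar> \<le> real n"
    using real_arch_simple by blast
  have "emeasure (\<kappa> x) {a..b} \<le> emeasure (\<kappa> x) {- real n..real n}"
    using n lf_kernelD(1)[OF assms] by (intro emeasure_mono) auto
  then show ?thesis
    using lf_kernelD(2)[OF assms, of n] by (rule le_less_trans)
qed

lemma lf_kernel_compose:
  assumes "lf_kernel M \<kappa>" "h \<in> measurable N M"
  shows "lf_kernel N (\<lambda>y. \<kappa> (h y))"
  using assms measurable_compose[OF assms(2)] measurable_space[OF assms(2)]
  by (auto simp: lf_kernel_def)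

text \<open>Complements need finite mass, so the induction over rectangles is run for the kernel
  truncated to \<open>{- n..n}\<close>; the truncation is removed by monotone convergence.\<close>

lemma lf_kernel_emeasure_section:
  assumes \<kappa>: "lf_kernel M \<kappa>" and Q: "Q \<in> sets (M \<Otimes>\<^sub>M borel)"
  shows "(\<lambda>x. emeasure (\<kappa> x) {s. (x, s) \<in> Q}) \<in> borel_measurable M"
proof -
  let ?I = "\<lambda>n::nat. {- real n..real n}"
  have sets: "sets (\<kappa> x) = sets borel" if "x \<in> space M" for x
    using lf_kernelD(1)[OF \<kappa> that] .
  have sec: "{s. (x, s) \<in> Q} \<in> sets borel" if "Q \<in> sets (M \<Otimes>\<^sub>M borel)" for Q and x
    using sets_Pair1[OF that, of x] by (simp add: vimage_def)
  have fin: "(\<lambda>x. emeasure (\<kappa> x) ({s. (x, s) \<in> Q} \<inter> ?I n)) \<in> borel_measurable M"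
    if Q: "Q \<in> sets (M \<Otimes>\<^sub>M borel)" for n Q
    using Int_stable_pair_measure_generator pair_measure_closed[of M borel] Q[unfolded sets_pair_measure]
  proof (induction rule: sigma_sets_induct_disjoint)
    case (basic A)
    then obtain a b where A: "A = a \<times> b" "a \<in> sets M" "b \<in> sets borel" by auto
    have [measurable]: "(\<lambda>x. emeasure (\<kappa> x) (b \<inter> ?I n)) \<in> borel_measurable M"
      using lf_kernelD(3)[OF \<kappa>] A by auto
    note A(2)[measurable]
    have "(\<lambda>x. indicator a x * emeasure (\<kappa> x) (b \<inter> ?I n)) \<in> borel_measurable M" by measurable
    also have "(\<lambda>x. indicator a x * emeasure (\<kappa> x) (b \<inter> ?I n))
      = (\<lambda>x. emeasure (\<kappa> x) ({s. (x, s) \<in> A} \<inter> ?I n))"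
      by (auto simp: A indicator_def)
    finally show ?case .
  next
    case empty
    then show ?case by simp
  next
    case (compl A)
    then have A: "A \<in> sets (M \<Otimes>\<^sub>M borel)" by (simp add: sets_pair_measure)
    have [measurable]: "(\<lambda>x. emeasure (\<kappa> x) (?I n)) \<in> borel_measurable M"
      using lf_kernelD(3)[OF \<kappa>] by auto
    have "(\<lambda>x. emeasure (\<kappa> x) (?I n) - emeasure (\<kappa> x) ({s. (x, s) \<in> A} \<inter> ?I n)) \<in> borel_measurable M"
      using compl by measurable
    also have "?this \<longleftrightarrow> ?case"
    proof (rule measurable_cong)
      fix x assume x: "x \<in> space M"
      have "{s. (x, s) \<in> space M \<times> space borel - A} \<inter> ?I n = ?I n - ({s. (x, s) \<in> A} \<inter> ?I n)"
        using x by auto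
      moreover have "emeasure (\<kappa> x) (?I n - ({s. (x, s) \<in> A} \<inter> ?I n))
        = emeasure (\<kappa> x) (?I n) - emeasure (\<kappa> x) ({s. (x, s) \<in> A} \<inter> ?I n)"
      proof (rule emeasure_Diff)
        show "emeasure (\<kappa> x) ({s. (x, s) \<in> A} \<inter> ?I n) \<noteq> \<infinity>"
        proof -
          have "emeasure (\<kappa> x) ({s. (x, s) \<in> A} \<inter> ?I n) \<le> emeasure (\<kappa> x) (?I n)"
            by (intro emeasure_mono) (auto simp: sets x)
          then show ?thesis using lf_kernelD(2)[OF \<kappa> x, of n]
            by (auto simp: top_unique)
        qed
      qed (use sec[OF A] in \<open>auto simp: sets x\<close>)
      ultimately show "emeasure (\<kappa> x) (?I n) - emeasure (\<kappa> x) ({s. (x, s) \<in> A} \<inter> ?I n)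
        = emeasure (\<kappa> x) ({s. (x, s) \<in> space M \<times> space borel - A} \<inter> ?I n)" by simp
    qed
    finally show ?case .
  next
    case (union A)
    then have A: "\<And>i. A i \<in> sets (M \<Otimes>\<^sub>M borel)" by (auto simp: sets_pair_measure)
    have "(\<lambda>x. \<Sum>i. emeasure (\<kappa> x) ({s. (x, s) \<in> A i} \<inter> ?I n)) \<in> borel_measurable M"
      using union by measurable
    also have "?this \<longleftrightarrow> ?case"
    proof (rule measurable_cong)
      fix x assume x: "x \<in> space M"
      have "{s. (x, s) \<in> (\<Union>i. A i)} \<inter> ?I n = (\<Union>i. {s. (x, s) \<in> A i} \<inter> ?I n)" by auto
      moreover have "(\<Sum>i. emeasure (\<kappa> x) ({s. (x, s) \<in> A i} \<inter> ?I n))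
        = emeasure (\<kappa> x) (\<Union>i. {s. (x, s) \<in> A i} \<inter> ?I n)"
        using union(1) sec[OF A]
        by (intro suminf_emeasure) (auto simp: sets x disjoint_family_on_def)
      ultimately show "(\<Sum>i. emeasure (\<kappa> x) ({s. (x, s) \<in> A i} \<inter> ?I n))
        = emeasure (\<kappa> x) ({s. (x, s) \<in> (\<Union>i. A i)} \<inter> ?I n)" by simp
    qed
    finally show ?case .
  qed
  have "(\<lambda>x. SUP n. emeasure (\<kappa> x) ({s. (x, s) \<in> Q} \<inter> ?I n)) \<in> borel_measurable M"
    using fin[OF Q] by measurable
  also have "?this \<longleftrightarrow> ?thesis"
  proof (rule measurable_cong)
    fix x assume x: "x \<in> space M"
    have "(SUP n. emeasure (\<kappa> x) ({s. (x, s) \<in> Q} \<inter> ?I n))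
      = emeasure (\<kappa> x) (\<Union>n. {s. (x, s) \<in> Q} \<inter> ?I n)"
      using sec[OF Q] by (intro SUP_emeasure_incseq) (auto simp: sets x incseq_def)
    moreover have "(\<Union>n. {s. (x, s) \<in> Q} \<inter> ?I n) = {s. (x, s) \<in> Q}"
    proof -
      have "\<exists>n::nat. s \<in> ?I n" for s :: real
        using real_arch_simple[of "\<bar>s\<bar>"] by (auto simp: abs_le_iff minus_le_iff)
      then show ?thesis by auto
    qed
    ultimately show "(SUP n. emeasure (\<kappa> x) ({s. (x, s) \<in> Q} \<inter> ?I n))
      = emeasure (\<kappa> x) {s. (x, s) \<in> Q}" by simp
  qed
  finally show ?thesis .
qed

lemma lf_kernel_nn_integral:
  fixes f :: "'a \<times> real \<Rightarrow> ennreal"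
  assumes \<kappa>: "lf_kernel M \<kappa>" and f: "f \<in> borel_measurable (M \<Otimes>\<^sub>M borel)"
  shows "(\<lambda>x. \<integral>\<^sup>+ s. f (x, s) \<partial>\<kappa> x) \<in> borel_measurable M"
proof -
  have sets: "sets (\<kappa> x) = sets borel" if "x \<in> space M" for x
    using lf_kernelD(1)[OF \<kappa> that] .
  have meas: "(\<lambda>s. g (x, s)) \<in> borel_measurable (\<kappa> x)"
    if "x \<in> space M" "g \<in> borel_measurable (M \<Otimes>\<^sub>M borel)" for x and g :: "'a \<times> real \<Rightarrow> ennreal"
    using measurable_compose[OF measurable_Pair1'[OF that(1)] that(2)]
    by (simp add: measurable_cong_sets[OF sets[OF that(1)] refl])
  show ?thesis
    using f
  proof (induction rule: borel_measurable_induct)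
    case (cong f g)
    have "(\<lambda>x. \<integral>\<^sup>+ s. g (x, s) \<partial>\<kappa> x) \<in> borel_measurable M \<longleftrightarrow>
      (\<lambda>x. \<integral>\<^sup>+ s. f (x, s) \<partial>\<kappa> x) \<in> borel_measurable M"
      by (intro measurable_cong nn_integral_cong)
        (auto simp: space_pair_measure cong(3) sets_eq_imp_space_eq[OF sets])
    with cong show ?case by simp
  next
    case (set A)
    have "(\<lambda>x. \<integral>\<^sup>+ s. indicator A (x, s) \<partial>\<kappa> x) \<in> borel_measurable M \<longleftrightarrow>
      (\<lambda>x. emeasure (\<kappa> x) {s. (x, s) \<in> A}) \<in> borel_measurable M"
    proof (rule measurable_cong)
      fix x assume x: "x \<in> space M"
      have "{s. (x, s) \<in> A} \<in> sets (\<kappa> x)"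
        using sets_Pair1[OF set, of x] sets[OF x] by (simp add: vimage_def)
      then have "emeasure (\<kappa> x) {s. (x, s) \<in> A} = (\<integral>\<^sup>+ s. indicator {s. (x, s) \<in> A} s \<partial>\<kappa> x)" by simp
      also have "\<dots> = (\<integral>\<^sup>+ s. indicator A (x, s) \<partial>\<kappa> x)"
        by (intro nn_integral_cong) (auto simp: indicator_def)
      finally show "(\<integral>\<^sup>+ s. indicator A (x, s) \<partial>\<kappa> x) = emeasure (\<kappa> x) {s. (x, s) \<in> A}" ..
    qed
    then show ?case using lf_kernel_emeasure_section[OF \<kappa> set] by simp
  next
    case (mult u c)
    have "(\<lambda>x. \<integral>\<^sup>+ s. c * u (x, s) \<partial>\<kappa> x) \<in> borel_measurable M \<longleftrightarrow>
      (\<lambda>x. c * \<integral>\<^sup>+ s. u (x, s) \<partial>\<kappa> x) \<in> borel_measurable M"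
      by (intro measurable_cong nn_integral_cmult meas mult)
    with mult show ?case by simp
  next
    case (add u v)
    have "(\<lambda>x. \<integral>\<^sup>+ s. v (x, s) + u (x, s) \<partial>\<kappa> x) \<in> borel_measurable M \<longleftrightarrow>
      (\<lambda>x. (\<integral>\<^sup>+ s. v (x, s) \<partial>\<kappa> x) + (\<integral>\<^sup>+ s. u (x, s) \<partial>\<kappa> x)) \<in> borel_measurable M"
      by (intro measurable_cong nn_integral_add meas add)
    with add show ?case by simp
  next
    case (seq U)
    have "(\<lambda>x. \<integral>\<^sup>+ s. (SUP i. U i) (x, s) \<partial>\<kappa> x) \<in> borel_measurable M \<longleftrightarrow>
      (\<lambda>x. SUP i. (\<integral>\<^sup>+ s. U i (x, s) \<partial>\<kappa> x)) \<in> borel_measurable M"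
    proof (rule measurable_cong)
      fix x assume x: "x \<in> space M"
      show "(\<integral>\<^sup>+ s. (SUP i. U i) (x, s) \<partial>\<kappa> x) = (SUP i. (\<integral>\<^sup>+ s. U i (x, s) \<partial>\<kappa> x))"
        unfolding SUP_apply
        by (rule nn_integral_monotone_convergence_SUP)
          (use seq(3) in \<open>auto simp: incseq_def le_fun_def intro!: meas[OF x] seq\<close>)
    qed
    with seq show ?case by simp
  qed
qed

lemma lf_kernel_nn_integral' [measurable (raw)]:
  fixes f :: "'a \<Rightarrow> real \<Rightarrow> ennreal"
  assumes "lf_kernel M \<kappa>" "(\<lambda>p. f (fst p) (snd p)) \<in> borel_measurable (M \<Otimes>\<^sub>M borel)"
  shows "(\<lambda>x. \<integral>\<^sup>+ s. f x s \<partial>\<kappa> x) \<in> borel_measurable M"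
  using lf_kernel_nn_integral[OF assms] by simp

text \<open>The measure \<open>M\<close> composed with the kernel \<open>\<kappa>\<close>. The
  members of the kernel may have infinite mass, as local times on the whole line have;
  \<open>N\<close> only supplies the sigma-algebra.\<close>

definition mixture :: "'a measure \<Rightarrow> ('a \<Rightarrow> 'b measure) \<Rightarrow> 'b measure \<Rightarrow> 'b measure" where
  "mixture M \<kappa> N = measure_of (space N) (sets N) (\<lambda>C. \<integral>\<^sup>+ x. emeasure (\<kappa> x) C \<partial>M)"

lemma sets_mixture [simp]: "sets (mixture M \<kappa> N) = sets N"
  and space_mixture [simp]: "space (mixture M \<kappa> N) = space N"
  by (auto simp: mixture_def sets_measure_of_conv space_measure_of_conv sets.space_closed sets.sigma_sets_eq)

lemma emeasure_mixture:
  assumes "\<And>x. x \<in> space M \<Longrightarrow> sets (\<kappa> x) = sets N"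
    and meas: "\<And>C. C \<in> sets N \<Longrightarrow> (\<lambda>x. emeasure (\<kappa> x) C) \<in> borel_measurable M"
    and C: "C \<in> sets N"
  shows "emeasure (mixture M \<kappa> N) C = (\<integral>\<^sup>+ x. emeasure (\<kappa> x) C \<partial>M)"
  unfolding mixture_def
proof (rule emeasure_measure_of_sigma)
  show "sigma_algebra (space N) (sets N)" by (rule sets.sigma_algebra_axioms)
  show "positive (sets N) (\<lambda>C. \<integral>\<^sup>+ x. emeasure (\<kappa> x) C \<partial>M)" by (simp add: positive_def)
  show "countably_additive (sets N) (\<lambda>C. \<integral>\<^sup>+ x. emeasure (\<kappa> x) C \<partial>M)"
  proof (rule countably_additiveI)
    fix A :: "nat \<Rightarrow> 'b set"
    assume A: "range A \<subseteq> sets N" "disjoint_family A" "(\<Union>i. A i) \<in> sets N"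
    have "(\<Sum>i. \<integral>\<^sup>+ x. emeasure (\<kappa> x) (A i) \<partial>M) = (\<integral>\<^sup>+ x. (\<Sum>i. emeasure (\<kappa> x) (A i)) \<partial>M)"
      using A meas by (intro nn_integral_suminf[symmetric]) auto
    also have "\<dots> = (\<integral>\<^sup>+ x. emeasure (\<kappa> x) (\<Union>i. A i) \<partial>M)"
      using A assms(1) by (intro nn_integral_cong suminf_emeasure) auto
    finally show "(\<Sum>i. \<integral>\<^sup>+ x. emeasure (\<kappa> x) (A i) \<partial>M) = (\<integral>\<^sup>+ x. emeasure (\<kappa> x) (\<Union>i. A i) \<partial>M)" .
  qed
qed (rule C)

lemma nn_integral_mixture:
  assumes sets: "\<And>x. x \<in> space M \<Longrightarrow> sets (\<kappa> x) = sets N"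
    and meas: "\<And>C. C \<in> sets N \<Longrightarrow> (\<lambda>x. emeasure (\<kappa> x) C) \<in> borel_measurable M"
    and f: "f \<in> borel_measurable N"
  shows "(\<integral>\<^sup>+ s. f s \<partial>mixture M \<kappa> N) = (\<integral>\<^sup>+ x. \<integral>\<^sup>+ s. f s \<partial>\<kappa> x \<partial>M)"
proof -
  have mk: "g \<in> borel_measurable (\<kappa> x)" if "x \<in> space M" "g \<in> borel_measurable N" for g :: "'b \<Rightarrow> ennreal" and x
    using that by (simp add: measurable_cong_sets[OF sets[OF that(1)] refl])
  have sp: "space (\<kappa> x) = space N" if "x \<in> space M" for x
    using sets_eq_imp_space_eq[OF sets[OF that]] .
  have cg: "(F \<in> borel_measurable M \<and> c = (\<integral>\<^sup>+ x. F x \<partial>M))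
    \<longleftrightarrow> (G \<in> borel_measurable M \<and> c = (\<integral>\<^sup>+ x. G x \<partial>M))"
    if "\<And>x. x \<in> space M \<Longrightarrow> F x = G x" for F G :: "'a \<Rightarrow> ennreal" and c
    using measurable_cong[of M F G borel] nn_integral_cong[of M F G] that by auto
  \<comment> \<open>Measurability of the inner integral is carried along with the formula, because
    the induction steps for sums and suprema need it.\<close>
  have "(\<lambda>x. \<integral>\<^sup>+ s. f s \<partial>\<kappa> x) \<in> borel_measurable M \<and>
    (\<integral>\<^sup>+ s. f s \<partial>mixture M \<kappa> N) = (\<integral>\<^sup>+ x. \<integral>\<^sup>+ s. f s \<partial>\<kappa> x \<partial>M)"
    using f
  proof (induction rule: borel_measurable_induct)
    case (cong f g)
    have 1: "x \<in> space M \<Longrightarrow> (\<integral>\<^sup>+ s. g s \<partial>\<kappa> x) = (\<integral>\<^sup>+ s. f s \<partial>\<kappa> x)" for x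
      by (intro nn_integral_cong) (simp add: sp cong)
    have 2: "(\<integral>\<^sup>+ s. g s \<partial>mixture M \<kappa> N) = (\<integral>\<^sup>+ s. f s \<partial>mixture M \<kappa> N)"
      by (intro nn_integral_cong) (simp add: cong)
    show ?case using cong(4) 2 by (subst cg[OF 1[symmetric]]) (auto simp del: split_paired_All)
  next
    case (set A)
    have 1: "x \<in> space M \<Longrightarrow> (\<integral>\<^sup>+ s. indicator A s \<partial>\<kappa> x) = emeasure (\<kappa> x) A" for x
      using set sets by simp
    show ?case
      using set meas[OF set] by (subst cg[OF 1]) (auto simp: emeasure_mixture[OF sets meas set])
  next
    case (mult u c)
    have 1: "x \<in> space M \<Longrightarrow> (\<integral>\<^sup>+ s. c * u s \<partial>\<kappa> x) = c * (\<integral>\<^sup>+ s. u s \<partial>\<kappa> x)" for x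
      using mult by (intro nn_integral_cmult mk)
    have [measurable]: "u \<in> borel_measurable (mixture M \<kappa> N)"
      using mult by (simp add: measurable_cong_sets[OF sets_mixture refl])
    show ?case
      using mult by (subst cg[OF 1]) (auto simp: nn_integral_cmult)
  next
    case (add u v)
    have 1: "x \<in> space M \<Longrightarrow> (\<integral>\<^sup>+ s. v s + u s \<partial>\<kappa> x) = (\<integral>\<^sup>+ s. v s \<partial>\<kappa> x) + (\<integral>\<^sup>+ s. u s \<partial>\<kappa> x)" for x
      using add by (intro nn_integral_add mk)
    have [measurable]: "u \<in> borel_measurable (mixture M \<kappa> N)" "v \<in> borel_measurable (mixture M \<kappa> N)"
      using add by (simp_all add: measurable_cong_sets[OF sets_mixture refl])
    show ?case
      using add by (subst cg[OF 1]) (auto simp: nn_integral_add)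
  next
    case (seq U)
    have 1: "x \<in> space M \<Longrightarrow> (\<integral>\<^sup>+ s. (SUP i. U i) s \<partial>\<kappa> x) = (SUP i. \<integral>\<^sup>+ s. U i s \<partial>\<kappa> x)" for x
      unfolding SUP_apply
      by (rule nn_integral_monotone_convergence_SUP)
        (use seq(3) in \<open>auto simp: incseq_def le_fun_def intro!: mk seq\<close>)
    have 2: "(\<integral>\<^sup>+ s. (SUP i. U i) s \<partial>mixture M \<kappa> N) = (SUP i. \<integral>\<^sup>+ s. U i s \<partial>mixture M \<kappa> N)"
      unfolding SUP_apply
      by (rule nn_integral_monotone_convergence_SUP)
        (use seq(1,3) in \<open>auto simp: measurable_cong_sets[OF sets_mixture refl]\<close>)
    have 3: "(\<integral>\<^sup>+ x. (SUP i. \<integral>\<^sup>+ s. U i s \<partial>\<kappa> x) \<partial>M) = (SUP i. \<integral>\<^sup>+ x. \<integral>\<^sup>+ s. U i s \<partial>\<kappa> x \<partial>M)"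
      by (rule nn_integral_monotone_convergence_SUP)
        (use seq in \<open>auto simp: incseq_def le_fun_def intro!: nn_integral_mono\<close>)
    have [measurable]: "(\<lambda>x. \<integral>\<^sup>+ s. U i s \<partial>\<kappa> x) \<in> borel_measurable M" for i
      using seq by blast
    have "(\<lambda>x. SUP i. \<integral>\<^sup>+ s. U i s \<partial>\<kappa> x) \<in> borel_measurable M" by measurable
    then show ?case
      using seq by (subst cg[OF 1]) (auto simp: 2 3)
  qed
  then show ?thesis ..
qed

section \<open>Brownian motion\<close>

text \<open>The set of continuous functions is not an event of the product space. The measures are
  therefore compared after pushing them to the full product, where cylinders determine a finite
  measure; each event of the trace is the preimage of a product event.\<close>

lemma measure_eqI_path_space:
  assumes sets: "sets M = sets path_space" "sets N = sets path_space" and "finite_measure M"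
    and fdd: "\<And>J. finite J \<Longrightarrow> distr M (\<Pi>\<^sub>M t\<in>J. borel) (\<lambda>\<omega>. restrict \<omega> J)
      = distr N (\<Pi>\<^sub>M t\<in>J. borel) (\<lambda>\<omega>. restrict \<omega> J)"
  shows "M = N"
proof -
  interpret finite_measure M by fact
  let ?\<Pi> = "\<Pi>\<^sub>M t\<in>(UNIV :: real set). (borel :: real measure)"
  have sp: "space M = space path_space" "space N = space path_space"
    using sets sets_eq_imp_space_eq by blast+
  have incl0: "(\<lambda>\<omega>. \<omega>) \<in> measurable path_space ?\<Pi>"
    unfolding path_space_def by (rule measurable_restrict_space1) simp
  have incl: "(\<lambda>\<omega>. \<omega>) \<in> measurable M ?\<Pi>" "(\<lambda>\<omega>. \<omega>) \<in> measurable N ?\<Pi>"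
    using incl0 by (simp_all add: measurable_cong_sets[OF sets(1) refl] measurable_cong_sets[OF sets(2) refl])
  have r: "(\<lambda>\<omega>. restrict \<omega> J) \<in> measurable L (\<Pi>\<^sub>M t\<in>J. borel)"
    if "sets L = sets path_space" for J :: "real set" and L
    by (rule measurable_restrict) (simp add: measurable_cong_sets[OF that refl] measurable_eval)
  have emb: "emeasure (distr L ?\<Pi> (\<lambda>\<omega>. \<omega>)) (prod_emb UNIV (\<lambda>_. borel) J (Pi\<^sub>E J A))
    = emeasure (distr L (\<Pi>\<^sub>M t\<in>J. borel) (\<lambda>\<omega>. restrict \<omega> J)) (Pi\<^sub>E J A)"
    if L: "sets L = sets path_space" and J: "finite J" "\<And>t. t \<in> J \<Longrightarrow> A t \<in> sets borel" for L J and A :: "real \<Rightarrow> real set"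
  proof -
    have i: "(\<lambda>\<omega>. \<omega>) \<in> measurable L ?\<Pi>"
      using incl0 by (simp add: measurable_cong_sets[OF L refl])
    have A: "Pi\<^sub>E J A \<in> sets (\<Pi>\<^sub>M t\<in>J. borel)"
      using J by (intro sets_PiM_I_finite) auto
    have "prod_emb UNIV (\<lambda>_. borel) J (Pi\<^sub>E J A) \<inter> space L
      = (\<lambda>\<omega>. restrict \<omega> J) -` Pi\<^sub>E J A \<inter> space L"
      by (auto simp: prod_emb_def)
    moreover have "prod_emb UNIV (\<lambda>_. borel) J (Pi\<^sub>E J A) \<in> sets ?\<Pi>"
      using J by (intro sets_PiM_I) auto
    ultimately show ?thesis
      using A by (simp add: emeasure_distr[OF i] emeasure_distr[OF r[OF L]])
  qed
  have eq: "distr M ?\<Pi> (\<lambda>\<omega>. \<omega>) = distr N ?\<Pi> (\<lambda>\<omega>. \<omega>)"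
  proof (rule measure_eqI_PiM_infinite)
    show "finite_measure (distr M ?\<Pi> (\<lambda>\<omega>. \<omega>))"
      by (rule finite_measure_distr[OF incl(1)])
  qed (auto simp: emb sets fdd)
  show ?thesis
  proof (rule measure_eqI)
    fix A assume "A \<in> sets M"
    then have "A \<in> sets path_space" by (simp add: sets)
    then obtain B where B: "B \<in> sets ?\<Pi>" "A = {\<omega>. continuous_on UNIV \<omega>} \<inter> B"
      by (auto simp: path_space_def sets_restrict_space)
    have "emeasure (distr M ?\<Pi> (\<lambda>\<omega>. \<omega>)) B = emeasure M A"
      using B by (simp add: emeasure_distr[OF incl(1)] sp space_path_space Int_commute)
    moreover have "emeasure (distr N ?\<Pi> (\<lambda>\<omega>. \<omega>)) B = emeasure N A"
      using B by (simp add: emeasure_distr[OF incl(2)] sp space_path_space Int_commute)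
    ultimately show "emeasure M A = emeasure N A" by (simp add: eq)
  qed (simp add: sets)
qed

lemma two_sided_BMD:
  assumes "two_sided_BM M X"
  shows "s < t \<Longrightarrow> distributed M lborel (\<lambda>w. X t w - X s w) (normal_density 0 (sqrt (t - s)))"
    "(\<And>i. i < n \<Longrightarrow> u i < u (Suc i)) \<Longrightarrow>
      prob_space.indep_vars M (\<lambda>_. borel) (\<lambda>i w. X (u (Suc i)) w - X (u i) w) {..<n}"
  using assms unfolding two_sided_BM_def by simp_all

lemma two_sided_BM_path:
  assumes "two_sided_BM M X"
  shows "(\<lambda>w t. X t w) \<in> measurable M path_space"
  using assms by (intro measurable_path_spaceI) (auto simp: two_sided_BM_def)

lemma two_sided_BM_increments:
  assumes BM: "two_sided_BM M X" and n: "0 < n" and t: "\<And>i. i < n \<Longrightarrow> t i < t (Suc i)"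
  shows "distr M (\<Pi>\<^sub>M i\<in>{..<n}. borel) (\<lambda>w. \<lambda>i\<in>{..<n}. X (t (Suc i)) w - X (t i) w)
    = (\<Pi>\<^sub>M i\<in>{..<n}. density lborel (normal_density 0 (sqrt (t (Suc i) - t i))))"
proof -
  interpret prob_space M using BM by (simp add: two_sided_BM_def)
  have [measurable]: "X t \<in> borel_measurable M" for t using BM by (simp add: two_sided_BM_def)
  have "distr M (\<Pi>\<^sub>M i\<in>{..<n}. borel) (\<lambda>w. \<lambda>i\<in>{..<n}. X (t (Suc i)) w - X (t i) w)
    = (\<Pi>\<^sub>M i\<in>{..<n}. distr M borel (\<lambda>w. X (t (Suc i)) w - X (t i) w))"
    using BM n t by (subst indep_vars_iff_distr_eq_PiM'[symmetric]) (auto simp: two_sided_BM_def)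
  also have "\<dots> = (\<Pi>\<^sub>M i\<in>{..<n}. density lborel (normal_density 0 (sqrt (t (Suc i) - t i))))"
  proof (rule PiM_cong)
    fix i assume "i \<in> {..<n}"
    then have "distributed M lborel (\<lambda>w. X (t (Suc i)) w - X (t i) w) (normal_density 0 (sqrt (t (Suc i) - t i)))"
      using BM t by (simp add: two_sided_BM_def)
    then have "distr M lborel (\<lambda>w. X (t (Suc i)) w - X (t i) w)
      = density lborel (normal_density 0 (sqrt (t (Suc i) - t i)))"
      by (rule distributed_distr_eq_density)
    moreover have "distr M lborel (\<lambda>w. X (t (Suc i)) w - X (t i) w) = distr M borel (\<lambda>w. X (t (Suc i)) w - X (t i) w)"
      by (rule distr_cong) auto
    ultimately show "distr M borel (\<lambda>w. X (t (Suc i)) w - X (t i) w)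
      = density lborel (normal_density 0 (sqrt (t (Suc i) - t i)))" by simp
  qed simp
  finally show ?thesis .
qed

text \<open>The values at finitely many times are sums of increments over a grid containing 0, up to
  the null event that the path does not start in 0.\<close>

lemma two_sided_BM_fdd:
  assumes X: "two_sided_BM M X" and Y: "two_sided_BM N Y" and J: "finite J"
  shows "distr M (\<Pi>\<^sub>M t\<in>J. borel) (\<lambda>w. \<lambda>t\<in>J. X t w) = distr N (\<Pi>\<^sub>M t\<in>J. borel) (\<lambda>w. \<lambda>t\<in>J. Y t w)"
proof -
  \<comment> \<open>The time 0 anchors the values; the time 1 guarantees at least one increment,
    even if \<open>J\<close> is empty.\<close>
  define us where "us = sorted_list_of_set (J \<union> {0, 1::real})"
  define n where "n = length us - 1"
  have us: "set us = J \<union> {0, 1}" "sorted_wrt (<) us" "distinct us"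
    unfolding us_def using J
    by (simp_all only: set_sorted_list_of_set finite_Un finite_insert finite.emptyI
      strict_sorted_list_of_set distinct_sorted_list_of_set)
  have "card {0::real, 1} \<le> card (set us)" using us(1) J by (intro card_mono) auto
  then have len: "2 \<le> length us" using distinct_card[OF us(3)] by simp
  then have n: "0 < n" "length us = Suc n" by (auto simp: n_def)
  have t: "us ! i < us ! Suc i" if "i < n" for i
    using sorted_wrt_nth_less[OF us(2), of i "Suc i"] that n by simp
  have "\<exists>i\<le>n. us ! i = s" if "s \<in> J \<union> {0, 1}" for s
    using that us(1) n by (metis in_set_conv_nth less_Suc_eq_le)
  then obtain idx where idx: "\<And>s. s \<in> J \<union> {0, 1} \<Longrightarrow> idx s \<le> n \<and> us ! idx s = s"
    by metis
  \<comment> \<open>Both sums start at the first grid point, and their difference is the increment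
    between 0 and \<open>s\<close>, whatever the sign of \<open>s\<close>.\<close>
  define \<Phi> where "\<Phi> d = (\<lambda>s\<in>J. (\<Sum>i<idx s. d i) - (\<Sum>i<idx 0. d i :: real))" for d
  have \<Phi>[measurable]: "\<Phi> \<in> measurable (\<Pi>\<^sub>M i\<in>{..<n}. borel) (\<Pi>\<^sub>M t\<in>J. borel)"
    unfolding \<Phi>_def
    using idx by (intro measurable_restrict borel_measurable_diff borel_measurable_sum
      measurable_component_singleton) fastforce+
  define D where "D X w = (\<lambda>i\<in>{..<n}. X (us ! Suc i) w - X (us ! i) w)"
    for X :: "real \<Rightarrow> 'c \<Rightarrow> real" and w
  have gen: "distr M (\<Pi>\<^sub>M t\<in>J. borel) (\<lambda>w. \<lambda>t\<in>J. X t w)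
     = distr (\<Pi>\<^sub>M i\<in>{..<n}. density lborel (normal_density 0 (sqrt (us ! Suc i - us ! i)))) (\<Pi>\<^sub>M t\<in>J. borel) \<Phi>"
    if X: "two_sided_BM M X" for M :: "'d measure" and X
  proof -
    have [measurable]: "X t \<in> borel_measurable M" for t using X by (simp add: two_sided_BM_def)
    define D where "D w = (\<lambda>i\<in>{..<n}. X (us ! Suc i) w - X (us ! i) w)" for w
    have [measurable]: "D \<in> measurable M (\<Pi>\<^sub>M i\<in>{..<n}. borel)" unfolding D_def by measurable
    have "AE w in M. X 0 w = 0" using X by (simp add: two_sided_BM_def)
    then have ae: "AE w in M. (\<lambda>t\<in>J. X t w) = \<Phi> (D w)"
    proof eventually_elim
      fix w assume w: "X 0 w = 0"
      have tel: "(\<Sum>i<j. D w i) = X (us ! j) w - X (us ! 0) w" if "j \<le> n" for j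
      proof -
        have "(\<Sum>i<j. D w i) = (\<Sum>i<j. X (us ! Suc i) w - X (us ! i) w)"
          using that by (intro sum.cong) (auto simp: D_def)
        then show ?thesis using sum_lessThan_telescope[of "\<lambda>i. X (us ! i) w" j] by simp
      qed
      show "(\<lambda>t\<in>J. X t w) = \<Phi> (D w)"
        unfolding \<Phi>_def
      proof (rule restrict_ext)
        fix s assume "s \<in> J"
        then show "X s w = (\<Sum>i<idx s. D w i) - (\<Sum>i<idx 0. D w i)"
          using idx[of s] idx[of 0] w tel[of "idx s"] tel[of "idx 0"] by simp
      qed
    qed
    have "distr M (\<Pi>\<^sub>M t\<in>J. borel) (\<lambda>w. \<lambda>t\<in>J. X t w) = distr M (\<Pi>\<^sub>M t\<in>J. borel) (\<lambda>w. \<Phi> (D w))"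
      using ae by (intro distr_cong_AE) auto
    also have "\<dots> = distr (distr M (\<Pi>\<^sub>M i\<in>{..<n}. borel) D) (\<Pi>\<^sub>M t\<in>J. borel) \<Phi>"
      by (subst distr_distr) (auto simp: comp_def)
    also have "distr M (\<Pi>\<^sub>M i\<in>{..<n}. borel) D
      = (\<Pi>\<^sub>M i\<in>{..<n}. density lborel (normal_density 0 (sqrt (us ! Suc i - us ! i))))"
      unfolding D_def by (rule two_sided_BM_increments[OF X n(1)]) (rule t)
    finally show ?thesis .
  qed
  show ?thesis using gen[OF X] gen[OF Y] by simp
qed

text \<open>Uniqueness reduces every invariance of the law to a check of the defining properties. It
  is used for stationarity of the increments, for scaling, and for the recentred path of an unbiased
  shift.\<close>

lemma BM_law_unique:
  assumes P0: "BM_law P0" and X: "two_sided_BM M X"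
  shows "distr M path_space (\<lambda>w t. X t w) = P0"
proof (rule measure_eqI_path_space)
  note [measurable] = two_sided_BM_path[OF X]
  interpret prob_space M using X by (simp add: two_sided_BM_def)
  show "finite_measure (distr M path_space (\<lambda>w t. X t w))"
    by (rule finite_measure_distr) simp
  show sP: "sets P0 = sets path_space" using P0 by (simp add: BM_law_def)
  fix J :: "real set" assume J: "finite J"
  have "(\<lambda>\<omega>. restrict \<omega> J) \<in> measurable path_space (\<Pi>\<^sub>M t\<in>J. borel)"
    by (intro measurable_restrict measurable_eval)
  then have "distr (distr M path_space (\<lambda>w t. X t w)) (\<Pi>\<^sub>M t\<in>J. borel) (\<lambda>\<omega>. restrict \<omega> J)
    = distr M (\<Pi>\<^sub>M t\<in>J. borel) (\<lambda>w. \<lambda>t\<in>J. X t w)"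
    by (subst distr_distr) (auto simp: comp_def)
  also have "\<dots> = distr P0 (\<Pi>\<^sub>M t\<in>J. borel) (\<lambda>\<omega>. restrict \<omega> J)"
    using P0 by (intro two_sided_BM_fdd[OF X _ J]) (simp add: BM_law_def)
  finally show "distr (distr M path_space (\<lambda>w t. X t w)) (\<Pi>\<^sub>M t\<in>J. borel) (\<lambda>\<omega>. restrict \<omega> J)
    = distr P0 (\<Pi>\<^sub>M t\<in>J. borel) (\<lambda>\<omega>. restrict \<omega> J)" .
qed simp

text \<open>Converse of uniqueness: the defining properties depend on the law alone. Independence of
  the increments is transported as an identity between a joint law and a product, which presupposes
  a nonempty index set; hence the case distinction on \<open>n\<close>.\<close>

lemma two_sided_BM_transfer:
  assumes P0: "BM_law P0" and M: "prob_space M" and Y: "Y \<in> measurable M path_space"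
    and law: "distr M path_space Y = P0"
  shows "two_sided_BM M (\<lambda>t w. Y w t)"
proof -
  interpret prob_space M by fact
  note Y[measurable] measurable_eval[measurable]
  have P: "two_sided_BM P0 (\<lambda>t \<omega>. \<omega> t)" and sP: "sets P0 = sets path_space"
    using P0 by (auto simp: BM_law_def)
  interpret P: prob_space P0 using P by (simp add: two_sided_BM_def)
  have cont: "continuous_on UNIV (Y w)" if "w \<in> space M" for w
    using measurable_space[OF Y that] by (simp add: space_path_space)
  have "AE w in P0. w 0 = 0" using P by (simp add: two_sided_BM_def)
  then have zero: "AE w in M. Y w 0 = 0"
    unfolding law[symmetric] by (rule AE_distrD[OF Y])
  have push: "distr M L (\<lambda>w. h (Y w)) = distr P0 L h" if "h \<in> measurable path_space L" for L and h :: "_ \<Rightarrow> 'x"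
    unfolding law[symmetric] using that by (subst distr_distr) (auto simp: comp_def)
  have distr: "distributed M lborel (\<lambda>w. Y w t - Y w s) (normal_density 0 (sqrt (t - s)))" if "s < t" for s t
  proof -
    have "distributed P0 lborel (\<lambda>w. w t - w s) (normal_density 0 (sqrt (t - s)))"
      using P that by (simp add: two_sided_BM_def)
    then show ?thesis
      using push[of "\<lambda>w. w t - w s" lborel] by (auto simp: distributed_def)
  qed
  have indep: "indep_vars (\<lambda>_. borel) (\<lambda>i w. Y w (t (Suc i)) - Y w (t i)) {..<n}"
    if t: "\<forall>i<n. t i < t (Suc i)" for t :: "nat \<Rightarrow> real" and n
  proof (cases "n = 0")
    case True
    then show ?thesis by (auto simp: indep_vars_def indep_sets_def)
  next
    case False
    then have n: "0 < n" by simp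
    have t': "i < n \<Longrightarrow> t i < t (Suc i)" for i using t by simp
    have "distr M (\<Pi>\<^sub>M i\<in>{..<n}. borel) (\<lambda>w. \<lambda>i\<in>{..<n}. Y w (t (Suc i)) - Y w (t i))
      = distr P0 (\<Pi>\<^sub>M i\<in>{..<n}. borel) (\<lambda>w. \<lambda>i\<in>{..<n}. w (t (Suc i)) - w (t i))"
      by (rule push) measurable
    also have "\<dots> = (\<Pi>\<^sub>M i\<in>{..<n}. distr P0 borel (\<lambda>w. w (t (Suc i)) - w (t i)))"
    proof (subst P.indep_vars_iff_distr_eq_PiM'[symmetric])
      show "P.indep_vars (\<lambda>_. borel) (\<lambda>i w. w (t (Suc i)) - w (t i)) {..<n}"
        using P t by (simp add: two_sided_BM_def)
    qed (use n in \<open>auto simp: measurable_cong_sets[OF sP refl]\<close>)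
    also have "\<dots> = (\<Pi>\<^sub>M i\<in>{..<n}. distr M borel (\<lambda>w. Y w (t (Suc i)) - Y w (t i)))"
      by (intro PiM_cong refl push[symmetric]) measurable
    finally show ?thesis
      using n by (subst indep_vars_iff_distr_eq_PiM') auto
  qed
  have "(\<lambda>w. Y w t) \<in> borel_measurable M" for t by measurable
  then show ?thesis
    unfolding two_sided_BM_def
    by (intro conjI allI ballI impI prob_space_axioms cont zero distr indep) auto
qed

lemma BM_law_stationary:
  assumes P0: "BM_law P0"
  shows "distr P0 path_space (\<lambda>\<omega> s. \<omega> (t + s) - \<omega> t) = P0"
proof (rule BM_law_unique[OF P0])
  have P: "two_sided_BM P0 (\<lambda>t \<omega>. \<omega> t)" and sP: "sets P0 = sets path_space"
    using P0 by (auto simp: BM_law_def)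
  then interpret prob_space P0 by (simp add: two_sided_BM_def)
  have sp: "space P0 = space path_space" using sP by (rule sets_eq_imp_space_eq)
  have [measurable]: "(\<lambda>\<omega>. \<omega> t) \<in> borel_measurable P0" for t
    by (simp add: measurable_cong_sets[OF sP refl] measurable_eval)
  have "distributed P0 lborel (\<lambda>\<omega>. \<omega> (t + r) - \<omega> (t + s)) (normal_density 0 (sqrt (r - s)))"
    if "s < r" for s r
  proof -
    have "distributed P0 lborel (\<lambda>\<omega>. \<omega> (t + r) - \<omega> (t + s)) (normal_density 0 (sqrt ((t + r) - (t + s))))"
      by (rule two_sided_BMD(1)[OF P]) (use that in simp)
    then show ?thesis by simp
  qed
  moreover have "indep_vars (\<lambda>_. borel) (\<lambda>i \<omega>. \<omega> (t + u (Suc i)) - \<omega> (t + u i)) {..<n}"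
    if "\<forall>i<n. u i < u (Suc i)" for u :: "nat \<Rightarrow> real" and n
    by (rule two_sided_BMD(2)[OF P, where u="\<lambda>i. t + u i"]) (use that in simp)
  moreover have "continuous_on UNIV (\<lambda>s. \<omega> (t + s) - \<omega> t)" if "\<omega> \<in> space P0" for \<omega>
    using that by (auto simp: sp space_path_space intro!: continuous_intros continuous_on_compose2[of UNIV \<omega>])
  moreover have "AE \<omega> in P0. \<omega> (t + 0) - \<omega> t = 0" by simp
  moreover have "(\<lambda>\<omega>. \<omega> (t + s) - \<omega> t) \<in> borel_measurable P0" for s by measurable
  ultimately show "two_sided_BM P0 (\<lambda>s \<omega>. \<omega> (t + s) - \<omega> t)"
    unfolding two_sided_BM_def by (intro conjI allI ballI impI prob_space_axioms) auto
qed

lemma BM_law_scaling: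
  assumes P0: "BM_law P0" and c: "0 < c"
  shows "distr P0 path_space (\<lambda>\<omega> s. \<omega> (c\<^sup>2 * s) / c) = P0"
proof (rule BM_law_unique[OF P0])
  have P: "two_sided_BM P0 (\<lambda>t \<omega>. \<omega> t)" and sP: "sets P0 = sets path_space"
    using P0 by (auto simp: BM_law_def)
  then interpret prob_space P0 by (simp add: two_sided_BM_def)
  have sp: "space P0 = space path_space" using sP by (rule sets_eq_imp_space_eq)
  have [measurable]: "(\<lambda>\<omega>. \<omega> t) \<in> borel_measurable P0" for t
    by (simp add: measurable_cong_sets[OF sP refl] measurable_eval)
  have "distributed P0 lborel (\<lambda>\<omega>. \<omega> (c\<^sup>2 * r) / c - \<omega> (c\<^sup>2 * s) / c) (normal_density 0 (sqrt (r - s)))"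
    if "s < r" for s r
  proof -
    have lt: "c\<^sup>2 * s < c\<^sup>2 * r" using c that by simp
    have "distributed P0 lborel (\<lambda>\<omega>. \<omega> (c\<^sup>2 * r) - \<omega> (c\<^sup>2 * s)) (normal_density 0 (sqrt (c\<^sup>2 * r - c\<^sup>2 * s)))"
      by (rule two_sided_BMD(1)[OF P lt])
    then have "distributed P0 lborel (\<lambda>\<omega>. 0 + 1 / c * (\<omega> (c\<^sup>2 * r) - \<omega> (c\<^sup>2 * s)))
      (normal_density (0 + 1 / c * 0) (\<bar>1 / c\<bar> * sqrt (c\<^sup>2 * r - c\<^sup>2 * s)))"
      using c lt by (intro normal_density_affine) auto
    moreover have "\<bar>1 / c\<bar> * sqrt (c\<^sup>2 * r - c\<^sup>2 * s) = sqrt (r - s)"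
      using c by (simp add: real_sqrt_mult flip: right_diff_distrib)
    ultimately show ?thesis by (simp add: diff_divide_distrib)
  qed
  moreover have "indep_vars (\<lambda>_. borel) (\<lambda>i \<omega>. \<omega> (c\<^sup>2 * u (Suc i)) / c - \<omega> (c\<^sup>2 * u i) / c) {..<n}"
    if "\<forall>i<n. u i < u (Suc i)" for u :: "nat \<Rightarrow> real" and n
  proof -
    have "indep_vars (\<lambda>_. borel) (\<lambda>i \<omega>. \<omega> (c\<^sup>2 * u (Suc i)) - \<omega> (c\<^sup>2 * u i)) {..<n}"
      by (rule two_sided_BMD(2)[OF P, where u="\<lambda>i. c\<^sup>2 * u i"]) (use that c in simp)
    from indep_vars_compose2[OF this, of "\<lambda>_ x. x / c" "\<lambda>_. borel"]
    show ?thesis by (simp add: diff_divide_distrib)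
  qed
  moreover have "continuous_on UNIV (\<lambda>s. \<omega> (c\<^sup>2 * s) / c)" if "\<omega> \<in> space P0" for \<omega>
    using that c by (auto simp: sp space_path_space intro!: continuous_intros continuous_on_compose2[of UNIV \<omega>])
  moreover have "AE \<omega> in P0. \<omega> (c\<^sup>2 * 0) / c = 0" using P c by (simp add: two_sided_BM_def)
  moreover have "(\<lambda>\<omega>. \<omega> (c\<^sup>2 * s) / c) \<in> borel_measurable P0" for s by measurable
  ultimately show "two_sided_BM P0 (\<lambda>s \<omega>. \<omega> (c\<^sup>2 * s) / c)"
    unfolding two_sided_BM_def by (intro conjI allI ballI impI prob_space_axioms) auto
qed

section \<open>Matching two mutually singular diffuse measures\<close>

definition sum_measure :: "real measure \<Rightarrow> real measure \<Rightarrow> real measure" where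
  "sum_measure \<mu> \<kappa> = mixture (count_space UNIV) (\<lambda>b::bool. if b then \<mu> else \<kappa>) borel"

lemma sets_sum_measure [simp]: "sets (sum_measure \<mu> \<kappa>) = sets borel"
  by (simp add: sum_measure_def)

lemma emeasure_sum_measure:
  assumes "sets \<mu> = sets borel" "sets \<kappa> = sets borel" "C \<in> sets borel"
  shows "emeasure (sum_measure \<mu> \<kappa>) C = emeasure \<mu> C + emeasure \<kappa> C"
  unfolding sum_measure_def
  by (subst emeasure_mixture)
    (use assms in \<open>auto simp: nn_integral_count_space_finite UNIV_bool add.commute\<close>)

lemma measure_eqI_Ioc:
  fixes \<mu> \<kappa> :: "real measure"
  assumes sets: "sets \<mu> = sets borel" "sets \<kappa> = sets borel"
    and eq: "\<And>u v. u \<le> v \<Longrightarrow> emeasure \<mu> {u<..v} = emeasure \<kappa> {u<..v}"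
    and fin: "\<And>u v. emeasure \<mu> {u<..v} < \<infinity>"
  shows "\<mu> = \<kappa>"
proof (rule measure_eqI_generator_eq[where E="range (\<lambda>(a, b). {a<..b::real})" and \<Omega>=UNIV
      and A="\<lambda>n::nat. {- real n<..real n}"])
  have "{a<..b} \<inter> {c<..d} = {max a c<..min b d}" for a b c d :: real by auto
  then show "Int_stable (range (\<lambda>(a, b). {a<..b::real}))"
    unfolding Int_stable_def by auto
  show "emeasure \<mu> X = emeasure \<kappa> X" if "X \<in> range (\<lambda>(a, b). {a<..b})" for X
    using that eq by (auto split: prod.splits) (metis emeasure_empty greaterThanAtMost_empty nle_le)
  show "sets \<mu> = sigma_sets UNIV (range (\<lambda>(a, b). {a<..b}))" "sets \<kappa> = sigma_sets UNIV (range (\<lambda>(a, b). {a<..b}))"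
    using sets by (simp_all add: borel_sigma_sets_Ioc)
  show "(\<Union>n::nat. {- real n<..real n}) = UNIV"
    by (auto simp: minus_less_iff) (metis le_less_trans reals_Archimedean2 less_imp_le linear max_less_iff_conj)
  show "emeasure \<mu> {- real n<..real n} \<noteq> \<infinity>" for n :: nat
    using fin[of "- real n" "real n"] by auto
qed auto

text \<open>The difference of the two distribution functions is monotone; its Stieltjes measure
  added to the smaller measure gives the larger one.\<close>

lemma emeasure_le_of_Ioc_le:
  fixes \<mu> \<kappa> :: "real measure"
  assumes sets: "sets \<mu> = sets borel" "sets \<kappa> = sets borel"
    and le: "\<And>u v. u \<le> v \<Longrightarrow> emeasure \<mu> {u<..v} \<le> emeasure \<kappa> {u<..v}"
    and fin: "\<And>u v. emeasure \<kappa> {u<..v} < \<infinity>"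
    and A: "A \<in> sets borel"
  shows "emeasure \<mu> A \<le> emeasure \<kappa> A"
proof -
  have fin\<mu>: "emeasure \<mu> {u<..v} < \<infinity>" for u v
    using le[of u v] fin[of u v] by (cases "u \<le> v") (auto simp: le_less_trans)
  have add: "measure N {u<..w} = measure N {u<..v} + measure N {v<..w}"
    if "u \<le> v" "v \<le> w" "sets N = sets borel" "\<And>u v. emeasure N {u<..v} < \<infinity>" for N :: "real measure" and u v w
  proof -
    have "{u<..w} = {u<..v} \<union> {v<..w}" using that by auto
    then show ?thesis
      using that(3) that(4)[of u v] that(4)[of v w]
      by (subst \<open>{u<..w} = _\<close>, intro measure_Union) (auto simp: less_top[symmetric])
  qed
  define d where "d u v = measure \<kappa> {u<..v} - measure \<mu> {u<..v}" for u v
  have dadd: "d u w = d u v + d v w" if "u \<le> v" "v \<le> w" for u v w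
    using add[OF that sets(1) fin\<mu>] add[OF that sets(2) fin] by (simp add: d_def)
  have dpos: "0 \<le> d u v" if "u \<le> v" for u v
    using le[OF that] fin[of u v] unfolding d_def measure_def
    by (simp add: enn2real_mono)
  define G where "G x = (if 0 \<le> x then d 0 x else - d x 0)" for x
  have G: "G v - G u = d u v" if "u \<le> v" for u v
    using that dadd[of 0 u v] dadd[of u v 0] dadd[of u 0 v] by (auto simp: G_def)
  have mono: "G x \<le> G y" if "x \<le> y" for x y
    using G[OF that] dpos[OF that] by linarith
  have lim0: "(\<lambda>n. measure N {a<..S n}) \<longlonglongrightarrow> 0"
    if N: "sets N = sets borel" "\<And>u v. emeasure N {u<..v} < \<infinity>"
      and S: "\<And>n. a < S n" "decseq S" "S \<longlonglongrightarrow> a" for N :: "real measure" and a S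
  proof -
    have "(\<lambda>n. measure N {a<..S n}) \<longlonglongrightarrow> measure N (\<Inter>n. {a<..S n})"
      using N S(2) by (intro Lim_measure_decseq) (auto simp: decseq_def less_top[symmetric], meson order_trans)
    moreover have "(\<Inter>n. {a<..S n}) = {}"
    proof -
      have "\<exists>n. S n < y" if "a < y" for y
        using order_tendstoD(2)[OF S(3) that] by (auto simp: eventually_sequentially)
      then show ?thesis by (intro equals0I) (metis INT_iff UNIV_I greaterThanAtMost_iff not_le)
    qed
    ultimately show ?thesis by simp
  qed
  have rc: "continuous (at_right a) G" for a
    unfolding continuous_within
  proof (rule tendsto_at_right_sequentially[where b="a + 1"])
    fix S assume S: "\<And>n. a < S n" "decseq S" "S \<longlonglongrightarrow> a"
    have "(\<lambda>n. G a + d a (S n)) \<longlonglongrightarrow> G a + (0 - 0)"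
      unfolding d_def using S by (intro tendsto_intros lim0 sets fin fin\<mu>)
    moreover have "G (S n) = G a + d a (S n)" for n
      using G[of a "S n"] S(1)[of n] by simp
    ultimately show "(\<lambda>n. G (S n)) \<longlonglongrightarrow> G a" by simp
  qed simp
  have "sum_measure \<mu> (interval_measure G) = \<kappa>"
  proof (rule measure_eqI_Ioc)
    show *: "emeasure (sum_measure \<mu> (interval_measure G)) {u<..v} = emeasure \<kappa> {u<..v}" if "u \<le> v" for u v
    proof -
      have "emeasure (sum_measure \<mu> (interval_measure G)) {u<..v} = emeasure \<mu> {u<..v} + ennreal (d u v)"
        using that by (simp add: emeasure_sum_measure sets emeasure_interval_measure_Ioc mono rc G)
      also have "\<dots> = ennreal (measure \<mu> {u<..v} + d u v)"
        using fin\<mu>[of u v] dpos[OF that] by (simp add: emeasure_eq_ennreal_measure less_top[symmetric])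
      also have "\<dots> = emeasure \<kappa> {u<..v}"
        using fin[of u v] by (simp add: d_def emeasure_eq_ennreal_measure less_top[symmetric])
      finally show ?thesis .
    qed
    show "emeasure (sum_measure \<mu> (interval_measure G)) {u<..v} < \<infinity>" for u v
      using *[of u v] fin[of u v] by (cases "u \<le> v") auto
  qed (use sets in auto)
  then have "emeasure \<kappa> A = emeasure \<mu> A + emeasure (interval_measure G) A"
    using emeasure_sum_measure[OF sets(1) _ A, of "interval_measure G"] by simp
  then show ?thesis by simp
qed

text \<open>The deterministic setting of one path: \<xi> and \<eta> stand for its local time at 0
  and its mixed local time, \<open>f\<close> for the difference function. Diffuseness makes
  \<open>f\<close> continuous; mutual singularity separates the two measures on the points left
  without a match.\<close>

locale diffuse_pair =
  fixes \<xi> \<eta> :: "real measure" and f :: "real \<Rightarrow> real"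
  assumes sets_xi: "sets \<xi> = sets borel" and sets_eta: "sets \<eta> = sets borel"
    and finite_xi: "\<And>a b. emeasure \<xi> {a..b} < \<infinity>" and finite_eta: "\<And>a b. emeasure \<eta> {a..b} < \<infinity>"
    and diffuse_xi: "\<And>s. emeasure \<xi> {s} = 0" and diffuse_eta: "\<And>s. emeasure \<eta> {s} = 0"
    and orth: "\<exists>Z\<in>sets borel. emeasure \<xi> (UNIV - Z) = 0 \<and> emeasure \<eta> Z = 0"
    and f: "\<And>a b. a \<le> b \<Longrightarrow> f b - f a = measure \<xi> {a..b} - measure \<eta> {a..b}"
begin

lemmas [measurable_cong] = sets_xi sets_eta

lemma space_xi [simp]: "space \<xi> = UNIV" and space_eta [simp]: "space \<eta> = UNIV"
  using sets_eq_imp_space_eq[OF sets_xi] sets_eq_imp_space_eq[OF sets_eta] by auto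

lemma finite_top [simp]: "emeasure \<xi> {a..b} < \<top>" "emeasure \<eta> {a..b} < \<top>"
  using finite_xi finite_eta by simp_all

lemma emeasure_Icc:
  "emeasure \<xi> {a..b} = ennreal (measure \<xi> {a..b})" "emeasure \<eta> {a..b} = ennreal (measure \<eta> {a..b})"
  by (intro emeasure_eq_ennreal_measure less_imp_neq finite_top)+

lemma Ioc_Icc:
  assumes "sets N = sets borel" "emeasure N {u} = 0"
  shows "emeasure N {u<..v} = emeasure N {u..v::real}"
proof (cases "u \<le> v")
  case True
  then have "{u..v} = {u<..v} \<union> {u}" by auto
  moreover have "emeasure N ({u<..v} \<union> {u}) = emeasure N {u<..v}"
  proof (rule emeasure_Un_null_set)
    show "{u} \<in> null_sets N" using assms by (simp add: null_sets_def)
  qed (simp add: assms(1))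
  ultimately show ?thesis by (simp only:)
qed auto

lemma small_Icc:
  assumes N: "sets N = sets borel" "\<And>a b. emeasure N {a..b} < \<infinity>" "emeasure N {x} = 0" and e: "0 < e"
  shows "\<exists>d>0. measure N {x - d..x + d::real} < e"
proof -
  have "(\<lambda>n. measure N {x - 1 / real (Suc n)..x + 1 / real (Suc n)})
      \<longlonglongrightarrow> measure N (\<Inter>n. {x - 1 / real (Suc n)..x + 1 / real (Suc n)})"
  proof (rule Lim_measure_decseq)
    have "1 / real (Suc n) \<le> 1 / real (Suc m)" if "m \<le> n" for m n
      using that by (simp add: frac_le)
    then show "decseq (\<lambda>n. {x - 1 / real (Suc n)..x + 1 / real (Suc n)})"
      by (auto simp: decseq_def simp del: of_nat_Suc)
  qed (use N(1) N(2)[THEN less_imp_neq] in auto)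
  also have "(\<Inter>n. {x - 1 / real (Suc n)..x + 1 / real (Suc n)}) = {x}"
  proof -
    have "y = x" if "\<forall>n. x - 1 / real (Suc n) \<le> y \<and> y \<le> x + 1 / real (Suc n)" for y
    proof (rule ccontr)
      assume "y \<noteq> x"
      then obtain n where "1 / real (Suc n) < \<bar>y - x\<bar>"
        using nat_approx_posE[of "\<bar>y - x\<bar>"] by auto
      then show False using that[rule_format, of n] by linarith
    qed
    then show ?thesis by (auto simp del: of_nat_Suc)
  qed
  finally have "(\<lambda>n. measure N {x - 1 / real (Suc n)..x + 1 / real (Suc n)}) \<longlonglongrightarrow> 0"
    using N(3) by (simp add: measure_def)
  from order_tendstoD(2)[OF this e] obtain n where "measure N {x - 1 / real (Suc n)..x + 1 / real (Suc n)} < e"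
    by (auto simp: eventually_sequentially)
  then show ?thesis by (intro exI[of _ "1 / real (Suc n)"]) simp
qed

text \<open>Without an atom at \<open>x\<close>, small intervals around \<open>x\<close> have small
  mass. This is applied to \<open>f\<close> with the sum of the two measures and to the running
  infimum with \<xi> alone.\<close>

lemma isCont_of_le_measure:
  fixes g :: "real \<Rightarrow> real"
  assumes N: "sets N = sets borel" "\<And>a b. emeasure N {a..b} < \<infinity>" "emeasure N {x} = 0"
    and g: "\<And>u v. u \<le> v \<Longrightarrow> \<bar>g v - g u\<bar> \<le> measure N {u..v}"
  shows "isCont g x"
  unfolding continuous_at_eps_delta
proof (intro allI impI)
  fix e :: real assume "0 < e"
  from small_Icc[OF N this] obtain d where d: "0 < d" "measure N {x - d..x + d} < e" by auto
  have "\<bar>g y - g x\<bar> < e" if "\<bar>y - x\<bar> < d" for y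
  proof -
    have "\<bar>g y - g x\<bar> \<le> measure N {min x y..max x y}"
      using g[of "min x y" "max x y"] by (auto simp: min_def max_def abs_minus_commute split: if_splits)
    also have "\<dots> \<le> measure N {x - d..x + d}"
      using that N(1) N(2)[THEN less_imp_neq] by (intro measure_mono_fmeasurable fmeasurableI)
        (auto simp: less_top[symmetric] fmeasurable_def)
    finally show ?thesis using d by simp
  qed
  then show "\<exists>d>0. \<forall>y. dist y x < d \<longrightarrow> dist (g y) (g x) < e"
    using d(1) by (auto simp: dist_real_def)
qed

lemma f_continuous: "continuous_on A f"
proof -
  have s: "emeasure (sum_measure \<xi> \<eta>) C = emeasure \<xi> C + emeasure \<eta> C" if "C \<in> sets borel" for C
    using emeasure_sum_measure[OF sets_xi sets_eta that] .
  have "isCont f x" for x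
  proof (rule isCont_of_le_measure[where N="sum_measure \<xi> \<eta>"])
    fix u v :: real assume "u \<le> v"
    have "measure (sum_measure \<xi> \<eta>) {u..v} = measure \<xi> {u..v} + measure \<eta> {u..v}"
      using finite_xi[of u v] finite_eta[of u v]
      by (simp add: measure_def s enn2real_plus)
    then show "\<bar>f v - f u\<bar> \<le> measure (sum_measure \<xi> \<eta>) {u..v}"
      using f[OF \<open>u \<le> v\<close>] measure_nonneg[of \<xi> "{u..v}"] measure_nonneg[of \<eta> "{u..v}"] by linarith
  qed (auto simp: s finite_xi finite_eta diffuse_xi diffuse_eta)
  then show ?thesis by (simp add: continuous_at_imp_continuous_on)
qed

text \<open>The points of \<open>{a..b}\<close> whose match does not come before
  \<open>b\<close>.\<close>

definition future_minima :: "real \<Rightarrow> real \<Rightarrow> real set" where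
  "future_minima a b = {s\<in>{a..b}. \<forall>t\<in>{s..b}. f s \<le> f t}"

lemma closed_future_minima: "closed (future_minima a b)"
proof -
  \<comment> \<open>The range \<open>{s..b}\<close> of the quantifier depends on \<open>s\<close>.
    With \<open>t = min b (s + h)\<close> the range of \<open>h\<close> is fixed and each single
    condition is closed in \<open>s\<close>.\<close>
  have "future_minima a b = {a..b} \<inter> (\<Inter>h\<in>{0..}. {s. f s \<le> f (min b (s + h))})"
  proof (intro set_eqI iffI)
    fix s assume s: "s \<in> {a..b} \<inter> (\<Inter>h\<in>{0..}. {s. f s \<le> f (min b (s + h))})"
    have "f s \<le> f t" if "t \<in> {s..b}" for t
    proof -
      have "\<forall>h\<in>{0..}. f s \<le> f (min b (s + h))" using s by auto
      from this[rule_format, of "t - s"] that show ?thesis by (simp add: min_absorb2)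
    qed
    then show "s \<in> future_minima a b" using s by (auto simp: future_minima_def)
  qed (auto simp: future_minima_def)
  moreover have "closed {s. f s \<le> f (min b (s + h))}" for h
    by (intro closed_Collect_le continuous_on_compose2[OF f_continuous[of UNIV]] continuous_intros) auto
  ultimately show ?thesis by (auto intro!: closed_Int closed_INT)
qed

definition future_inf :: "real \<Rightarrow> real \<Rightarrow> real" where
  "future_inf b s = Inf (f ` {s..b})"

lemma future_inf_le:
  assumes "t \<in> {s..b}"
  shows "future_inf b s \<le> f t"
  unfolding future_inf_def
proof (rule cInf_lower)
  show "bdd_below (f ` {s..b})"
    by (intro bounded_imp_bdd_below compact_imp_bounded compact_continuous_image f_continuous compact_Icc)
qed (use assms in auto)

lemma future_inf_attained:
  assumes "s \<le> b"
  obtains x where "x \<in> {s..b}" "f x = future_inf b s"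
proof -
  obtain x where x: "x \<in> {s..b}" "\<forall>y\<in>{s..b}. f x \<le> f y"
    using continuous_attains_inf[of "{s..b}" f] assms f_continuous by auto
  then have "f x = future_inf b s"
    unfolding future_inf_def by (intro cInf_eq_minimum[symmetric]) auto
  with x(1) show ?thesis by (rule that)
qed

lemma future_inf_mono: "s \<le> s' \<Longrightarrow> s' \<le> b \<Longrightarrow> future_inf b s \<le> future_inf b s'"
  by (metis future_inf_attained future_inf_le atLeastAtMost_iff order_trans)

lemma future_inf_self [simp]: "future_inf b b = f b"
  by (simp add: future_inf_def)

lemma future_minima_iff: "s \<in> future_minima a b \<longleftrightarrow> a \<le> s \<and> s \<le> b \<and> f s = future_inf b s"
proof (cases "a \<le> s \<and> s \<le> b")
  case True
  then obtain x where x: "x \<in> {s..b}" "f x = future_inf b s" using future_inf_attained[of s b] by auto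
  have "(\<forall>t\<in>{s..b}. f s \<le> f t) \<longleftrightarrow> f s = future_inf b s"
  proof
    assume "\<forall>t\<in>{s..b}. f s \<le> f t"
    then have "f s \<le> future_inf b s" using x by metis
    then show "f s = future_inf b s" using future_inf_le[of s s b] True by simp
  qed (auto dest: future_inf_le)
  then show ?thesis using True by (simp add: future_minima_def)
qed (auto simp: future_minima_def)

text \<open>The infimum over the remaining time can rise only while \<open>f\<close> itself rises,
  and \<open>f\<close> rises by at most the mass of \<xi>.\<close>

lemma future_inf_diff:
  assumes "u \<le> v" "v \<le> b"
  shows "future_inf b v - future_inf b u \<le> measure \<xi> {u..v}"
proof -
  obtain x where x: "x \<in> {u..b}" "f x = future_inf b u" using future_inf_attained[of u b] assms by auto
  show ?thesis
  proof (cases "v \<le> x")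
    case True
    then have "future_inf b v \<le> future_inf b u" using future_inf_le[of x v b] x by auto
    then show ?thesis using measure_nonneg[of \<xi> "{u..v}"] by linarith
  next
    case False
    have "future_inf b v - future_inf b u \<le> f v - f x" using future_inf_le[of v v b] assms x by auto
    also have "\<dots> \<le> measure \<xi> {x..v}" using f[of x v] False measure_nonneg[of \<eta> "{x..v}"] by linarith
    also have "\<dots> \<le> measure \<xi> {u..v}"
      using x finite_xi[of u v] by (intro measure_mono_fmeasurable) (auto simp: fmeasurable_def sets_xi)
    finally show ?thesis .
  qed
qed

text \<open>The running infimum, continued by constants outside \<open>{a..b}\<close>, so that it is
  a distribution function on the whole line.\<close>

definition clamped_inf :: "real \<Rightarrow> real \<Rightarrow> real \<Rightarrow> real" where
  "clamped_inf a b s = future_inf b (max a (min b s))"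

lemma clamped_inf_mono: "a \<le> b \<Longrightarrow> u \<le> v \<Longrightarrow> clamped_inf a b u \<le> clamped_inf a b v"
  unfolding clamped_inf_def by (rule future_inf_mono) auto

lemma clamped_inf_diff:
  assumes "a \<le> b" "u \<le> v"
  shows "\<bar>clamped_inf a b v - clamped_inf a b u\<bar> \<le> measure \<xi> {u..v}"
proof -
  have "clamped_inf a b v - clamped_inf a b u \<le> measure \<xi> {max a (min b u)..max a (min b v)}"
    unfolding clamped_inf_def using assms by (intro future_inf_diff) auto
  moreover have "measure \<xi> {max a (min b u)..max a (min b v)} \<le> measure \<xi> {u..v}"
    if "u \<le> b" "a \<le> v"
    using that assms finite_xi[of u v] by (intro measure_mono_fmeasurable) (auto simp: fmeasurable_def sets_xi)
  moreover have "clamped_inf a b v - clamped_inf a b u = 0" if "b < u \<or> v < a"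
    using that assms by (auto simp: clamped_inf_def)
  ultimately show ?thesis
    using clamped_inf_mono[OF assms] measure_nonneg[of \<xi> "{u..v}"] by linarith
qed

lemma clamped_inf_continuous: "a \<le> b \<Longrightarrow> continuous_on UNIV (clamped_inf a b)"
  by (intro continuous_at_imp_continuous_on ballI isCont_of_le_measure[where N=\<xi>] clamped_inf_diff
      sets_xi finite_xi diffuse_xi)

text \<open>This measure sits where the running infimum increases, that is, on the future minima;
  there it is compared with \<xi> from both sides.\<close>

definition \<delta> :: "real \<Rightarrow> real \<Rightarrow> real measure" where
  "\<delta> a b = interval_measure (clamped_inf a b)"

lemma sets_delta [simp, measurable_cong]: "sets (\<delta> a b) = sets borel"
  by (simp add: \<delta>_def)

lemma delta_Icc: "a \<le> b \<Longrightarrow> u \<le> v \<Longrightarrow> emeasure (\<delta> a b) {u..v} = ennreal (clamped_inf a b v - clamped_inf a b u)"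
  unfolding \<delta>_def by (intro emeasure_interval_measure_Icc clamped_inf_mono clamped_inf_continuous)

lemma delta_singleton: "a \<le> b \<Longrightarrow> emeasure (\<delta> a b) {u} = 0"
  using delta_Icc[of a b u u] by simp

lemma delta_le_xi:
  assumes "a \<le> b" "A \<in> sets borel"
  shows "emeasure (\<delta> a b) A \<le> emeasure \<xi> A"
proof (rule emeasure_le_of_Ioc_le)
  fix u v :: real assume "u \<le> v"
  then have "emeasure (\<delta> a b) {u..v} = ennreal (clamped_inf a b v - clamped_inf a b u)" by (simp add: delta_Icc assms)
  also have "\<dots> \<le> ennreal (measure \<xi> {u..v})"
    using clamped_inf_diff[OF assms(1) \<open>u \<le> v\<close>] by (intro ennreal_leI) simp
  also have "\<dots> = emeasure \<xi> {u..v}"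
    using finite_xi[of u v] by (simp add: emeasure_eq_ennreal_measure less_top[symmetric])
  finally have "emeasure (\<delta> a b) {u..v} \<le> emeasure \<xi> {u..v}" .
  then show "emeasure (\<delta> a b) {u<..v} \<le> emeasure \<xi> {u<..v}"
    by (simp add: Ioc_Icc diffuse_xi sets_xi delta_singleton assms)
next
  show "emeasure \<xi> {u<..v} < \<infinity>" for u v
    by (simp add: Ioc_Icc diffuse_xi sets_xi finite_xi)
qed (use assms sets_xi in auto)

text \<open>In an interval, let \<open>u'\<close> and \<open>v'\<close> be the first and last future
  minimum; they exist by closedness. At both points the running infimum equals \<open>f\<close>, so
  the mass of \<xi> between them is the increment of the running infimum plus the mass of
  \<eta>.\<close>

lemma xi_future_minima_le_delta:
  assumes ab: "a \<le> b" and A: "A \<in> sets borel"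
  shows "emeasure \<xi> (future_minima a b \<inter> A) \<le> emeasure (\<delta> a b) A + emeasure \<eta> A"
proof -
  have Ub[measurable]: "future_minima a b \<in> sets borel" using closed_future_minima by (rule borel_closed)
  define N where "N = density \<xi> (indicator (future_minima a b))"
  have measurable_ind: "indicator (future_minima a b) \<in> borel_measurable \<xi>"
    by (rule borel_measurable_indicator) (simp add: sets_xi Ub)
  have N: "emeasure N C = emeasure \<xi> (future_minima a b \<inter> C)" if "C \<in> sets borel" for C
    unfolding N_def using that measurable_ind by (subst emeasure_density)
      (auto simp: sets_xi Ub nn_integral_indicator[symmetric] indicator_inter_arith simp del: nn_integral_indicator)
  have S: "emeasure (sum_measure (\<delta> a b) \<eta>) C = emeasure (\<delta> a b) C + emeasure \<eta> C" if "C \<in> sets borel" for C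
    using that sets_eta by (intro emeasure_sum_measure) auto
  have "emeasure N A \<le> emeasure (sum_measure (\<delta> a b) \<eta>) A"
  proof (rule emeasure_le_of_Ioc_le)
    fix u v :: real assume uv: "u \<le> v"
    show "emeasure N {u<..v} \<le> emeasure (sum_measure (\<delta> a b) \<eta>) {u<..v}"
    proof (cases "future_minima a b \<inter> {u..v} = {}")
      case True
      have "future_minima a b \<inter> {u<..v} \<subseteq> future_minima a b \<inter> {u..v}" by auto
      then show ?thesis using True by (simp add: N)
    next
      case False
      have c: "compact (future_minima a b \<inter> {u..v})" using closed_future_minima by (intro closed_Int_compact) auto
      obtain u' where u': "u' \<in> future_minima a b \<inter> {u..v}" "\<And>x. x \<in> future_minima a b \<inter> {u..v} \<Longrightarrow> u' \<le> x"
        using compact_attains_inf[OF c False] by auto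
      obtain v' where v': "v' \<in> future_minima a b \<inter> {u..v}" "\<And>x. x \<in> future_minima a b \<inter> {u..v} \<Longrightarrow> x \<le> v'"
        using compact_attains_sup[OF c False] by auto
      have le: "u' \<le> v'" using u' v' by auto
      have G': "clamped_inf a b u' = f u'" "clamped_inf a b v' = f v'" using u' v' by (auto simp: future_minima_iff clamped_inf_def)
      have Gm: "clamped_inf a b u \<le> clamped_inf a b u'" "clamped_inf a b v' \<le> clamped_inf a b v" using u' v' ab by (auto intro!: clamped_inf_mono)
      have m: "measure \<eta> {u'..v'} \<le> measure \<eta> {u..v}"
        using u' v' finite_eta[of u v] by (intro measure_mono_fmeasurable) (auto simp: fmeasurable_def sets_eta)
      have "emeasure N {u<..v} \<le> emeasure \<xi> {u'..v'}"
        unfolding N[OF greaterThanAtMost_borel] using u' v' by (intro emeasure_mono) (auto simp: sets_xi)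
      also have "\<dots> = ennreal (measure \<xi> {u'..v'})"
        using finite_xi[of u' v'] by (simp add: emeasure_eq_ennreal_measure less_top[symmetric])
      also have "\<dots> \<le> ennreal ((clamped_inf a b v - clamped_inf a b u) + measure \<eta> {u..v})"
        using f[OF le] G' Gm m by (intro ennreal_leI) linarith
      also have "\<dots> = ennreal (clamped_inf a b v - clamped_inf a b u) + ennreal (measure \<eta> {u..v})"
        using clamped_inf_mono[OF ab uv] by (intro ennreal_plus) auto
      also have "\<dots> = emeasure (\<delta> a b) {u<..v} + emeasure \<eta> {u<..v}"
      proof -
        show ?thesis
          by (simp only: emeasure_Icc Ioc_Icc[OF sets_delta delta_singleton[OF ab]] delta_Icc[OF ab uv]
              Ioc_Icc[OF sets_eta diffuse_eta])
      qed
      also have "\<dots> = emeasure (sum_measure (\<delta> a b) \<eta>) {u<..v}" by (simp add: S)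
      finally show ?thesis .
    qed
  next
    show "emeasure (sum_measure (\<delta> a b) \<eta>) {u<..v} < \<infinity>" for u v
      using finite_eta[of u v]
      by (cases "u \<le> v") (auto simp: S Ioc_Icc sets_eta diffuse_eta delta_singleton delta_Icc ab)
  qed (auto simp: A N_def sets_xi)
  then show ?thesis by (simp add: N S A)
qed

text \<open>Mutual singularity removes the error term: the previous bound is applied to
  \<open>A \<inter> Z\<close>, where \<open>Z\<close> carries \<xi> and is null for \<eta>.\<close>

lemma xi_future_minima_le_delta':
  assumes ab: "a \<le> b" and A: "A \<in> sets borel"
  shows "emeasure \<xi> (future_minima a b \<inter> A) \<le> emeasure (\<delta> a b) A"
proof -
  obtain Z where Z[measurable]: "Z \<in> sets borel" and Z0: "emeasure \<xi> (UNIV - Z) = 0" "emeasure \<eta> Z = 0"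
    using orth by auto
  note A[measurable]
  have future_minima[measurable]: "future_minima a b \<in> sets borel" using closed_future_minima by (rule borel_closed)
  have "emeasure \<xi> (future_minima a b \<inter> A) \<le> emeasure \<xi> ((future_minima a b \<inter> (A \<inter> Z)) \<union> (UNIV - Z))"
    by (intro emeasure_mono) (auto simp: sets_xi)
  also have "\<dots> = emeasure \<xi> (future_minima a b \<inter> (A \<inter> Z))"
    using Z0 by (intro emeasure_Un_null_set) (auto intro!: null_setsI simp: sets_xi)
  also have "\<dots> \<le> emeasure (\<delta> a b) (A \<inter> Z) + emeasure \<eta> (A \<inter> Z)"
    by (intro xi_future_minima_le_delta ab) measurable
  also have "emeasure \<eta> (A \<inter> Z) = 0"
    using emeasure_mono[of "A \<inter> Z" Z \<eta>] Z0 by (auto simp: sets_eta)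
  also have "emeasure (\<delta> a b) (A \<inter> Z) + 0 \<le> emeasure (\<delta> a b) A"
    by (auto intro!: emeasure_mono)
  finally show ?thesis .
qed

lemma delta_const_null:
  assumes ab: "a \<le> b" and c: "clamped_inf a b u = clamped_inf a b v"
  shows "emeasure (\<delta> a b) {u..v} = 0"
  using delta_Icc[OF ab, of u v] c by (cases "u \<le> v") auto

text \<open>The upper bound is the total mass of \<open>\<delta> a b\<close>. For the lower bound,
  \<delta> is dominated by \<xi> and gives no mass to points other than future minima, because the
  running infimum is locally constant there.\<close>

lemma xi_future_minima:
  assumes ab: "a \<le> b"
  shows "emeasure \<xi> (future_minima a b) = ennreal (f b - future_inf b a)"
proof (rule antisym)
  have future_minima[measurable]: "future_minima a b \<in> sets borel" using closed_future_minima by (rule borel_closed)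
  have clamped_inf: "clamped_inf a b b = f b" "clamped_inf a b a = future_inf b a" using ab by (auto simp: clamped_inf_def)
  have "future_minima a b \<inter> {a..b} = future_minima a b" by (auto simp: future_minima_def)
  then have "emeasure \<xi> (future_minima a b) = emeasure \<xi> (future_minima a b \<inter> {a..b})" by simp
  also have "\<dots> \<le> emeasure (\<delta> a b) {a..b}"
    by (intro xi_future_minima_le_delta' ab) auto
  finally show "emeasure \<xi> (future_minima a b) \<le> ennreal (f b - future_inf b a)" by (simp add: delta_Icc ab clamped_inf)
  \<comment> \<open>The union of the rational intervals on which the running infimum is constant: a
    countable union of null sets of \<delta>.\<close>
  define C where "C = (\<Union>p\<in>\<rat>. \<Union>q\<in>{q\<in>\<rat>. clamped_inf a b p = clamped_inf a b q}. {p..q})"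
  have Cm[measurable]: "C \<in> sets borel"
    unfolding C_def by (intro sets.countable_UN'' countable_rat countable_Collect) auto
  have C0: "emeasure (\<delta> a b) C = 0"
  proof -
    have "C \<in> null_sets (\<delta> a b)"
      unfolding C_def
      by (intro null_sets_UN' countable_rat countable_Collect null_setsI delta_const_null ab) auto
    then show ?thesis by auto
  qed
  \<comment> \<open>If \<open>s\<close> is not a future minimum, the infimum over
    \<open>{s..b}\<close> is attained at some later \<open>x\<close>, and near \<open>s\<close> the
    function \<open>f\<close> stays above it. So the infimum does not change from a rational
    \<open>p\<close> just before \<open>s\<close> to a rational \<open>q\<close> between
    \<open>s\<close> and \<open>x\<close>.\<close>
  have "{a<..<b} \<subseteq> future_minima a b \<union> C"
  proof
    fix s assume s: "s \<in> {a<..<b}"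
    show "s \<in> future_minima a b \<union> C"
    proof (cases "s \<in> future_minima a b")
      case False
      obtain x where x: "x \<in> {s..b}" "f x = future_inf b s" using future_inf_attained[of s b] s by auto
      have ne: "future_inf b s < f s" using False s future_inf_le[of s s b] by (auto simp: future_minima_iff)
      then have xs: "s < x" using x by (cases "x = s") auto
      have "\<forall>\<^sub>F y in at s. future_inf b s < f y"
        using f_continuous[of UNIV] ne by (intro order_tendstoD(1)[of f "f s"])
          (auto simp: continuous_on_eq_continuous_at isCont_def)
      then obtain d where d: "0 < d" "\<And>y. \<bar>y - s\<bar> < d \<Longrightarrow> future_inf b s < f y"
        using ne by (auto simp: eventually_at dist_real_def) (metis diff_self abs_zero)
      obtain p where p: "p \<in> \<rat>" "max a (s - d) < p" "p < s"
        using Rats_dense_in_real[of "max a (s - d)" s] s d by auto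
      obtain q where q: "q \<in> \<rat>" "s < q" "q < x" using Rats_dense_in_real[OF xs] by auto
      have "future_inf b p = future_inf b q"
      proof (rule antisym)
        show "future_inf b p \<le> future_inf b q" using p q x s by (intro future_inf_mono) auto
        have "future_inf b q \<le> future_inf b s" using future_inf_le[of x q b] q x by auto
        also have "future_inf b s \<le> future_inf b p"
        proof -
          obtain y where y: "y \<in> {p..b}" "f y = future_inf b p" using future_inf_attained[of p b] p s by auto
          show ?thesis
          proof (cases "y < s")
            case True
            then show ?thesis using d(2)[of y] y p by auto
          next
            case False
            then show ?thesis using future_inf_le[of y s b] y by auto
          qed
        qed
        finally show "future_inf b q \<le> future_inf b p" .
      qed
      moreover have "a \<le> p" "p \<le> b" "a \<le> q" "q \<le> b" using p q x s by auto
      ultimately have "clamped_inf a b p = clamped_inf a b q" by (simp add: clamped_inf_def)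
      then have "s \<in> C" unfolding C_def using p q by fastforce
      then show ?thesis by simp
    qed simp
  qed
  then have sub: "{a..b} \<subseteq> (future_minima a b \<union> C) \<union> {a, b}" by force
  have "ennreal (f b - future_inf b a) = emeasure (\<delta> a b) {a..b}" by (simp add: delta_Icc ab clamped_inf)
  also have "\<dots> \<le> emeasure (\<delta> a b) (future_minima a b \<union> (C \<union> ({a} \<union> {b})))"
    using sub by (intro emeasure_mono) auto
  also have "\<dots> = emeasure (\<delta> a b) (future_minima a b)"
    using C0 by (intro emeasure_Un_null_set null_sets.Un) (auto intro!: null_setsI simp: delta_singleton ab)
  also have "\<dots> \<le> emeasure \<xi> (future_minima a b)" by (intro delta_le_xi ab) measurable
  finally show "ennreal (f b - future_inf b a) \<le> emeasure \<xi> (future_minima a b)" .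
qed

text \<open>If \<open>f\<close> comes back to the level \<open>f s\<close> at a later
  \<open>t\<close>, the running infimum is constant from \<open>s\<close> to a rational
  \<open>q\<close> before \<open>t\<close>. For each \<open>q\<close> the points of this kind lie in
  one flat stretch, which is null for \<delta> and hence, on future minima, for \<xi>.\<close>

lemma xi_touch_null:
  assumes ab: "a \<le> b"
  shows "AE s in \<xi>. s \<in> future_minima a b \<longrightarrow> (\<forall>t\<in>{s<..b}. f s < f t)"
proof -
  have future_minima[measurable]: "future_minima a b \<in> sets borel" using closed_future_minima by (rule borel_closed)
  define W where "W q = {s. s \<le> q \<and> a \<le> s \<and> clamped_inf a b s = clamped_inf a b q}" for q
  have Gm[measurable]: "clamped_inf a b \<in> borel_measurable borel"
    using clamped_inf_continuous[OF ab] by (rule borel_measurable_continuous_onI)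
  have Wm[measurable]: "W q \<in> sets borel" for q unfolding W_def by measurable
  have W0: "emeasure (\<delta> a b) (W q) = 0" for q
  proof (cases "W q = {}")
    case False
    have "closed {s. clamped_inf a b s = clamped_inf a b q}"
      by (intro closed_Collect_eq clamped_inf_continuous ab continuous_intros)
    moreover have "W q = {a..q} \<inter> {s. clamped_inf a b s = clamped_inf a b q}" by (auto simp: W_def)
    ultimately have "compact (W q)" by (auto intro!: compact_Int_closed)
    then obtain c where c: "c \<in> W q" "\<forall>x\<in>W q. c \<le> x"
      using compact_attains_inf[of "W q"] False by auto
    then have "W q \<subseteq> {c..q}" "clamped_inf a b c = clamped_inf a b q" by (auto simp: W_def)
    then show ?thesis
      using emeasure_mono[of "W q" "{c..q}" "\<delta> a b"] delta_const_null[OF ab, of c q] by simp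
  qed simp
  have null: "future_minima a b \<inter> W q \<in> null_sets \<xi>" for q
    using xi_future_minima_le_delta'[OF ab Wm[of q]] W0[of q] by (intro null_setsI) (auto simp: sets_xi)
  have "(\<Union>q\<in>\<rat>. future_minima a b \<inter> W q) \<in> null_sets \<xi>"
    by (intro null_sets_UN' countable_rat null)
  then show ?thesis
  proof (rule AE_I')
    show "{s\<in>space \<xi>. \<not> (s \<in> future_minima a b \<longrightarrow> (\<forall>t\<in>{s<..b}. f s < f t))} \<subseteq> (\<Union>q\<in>\<rat>. future_minima a b \<inter> W q)"
    proof clarsimp
      fix s t assume s: "s \<in> future_minima a b" and t: "s < t" "t \<le> b" "\<not> f s < f t"
      have "f t = f s" using s t by (auto simp: future_minima_def intro!: antisym)
      obtain q where q: "q \<in> \<rat>" "s < q" "q < t" using Rats_dense_in_real[OF t(1)] by auto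
      have "future_inf b q \<le> f t" using q t by (intro future_inf_le) auto
      moreover have "future_inf b s \<le> future_inf b q" using q t by (intro future_inf_mono) auto
      moreover have "f s = future_inf b s" using s by (simp add: future_minima_iff)
      ultimately have "future_inf b q = future_inf b s" using \<open>f t = f s\<close> by simp
      then have "s \<in> W q" using s q t by (auto simp: W_def clamped_inf_def future_minima_iff max_def min_def)
      then show "\<exists>q\<in>\<rat>. s \<in> W q" using q by auto
    qed
  qed
qed

end

text \<open>Time reversal turns rises of \<open>f\<close> into falls, so \<xi> and \<eta> exchange
  their roles; results on future minima and \<xi> become results on past minima and \<eta>.\<close>

lemma (in diffuse_pair) reflected:
  "diffuse_pair (distr \<eta> borel uminus) (distr \<xi> borel uminus) (\<lambda>t. f (- t))"
proof
  have [simp]: "(\<lambda>x. x) \<in> borel_measurable \<xi>" "(\<lambda>x. x) \<in> borel_measurable \<eta>"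
    by (simp_all add: measurable_ident_sets sets_xi sets_eta)
  have v: "uminus -` {a..b::real} = {-b..-a}" for a b by auto
  have v1: "uminus -` {s::real} = {-s}" for s by (auto simp: minus_equation_iff)
  show "emeasure (distr \<eta> borel uminus) {a..b} < \<infinity>" "emeasure (distr \<xi> borel uminus) {a..b} < \<infinity>" for a b
    by (simp_all add: emeasure_distr v)
  show "emeasure (distr \<eta> borel uminus) {s} = 0" "emeasure (distr \<xi> borel uminus) {s} = 0" for s
    by (simp_all add: emeasure_distr v1 diffuse_xi diffuse_eta)
  show "f (- b) - f (- a) = measure (distr \<eta> borel uminus) {a..b} - measure (distr \<xi> borel uminus) {a..b}"
    if "a \<le> b" for a b
    using f[of "-b" "-a"] that by (simp add: measure_distr v)
  obtain Z where Z[measurable]: "Z \<in> sets borel" and Z0: "emeasure \<xi> (UNIV - Z) = 0" "emeasure \<eta> Z = 0"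
    using orth by auto
  have [measurable]: "uminus -` Z \<in> sets borel"
    using measurable_sets[of uminus borel borel Z] by simp
  have "uminus -` (UNIV - uminus -` (UNIV - Z)) = Z" "uminus -` uminus -` (UNIV - Z) = UNIV - Z" by auto
  then show "\<exists>Z\<in>sets borel. emeasure (distr \<eta> borel uminus) (UNIV - Z) = 0 \<and> emeasure (distr \<xi> borel uminus) Z = 0"
    using Z0 by (intro bexI[of _ "uminus -` (UNIV - Z)"]) (auto simp: emeasure_distr vimage_Diff)
qed auto

section \<open>Past minima and the first passage matching\<close>

context diffuse_pair
begin

lemma emeasure_xi_eta: "a \<le> b \<Longrightarrow> f b = f a \<Longrightarrow> emeasure \<xi> {a..b} = emeasure \<eta> {a..b}"
  using f[of a b] by (simp add: emeasure_Icc)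

text \<open>Mirror image of the future minima: up to null sets, the points of \<open>{a..b}\<close>
  that are the match of no point of \<open>{a..b}\<close>.\<close>

definition past_minima :: "real \<Rightarrow> real \<Rightarrow> real set" where
  "past_minima a b = {r\<in>{a..b}. \<forall>t\<in>{a..r}. f r \<le> f t}"

lemma past_minima_reflected: "past_minima a b = uminus -` diffuse_pair.future_minima (\<lambda>t. f (- t)) (- b) (- a)"
proof -
  interpret R: diffuse_pair "distr \<eta> borel uminus" "distr \<xi> borel uminus" "\<lambda>t. f (- t)"
    by (rule reflected)
  have "(\<forall>t\<in>{a..r}. f r \<le> f t) \<longleftrightarrow> (\<forall>t\<in>{- r..- a}. f r \<le> f (- t))" for r
  proof safe
    fix t assume "\<forall>t\<in>{a..r}. f r \<le> f t" "t \<in> {- r..- a}"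
    then show "f r \<le> f (- t)" by auto
  next
    fix t assume "\<forall>t\<in>{- r..- a}. f r \<le> f (- t)" "t \<in> {a..r}"
    then show "f r \<le> f t" by (auto dest: bspec[of _ _ "- t"])
  qed
  then show ?thesis
    by (intro set_eqI) (simp only: past_minima_def R.future_minima_def vimage_eq mem_Collect_eq atLeastAtMost_iff
        neg_le_iff_le minus_minus, blast)
qed

lemma past_minima_borel [measurable]: "past_minima a b \<in> sets borel"
proof -
  interpret R: diffuse_pair "distr \<eta> borel uminus" "distr \<xi> borel uminus" "\<lambda>t. f (- t)"
    by (rule reflected)
  have "uminus -` R.future_minima (- b) (- a) \<inter> space borel \<in> sets borel"
    by (intro measurable_sets[of _ borel borel] borel_closed R.closed_future_minima) measurable
  then show ?thesis by (simp add: past_minima_reflected)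
qed

lemma future_minima_borel [measurable]: "future_minima a b \<in> sets borel"
  using closed_future_minima by (rule borel_closed)

lemma eta_past_minima:
  assumes ab: "a \<le> b"
  shows "emeasure \<eta> (past_minima a b) = ennreal (f a - future_inf b a)"
proof -
  interpret R: diffuse_pair "distr \<eta> borel uminus" "distr \<xi> borel uminus" "\<lambda>t. f (- t)"
    by (rule reflected)
  have "(\<lambda>t. f (- t)) ` {- b..- a} = f ` uminus ` {- b..- a}" by (simp only: image_image)
  then have future_inf: "R.future_inf (- a) (- b) = future_inf b a" by (simp add: R.future_inf_def future_inf_def)
  have "emeasure \<eta> (past_minima a b) = emeasure (distr \<eta> borel uminus) (R.future_minima (- b) (- a))"
    by (subst emeasure_distr) (auto simp: past_minima_reflected measurable_ident_sets sets_eta)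
  also have "\<dots> = ennreal (f (- (- a)) - R.future_inf (- a) (- b))"
    using ab by (intro R.xi_future_minima) auto
  finally show ?thesis by (simp add: future_inf)
qed

text \<open>With m the minimum of \<open>f\<close> on \<open>{a..b}\<close>, the two removed sets
  have masses \<open>f b - m\<close> and \<open>f a - m\<close>; their difference
  \<open>f b - f a\<close> is exactly the difference of the total masses of \<xi> and
  \<eta>.\<close>

lemma passage_balance:
  assumes ab: "a \<le> b"
  shows "emeasure \<xi> ({a..b} - future_minima a b) = emeasure \<eta> ({a..b} - past_minima a b)"
proof -
  have future_inf: "future_inf b a \<le> f b" "future_inf b a \<le> f a" using ab by (auto intro: future_inf_le)
  have sub: "future_minima a b \<subseteq> {a..b}" "past_minima a b \<subseteq> {a..b}" by (auto simp: future_minima_def past_minima_def)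
  have "emeasure \<xi> ({a..b} - future_minima a b) = emeasure \<xi> {a..b} - emeasure \<xi> (future_minima a b)"
    using sub by (intro emeasure_Diff) (auto simp: xi_future_minima[OF ab] sets_xi)
  also have "\<dots> = ennreal (measure \<xi> {a..b} - (f b - future_inf b a))"
    using future_inf by (simp add: xi_future_minima[OF ab] emeasure_Icc ennreal_minus)
  also have "measure \<xi> {a..b} - (f b - future_inf b a) = measure \<eta> {a..b} - (f a - future_inf b a)"
    using f[OF ab] by simp
  also have "ennreal \<dots> = emeasure \<eta> {a..b} - emeasure \<eta> (past_minima a b)"
    using future_inf by (simp add: eta_past_minima[OF ab] emeasure_Icc ennreal_minus)
  also have "\<dots> = emeasure \<eta> ({a..b} - past_minima a b)"
    using sub by (intro emeasure_Diff[symmetric]) (auto simp: eta_past_minima[OF ab] sets_eta)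
  finally show ?thesis .
qed

text \<open>The match of \<open>s\<close>. The strict inequality \<open>f t < f s\<close> makes the
  sublevel sets of \<tau> open and so \<tau> measurable.\<close>

definition \<tau> :: "real \<Rightarrow> ereal" where
  "\<tau> s = (INF t\<in>{t. s < t \<and> f t < f s}. ereal t)"

lemma tau_less_iff: "\<tau> s < y \<longleftrightarrow> (\<exists>t. s < t \<and> f t < f s \<and> ereal t < y)"
  by (auto simp: \<tau>_def Inf_less_iff)

lemma tau_ge: "ereal s \<le> \<tau> s"
  unfolding \<tau>_def by (rule INF_greatest) auto

lemma tau_real: "\<tau> s < \<infinity> \<Longrightarrow> ereal (real_of_ereal (\<tau> s)) = \<tau> s"
  using tau_ge[of s] by (cases "\<tau> s") auto

lemma open_f_less: "open {s. f t < f s}" "open {s. f s < f t}"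
  by (intro open_Collect_less f_continuous continuous_intros)+

lemma open_tau_less: "open {s. \<tau> s < y}"
proof -
  have "{s. \<tau> s < y} = (\<Union>t\<in>{t. ereal t < y}. {s. s < t} \<inter> {s. f t < f s})"
    by (auto simp: tau_less_iff)
  also have "open \<dots>"
    by (intro open_UN ballI open_Int open_f_less) (auto simp: open_Collect_less)
  finally show ?thesis .
qed

lemma measurable_tau [measurable]: "\<tau> \<in> borel_measurable borel"
  by (rule borel_measurableI_less) (auto intro: borel_open open_tau_less)

lemma open_backward: "open {r. \<exists>t\<ge>a. t < r \<and> f t < f r}" "open {r. \<exists>t<r. f t < f r}"
proof -
  have "{r. \<exists>t\<ge>a. t < r \<and> f t < f r} = (\<Union>t\<in>{a..}. {r. t < r} \<inter> {r. f t < f r})" by auto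
  then show "open {r. \<exists>t\<ge>a. t < r \<and> f t < f r}" by (auto intro!: open_UN open_Int open_f_less simp: open_Collect_less)
  have "{r. \<exists>t<r. f t < f r} = (\<Union>t. {r. t < r} \<inter> {r. f t < f r})" by auto
  then show "open {r. \<exists>t<r. f t < f r}" by (auto intro!: open_UN open_Int open_f_less simp: open_Collect_less)
qed

lemma passage_balance':
  "emeasure \<xi> {s. a \<le> s \<and> \<tau> s < ereal b} = emeasure \<eta> {r. (\<exists>t\<ge>a. t < r \<and> f t < f r) \<and> r < b}"
proof (cases "a \<le> b")
  case True
  have e1: "{s. a \<le> s \<and> \<tau> s < ereal b} = {a..b} - future_minima a b"
  proof (intro set_eqI iffI)
    fix s assume s: "s \<in> {a..b} - future_minima a b"
    then obtain t where t: "s \<le> t" "t \<le> b" "f t < f s" by (auto simp: future_minima_def not_le)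
    then have "s < t" by (cases "s = t") auto
    \<comment> \<open>A witness strictly before \<open>b\<close> is required; if the given one is
      \<open>b\<close> itself, continuity moves it slightly to the left.\<close>
    have "\<exists>t'. s < t' \<and> t' < b \<and> f t' < f s"
    proof (cases "t = b")
      case True
      have "\<forall>\<^sub>F y in at t. f y < f s"
        using f_continuous[of UNIV] t(3) by (intro order_tendstoD(2)[of f "f t"])
          (auto simp: continuous_on_eq_continuous_at isCont_def)
      then obtain d where d: "0 < d" "\<And>y. y \<noteq> t \<Longrightarrow> \<bar>y - t\<bar> < d \<Longrightarrow> f y < f s"
        by (auto simp: eventually_at dist_real_def)
      define y where "y = max (t - d / 2) ((s + t) / 2)"
      have "s < y" "y < t" "t - d / 2 \<le> y" using \<open>s < t\<close> d(1) by (auto simp: y_def less_max_iff_disj)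
      then have "\<bar>y - t\<bar> < d" using d(1) by linarith
      then show ?thesis using d(2)[of y] True \<open>s < y\<close> \<open>y < t\<close> by auto
    qed (use t \<open>s < t\<close> in auto)
    then show "s \<in> {s. a \<le> s \<and> \<tau> s < ereal b}" using s by (auto simp: tau_less_iff)
  next
    fix s assume s: "s \<in> {s. a \<le> s \<and> \<tau> s < ereal b}"
    then obtain t where "s < t" "f t < f s" "t < b" by (auto simp: tau_less_iff)
    then show "s \<in> {a..b} - future_minima a b" using s by (auto simp: future_minima_def not_le intro!: bexI[of _ t])
  qed
  have e2: "{a..b} - past_minima a b = {r. (\<exists>t\<ge>a. t < r \<and> f t < f r) \<and> r \<le> b}"
  proof (intro set_eqI iffI)
    fix r assume r: "r \<in> {a..b} - past_minima a b"
    then obtain t where t: "a \<le> t" "t \<le> r" "f t < f r" by (auto simp: past_minima_def not_le)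
    then show "r \<in> {r. (\<exists>t\<ge>a. t < r \<and> f t < f r) \<and> r \<le> b}" using r by (cases "r = t") (auto intro!: exI[of _ t])
  next
    fix r assume "r \<in> {r. (\<exists>t\<ge>a. t < r \<and> f t < f r) \<and> r \<le> b}"
    then obtain t where "a \<le> t" "t < r" "f t < f r" "r \<le> b" by auto
    then show "r \<in> {a..b} - past_minima a b" by (auto simp: past_minima_def not_le intro!: bexI[of _ t])
  qed
  have e3: "emeasure \<eta> {r. (\<exists>t\<ge>a. t < r \<and> f t < f r) \<and> r \<le> b}
    = emeasure \<eta> {r. (\<exists>t\<ge>a. t < r \<and> f t < f r) \<and> r < b}"
  proof -
    let ?B = "{r. \<exists>t\<ge>a. t < r \<and> f t < f r}"
    have B: "?B \<in> sets borel" using open_backward(1)[of a] by (rule borel_open)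
    have sB: "?B \<inter> {..<b} \<in> sets \<eta>" using B by (auto simp: sets_eta)
    have "emeasure \<eta> (?B \<inter> {..b}) \<le> emeasure \<eta> ((?B \<inter> {..<b}) \<union> {b})"
      using B sB by (intro emeasure_mono) (auto simp: sets_eta)
    also have "\<dots> = emeasure \<eta> (?B \<inter> {..<b})"
      using sB by (intro emeasure_Un_null_set) (auto intro!: null_setsI simp: diffuse_eta sets_eta)
    finally have le: "emeasure \<eta> (?B \<inter> {..b}) \<le> emeasure \<eta> (?B \<inter> {..<b})" .
    have ge: "emeasure \<eta> (?B \<inter> {..<b}) \<le> emeasure \<eta> (?B \<inter> {..b})"
      using B by (intro emeasure_mono) (auto simp: sets_eta)
    have sets: "?B \<inter> {..b} = {r. (\<exists>t\<ge>a. t < r \<and> f t < f r) \<and> r \<le> b}"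
      "?B \<inter> {..<b} = {r. (\<exists>t\<ge>a. t < r \<and> f t < f r) \<and> r < b}" by auto
    show ?thesis using antisym[OF le ge] unfolding sets .
  qed
  show ?thesis by (simp only: e1 passage_balance[OF True] e2 e3)
next
  case False
  have e1: "{s. a \<le> s \<and> \<tau> s < ereal b} = {}"
  proof -
    have "\<not> (a \<le> s \<and> \<tau> s < ereal b)" for s
      using False le_less_trans[OF tau_ge[of s], of "ereal b"] by auto
    then show ?thesis by auto
  qed
  have e2: "{r. (\<exists>t\<ge>a. t < r \<and> f t < f r) \<and> r < b} = {}" using False by auto
  show ?thesis by (simp only: e1 e2 emeasure_empty)
qed

text \<open>The value is 0 where \<tau> is infinite, so it is meaningful only under the condition
  \<open>\<tau> s < \<infinity>\<close>.\<close>

definition tr :: "real \<Rightarrow> real" where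
  "tr s = real_of_ereal (\<tau> s)"

lemma measurable_tr [measurable]: "tr \<in> borel_measurable borel"
  unfolding tr_def by measurable

lemma tau_tr: "\<tau> s < \<infinity> \<Longrightarrow> \<tau> s = ereal (tr s)"
  using tau_real[of s] by (simp add: tr_def)

text \<open>Restricting the starting points to \<open>s \<ge> a\<close> makes both sides finite on
  the half-lines \<open>{..<b}\<close>, which generate the Borel sets; afterwards \<open>a\<close>
  is sent to minus infinity.\<close>

lemma balance_from:
  "distr (density \<xi> (indicator {s. a \<le> s \<and> \<tau> s < \<infinity>})) borel tr
    = density \<eta> (indicator {r. \<exists>t\<ge>a. t < r \<and> f t < f r})" (is "?L = ?R")
proof (rule measure_eqI_generator_eq[where E="range lessThan" and \<Omega>=UNIV and A="\<lambda>n::nat. {..<real n}"])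
  have B[measurable]: "{r. \<exists>t\<ge>a. t < r \<and> f t < f r} \<in> sets borel" using open_backward(1)[of a] by (rule borel_open)
  have A[measurable]: "{s. a \<le> s \<and> \<tau> s < \<infinity>} \<in> sets borel" by measurable
  have L: "emeasure ?L {..<b} = emeasure \<xi> {s. a \<le> s \<and> \<tau> s < ereal b}" for b
  proof -
    have "emeasure ?L {..<b} = emeasure (density \<xi> (indicator {s. a \<le> s \<and> \<tau> s < \<infinity>})) (tr -` {..<b})"
      by (subst emeasure_distr) (auto simp: measurable_tr measurable_cong_sets[OF sets_xi refl])
    also have "\<dots> = emeasure \<xi> ({s. a \<le> s \<and> \<tau> s < \<infinity>} \<inter> tr -` {..<b})"
    proof -
      have "tr -` {..<b} \<inter> space borel \<in> sets borel" by (intro measurable_sets[OF measurable_tr]) simp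
      then show ?thesis by (intro emeasure_restricted) (auto simp: sets_xi A) 
    qed
    also have "{s. a \<le> s \<and> \<tau> s < \<infinity>} \<inter> tr -` {..<b} = {s. a \<le> s \<and> \<tau> s < ereal b}"
    proof -
      have "\<tau> s < \<infinity> \<and> tr s < b \<longleftrightarrow> \<tau> s < ereal b" for s
        using tau_ge[of s] by (cases "\<tau> s") (auto simp: tr_def)
      then show ?thesis by blast
    qed
    finally show ?thesis .
  qed
  have R: "emeasure ?R {..<b} = emeasure \<eta> {r. (\<exists>t\<ge>a. t < r \<and> f t < f r) \<and> r < b}" for b
  proof -
    have "emeasure ?R {..<b} = emeasure \<eta> ({r. \<exists>t\<ge>a. t < r \<and> f t < f r} \<inter> {..<b})"
      by (intro emeasure_restricted) (auto simp: sets_eta B)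
    also have "{r. \<exists>t\<ge>a. t < r \<and> f t < f r} \<inter> {..<b} = {r. (\<exists>t\<ge>a. t < r \<and> f t < f r) \<and> r < b}" by auto
    finally show ?thesis .
  qed
  show "emeasure ?L X = emeasure ?R X" if "X \<in> range lessThan" for X
    using that L R passage_balance' by auto
  show "emeasure ?L {..<real n} \<noteq> \<infinity>" for n :: nat
  proof -
    have "{s. a \<le> s \<and> \<tau> s < ereal n} \<subseteq> {a..real n}"
      using le_less_trans[OF tau_ge] by fastforce
    then have "emeasure \<xi> {s. a \<le> s \<and> \<tau> s < ereal n} \<le> emeasure \<xi> {a..real n}"
      by (intro emeasure_mono) (auto simp: sets_xi)
    from le_less_trans[OF this finite_top(1)] show ?thesis unfolding L by simp
  qed
  show "Int_stable (range (lessThan :: real \<Rightarrow> _))"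
  proof -
    have "{..<a} \<inter> {..<b} = {..<min a b}" for a b :: real by auto
    then show ?thesis unfolding Int_stable_def by auto
  qed
  show "(\<Union>n::nat. {..<real n}) = UNIV" by (auto intro: reals_Archimedean2)
  show "sets ?L = sigma_sets UNIV (range lessThan)" "sets ?R = sigma_sets UNIV (range lessThan)"
    by (simp_all add: sets_eta borel_Iio)
qed auto

lemma balance:
  "distr (density \<xi> (indicator {s. \<tau> s < \<infinity>})) borel tr = density \<eta> (indicator {r. \<exists>t<r. f t < f r})" (is "?L = ?R")
proof (rule measure_eqI)
  fix C assume "C \<in> sets ?L"
  then have C[measurable]: "C \<in> sets borel" by simp
  define An where "An n = {s. - real n \<le> s \<and> \<tau> s < \<infinity>}" for n
  define Bn where "Bn n = {r. \<exists>t\<ge>- real n. t < r \<and> f t < f r}" for n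
  have A[measurable]: "An n \<in> sets borel" for n unfolding An_def by measurable
  have B[measurable]: "Bn n \<in> sets borel" for n unfolding Bn_def using open_backward(1) by (rule borel_open)
  have A'[measurable]: "{s. \<tau> s < \<infinity>} \<in> sets borel" by measurable
  have B'[measurable]: "{r. \<exists>t<r. f t < f r} \<in> sets borel" using open_backward(2) by (rule borel_open)
  have trC[measurable]: "tr -` C \<in> sets borel" using measurable_sets[OF measurable_tr C] by simp
  have dL: "emeasure (distr (density \<xi> (indicator S)) borel tr) C = emeasure \<xi> (S \<inter> tr -` C)" if "S \<in> sets borel" for S
  proof -
    have "emeasure (distr (density \<xi> (indicator S)) borel tr) C = emeasure (density \<xi> (indicator S)) (tr -` C)"
      by (subst emeasure_distr) (auto simp: measurable_cong_sets[OF sets_xi refl])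
    also have "\<dots> = emeasure \<xi> (S \<inter> tr -` C)"
      using that by (intro emeasure_restricted) (auto simp: sets_xi)
    finally show ?thesis .
  qed
  have dR: "emeasure (density \<eta> (indicator S)) C = emeasure \<eta> (S \<inter> C)" if "S \<in> sets borel" for S
    using that by (intro emeasure_restricted) (auto simp: sets_eta)
  have eq: "emeasure \<xi> (An n \<inter> tr -` C) = emeasure \<eta> (Bn n \<inter> C)" for n
    using arg_cong[OF balance_from[of "- real n"], of "\<lambda>future_inf. emeasure future_inf C"]
    unfolding An_def[symmetric] Bn_def[symmetric] dL[OF A] dR[OF B] .
  have "\<exists>n. - real n \<le> s" for s
    using real_arch_simple[of "- s"] by (auto simp: minus_le_iff)
  then have "emeasure \<xi> ({s. \<tau> s < \<infinity>} \<inter> tr -` C) = emeasure \<xi> (\<Union>n. An n \<inter> tr -` C)"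
    by (intro arg_cong[where f="emeasure \<xi>"]) (auto simp: An_def)
  also have "\<dots> = (SUP n. emeasure \<xi> (An n \<inter> tr -` C))"
    by (intro SUP_emeasure_incseq[symmetric]) (auto simp: sets_xi incseq_def An_def)
  also have "\<dots> = (SUP n. emeasure \<eta> (Bn n \<inter> C))" by (simp add: eq)
  also have "\<dots> = emeasure \<eta> (\<Union>n. Bn n \<inter> C)"
  proof (rule SUP_emeasure_incseq)
    show "range (\<lambda>n. Bn n \<inter> C) \<subseteq> sets \<eta>" using B C by (auto simp: sets_eta)
    have "Bn m \<subseteq> Bn n" if "m \<le> n" for m n
    proof
      fix r assume "r \<in> Bn m"
      then obtain t where t: "- real m \<le> t" "t < r" "f t < f r" by (auto simp: Bn_def)
      then have "- real n \<le> t" using that by simp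
      then show "r \<in> Bn n" using t by (auto simp: Bn_def)
    qed
    then show "incseq (\<lambda>n. Bn n \<inter> C)" by (auto simp: incseq_def)
  qed
  also have "(\<Union>n. Bn n \<inter> C) = {r. \<exists>t<r. f t < f r} \<inter> C"
    using \<open>\<And>s. \<exists>n. - real n \<le> s\<close> by (auto simp: Bn_def) blast
  finally show "emeasure ?L C = emeasure ?R C"
    by (simp only: dL[OF A'] dR[OF B'])
qed (simp add: sets_eta)

lemma balance_integral:
  fixes F :: "real \<Rightarrow> ennreal"
  assumes F[measurable]: "F \<in> borel_measurable borel"
  shows "(\<integral>\<^sup>+ s. indicator {s. \<tau> s < \<infinity>} s * F (tr s) \<partial>\<xi>)
    = (\<integral>\<^sup>+ r. indicator {r. \<exists>t<r. f t < f r} r * F r \<partial>\<eta>)"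
proof -
  have A: "{s. \<tau> s < \<infinity>} \<in> sets borel" using open_tau_less by (rule borel_open)
  have B: "{r. \<exists>t<r. f t < f r} \<in> sets borel" using open_backward(2) by (rule borel_open)
  have mx: "indicator {s. \<tau> s < \<infinity>} \<in> borel_measurable \<xi>" "tr \<in> borel_measurable \<xi>" "(\<lambda>s. F (tr s)) \<in> borel_measurable \<xi>"
    using A by (auto simp only: measurable_cong_sets[OF sets_xi refl] intro!: borel_measurable_indicator measurable_tr
        measurable_compose[OF measurable_tr F])
  have me: "indicator {r. \<exists>t<r. f t < f r} \<in> borel_measurable \<eta>" "F \<in> borel_measurable \<eta>"
    using B by (auto simp only: measurable_cong_sets[OF sets_eta refl] intro!: borel_measurable_indicator F)
  have "(\<integral>\<^sup>+ s. indicator {s. \<tau> s < \<infinity>} s * F (tr s) \<partial>\<xi>)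
    = (\<integral>\<^sup>+ s. F (tr s) \<partial>density \<xi> (indicator {s. \<tau> s < \<infinity>}))"
    by (rule nn_integral_density[symmetric, OF mx(1,3)])
  also have "\<dots> = (\<integral>\<^sup>+ r. F r \<partial>distr (density \<xi> (indicator {s. \<tau> s < \<infinity>})) borel tr)"
    using mx(2) by (intro nn_integral_distr[symmetric]) auto
  also have "\<dots> = (\<integral>\<^sup>+ r. F r \<partial>density \<eta> (indicator {r. \<exists>t<r. f t < f r}))"
    by (simp only: balance)
  also have "\<dots> = (\<integral>\<^sup>+ r. indicator {r. \<exists>t<r. f t < f r} r * F r \<partial>\<eta>)"
    by (rule nn_integral_density[OF me])
  finally show ?thesis .
qed

lemma ge_before_tau:
  assumes "s \<le> t" "ereal t < \<tau> s"
  shows "f s \<le> f t"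
proof (rule ccontr)
  assume "\<not> f s \<le> f t"
  then have "\<tau> s \<le> ereal t"
    unfolding \<tau>_def using assms(1) by (intro INF_lower) (auto simp: not_le less_le)
  with assms(2) show False by simp
qed

text \<open>If \<open>t\<close> precedes the match of \<open>s\<close>, then \<open>s\<close> is a
  future minimum of a rational interval that contains \<open>s\<close> and \<open>t\<close>; the
  exceptional sets of countably many such intervals suffice.\<close>

lemma AE_strict_before_tau:
  "AE s in \<xi>. \<forall>t. s < t \<longrightarrow> ereal t < \<tau> s \<longrightarrow> f s < f t"
proof -
  have "AE s in \<xi>. \<forall>a\<in>\<rat>. \<forall>b\<in>\<rat>. a \<le> b \<longrightarrow> s \<in> future_minima a b \<longrightarrow> (\<forall>t\<in>{s<..b}. f s < f t)"
    by (intro AE_ball_countable' countable_rat) (use xi_touch_null in auto)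
  then show ?thesis
  proof (eventually_elim, safe)
    fix s t assume *: "\<forall>a\<in>\<rat>. \<forall>b\<in>\<rat>. a \<le> b \<longrightarrow> s \<in> future_minima a b \<longrightarrow> (\<forall>t\<in>{s<..b}. f s < f t)"
      and t: "s < t" "ereal t < \<tau> s"
    obtain a where a: "a \<in> \<rat>" "a < s" using Rats_dense_in_real[of "s - 1" s] by auto
    obtain c where c: "ereal t < ereal c" "ereal c < \<tau> s" using ereal_dense2[OF t(2)] by auto
    obtain b where b: "b \<in> \<rat>" "t < b" "b < c" using Rats_dense_in_real[of t c] c by auto
    have "s \<in> future_minima a b"
    proof -
      have "f s \<le> f x" if "x \<in> {s..b}" for x
      proof (rule ge_before_tau)
        have "ereal x < ereal c" using that b by simp
        then show "ereal x < \<tau> s" using c(2) by (rule less_trans)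
      qed (use that in auto)
      then show ?thesis using a b t by (auto simp: future_minima_def)
    qed
    then show "f s < f t" using *[rule_format, OF a(1) b(1)] a b t by auto
  qed
qed

text \<open>Inside \<open>{- n..n}\<close> let \<open>a\<close> be the smallest point of the set.
  All its other points are past minima of \<open>{a..n}\<close>, whose \<eta>-mass is
  \<open>f a\<close> minus the minimum of \<open>f\<close> on \<open>{a..n}\<close>; the second
  condition at \<open>a\<close> bounds this by \<open>h\<close>.\<close>

lemma eta_unmatched_le:
  assumes "0 \<le> h"
  shows "emeasure \<eta> {r. (\<forall>t\<le>r. f r \<le> f t) \<and> (\<forall>t\<ge>r. f r - h \<le> f t)} \<le> ennreal h"
proof -
  let ?D = "{r. (\<forall>t\<le>r. f r \<le> f t) \<and> (\<forall>t\<ge>r. f r - h \<le> f t)}"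
  have "?D = (\<Inter>u\<in>{0..}. {r. f r \<le> f (r - u)} \<inter> {r. f r - h \<le> f (r + u)})"
  proof (intro set_eqI iffI)
    fix r assume r: "r \<in> (\<Inter>u\<in>{0..}. {r. f r \<le> f (r - u)} \<inter> {r. f r - h \<le> f (r + u)})"
    have "f r \<le> f t" if "t \<le> r" for t
      using r that by (auto dest: bspec[of _ _ "r - t"])
    moreover have "f r - h \<le> f t" if "r \<le> t" for t
      using r that by (auto dest: bspec[of _ _ "t - r"])
    ultimately show "r \<in> ?D" by auto
  qed auto
  moreover have "closed {r. f r \<le> f (r - u)}" "closed {r. f r - h \<le> f (r + u)}" for u
    by (intro closed_Collect_le continuous_intros f_continuous
        continuous_on_compose2[OF f_continuous[of UNIV]]; simp)+
  ultimately have cl: "closed ?D" by (simp only:) (intro closed_INT closed_Int ballI)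
  have "emeasure \<eta> (?D \<inter> {- real n..real n}) \<le> ennreal h" for n :: nat
  proof (cases "?D \<inter> {- real n..real n} = {}")
    case False
    have "compact (?D \<inter> {- real n..real n})" using cl by (intro closed_Int_compact compact_Icc)
    from compact_attains_inf[OF this False]
    obtain a where a: "a \<in> ?D \<inter> {- real n..real n}" "\<forall>x\<in>?D \<inter> {- real n..real n}. a \<le> x"
      by (elim bexE)
    then have an: "a \<le> real n" by auto
    obtain x where x: "x \<in> {a..real n}" "f x = future_inf (real n) a" using future_inf_attained[OF an] by auto
    have "emeasure \<eta> (?D \<inter> {- real n..real n}) \<le> emeasure \<eta> (past_minima a (real n))"
    proof (rule emeasure_mono)
      show "?D \<inter> {- real n..real n} \<subseteq> past_minima a (real n)" using a(2) by (auto simp: past_minima_def)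
    qed (simp add: sets_eta)
    also have "\<dots> = ennreal (f a - f x)" using eta_past_minima[OF an] x by simp
    also have "\<dots> \<le> ennreal h" using a(1) x by (intro ennreal_leI) (auto dest!: spec[of _ x])
    finally show ?thesis .
  qed simp
  then have "(SUP n. emeasure \<eta> (?D \<inter> {- real n..real n})) \<le> ennreal h" by (rule SUP_least)
  also have "(SUP n. emeasure \<eta> (?D \<inter> {- real n..real n})) = emeasure \<eta> (\<Union>n::nat. ?D \<inter> {- real n..real n})"
    using cl by (intro SUP_emeasure_incseq) (auto simp: sets_eta incseq_def intro!: sets.Int borel_closed)
  also have "(\<Union>n::nat. ?D \<inter> {- real n..real n}) = ?D"
  proof -
    have "\<exists>n::nat. x \<in> {- real n..real n}" for x :: real
      using real_arch_simple[of "\<bar>x\<bar>"] by (auto simp: abs_le_iff minus_le_iff)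
    then show ?thesis by blast
  qed
  finally show ?thesis .
qed

text \<open>The intervals \<open>{s..tr s}\<close> are nested: \<open>f\<close> stays at or above
  \<open>f s\<close> up to \<open>tr s\<close>, so any point of the interval has a level at least
  \<open>f s\<close>, and this level has been passed as soon as \<open>f\<close> falls below
  \<open>f s\<close>.\<close>

lemma tau_return:
  assumes "\<tau> s < \<infinity>"
  shows "s \<le> tr s" "f (tr s) = f s" and "\<And>s'. s \<le> s' \<Longrightarrow> s' \<le> tr s \<Longrightarrow> \<tau> s' \<le> \<tau> s"
proof -
  define b where "b = tr s"
  have b: "\<tau> s = ereal b" using tau_tr[OF assms] by (simp add: b_def)
  show sb: "s \<le> tr s" using tau_ge[of s] by (simp add: b flip: b_def)
  have near: "\<exists>t\<ge>b. t < b + e \<and> f t < f s" if "0 < e" for e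
  proof -
    have "\<tau> s < ereal (b + e)" using that by (simp add: b)
    then obtain t where t: "s < t" "f t < f s" "t < b + e" by (auto simp: tau_less_iff)
    have "\<tau> s \<le> ereal t" unfolding \<tau>_def using t by (intro INF_lower) auto
    then show ?thesis using t by (auto simp: b)
  qed
  have ge: "f s \<le> f t" if "s \<le> t" "t < b" for t
    using that by (intro ge_before_tau) (auto simp: b)
  have cont: "isCont f b" using f_continuous[of UNIV] by (simp add: continuous_on_eq_continuous_at)
  have "f s \<le> f b"
  proof (rule ccontr)
    assume "\<not> f s \<le> f b"
    then have ne: "f b < f s" "s < b" using sb by (auto simp: not_le less_le b_def)
    have "\<forall>\<^sub>F y in at b. f y < f s"
      using cont ne(1) by (auto simp: isCont_def intro: order_tendstoD(2))
    then obtain d where d: "0 < d" "\<And>y. y \<noteq> b \<Longrightarrow> \<bar>y - b\<bar> < d \<Longrightarrow> f y < f s"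
      by (auto simp: eventually_at dist_real_def)
    define y where "y = max s (b - d / 2)"
    have "s \<le> y" "y < b" "b - d / 2 \<le> y" using ne d(1) by (auto simp: y_def)
    then show False using d(2)[of y] ge[of y] d(1) by auto
  qed
  moreover have "f b \<le> f s"
  proof (rule ccontr)
    assume "\<not> f b \<le> f s"
    then have "\<forall>\<^sub>F y in at b. f s < f y"
      using cont by (auto simp: isCont_def not_le intro: order_tendstoD(1))
    then obtain d where d: "0 < d" "\<And>y. y \<noteq> b \<Longrightarrow> \<bar>y - b\<bar> < d \<Longrightarrow> f s < f y"
      by (auto simp: eventually_at dist_real_def)
    from near[OF d(1)] obtain t where t: "b \<le> t" "t < b + d" "f t < f s" by auto
    then show False using d(2)[of t] \<open>\<not> f b \<le> f s\<close> by (cases "t = b") auto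
  qed
  ultimately show fb: "f (tr s) = f s" by (simp flip: b_def)
  show "\<tau> s' \<le> \<tau> s" if "s \<le> s'" "s' \<le> tr s" for s'
  proof (rule ccontr)
    assume "\<not> \<tau> s' \<le> \<tau> s"
    then have "ereal b < \<tau> s'" by (simp add: b not_le)
    then obtain c where c: "ereal b < ereal c" "ereal c < \<tau> s'" using ereal_dense2 by blast
    then obtain t where t: "b \<le> t" "t < c" "f t < f s" using near[of "c - b"] by auto
    have fs': "f s \<le> f s'"
      using ge[of s'] that fb by (cases "s' = b") (auto simp flip: b_def)
    have "t \<noteq> s'" using t fs' by auto
    then have "s' < t" using that t by (auto simp flip: b_def)
    have "ereal t < \<tau> s'" using less_trans[of "ereal t" "ereal c" "\<tau> s'"] t c by simp
    then have "f s' \<le> f t" using \<open>s' < t\<close> by (intro ge_before_tau) auto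
    then show False using t fs' by simp
  qed
qed

text \<open>The preimage of the interval under \<open>g\<close> has mass
  \<open>\<eta> {a..b}\<close>, which equals \<open>\<xi> {a..b}\<close> and is already used up by
  the interval itself. So almost no point enters from outside, and \<open>g\<close> also transports
  the restrictions.\<close>

lemma xi_restrict_push:
  assumes g[measurable]: "g \<in> borel_measurable borel"
    and push: "\<And>C. C \<in> sets borel \<Longrightarrow> emeasure \<xi> (g -` C) = emeasure \<eta> C"
    and I: "AE s in \<xi>. s \<in> {a..b} \<longrightarrow> g s \<in> {a..b}" and eq: "emeasure \<xi> {a..b} = emeasure \<eta> {a..b}"
  shows "emeasure \<xi> ({a..b} \<inter> {s. g s \<le> c}) = emeasure \<eta> ({a..b} \<inter> {..c})"
proof -
  have gs: "g -` C \<in> sets \<xi>" if "C \<in> sets borel" for C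
    using measurable_sets[OF g that] by (simp add: sets_xi)
  have fin: "emeasure \<xi> {a..b} \<noteq> \<infinity>" using finite_xi by (rule less_imp_neq)
  have Is: "{a..b} \<in> sets \<xi>" by (simp add: sets_xi)
  have sub: "emeasure \<xi> ({a..b} \<inter> g -` {a..b}) = emeasure \<xi> {a..b}"
    using I gs[of "{a..b}"] Is by (intro emeasure_eq_AE) auto
  have null: "g -` {a..b} - ({a..b} \<inter> g -` {a..b}) \<in> null_sets \<xi>"
  proof (rule null_setsI)
    have "emeasure \<xi> (g -` {a..b} - ({a..b} \<inter> g -` {a..b}))
      = emeasure \<xi> (g -` {a..b}) - emeasure \<xi> ({a..b} \<inter> g -` {a..b})"
      using fin gs[of "{a..b}"] Is by (intro emeasure_Diff) (auto simp: sub)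
    then show "emeasure \<xi> (g -` {a..b} - ({a..b} \<inter> g -` {a..b})) = 0"
      using fin by (simp add: push sub eq)
  qed (use gs[of "{a..b}"] Is in auto)
  have "AE s in \<xi>. s \<in> g -` {a..b} \<longrightarrow> s \<in> {a..b}"
    using AE_not_in[OF null] by eventually_elim auto
  then have "emeasure \<xi> ({a..b} \<inter> {s. g s \<le> c}) = emeasure \<xi> (g -` ({a..b} \<inter> {..c}))"
    using I gs[of "{..c}"] gs[of "{a..b} \<inter> {..c}"] Is
    by (intro emeasure_eq_AE) (auto elim!: eventually_elim2 simp: vimage_def)
  then show ?thesis by (simp add: push)
qed

text \<open>On an interval \<open>{a..tr a}\<close> both maps transport the restricted \<xi> to the
  restricted \<eta>. Two functions with the same image measure of finite mass, one below the other,
  agree almost everywhere. The remaining work is to cover the line by countably many such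
  intervals.\<close>

lemma minimal:
  assumes \<sigma>[measurable]: "\<sigma> \<in> borel_measurable borel"
    and le: "AE s in \<xi>. s \<le> \<sigma> s \<and> \<sigma> s \<le> tr s"
    and fin: "AE s in \<xi>. \<tau> s < \<infinity>"
    and push: "\<And>C. C \<in> sets borel \<Longrightarrow> emeasure \<xi> (\<sigma> -` C) = emeasure \<eta> C"
      "\<And>C. C \<in> sets borel \<Longrightarrow> emeasure \<xi> (tr -` C) = emeasure \<eta> C"
  shows "AE s in \<xi>. \<sigma> s = tr s"
proof -
  define N where "N = {s. \<sigma> s < tr s}"
  have N[measurable]: "N \<in> sets borel" unfolding N_def by measurable
  have local: "emeasure \<xi> (N \<inter> {a..tr a}) = 0" if a: "\<tau> a < \<infinity>" for a
  proof -
    let ?I = "{a..tr a}"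
    have eq: "emeasure \<xi> ?I = emeasure \<eta> ?I"
      using tau_return[OF a] by (intro emeasure_xi_eta) auto
    have tI: "AE s in \<xi>. s \<in> ?I \<longrightarrow> tr s \<in> ?I"
      using fin
    proof eventually_elim
      fix s assume s: "\<tau> s < \<infinity>"
      show "s \<in> ?I \<longrightarrow> tr s \<in> ?I"
      proof
        assume "s \<in> ?I"
        then have "\<tau> s \<le> \<tau> a" using tau_return(3)[OF a] by auto
        then show "tr s \<in> ?I" using tau_tr[OF s] tau_tr[OF a] tau_return(1)[OF s] \<open>s \<in> ?I\<close> by auto
      qed
    qed
    have sI: "AE s in \<xi>. s \<in> ?I \<longrightarrow> \<sigma> s \<in> ?I"
      using tI le by eventually_elim auto
    \<comment> \<open>Since \<open>\<sigma> \<le> tr\<close>, the second set is almost contained in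
      the first; both have the same finite mass, so the difference is null.\<close>
    have null: "?I \<inter> {s. \<sigma> s \<le> c} - ?I \<inter> {s. tr s \<le> c} \<in> null_sets \<xi>" for c
    proof -
      have A: "?I \<inter> {s. \<sigma> s \<le> c} \<in> sets \<xi>" "?I \<inter> {s. tr s \<le> c} \<in> sets \<xi>"
        unfolding sets_xi by measurable
      have AB: "emeasure \<xi> (?I \<inter> {s. \<sigma> s \<le> c} \<inter> (?I \<inter> {s. tr s \<le> c})) = emeasure \<xi> (?I \<inter> {s. tr s \<le> c})"
        using A le by (intro emeasure_eq_AE) auto
      have e: "emeasure \<xi> (?I \<inter> {s. \<sigma> s \<le> c}) = emeasure \<xi> (?I \<inter> {s. tr s \<le> c})"
        using xi_restrict_push[OF \<sigma> push(1) sI eq] xi_restrict_push[OF measurable_tr push(2) tI eq] by simp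
      have f: "emeasure \<xi> (?I \<inter> {s. tr s \<le> c}) \<noteq> \<infinity>"
      proof -
        have "emeasure \<xi> (?I \<inter> {s. tr s \<le> c}) \<le> emeasure \<xi> ?I"
          by (intro emeasure_mono) (auto simp: sets_xi)
        from le_less_trans[OF this finite_xi] show ?thesis by (rule less_imp_neq)
      qed
      have "emeasure \<xi> (?I \<inter> {s. \<sigma> s \<le> c} - ?I \<inter> {s. \<sigma> s \<le> c} \<inter> (?I \<inter> {s. tr s \<le> c})) = 0"
      proof (subst emeasure_Diff)
        show "emeasure \<xi> (?I \<inter> {s. \<sigma> s \<le> c} \<inter> (?I \<inter> {s. tr s \<le> c})) \<noteq> \<infinity>" unfolding AB by (rule f)
        show "emeasure \<xi> (?I \<inter> {s. \<sigma> s \<le> c}) - emeasure \<xi> (?I \<inter> {s. \<sigma> s \<le> c} \<inter> (?I \<inter> {s. tr s \<le> c})) = 0"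
          unfolding AB e using f by simp
      qed (intro sets.Int A | blast)+
      moreover have "?I \<inter> {s. \<sigma> s \<le> c} - ?I \<inter> {s. \<sigma> s \<le> c} \<inter> (?I \<inter> {s. tr s \<le> c})
        = ?I \<inter> {s. \<sigma> s \<le> c} - ?I \<inter> {s. tr s \<le> c}" by auto
      ultimately show ?thesis using A by (intro null_setsI) auto
    qed
    have sub: "N \<inter> ?I \<subseteq> (\<Union>c\<in>\<rat>. ?I \<inter> {s. \<sigma> s \<le> c} - ?I \<inter> {s. tr s \<le> c})"
    proof
      fix s assume s: "s \<in> N \<inter> ?I"
      then obtain c where "c \<in> \<rat>" "\<sigma> s < c" "c < tr s" using Rats_dense_in_real[of "\<sigma> s" "tr s"] by (auto simp: N_def)
      then show "s \<in> (\<Union>c\<in>\<rat>. ?I \<inter> {s. \<sigma> s \<le> c} - ?I \<inter> {s. tr s \<le> c})" using s by (intro UN_I[of c]) auto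
    qed
    have "(\<Union>c\<in>\<rat>. ?I \<inter> {s. \<sigma> s \<le> c} - ?I \<inter> {s. tr s \<le> c}) \<in> null_sets \<xi>"
      by (intro null_sets_UN' countable_rat null)
    from null_sets_subset[OF this _ sub] have "N \<inter> ?I \<in> null_sets \<xi>"
      using N by (simp add: sets_xi)
    then show ?thesis by auto
  qed
  \<comment> \<open>Each bad point \<open>s\<close> has a rational \<open>q\<close> with
    \<open>s \<in> J q\<close>, but starting points range over an uncountable set. Membership in
    \<open>J q\<close> passes to later points, so a rational starting point in \<open>J q\<close> at
    or before \<open>s\<close> can be used, unless \<open>s\<close> belongs to \<open>X q\<close>,
    which has at most one point and is null.\<close>
  define J where "J q = {s. s < q \<and> emeasure \<xi> (N \<inter> {s..q}) = 0}" for q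
  define X where "X q = {s\<in>J q. \<forall>p\<in>\<rat>. p \<le> s \<longrightarrow> p \<notin> J q}" for q
  have up: "s' \<in> J q" if "s \<in> J q" "s \<le> s'" "s' < q" for s s' q
  proof -
    have "emeasure \<xi> (N \<inter> {s'..q}) \<le> emeasure \<xi> (N \<inter> {s..q})"
      using that(2) by (intro emeasure_mono) (auto simp: sets_xi)
    then show ?thesis using that by (auto simp: J_def)
  qed
  have X: "X q \<in> null_sets \<xi>" for q
  proof -
    have "s = s'" if s: "s \<in> X q" "s' \<in> X q" for s s'
    proof (rule ccontr)
      assume "s \<noteq> s'"
      then obtain u v where uv: "u \<in> X q" "v \<in> X q" "u < v" using s by (metis linorder_neqE)
      obtain p where p: "p \<in> \<rat>" "u < p" "p < v" using Rats_dense_in_real[OF uv(3)] by auto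
      have uJ: "u \<in> J q" and vJ: "v \<in> J q" using uv(1,2) unfolding X_def by blast+
      have "p < q" using p(3) vJ unfolding J_def by simp
      with uJ p(2) have pJ: "p \<in> J q" by (intro up[of u q p]) linarith+
      from uv(2) have "\<forall>p\<in>\<rat>. p \<le> v \<longrightarrow> p \<notin> J q" unfolding X_def by blast
      from this[rule_format, OF p(1)] p(3) pJ show False by simp
    qed
    then have "X q = {} \<or> (\<exists>x. X q = {x})" by blast
    then show ?thesis using diffuse_xi by (auto intro!: null_setsI simp: sets_xi)
  qed
  have E: "(\<Union>q\<in>\<rat>. \<Union>p\<in>\<rat> \<inter> J q. N \<inter> {p..q}) \<union> (\<Union>q\<in>\<rat>. X q) \<in> null_sets \<xi>"
    by (intro null_sets.Un null_sets_UN' countable_rat X countable_Int1 null_setsI)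
      (auto simp: J_def sets_xi)
  show ?thesis
    using AE_not_in[OF E] fin le
  proof eventually_elim
    fix s
    assume nE: "s \<notin> (\<Union>q\<in>\<rat>. \<Union>p\<in>\<rat> \<inter> J q. N \<inter> {p..q}) \<union> (\<Union>q\<in>\<rat>. X q)"
      and s: "\<tau> s < \<infinity>" "s \<le> \<sigma> s \<and> \<sigma> s \<le> tr s"
    show "\<sigma> s = tr s"
    proof (rule ccontr)
      assume "\<sigma> s \<noteq> tr s"
      then have sN: "s \<in> N" and "s < tr s" using s by (auto simp: N_def)
      then obtain q where q: "q \<in> \<rat>" "s < q" "q < tr s" using Rats_dense_in_real by blast
      have "emeasure \<xi> (N \<inter> {s..q}) \<le> emeasure \<xi> (N \<inter> {s..tr s})"
        using q by (intro emeasure_mono) (auto simp: sets_xi)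
      then have sJ: "s \<in> J q" using local[OF s(1)] q by (auto simp: J_def)
      have "s \<notin> X q" using nE q(1) by auto
      then obtain p where p: "p \<in> \<rat>" "p \<le> s" "p \<in> J q" using sJ unfolding X_def by blast
      have "s \<in> (\<Union>q\<in>\<rat>. \<Union>p\<in>\<rat> \<inter> J q. N \<inter> {p..q})"
        using p q sN by (intro UN_I[of q] UN_I[of p]) auto
      then show False using nE by blast
    qed
  qed
qed

end

section \<open>Palm measures of the local times\<close>

text \<open>Only the kernel at level 0 is carried; the local time at level \<open>x\<close> is
  \<open>K (raise (- x) \<omega>)\<close>. The kernel is locally finite for every path, and the null
  set of the occupation formula does not depend on the integrand; the last section derives this form
  from the given local time.\<close>

locale bm_local_time =
  fixes P0 :: "(real \<Rightarrow> real) measure" and K :: "(real \<Rightarrow> real) \<Rightarrow> real measure"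
  assumes BM: "BM_law P0"
    and kernel: "lf_kernel path_space K"
    and diffuse: "\<And>x. AE \<omega> in P0. \<forall>s. emeasure (K (raise x \<omega>)) {s} = 0"
    and shift_inv: "\<And>t x C. C \<in> sets borel \<Longrightarrow> AE \<omega> in P0.
      emeasure (K (shift_path t (raise x \<omega>))) {s. s + t \<in> C} = emeasure (K (raise x \<omega>)) C"
    and support: "\<And>\<omega>. \<omega> \<in> space path_space \<Longrightarrow> emeasure (K \<omega>) {t. \<omega> t \<noteq> 0} = 0"
    and occupation: "AE \<omega> in P0. \<forall>f\<in>borel_measurable (borel \<Otimes>\<^sub>M borel).
      (\<integral>\<^sup>+ s. f (\<omega> s, s) \<partial>lborel) = (\<integral>\<^sup>+ x. \<integral>\<^sup>+ s. f (x, s) \<partial>K (raise (- x) \<omega>) \<partial>lborel)"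
begin

lemma sets_P0 [measurable_cong, simp]: "sets P0 = sets path_space"
  using BM by (simp add: BM_law_def)

lemma space_P0 [simp]: "space P0 = space path_space"
  using sets_P0 by (rule sets_eq_imp_space_eq)

lemma measurable_P0 [simp]: "measurable P0 = measurable path_space"
  by (intro ext measurable_cong_sets) auto

sublocale P0: prob_space P0
  using BM by (simp add: BM_law_def two_sided_BM_def)

lemma kernelD:
  assumes "\<omega> \<in> space path_space"
  shows "sets (K \<omega>) = sets borel" "space (K \<omega>) = UNIV" "emeasure (K \<omega>) {a..b} < \<infinity>"
  using lf_kernelD(1)[OF kernel assms] sets_eq_imp_space_eq[OF lf_kernelD(1)[OF kernel assms]]
    lf_kernel_finite_Icc[OF kernel assms] by auto

definition start :: "real measure \<Rightarrow> (real \<Rightarrow> real) measure" where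
  "start \<mu> = distr (\<mu> \<Otimes>\<^sub>M P0) path_space (\<lambda>p. raise (fst p) (snd p))"

lemma sets_start [simp, measurable_cong]: "sets (start \<mu>) = sets path_space"
  and space_start [simp]: "space (start \<mu>) = space path_space"
  by (auto simp: start_def)

lemma measurable_start [simp]: "measurable (start \<mu>) = measurable path_space"
  by (intro ext measurable_cong_sets) auto

lemma nn_integral_start:
  assumes \<mu>: "sigma_finite_measure \<mu>" "sets \<mu> = sets borel" and F[measurable]: "F \<in> borel_measurable path_space"
  shows "(\<integral>\<^sup>+ \<omega>. F \<omega> \<partial>start \<mu>) = (\<integral>\<^sup>+ x. \<integral>\<^sup>+ \<omega>. F (raise x \<omega>) \<partial>P0 \<partial>\<mu>)"
proof -
  note \<mu>(2)[measurable_cong]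
  have "(\<integral>\<^sup>+ \<omega>. F \<omega> \<partial>start \<mu>) = (\<integral>\<^sup>+ p. F (raise (fst p) (snd p)) \<partial>(\<mu> \<Otimes>\<^sub>M P0))"
    unfolding start_def by (subst nn_integral_distr) auto
  also have "\<dots> = (\<integral>\<^sup>+ x. \<integral>\<^sup>+ \<omega>. F (raise x \<omega>) \<partial>P0 \<partial>\<mu>)"
    by (subst P0.nn_integral_fst[symmetric]) auto
  finally show ?thesis .
qed

lemma AE_start:
  assumes \<mu>: "sigma_finite_measure \<mu>" "sets \<mu> = sets borel" and Q[measurable]: "Measurable.pred path_space Q"
  shows "(AE \<omega> in start \<mu>. Q \<omega>) \<longleftrightarrow> (AE x in \<mu>. AE \<omega> in P0. Q (raise x \<omega>))"
proof -
  note \<mu>(2)[measurable_cong]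
  interpret \<mu>: sigma_finite_measure \<mu> by fact
  interpret pair_sigma_finite \<mu> P0 ..
  have "(AE \<omega> in start \<mu>. Q \<omega>) \<longleftrightarrow> (AE p in \<mu> \<Otimes>\<^sub>M P0. Q (raise (fst p) (snd p)))"
    unfolding start_def by (rule AE_distr_iff) measurable
  also have "\<dots> \<longleftrightarrow> (AE x in \<mu>. AE \<omega> in P0. Q (raise x \<omega>))"
    by (rule AE_pair_iff[symmetric]) measurable
  finally show ?thesis .
qed

lemma AE_startI:
  assumes "sigma_finite_measure \<mu>" "sets \<mu> = sets borel" "Measurable.pred path_space Q"
    and "\<And>x. AE \<omega> in P0. Q (raise x \<omega>)"
  shows "AE \<omega> in start \<mu>. Q \<omega>"
  using assms by (simp add: AE_start)

abbreviation "P_leb \<equiv> start lborel"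

lemmas nn_integral_P_leb = nn_integral_start[OF sigma_finite_lborel sets_lborel]
lemmas AE_P_leb_I = AE_startI[OF sigma_finite_lborel sets_lborel]

lemma stationary:
  assumes [measurable]: "F \<in> borel_measurable path_space"
  shows "(\<integral>\<^sup>+ \<omega>. F (raise (- \<omega> t) (shift_path t \<omega>)) \<partial>P0) = (\<integral>\<^sup>+ \<omega>. F \<omega> \<partial>P0)"
proof -
  note measurable_eval[measurable]
  have eq: "raise (- \<omega> t) (shift_path t \<omega>) = (\<lambda>s. \<omega> (t + s) - \<omega> t)" for \<omega>
    by (auto simp: raise_def shift_path_def)
  have [measurable]: "(\<lambda>\<omega>. raise (- \<omega> t) (shift_path t \<omega>)) \<in> measurable path_space path_space" by measurable
  have "(\<integral>\<^sup>+ \<omega>. F \<omega> \<partial>P0) = (\<integral>\<^sup>+ \<omega>. F \<omega> \<partial>distr P0 path_space (\<lambda>\<omega>. raise (- \<omega> t) (shift_path t \<omega>)))"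
    unfolding eq BM_law_stationary[OF BM] ..
  also have "\<dots> = (\<integral>\<^sup>+ \<omega>. F (raise (- \<omega> t) (shift_path t \<omega>)) \<partial>P0)"
    by (rule nn_integral_distr) auto
  finally show ?thesis ..
qed

lemma measurable_kernel_integral [measurable (raw)]:
  fixes f :: "'a \<Rightarrow> real \<Rightarrow> ennreal"
  assumes h: "h \<in> measurable M path_space" and f: "(\<lambda>p. f (fst p) (snd p)) \<in> borel_measurable (M \<Otimes>\<^sub>M borel)"
  shows "(\<lambda>x. \<integral>\<^sup>+ s. f x s \<partial>K (h x)) \<in> borel_measurable M"
  by (rule lf_kernel_nn_integral'[OF lf_kernel_compose[OF kernel h] f])

text \<open>Since \<open>P_leb\<close> is invariant under vertical translation, the integral over the starting level
  can be combined with the local time at a fixed level into an occupation integral.\<close>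

theorem palm:
  fixes g :: "(real \<Rightarrow> real) \<Rightarrow> real \<Rightarrow> ennreal"
  assumes g[measurable]: "(\<lambda>p. g (fst p) (snd p)) \<in> borel_measurable (path_space \<Otimes>\<^sub>M borel)"
  shows "(\<integral>\<^sup>+ \<omega>. \<integral>\<^sup>+ s. g (shift_path s \<omega>) s \<partial>K (raise (- x) \<omega>) \<partial>P_leb)
    = (\<integral>\<^sup>+ s. \<integral>\<^sup>+ \<omega>. g (raise x \<omega>) s \<partial>P0 \<partial>lborel)"
proof -
  have mg: "(\<lambda>y. g (h y) (k y)) \<in> borel_measurable M"
    if "h \<in> measurable M path_space" "k \<in> borel_measurable M" for h k and M :: "'c measure"
    using measurable_compose[OF measurable_Pair[OF that] g] by simp
  interpret pair_sigma_finite lborel P0 ..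
  interpret LP: pair_sigma_finite P0 lborel ..
  have [measurable]: "(\<lambda>\<omega>. \<integral>\<^sup>+ s. g (shift_path s \<omega>) s \<partial>K (raise (- x) \<omega>)) \<in> borel_measurable path_space"
    by (intro measurable_kernel_integral mg) measurable
  have m1: "(\<lambda>p. \<integral>\<^sup>+ s. g (raise (x - fst p) (shift_path s (snd p))) s \<partial>K (raise (- fst p) (snd p)))
    \<in> borel_measurable (lborel \<Otimes>\<^sub>M P0)"
    by (intro measurable_kernel_integral mg) measurable
  have m2: "(\<lambda>z. \<integral>\<^sup>+ \<omega>. \<integral>\<^sup>+ s. g (raise z (shift_path s \<omega>)) s \<partial>K (raise (z - x) \<omega>) \<partial>P0) \<in> borel_measurable borel"
  proof (rule P0.borel_measurable_nn_integral)
    show "(\<lambda>(z, \<omega>). \<integral>\<^sup>+ s. g (raise z (shift_path s \<omega>)) s \<partial>K (raise (z - x) \<omega>)) \<in> borel_measurable (borel \<Otimes>\<^sub>M P0)"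
      unfolding case_prod_unfold by (intro measurable_kernel_integral mg) measurable
  qed
  have m3: "(\<lambda>p. g (raise (x - fst p (snd p)) (shift_path (snd p) (fst p))) (snd p)) \<in> borel_measurable (P0 \<Otimes>\<^sub>M lborel)"
  proof -
    have [measurable]: "(\<lambda>p. fst p (snd p)) \<in> borel_measurable (path_space \<Otimes>\<^sub>M borel)" by (rule measurable_eval_pair)
    have "(\<lambda>p. fst p (snd p)) \<in> borel_measurable (P0 \<Otimes>\<^sub>M lborel)" by measurable
    then show ?thesis by (intro mg measurable_raise measurable_shift_path) measurable
  qed
  have "(\<integral>\<^sup>+ \<omega>. \<integral>\<^sup>+ s. g (shift_path s \<omega>) s \<partial>K (raise (- x) \<omega>) \<partial>P_leb)
    = (\<integral>\<^sup>+ z. \<integral>\<^sup>+ \<omega>. \<integral>\<^sup>+ s. g (raise z (shift_path s \<omega>)) s \<partial>K (raise (z - x) \<omega>) \<partial>P0 \<partial>lborel)"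
    by (subst nn_integral_P_leb) (auto simp: add.commute)
  \<comment> \<open>The substitution \<open>z = x - y\<close> makes the level \<open>y\<close> of
    the local time the variable of integration, as in the occupation formula.\<close>
  also have "\<dots> = (\<integral>\<^sup>+ y. \<integral>\<^sup>+ \<omega>. \<integral>\<^sup>+ s. g (raise (x - y) (shift_path s \<omega>)) s \<partial>K (raise (- y) \<omega>) \<partial>P0 \<partial>lborel)"
    using nn_integral_real_affine[OF m2, of "-1" x] by simp
  also have "\<dots> = (\<integral>\<^sup>+ \<omega>. \<integral>\<^sup>+ y. \<integral>\<^sup>+ s. g (raise (x - y) (shift_path s \<omega>)) s \<partial>K (raise (- y) \<omega>) \<partial>lborel \<partial>P0)"
    using m1 by (intro Fubini'[symmetric]) (simp add: case_prod_unfold)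
  \<comment> \<open>The occupation formula merges the integrals over the level \<open>y\<close> and
    over the local time at \<open>y\<close> into one over time with \<open>y = \<omega> s\<close>.
    The path is then recentred at its position at time \<open>s\<close>, and stationarity of
    increments removes the shift.\<close>
  also have "\<dots> = (\<integral>\<^sup>+ \<omega>. \<integral>\<^sup>+ s. g (raise (x - \<omega> s) (shift_path s \<omega>)) s \<partial>lborel \<partial>P0)"
  proof (intro nn_integral_cong_AE)
    show "AE \<omega> in P0. (\<integral>\<^sup>+ y. \<integral>\<^sup>+ s. g (raise (x - y) (shift_path s \<omega>)) s \<partial>K (raise (- y) \<omega>) \<partial>lborel)
      = (\<integral>\<^sup>+ s. g (raise (x - \<omega> s) (shift_path s \<omega>)) s \<partial>lborel)"
      using occupation AE_space
    proof eventually_elim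
      fix \<omega> assume occ: "\<forall>f\<in>borel_measurable (borel \<Otimes>\<^sub>M borel).
        (\<integral>\<^sup>+ s. f (\<omega> s, s) \<partial>lborel) = (\<integral>\<^sup>+ x. \<integral>\<^sup>+ s. f (x, s) \<partial>K (raise (- x) \<omega>) \<partial>lborel)"
        and \<omega>: "\<omega> \<in> space P0"
      have "(\<lambda>p. g (raise (x - fst p) (shift_path (snd p) \<omega>)) (snd p)) \<in> borel_measurable (borel \<Otimes>\<^sub>M borel)"
        using \<omega> by (intro mg measurable_raise measurable_shift_path) auto
      from occ[rule_format, OF this]
      show "(\<integral>\<^sup>+ y. \<integral>\<^sup>+ s. g (raise (x - y) (shift_path s \<omega>)) s \<partial>K (raise (- y) \<omega>) \<partial>lborel)
        = (\<integral>\<^sup>+ s. g (raise (x - \<omega> s) (shift_path s \<omega>)) s \<partial>lborel)" by simp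
    qed
  qed
  also have "\<dots> = (\<integral>\<^sup>+ s. \<integral>\<^sup>+ \<omega>. g (raise (x - \<omega> s) (shift_path s \<omega>)) s \<partial>P0 \<partial>lborel)"
    using m3 by (intro LP.Fubini'[symmetric]) (simp add: case_prod_unfold)
  also have "\<dots> = (\<integral>\<^sup>+ s. \<integral>\<^sup>+ \<omega>. g (raise x \<omega>) s \<partial>P0 \<partial>lborel)"
  proof (rule nn_integral_cong)
    fix s
    have "(\<lambda>\<omega>. g (raise x \<omega>) s) \<in> borel_measurable path_space" by (intro mg) measurable
    from stationary[OF this, of s]
    show "(\<integral>\<^sup>+ \<omega>. g (raise (x - \<omega> s) (shift_path s \<omega>)) s \<partial>P0) = (\<integral>\<^sup>+ \<omega>. g (raise x \<omega>) s \<partial>P0)"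
      by simp
  qed
  finally show ?thesis .
qed

end

section \<open>Conservativity and invariant events\<close>

lemma nn_integral_lborel_shift:
  fixes f :: "real \<Rightarrow> ennreal"
  assumes "f \<in> borel_measurable borel"
  shows "(\<integral>\<^sup>+ z. f (z + h) \<partial>lborel) = (\<integral>\<^sup>+ z. f z \<partial>lborel)"
  using nn_integral_real_affine[OF assms, of 1 h] by (simp add: add.commute)

lemma nn_integral_lborel_reflect:
  fixes f :: "real \<Rightarrow> ennreal"
  assumes "f \<in> borel_measurable borel"
  shows "(\<integral>\<^sup>+ z. f (h - z) \<partial>lborel) = (\<integral>\<^sup>+ z. f z \<partial>lborel)"
  using nn_integral_real_affine[OF assms, of "-1" h] by simp

lemma translate_L1_triangle:
  fixes k g :: "real \<Rightarrow> real"
  assumes [measurable]: "k \<in> borel_measurable borel" "g \<in> borel_measurable borel"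
  shows "(\<integral>\<^sup>+ z. ennreal \<bar>k (z + h) - k z\<bar> \<partial>lborel)
    \<le> 2 * (\<integral>\<^sup>+ z. ennreal \<bar>k z - g z\<bar> \<partial>lborel) + (\<integral>\<^sup>+ z. ennreal \<bar>g (z + h) - g z\<bar> \<partial>lborel)"
proof -
  have "(\<integral>\<^sup>+ z. ennreal \<bar>k (z + h) - k z\<bar> \<partial>lborel)
    \<le> (\<integral>\<^sup>+ z. ennreal \<bar>k (z + h) - g (z + h)\<bar> + ennreal \<bar>k z - g z\<bar> + ennreal \<bar>g (z + h) - g z\<bar> \<partial>lborel)"
    by (intro nn_integral_mono) (simp add: ennreal_plus[symmetric] del: ennreal_plus)
  also have "\<dots> = (\<integral>\<^sup>+ z. ennreal \<bar>k (z + h) - g (z + h)\<bar> \<partial>lborel) + (\<integral>\<^sup>+ z. ennreal \<bar>k z - g z\<bar> \<partial>lborel)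
     + (\<integral>\<^sup>+ z. ennreal \<bar>g (z + h) - g z\<bar> \<partial>lborel)"
    by (simp add: nn_integral_add)
  also have "(\<integral>\<^sup>+ z. ennreal \<bar>k (z + h) - g (z + h)\<bar> \<partial>lborel) = (\<integral>\<^sup>+ z. ennreal \<bar>k z - g z\<bar> \<partial>lborel)"
    using nn_integral_lborel_shift[of "\<lambda>z. ennreal \<bar>k z - g z\<bar>" h] by simp
  finally show ?thesis by (simp add: mult_2)
qed

text \<open>Translation preserves the L^1 norm, so replacing \<open>k\<close> by \<open>g\<close>
  costs at most twice their distance; this fixes the tolerance \<open>r / 4\<close> for the
  approximation.\<close>

lemma translate_L1_limit:
  fixes k :: "real \<Rightarrow> real" and h :: "nat \<Rightarrow> real"
  assumes k: "k \<in> borel_measurable borel"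
    and appr: "\<And>e::real. 0 < e \<Longrightarrow> \<exists>g\<in>borel_measurable borel.
      (\<integral>\<^sup>+ z. ennreal \<bar>k z - g z\<bar> \<partial>lborel) \<le> ennreal e \<and>
      (\<lambda>m. \<integral>\<^sup>+ z. ennreal \<bar>g (z + h m) - g z\<bar> \<partial>lborel) \<longlonglongrightarrow> 0"
  shows "(\<lambda>m. \<integral>\<^sup>+ z. ennreal \<bar>k (z + h m) - k z\<bar> \<partial>lborel) \<longlonglongrightarrow> 0"
proof (rule tendsto_zero_ennreal)
  fix r :: real assume r: "0 < r"
  obtain g where g: "g \<in> borel_measurable borel"
      "(\<integral>\<^sup>+ z. ennreal \<bar>k z - g z\<bar> \<partial>lborel) \<le> ennreal (r / 4)"
      "(\<lambda>m. \<integral>\<^sup>+ z. ennreal \<bar>g (z + h m) - g z\<bar> \<partial>lborel) \<longlonglongrightarrow> 0"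
    using appr[of "r / 4"] r by auto
  have "\<forall>\<^sub>F m in sequentially. (\<integral>\<^sup>+ z. ennreal \<bar>g (z + h m) - g z\<bar> \<partial>lborel) < ennreal (r / 2)"
    using g(3) r by (intro order_tendstoD(2)) auto
  then show "\<forall>\<^sub>F m in sequentially. (\<integral>\<^sup>+ z. ennreal \<bar>k (z + h m) - k z\<bar> \<partial>lborel) < ennreal r"
  proof eventually_elim
    fix m assume m: "(\<integral>\<^sup>+ z. ennreal \<bar>g (z + h m) - g z\<bar> \<partial>lborel) < ennreal (r / 2)"
    have "(\<integral>\<^sup>+ z. ennreal \<bar>k (z + h m) - k z\<bar> \<partial>lborel)
      \<le> 2 * (\<integral>\<^sup>+ z. ennreal \<bar>k z - g z\<bar> \<partial>lborel) + (\<integral>\<^sup>+ z. ennreal \<bar>g (z + h m) - g z\<bar> \<partial>lborel)"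
      by (rule translate_L1_triangle[OF k g(1)])
    also have "\<dots> \<le> 2 * ennreal (r / 4) + (\<integral>\<^sup>+ z. ennreal \<bar>g (z + h m) - g z\<bar> \<partial>lborel)"
      by (intro add_mono mult_left_mono g(2)) auto
    also have "2 * ennreal (r / 4) = ennreal (r / 2)"
    proof -
      have "2 * ennreal (r / 4) = ennreal 2 * ennreal (r / 4)" by simp
      also have "\<dots> = ennreal (r / 2)" using r by (subst ennreal_mult[symmetric]) auto
      finally show ?thesis .
    qed
    also have "ennreal (r / 2) + (\<integral>\<^sup>+ z. ennreal \<bar>g (z + h m) - g z\<bar> \<partial>lborel) < ennreal (r / 2) + ennreal (r / 2)"
      using m by (intro ennreal_add_left_cancel_less[THEN iffD2]) auto
    also have "\<dots> = ennreal r" using r by (subst ennreal_plus[symmetric]) auto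
    finally show "(\<integral>\<^sup>+ z. ennreal \<bar>k (z + h m) - k z\<bar> \<partial>lborel) < ennreal r" .
  qed
qed

text \<open>A point of an open set stays in it under small translations, so dominated convergence
  handles the points that leave \<open>U\<close>; the points that enter \<open>U\<close> are those
  that leave it under the opposite translation.\<close>

lemma translate_L1_open:
  fixes U :: "real set"
  assumes U: "open U" "emeasure lborel U < \<infinity>" and h: "h \<longlonglongrightarrow> (0::real)"
  shows "(\<lambda>m. \<integral>\<^sup>+ z. ennreal \<bar>indicator U (z + h m) - indicator U z\<bar> \<partial>lborel) \<longlonglongrightarrow> 0"
proof -
  have [measurable]: "U \<in> sets borel" using U(1) by (rule borel_open)
  have one: "(\<lambda>m. \<integral>\<^sup>+ z. indicator U z * indicator (- U) (z + h m) \<partial>lborel) \<longlonglongrightarrow> 0"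
    if h: "h \<longlonglongrightarrow> (0::real)" for h
  proof -
    have "(\<lambda>m. \<integral>\<^sup>+ z. indicator U z * indicator (- U) (z + h m) \<partial>lborel) \<longlonglongrightarrow> (\<integral>\<^sup>+ z. 0 \<partial>(lborel :: real measure))"
    proof (rule nn_integral_dominated_convergence[where w="indicator U"])
      show "(\<integral>\<^sup>+ z. indicator U z \<partial>lborel) < \<infinity>" using U(2) by simp
      show "AE z in lborel. (\<lambda>m. indicator U z * indicator (- U) (z + h m) :: ennreal) \<longlonglongrightarrow> 0"
      proof (rule AE_I2)
        fix z :: real
        show "(\<lambda>m. indicator U z * indicator (- U) (z + h m) :: ennreal) \<longlonglongrightarrow> 0"
        proof (cases "z \<in> U")
          case True
          have "(\<lambda>m. z + h m) \<longlonglongrightarrow> z + 0" by (intro tendsto_intros h)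
          then have "\<forall>\<^sub>F m in sequentially. z + h m \<in> U"
            using True U(1) by (auto simp: tendsto_def)
          then have "\<forall>\<^sub>F m in sequentially. (0::ennreal) = indicator U z * indicator (- U) (z + h m)"
            by eventually_elim simp
          then show ?thesis by (rule Lim_transform_eventually[rotated]) simp
        qed simp
      qed
      show "AE z in lborel. indicator U z * indicator (- U) (z + h m) \<le> (indicator U z :: ennreal)" for m
        by (auto simp: indicator_def)
    qed measurable
    then show ?thesis by simp
  qed
  have eq: "(\<integral>\<^sup>+ z. ennreal \<bar>indicator U (z + h m) - indicator U z\<bar> \<partial>lborel)
    = (\<integral>\<^sup>+ z. indicator U z * indicator (- U) (z + h m) \<partial>lborel)
      + (\<integral>\<^sup>+ z. indicator U z * indicator (- U) (z + - h m) \<partial>lborel)" for m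
  proof -
    have "(\<integral>\<^sup>+ z. ennreal \<bar>indicator U (z + h m) - indicator U z\<bar> \<partial>lborel)
      = (\<integral>\<^sup>+ z. indicator U z * indicator (- U) (z + h m) + indicator U (z + h m) * indicator (- U) z \<partial>lborel)"
      by (intro nn_integral_cong) (auto simp: indicator_def)
    also have "\<dots> = (\<integral>\<^sup>+ z. indicator U z * indicator (- U) (z + h m) \<partial>lborel)
      + (\<integral>\<^sup>+ z. indicator U (z + h m) * indicator (- U) z \<partial>lborel)"
      by (intro nn_integral_add) measurable
    also have "(\<integral>\<^sup>+ z. indicator U (z + h m) * indicator (- U) z \<partial>lborel)
      = (\<integral>\<^sup>+ z. indicator U z * indicator (- U) (z + - h m) \<partial>lborel)"
      using nn_integral_lborel_shift[of "\<lambda>z. indicator U z * indicator (- U) (z + - h m)" "h m"] by simp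
    finally show ?thesis .
  qed
  have "(\<lambda>m. - h m) \<longlonglongrightarrow> 0" using tendsto_minus[OF h] by simp
  from tendsto_add[OF one[OF h] one[OF this]] show ?thesis by (simp add: eq)
qed

lemma translate_L1_tendsto:
  fixes k :: "real \<Rightarrow> real"
  assumes "integrable lborel k" and h: "h \<longlonglongrightarrow> (0::real)"
  shows "(\<lambda>m. \<integral>\<^sup>+ z. ennreal \<bar>k (z + h m) - k z\<bar> \<partial>lborel) \<longlonglongrightarrow> 0"
  using assms(1)
proof (induction rule: integrable_induct)
  case (base A c)
  note [measurable] = base(1)
  have A: "A \<in> sets borel" using base(1) by simp
  show ?case
  proof (rule translate_L1_limit)
    fix e :: real assume e: "0 < e"
    \<comment> \<open>The summand 1 avoids a division by zero for \<open>c = 0\<close>.\<close>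
    define d where "d = e / (\<bar>c\<bar> + 1)"
    have d: "0 < d" using e by (simp add: d_def)
    obtain U where U: "open U" "A \<subseteq> U" "emeasure lborel (U - A) < ennreal d"
      using outer_regular_lborel[OF A d] by blast
    have [measurable]: "U \<in> sets borel" using U(1) by (rule borel_open)
    have "emeasure lborel U \<le> emeasure lborel A + emeasure lborel (U - A)"
      using emeasure_subadditive[of A lborel "U - A"] U(2) A by (simp add: Un_absorb1)
    also have "\<dots> < \<infinity>" using base(2) less_trans[OF U(3) ennreal_less_top] by simp
    finally have Ufin: "emeasure lborel U < \<infinity>" .
    show "\<exists>g\<in>borel_measurable borel. (\<integral>\<^sup>+ z. ennreal \<bar>indicator A z *\<^sub>R c - g z\<bar> \<partial>lborel) \<le> ennreal e \<and>
      (\<lambda>m. \<integral>\<^sup>+ z. ennreal \<bar>g (z + h m) - g z\<bar> \<partial>lborel) \<longlonglongrightarrow> 0"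
    proof (intro bexI[of _ "\<lambda>z. indicator U z * c"] conjI)
      have "(\<integral>\<^sup>+ z. ennreal \<bar>indicator A z *\<^sub>R c - indicator U z * c\<bar> \<partial>lborel)
        = (\<integral>\<^sup>+ z. ennreal \<bar>c\<bar> * indicator (U - A) z \<partial>lborel)"
        using U(2) by (intro nn_integral_cong) (auto simp: indicator_def)
      also have "\<dots> = ennreal \<bar>c\<bar> * emeasure lborel (U - A)"
        using A by (simp add: nn_integral_cmult)
      also have "\<dots> \<le> ennreal \<bar>c\<bar> * ennreal d"
        using U(3) by (intro mult_left_mono) auto
      also have "\<dots> = ennreal (\<bar>c\<bar> * d)" using d by (simp add: ennreal_mult)
      also have "\<dots> \<le> ennreal e"
        using e by (intro ennreal_leI) (simp add: d_def field_simps)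
      finally show "(\<integral>\<^sup>+ z. ennreal \<bar>indicator A z *\<^sub>R c - indicator U z * c\<bar> \<partial>lborel) \<le> ennreal e" .
      have "(\<integral>\<^sup>+ z. ennreal \<bar>indicator U (z + h m) * c - indicator U z * c\<bar> \<partial>lborel)
        = ennreal \<bar>c\<bar> * (\<integral>\<^sup>+ z. ennreal \<bar>indicator U (z + h m) - indicator U z\<bar> \<partial>lborel)" for m
        by (subst nn_integral_cmult[symmetric])
          (auto simp: ennreal_mult[symmetric] abs_mult[symmetric] algebra_simps)
      moreover have "(\<lambda>m. ennreal \<bar>c\<bar> * (\<integral>\<^sup>+ z. ennreal \<bar>indicator U (z + h m) - indicator U z\<bar> \<partial>lborel)) \<longlonglongrightarrow> ennreal \<bar>c\<bar> * 0"
        by (intro ennreal_tendsto_cmult translate_L1_open[OF U(1) Ufin h]) simp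
      ultimately show "(\<lambda>m. \<integral>\<^sup>+ z. ennreal \<bar>indicator U (z + h m) * c - indicator U z * c\<bar> \<partial>lborel) \<longlonglongrightarrow> 0" by simp
    qed measurable
  qed measurable
next
  case (add f g)
  have [measurable]: "f \<in> borel_measurable borel" "g \<in> borel_measurable borel"
    using add by (auto dest: borel_measurable_integrable)
  have "(\<lambda>m. (\<integral>\<^sup>+ z. ennreal \<bar>f (z + h m) - f z\<bar> \<partial>lborel) + (\<integral>\<^sup>+ z. ennreal \<bar>g (z + h m) - g z\<bar> \<partial>lborel)) \<longlonglongrightarrow> 0 + 0"
    by (intro tendsto_add add)
  then have lim: "(\<lambda>m. (\<integral>\<^sup>+ z. ennreal \<bar>f (z + h m) - f z\<bar> \<partial>lborel) + (\<integral>\<^sup>+ z. ennreal \<bar>g (z + h m) - g z\<bar> \<partial>lborel)) \<longlonglongrightarrow> 0" by simp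
  show ?case
  proof (rule tendsto_sandwich[OF _ _ tendsto_const lim])
    have "(\<integral>\<^sup>+ z. ennreal \<bar>f (z + h m) + g (z + h m) - (f z + g z)\<bar> \<partial>lborel)
      \<le> (\<integral>\<^sup>+ z. ennreal \<bar>f (z + h m) - f z\<bar> \<partial>lborel) + (\<integral>\<^sup>+ z. ennreal \<bar>g (z + h m) - g z\<bar> \<partial>lborel)" for m
    proof -
      have "(\<integral>\<^sup>+ z. ennreal \<bar>f (z + h m) + g (z + h m) - (f z + g z)\<bar> \<partial>lborel)
        \<le> (\<integral>\<^sup>+ z. ennreal \<bar>f (z + h m) - f z\<bar> + ennreal \<bar>g (z + h m) - g z\<bar> \<partial>lborel)"
        by (intro nn_integral_mono) (simp add: ennreal_plus[symmetric] del: ennreal_plus)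
      also have "\<dots> = (\<integral>\<^sup>+ z. ennreal \<bar>f (z + h m) - f z\<bar> \<partial>lborel) + (\<integral>\<^sup>+ z. ennreal \<bar>g (z + h m) - g z\<bar> \<partial>lborel)"
        by (rule nn_integral_add) measurable
      finally show ?thesis .
    qed
    then show "\<forall>\<^sub>F m in sequentially. (\<integral>\<^sup>+ z. ennreal \<bar>f (z + h m) + g (z + h m) - (f z + g z)\<bar> \<partial>lborel)
      \<le> (\<integral>\<^sup>+ z. ennreal \<bar>f (z + h m) - f z\<bar> \<partial>lborel) + (\<integral>\<^sup>+ z. ennreal \<bar>g (z + h m) - g z\<bar> \<partial>lborel)"
      by (intro always_eventually allI)
  qed simp
next
  case (lim f s)
  have [measurable]: "f \<in> borel_measurable borel" "\<And>i. s i \<in> borel_measurable borel"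
    using lim by (auto dest: borel_measurable_integrable)
  show ?case
  proof (rule translate_L1_limit)
    fix e :: real assume e: "0 < e"
    have "(\<lambda>i. \<integral>\<^sup>+ z. ennreal \<bar>f z - s i z\<bar> \<partial>lborel) \<longlonglongrightarrow> (\<integral>\<^sup>+ z. 0 \<partial>(lborel :: real measure))"
    proof (rule nn_integral_dominated_convergence[where w="\<lambda>z. ennreal (3 * norm (f z))"])
      have "integrable lborel (\<lambda>z. 3 * norm (f z))" using lim by auto
      then have "(\<integral>\<^sup>+ z. ennreal (norm (3 * norm (f z))) \<partial>lborel) < \<infinity>"
        by (simp only: integrable_iff_bounded)
      then show "(\<integral>\<^sup>+ z. ennreal (3 * norm (f z)) \<partial>lborel) < \<infinity>"
        by (simp add: abs_mult)
      show "AE z in lborel. ennreal \<bar>f z - s i z\<bar> \<le> ennreal (3 * norm (f z))" for i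
      proof (intro AE_I2 ennreal_leI)
        fix z :: real
        have "norm (s i z) \<le> 2 * norm (f z)" using lim by auto
        then show "\<bar>f z - s i z\<bar> \<le> 3 * norm (f z)" by simp
      qed
      show "AE z in lborel. (\<lambda>i. ennreal \<bar>f z - s i z\<bar>) \<longlonglongrightarrow> 0"
      proof (rule AE_I2)
        fix z :: real assume "z \<in> space lborel"
        then have "(\<lambda>i. \<bar>f z - s i z\<bar>) \<longlonglongrightarrow> \<bar>f z - f z\<bar>" by (intro tendsto_intros lim)
        then show "(\<lambda>i. ennreal \<bar>f z - s i z\<bar>) \<longlonglongrightarrow> 0" using tendsto_ennrealI by fastforce
      qed
    qed measurable
    then have "\<forall>\<^sub>F i in sequentially. (\<integral>\<^sup>+ z. ennreal \<bar>f z - s i z\<bar> \<partial>lborel) < ennreal e"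
      using e by (intro order_tendstoD(2)) auto
    then obtain i where "(\<integral>\<^sup>+ z. ennreal \<bar>f z - s i z\<bar> \<partial>lborel) < ennreal e"
      by (auto simp: eventually_sequentially)
    then show "\<exists>g\<in>borel_measurable borel. (\<integral>\<^sup>+ z. ennreal \<bar>f z - g z\<bar> \<partial>lborel) \<le> ennreal e \<and>
      (\<lambda>m. \<integral>\<^sup>+ z. ennreal \<bar>g (z + h m) - g z\<bar> \<partial>lborel) \<longlonglongrightarrow> 0"
      using lim by (intro bexI[of _ "s i"]) auto
  qed measurable
qed

section \<open>Null sets under the Palm formula and conservativity\<close>

context bm_local_time
begin

lemma kernel_measurable:
  assumes "\<omega> \<in> space path_space"
  shows "measurable (K \<omega>) = measurable borel"
  using kernelD(1)[OF assms] by (intro ext measurable_cong_sets) auto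

text \<open>The Palm formula for the indicator of the exceptional set: its right side vanishes if
  the set is null at each fixed time. The property may depend on \<open>s\<close>, which is how
  shift invariance at fixed times becomes shift invariance at local time points.\<close>

lemma palm_AE_up:
  assumes Q[measurable]: "Measurable.pred (path_space \<Otimes>\<^sub>M borel) (\<lambda>p. Q (fst p) (snd p))"
    and ae: "\<And>s. AE \<omega> in P0. Q (raise x \<omega>) s"
  shows "AE \<omega> in P_leb. AE s in K (raise (- x) \<omega>). Q (shift_path s \<omega>) s"
proof -
  define g where "g \<omega> s = (indicator {p. \<not> Q (fst p) (snd p)} (\<omega>, s) :: ennreal)" for \<omega> s
  have g: "(\<lambda>p. g (fst p) (snd p)) \<in> borel_measurable (path_space \<Otimes>\<^sub>M borel)"
    unfolding g_def by measurable
  have gs: "(\<lambda>p. g (shift_path (snd p) (fst p)) (snd p)) \<in> borel_measurable (path_space \<Otimes>\<^sub>M borel)"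
  proof -
    have "(\<lambda>p. (shift_path (snd p) (fst p), snd p)) \<in> measurable (path_space \<Otimes>\<^sub>M borel) (path_space \<Otimes>\<^sub>M borel)"
      by measurable
    from measurable_compose[OF this g] show ?thesis by simp
  qed
  have m: "(\<lambda>\<omega>. \<integral>\<^sup>+ s. g (shift_path s \<omega>) s \<partial>K (raise (- x) \<omega>)) \<in> borel_measurable path_space"
    using gs by (intro measurable_kernel_integral) auto
  have "(\<integral>\<^sup>+ \<omega>. g (raise x \<omega>) s \<partial>P0) = 0" for s
  proof -
    have "(\<integral>\<^sup>+ \<omega>. g (raise x \<omega>) s \<partial>P0) = (\<integral>\<^sup>+ \<omega>. 0 \<partial>P0)"
      using ae[of s] by (intro nn_integral_cong_AE) (auto simp: g_def)
    then show ?thesis by simp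
  qed
  then have "(\<integral>\<^sup>+ \<omega>. \<integral>\<^sup>+ s. g (shift_path s \<omega>) s \<partial>K (raise (- x) \<omega>) \<partial>P_leb) = 0"
    by (subst palm[OF g]) simp
  then have "AE \<omega> in P_leb. (\<integral>\<^sup>+ s. g (shift_path s \<omega>) s \<partial>K (raise (- x) \<omega>)) = 0"
    using m by (subst (asm) nn_integral_0_iff_AE) auto
  then show ?thesis
    using AE_space
  proof eventually_elim
    fix \<omega> assume 0: "(\<integral>\<^sup>+ s. g (shift_path s \<omega>) s \<partial>K (raise (- x) \<omega>)) = 0" and "\<omega> \<in> space P_leb"
    then have \<omega>: "\<omega> \<in> space path_space" "raise (- x) \<omega> \<in> space path_space" by simp_all
    have "(\<lambda>s. g (shift_path s \<omega>) s) \<in> borel_measurable borel"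
      using measurable_compose[OF measurable_Pair1'[OF \<omega>(1)] gs] by simp
    then have "AE s in K (raise (- x) \<omega>). g (shift_path s \<omega>) s = 0"
      using 0 by (subst (asm) nn_integral_0_iff_AE) (auto simp: kernel_measurable[OF \<omega>(2)])
    then show "AE s in K (raise (- x) \<omega>). Q (shift_path s \<omega>) s"
      by eventually_elim (auto simp: g_def indicator_def split: if_splits)
  qed
qed

text \<open>The window \<open>{0..1}\<close> in time has length 1, so that the right side of the
  Palm formula is just the probability of the exceptional set.\<close>

lemma palm_AE_down:
  assumes Q[measurable]: "Measurable.pred path_space Q"
    and ae: "AE \<omega> in P_leb. AE s in K (raise (- x) \<omega>). Q (shift_path s \<omega>)"
  shows "AE \<omega> in P0. Q (raise x \<omega>)"
proof -
  define g where "g \<omega> s = (indicator {\<omega>. \<not> Q \<omega>} \<omega> * indicator {0..1::real} s :: ennreal)" for \<omega> s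
  have g: "(\<lambda>p. g (fst p) (snd p)) \<in> borel_measurable (path_space \<Otimes>\<^sub>M borel)"
    unfolding g_def by measurable
  have "(\<integral>\<^sup>+ \<omega>. \<integral>\<^sup>+ s. g (shift_path s \<omega>) s \<partial>K (raise (- x) \<omega>) \<partial>P_leb) = (\<integral>\<^sup>+ \<omega>. 0 \<partial>P_leb)"
  proof (rule nn_integral_cong_AE)
    show "AE \<omega> in P_leb. (\<integral>\<^sup>+ s. g (shift_path s \<omega>) s \<partial>K (raise (- x) \<omega>)) = 0"
      using ae
    proof eventually_elim
      fix \<omega> assume "AE s in K (raise (- x) \<omega>). Q (shift_path s \<omega>)"
      then have "(\<integral>\<^sup>+ s. g (shift_path s \<omega>) s \<partial>K (raise (- x) \<omega>)) = (\<integral>\<^sup>+ s. 0 \<partial>K (raise (- x) \<omega>))"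
        by (intro nn_integral_cong_AE) (auto simp: g_def)
      then show "(\<integral>\<^sup>+ s. g (shift_path s \<omega>) s \<partial>K (raise (- x) \<omega>)) = 0" by simp
    qed
  qed
  then have "0 = (\<integral>\<^sup>+ s. \<integral>\<^sup>+ \<omega>. g (raise x \<omega>) s \<partial>P0 \<partial>lborel)"
    by (subst (asm) palm[OF g]) simp
  also have "\<dots> = (\<integral>\<^sup>+ s. (\<integral>\<^sup>+ \<omega>. indicator {\<omega>. \<not> Q \<omega>} (raise x \<omega>) \<partial>P0) * indicator {0..1::real} s \<partial>lborel)"
    unfolding g_def by (intro nn_integral_cong nn_integral_multc) measurable
  also have "\<dots> = (\<integral>\<^sup>+ \<omega>. indicator {\<omega>. \<not> Q \<omega>} (raise x \<omega>) \<partial>P0)"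
    by (subst nn_integral_cmult) auto
  finally have "AE \<omega> in P0. (indicator {\<omega>. \<not> Q \<omega>} (raise x \<omega>) :: ennreal) = 0"
    by (subst nn_integral_0_iff_AE[symmetric]) auto
  then show ?thesis by eventually_elim (auto simp: indicator_def split: if_splits)
qed

lemma AE_zero: "AE \<omega> in P0. \<omega> 0 = 0"
  using BM by (simp add: BM_law_def two_sided_BM_def)

lemma tail_scaling:
  assumes "0 < s"
  shows "emeasure P0 {\<omega>\<in>space P0. c * sqrt s < \<bar>\<omega> s\<bar>} = emeasure P0 {\<omega>\<in>space P0. c < \<bar>\<omega> 1\<bar>}"
proof -
  note measurable_eval[measurable]
  define S where "S \<omega> r = \<omega> ((sqrt s)\<^sup>2 * r) / sqrt s" for \<omega> :: "real \<Rightarrow> real" and r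
  have S: "distr P0 path_space S = P0"
    unfolding S_def using assms by (intro BM_law_scaling[OF BM]) simp
  have Sm: "S \<in> measurable P0 path_space"
  proof (rule measurable_path_spaceI)
    show "(\<lambda>\<omega>. S \<omega> t) \<in> borel_measurable P0" for t unfolding S_def by measurable
    fix \<omega> assume "\<omega> \<in> space P0"
    then have c: "continuous_on UNIV \<omega>" by (simp add: space_path_space)
    have "continuous_on UNIV (\<lambda>r. \<omega> ((sqrt s)\<^sup>2 * r))"
      by (rule continuous_on_compose2[OF c]) (auto intro!: continuous_intros)
    then show "continuous_on UNIV (S \<omega>)"
      unfolding S_def[abs_def] by (intro continuous_on_divide continuous_on_const) (use assms in auto)
  qed
  have "emeasure P0 {\<omega>\<in>space P0. c < \<bar>\<omega> 1\<bar>} = emeasure (distr P0 path_space S) {\<omega>\<in>space path_space. c < \<bar>\<omega> 1\<bar>}"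
    by (simp add: S)
  also have "\<dots> = emeasure P0 (S -` {\<omega>\<in>space path_space. c < \<bar>\<omega> 1\<bar>} \<inter> space P0)"
    by (rule emeasure_distr[OF Sm]) measurable
  also have "S -` {\<omega>\<in>space path_space. c < \<bar>\<omega> 1\<bar>} \<inter> space P0 = {\<omega>\<in>space P0. c * sqrt s < \<bar>\<omega> s\<bar>}"
    using measurable_space[OF Sm] assms by (auto simp: S_def field_simps)
  finally show ?thesis ..
qed

lemma tail_limit: "(\<lambda>m. emeasure P0 {\<omega>\<in>space P0. real m < \<bar>\<omega> 1\<bar>}) \<longlonglongrightarrow> 0"
proof -
  note measurable_eval[measurable]
  have "(\<lambda>m. emeasure P0 {\<omega>\<in>space P0. real m < \<bar>\<omega> 1\<bar>}) \<longlonglongrightarrow> emeasure P0 (\<Inter>m. {\<omega>\<in>space P0. real m < \<bar>\<omega> 1\<bar>})"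
    by (intro Lim_emeasure_decseq) (auto simp: decseq_def)
  also have "(\<Inter>m. {\<omega>\<in>space P0. real m < \<bar>\<omega> 1\<bar>}) = {}"
  proof -
    have "\<exists>m. \<not> real m < \<bar>\<omega> 1\<bar>" for \<omega> :: "real \<Rightarrow> real"
      using real_arch_simple[of "\<bar>\<omega> 1\<bar>"] by (auto simp: not_less)
    then show ?thesis by blast
  qed
  finally show ?thesis by simp
qed

lemma nn_integral_inverse:
  assumes "0 \<le> u"
  shows "(\<integral>\<^sup>+ s. ennreal (1 / s) * indicator {1..exp u} s \<partial>lborel) = ennreal u"
proof -
  have "(\<integral>\<^sup>+ s. ennreal (1 / s) * indicator {1..exp u} s \<partial>lborel) = ennreal (ln (exp u) - ln 1)"
    by (rule nn_integral_FTC_Icc) (use assms in \<open>auto intro!: derivative_eq_intros\<close>)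
  then show ?thesis by simp
qed

text \<open>The time spent at times \<open>1 \<le> s \<le> e\<^sup>u\<close> outside \<open>[- m sqrt s, m sqrt s]\<close> has, weighted by
  \<open>1 / s\<close>, mean at most \<open>u\<close> times a small number by scaling; inside, the integrand below is of
  order \<open>1 / s\<close>.\<close>

lemma conservative_prob:
  fixes m :: nat and k :: nat
  shows "emeasure P0 {\<omega>\<in>space P0. (\<integral>\<^sup>+ s. ennreal (1 / (1 + (\<omega> s)\<^sup>2)) \<partial>lborel) \<le> ennreal (real k)}
    \<le> emeasure P0 {\<omega>\<in>space P0. real m < \<bar>\<omega> 1\<bar>}" (is "emeasure P0 ?A \<le> emeasure P0 ?B")
proof -
  define Z where "Z \<omega> = (\<integral>\<^sup>+ s. ennreal (1 / (1 + (\<omega> s)\<^sup>2)) \<partial>lborel)" for \<omega> :: "real \<Rightarrow> real"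
  have Zm[measurable]: "Z \<in> borel_measurable path_space"
    unfolding Z_def[abs_def]
  proof (rule sigma_finite_measure.borel_measurable_nn_integral[OF sigma_finite_lborel])
    have [measurable]: "(\<lambda>p. fst p (snd p)) \<in> borel_measurable (path_space \<Otimes>\<^sub>M lborel)"
      using measurable_eval_pair by (simp cong: measurable_cong_sets)
    show "(\<lambda>(\<omega>, s). ennreal (1 / (1 + (\<omega> s)\<^sup>2))) \<in> borel_measurable (path_space \<Otimes>\<^sub>M lborel)"
      unfolding case_prod_unfold by measurable
  qed
  have A: "?A \<in> sets P0" using Zm by (simp flip: Z_def)
  define bad where "bad u \<omega> = (\<integral>\<^sup>+ s. indicator {s. real m * sqrt s < \<bar>\<omega> s\<bar>} s * (ennreal (1 / s) * indicator {1..exp u} s) \<partial>lborel)"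
    for u and \<omega> :: "real \<Rightarrow> real"
  have mb: "(\<lambda>p. indicator {s. real m * sqrt s < \<bar>fst p s\<bar>} (snd p) * (ennreal (1 / snd p) * indicator {1..exp u} (snd p)))
      \<in> borel_measurable (P0 \<Otimes>\<^sub>M lborel)" for u
  proof -
    have "(\<lambda>p. fst p (snd p)) \<in> borel_measurable (path_space \<Otimes>\<^sub>M borel)" by (rule measurable_eval_pair)
    then have [measurable]: "(\<lambda>p. fst p (snd p)) \<in> borel_measurable (P0 \<Otimes>\<^sub>M lborel)"
      by (simp cong: measurable_cong_sets)
    have "(\<lambda>p. indicator {p. real m * sqrt (snd p) < \<bar>fst p (snd p)\<bar>} p * (ennreal (1 / snd p) * indicator {1..exp u} (snd p)))
      \<in> borel_measurable (P0 \<Otimes>\<^sub>M lborel)" by measurable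
    then show ?thesis by (simp add: indicator_def)
  qed
  interpret PL: pair_sigma_finite P0 lborel ..
  have badm: "bad u \<in> borel_measurable P0" for u
    unfolding bad_def[abs_def]
    by (rule sigma_finite_measure.borel_measurable_nn_integral[OF sigma_finite_lborel])
      (use mb in \<open>simp add: case_prod_unfold\<close>)
  have Ebad: "(\<integral>\<^sup>+ \<omega>. bad u \<omega> \<partial>P0) = emeasure P0 ?B * ennreal u" if "0 \<le> u" for u
  proof -
    have "(\<integral>\<^sup>+ \<omega>. bad u \<omega> \<partial>P0)
      = (\<integral>\<^sup>+ s. \<integral>\<^sup>+ \<omega>. indicator {s. real m * sqrt s < \<bar>\<omega> s\<bar>} s * (ennreal (1 / s) * indicator {1..exp u} s) \<partial>P0 \<partial>lborel)"
      unfolding bad_def using mb[of u] by (intro PL.Fubini'[symmetric]) (simp add: case_prod_unfold)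
    also have "\<dots> = (\<integral>\<^sup>+ s. emeasure P0 ?B * (ennreal (1 / s) * indicator {1..exp u} s) \<partial>lborel)"
    proof (rule nn_integral_cong)
      fix s :: real
      have ms: "{\<omega>\<in>space P0. real m * sqrt s < \<bar>\<omega> s\<bar>} \<in> sets P0"
        using measurable_eval[of s] by simp
      have "(\<integral>\<^sup>+ \<omega>. indicator {s. real m * sqrt s < \<bar>\<omega> s\<bar>} s * (ennreal (1 / s) * indicator {1..exp u} s) \<partial>P0)
        = (\<integral>\<^sup>+ \<omega>. indicator {\<omega>\<in>space P0. real m * sqrt s < \<bar>\<omega> s\<bar>} \<omega> * (ennreal (1 / s) * indicator {1..exp u} s) \<partial>P0)"
        by (intro nn_integral_cong) (auto simp: indicator_def)
      also have "\<dots> = emeasure P0 {\<omega>\<in>space P0. real m * sqrt s < \<bar>\<omega> s\<bar>} * (ennreal (1 / s) * indicator {1..exp u} s)"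
        using ms by (subst nn_integral_multc) auto
      also have "\<dots> = emeasure P0 ?B * (ennreal (1 / s) * indicator {1..exp u} s)"
      proof (cases "s \<in> {1..exp u}")
        case True
        then have "0 < s" by simp
        from tail_scaling[OF this, of "real m"] show ?thesis by simp
      qed simp
      finally show "(\<integral>\<^sup>+ \<omega>. indicator {s. real m * sqrt s < \<bar>\<omega> s\<bar>} s * (ennreal (1 / s) * indicator {1..exp u} s) \<partial>P0)
        = emeasure P0 ?B * (ennreal (1 / s) * indicator {1..exp u} s)" .
    qed
    also have "\<dots> = emeasure P0 ?B * ennreal u"
      using that by (subst nn_integral_cmult) (auto simp: nn_integral_inverse)
    finally show ?thesis .
  qed
  have low: "ennreal u \<le> bad u \<omega> + ennreal (1 + (real m)\<^sup>2) * Z \<omega>" if "0 \<le> u" "\<omega> \<in> space P0" for u \<omega>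
  proof -
    have [measurable]: "\<omega> \<in> borel_measurable borel"
      using path_continuous[of \<omega> UNIV] that by (intro borel_measurable_continuous_onI) simp
    have "ennreal u = (\<integral>\<^sup>+ s. ennreal (1 / s) * indicator {1..exp u} s \<partial>lborel)"
      using that by (simp add: nn_integral_inverse)
    also have "\<dots> \<le> (\<integral>\<^sup>+ s. indicator {s. real m * sqrt s < \<bar>\<omega> s\<bar>} s * (ennreal (1 / s) * indicator {1..exp u} s)
      + ennreal (1 + (real m)\<^sup>2) * ennreal (1 / (1 + (\<omega> s)\<^sup>2)) \<partial>lborel)"
    proof (rule nn_integral_mono)
      fix s :: real
      show "ennreal (1 / s) * indicator {1..exp u} s \<le>
        indicator {s. real m * sqrt s < \<bar>\<omega> s\<bar>} s * (ennreal (1 / s) * indicator {1..exp u} s)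
        + ennreal (1 + (real m)\<^sup>2) * ennreal (1 / (1 + (\<omega> s)\<^sup>2))"
      proof (cases "s \<in> {1..exp u} \<and> \<bar>\<omega> s\<bar> \<le> real m * sqrt s")
        case True
        then have "\<bar>\<omega> s\<bar>\<^sup>2 \<le> (real m * sqrt s)\<^sup>2" by (intro power_mono) auto
        then have "(\<omega> s)\<^sup>2 \<le> (real m)\<^sup>2 * s" using True by (simp add: power_mult_distrib)
        then have "1 + (\<omega> s)\<^sup>2 \<le> (1 + (real m)\<^sup>2) * s" using True by (simp add: algebra_simps)
        then have "1 / s \<le> (1 + (real m)\<^sup>2) * (1 / (1 + (\<omega> s)\<^sup>2))"
          using True by (simp add: field_simps add_pos_nonneg)
        then have "ennreal (1 / s) \<le> ennreal (1 + (real m)\<^sup>2) * ennreal (1 / (1 + (\<omega> s)\<^sup>2))"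
          by (subst ennreal_mult[symmetric]) (auto intro!: ennreal_leI)
        then show ?thesis using True by (simp add: add_increasing)
      qed (auto simp: indicator_def)
    qed
    also have "\<dots> = bad u \<omega> + ennreal (1 + (real m)\<^sup>2) * Z \<omega>"
      unfolding bad_def Z_def by (subst nn_integral_add, measurable) (subst nn_integral_cmult, measurable)
    finally show ?thesis .
  qed
  \<comment> \<open>On the event \<open>?A\<close> the last term in \<open>low\<close> is at most
    this constant, uniformly in \<open>u\<close>.\<close>
  define C where "C = (1 + (real m)\<^sup>2) * real k"
  have C0: "0 \<le> C" by (simp add: C_def)
  have step: "ennreal (u - C) * emeasure P0 ?A \<le> emeasure P0 ?B * ennreal u" if u: "0 \<le> u" for u
  proof -
    have "ennreal (u - C) * emeasure P0 ?A = (\<integral>\<^sup>+ \<omega>. ennreal (u - C) * indicator ?A \<omega> \<partial>P0)"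
      using A by (simp add: nn_integral_cmult)
    also have "\<dots> \<le> (\<integral>\<^sup>+ \<omega>. bad u \<omega> \<partial>P0)"
    proof (rule nn_integral_mono)
      fix \<omega> assume \<omega>: "\<omega> \<in> space P0"
      show "ennreal (u - C) * indicator ?A \<omega> \<le> bad u \<omega>"
      proof (cases "\<omega> \<in> ?A")
        case True
        have "ennreal u \<le> bad u \<omega> + ennreal (1 + (real m)\<^sup>2) * Z \<omega>" by (rule low[OF u \<omega>])
        also have "\<dots> \<le> bad u \<omega> + ennreal (1 + (real m)\<^sup>2) * ennreal (real k)"
          using True by (intro add_left_mono mult_left_mono) (auto simp: Z_def)
        also have "\<dots> = bad u \<omega> + ennreal C" by (simp add: C_def ennreal_mult)
        finally have "ennreal u - ennreal C \<le> bad u \<omega>"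
          by (simp add: ennreal_minus_le_iff add.commute)
        then show ?thesis using True C0 by (simp add: ennreal_minus)
      qed simp
    qed
    finally show ?thesis by (simp add: Ebad u)
  qed
  define a where "a = measure P0 ?A"
  define b where "b = measure P0 ?B"
  have ab: "emeasure P0 ?A = ennreal a" "emeasure P0 ?B = ennreal b" "0 \<le> a" "0 \<le> b"
    by (auto simp: a_def b_def P0.emeasure_eq_measure)
  have real_step: "(u - C) * a \<le> b * u" if u: "C \<le> u" for u
    using step[of u] u C0 ab by (simp add: ennreal_mult[symmetric])
  have "a \<le> b"
  proof (rule ccontr)
    assume "\<not> a \<le> b"
    then have pos: "0 < a - b" by simp
    \<comment> \<open>Chosen so large that \<open>u * (a - b)\<close> exceeds \<open>C * a\<close>,
      against \<open>real_step\<close>.\<close>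
    define u where "u = C + (C * a + 1) / (a - b)"
    have uC: "C \<le> u" using pos C0 ab by (simp add: u_def)
    have "(C * a + 1) / (a - b) * (a - b) = C * a + 1"
      using nonzero_eq_divide_eq[of "a - b" "(C * a + 1) / (a - b)" "C * a + 1"] pos by simp
    then have "u * (a - b) = C * (a - b) + (C * a + 1)" by (simp only: u_def distrib_right)
    moreover have "u * (a - b) \<le> C * a" using real_step[OF uC] by (simp add: algebra_simps)
    moreover have "0 \<le> C * (a - b)" using pos C0 by simp
    ultimately show False by linarith
  qed
  then show ?thesis unfolding ab by (rule ennreal_leI)
qed

text \<open>The event that the integral is at most \<open>k\<close> has probability at most that of
  \<open>\<bar>\<omega> 1\<bar> > m\<close> for every \<open>m\<close>, hence 0. Changing the
  starting level alters the weight by a factor of at most \<open>2 * (1 + x\<^sup>2)\<close>.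
  Reversed time is the form in which the Palm formula for \<eta> will use it.\<close>

lemma conservative:
  "AE \<omega> in P0. (\<integral>\<^sup>+ s. ennreal (1 / (1 + (\<omega> (- s) + x)\<^sup>2)) \<partial>lborel) = \<infinity>"
proof -
  define Z where "Z \<omega> = (\<integral>\<^sup>+ s. ennreal (1 / (1 + (\<omega> s)\<^sup>2)) \<partial>lborel)" for \<omega> :: "real \<Rightarrow> real"
  have "AE \<omega> in P0. \<not> Z \<omega> \<le> ennreal (real k)" for k
  proof -
    have Zm[measurable]: "Z \<in> borel_measurable path_space"
      unfolding Z_def[abs_def]
    proof (rule sigma_finite_measure.borel_measurable_nn_integral[OF sigma_finite_lborel])
      have [measurable]: "(\<lambda>p. fst p (snd p)) \<in> borel_measurable (path_space \<Otimes>\<^sub>M lborel)"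
        using measurable_eval_pair by (simp cong: measurable_cong_sets)
      show "(\<lambda>(\<omega>, s). ennreal (1 / (1 + (\<omega> s)\<^sup>2))) \<in> borel_measurable (path_space \<Otimes>\<^sub>M lborel)"
        unfolding case_prod_unfold by measurable
    qed
    have "emeasure P0 {\<omega>\<in>space P0. Z \<omega> \<le> ennreal (real k)} \<le> 0"
      unfolding Z_def by (rule LIMSEQ_le_const[OF tail_limit]) (use conservative_prob in blast)
    then show ?thesis
      by (subst AE_iff_measurable[OF _ refl]) (auto simp: Zm)
  qed
  then have "AE \<omega> in P0. \<forall>k. \<not> Z \<omega> \<le> ennreal (real k)"
    unfolding AE_all_countable by blast
  then show ?thesis
    using AE_space
  proof eventually_elim
    fix \<omega> assume Z: "\<forall>k. \<not> Z \<omega> \<le> ennreal (real k)" and "\<omega> \<in> space P0"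
    then have [measurable]: "\<omega> \<in> borel_measurable borel"
      using path_continuous[of \<omega> UNIV] by (intro borel_measurable_continuous_onI) simp
    have "Z \<omega> = \<infinity>"
    proof (cases "Z \<omega>")
      case (real r)
      then obtain k where "r \<le> real k" using real_arch_simple by blast
      then show ?thesis using Z real by (metis ennreal_leI)
    qed simp
    moreover have "0 < 1 / (2 * (1 + x\<^sup>2))" by (intro divide_pos_pos mult_pos_pos add_pos_nonneg) auto
    then have "ennreal (1 / (2 * (1 + x\<^sup>2))) \<noteq> 0" by (simp only: ennreal_eq_0_iff not_le)
    ultimately have "\<infinity> = ennreal (1 / (2 * (1 + x\<^sup>2))) * Z \<omega>"
      by (simp only: ennreal_mult_top infinity_ennreal_def if_False)
    also have "\<dots> = (\<integral>\<^sup>+ s. ennreal (1 / (2 * (1 + x\<^sup>2))) * ennreal (1 / (1 + (\<omega> s)\<^sup>2)) \<partial>lborel)"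
      unfolding Z_def by (rule nn_integral_cmult[symmetric]) measurable
    also have "\<dots> \<le> (\<integral>\<^sup>+ s. ennreal (1 / (1 + (\<omega> s + x)\<^sup>2)) \<partial>lborel)"
    proof (rule nn_integral_mono)
      fix s :: real
      have "1 + (\<omega> s + x)\<^sup>2 \<le> 2 * (1 + x\<^sup>2) * (1 + (\<omega> s)\<^sup>2)"
      proof -
        have "2 * (1 + x\<^sup>2) * (1 + (\<omega> s)\<^sup>2) - (1 + (\<omega> s + x)\<^sup>2) = 1 + (\<omega> s - x)\<^sup>2 + 2 * (x * \<omega> s)\<^sup>2"
          by (simp add: power2_eq_square algebra_simps)
        also have "\<dots> \<ge> 0" by (intro add_nonneg_nonneg) auto
        finally show ?thesis by simp
      qed
      then have "1 / (2 * (1 + x\<^sup>2) * (1 + (\<omega> s)\<^sup>2)) \<le> 1 / (1 + (\<omega> s + x)\<^sup>2)"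
        by (intro divide_left_mono mult_pos_pos add_pos_nonneg) auto
      then show "ennreal (1 / (2 * (1 + x\<^sup>2))) * ennreal (1 / (1 + (\<omega> s)\<^sup>2)) \<le> ennreal (1 / (1 + (\<omega> s + x)\<^sup>2))"
        by (subst ennreal_mult[symmetric]) (auto intro!: ennreal_leI)
    qed
    also have "\<dots> = (\<integral>\<^sup>+ s. ennreal (1 / (1 + (\<omega> (- s) + x)\<^sup>2)) \<partial>lborel)"
      using nn_integral_lborel_reflect[of "\<lambda>s. ennreal (1 / (1 + (\<omega> s + x)\<^sup>2))" 0] by simp
    finally show "(\<integral>\<^sup>+ s. ennreal (1 / (1 + (\<omega> (- s) + x)\<^sup>2)) \<partial>lborel) = \<infinity>"
      by (simp add: top_unique)
  qed
qed

section \<open>Occupation densities and shift invariant events\<close>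

definition occ :: "real \<Rightarrow> (real \<Rightarrow> real) \<Rightarrow> real \<Rightarrow> real" where
  "occ n \<omega> z = measure (K (raise (- z) \<omega>)) {0..n}"

lemma occ_nonneg [simp]: "0 \<le> occ n \<omega> z"
  by (simp add: occ_def)

lemma occ_eq: "\<omega> \<in> space path_space \<Longrightarrow> emeasure (K (raise (- z) \<omega>)) {0..n} = ennreal (occ n \<omega> z)"
  unfolding occ_def by (intro emeasure_eq_ennreal_measure less_imp_neq) (use kernelD(3) in auto)

lemma measurable_occ:
  assumes [measurable]: "h \<in> measurable M path_space" "k \<in> borel_measurable M"
  shows "(\<lambda>x. occ n (h x) (k x)) \<in> borel_measurable M"
proof -
  have "(\<lambda>x. emeasure (K (raise (- k x) (h x))) {0..n}) \<in> borel_measurable M"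
    by (rule lf_kernelD(3)[OF lf_kernel_compose[OF kernel]]) measurable
  then show ?thesis unfolding occ_def measure_def by measurable
qed

lemma occ_raise: "occ n (raise z \<omega>) x = occ n \<omega> (x - z)"
  by (simp add: occ_def)

text \<open>As a function of the level, \<open>occ n \<omega>\<close> is the density of the
  occupation measure of the time interval \<open>{0..n}\<close>; this is the occupation formula for
  an integrand of product form.\<close>

lemma occ_density:
  assumes \<omega>: "\<omega> \<in> space path_space"
    and occu: "\<forall>f\<in>borel_measurable (borel \<Otimes>\<^sub>M borel).
      (\<integral>\<^sup>+ s. f (\<omega> s, s) \<partial>lborel) = (\<integral>\<^sup>+ x. \<integral>\<^sup>+ s. f (x, s) \<partial>K (raise (- x) \<omega>) \<partial>lborel)"
    and h[measurable]: "h \<in> borel_measurable borel"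
  shows "(\<integral>\<^sup>+ s. h (\<omega> s) * indicator {0..n} s \<partial>lborel) = (\<integral>\<^sup>+ z. h z * ennreal (occ n \<omega> z) \<partial>lborel)"
proof -
  have "(\<lambda>p. h (fst p) * indicator {0..n} (snd p)) \<in> borel_measurable (borel \<Otimes>\<^sub>M borel)" by measurable
  from occu[rule_format, OF this]
  have "(\<integral>\<^sup>+ s. h (\<omega> s) * indicator {0..n} s \<partial>lborel)
    = (\<integral>\<^sup>+ x. \<integral>\<^sup>+ s. h x * indicator {0..n} s \<partial>K (raise (- x) \<omega>) \<partial>lborel)" by simp
  also have "\<dots> = (\<integral>\<^sup>+ z. h z * ennreal (occ n \<omega> z) \<partial>lborel)"
    by (intro nn_integral_cong, subst nn_integral_cmult) (use \<omega> in \<open>auto simp: kernel_measurable kernelD occ_eq\<close>)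
  finally show ?thesis .
qed

lemma occ_total:
  assumes "\<omega> \<in> space path_space" "0 \<le> n"
    and "\<forall>f\<in>borel_measurable (borel \<Otimes>\<^sub>M borel).
      (\<integral>\<^sup>+ s. f (\<omega> s, s) \<partial>lborel) = (\<integral>\<^sup>+ x. \<integral>\<^sup>+ s. f (x, s) \<partial>K (raise (- x) \<omega>) \<partial>lborel)"
  shows "(\<integral>\<^sup>+ z. ennreal (occ n \<omega> z) \<partial>lborel) = ennreal n"
  using occ_density[OF assms(1,3), of "\<lambda>_. 1" n] assms(2) by simp

definition scaled :: "real \<Rightarrow> (real \<Rightarrow> real) \<Rightarrow> real \<Rightarrow> real" where
  "scaled m \<omega> = (\<lambda>s. \<omega> (m\<^sup>2 * s) / m)"

lemma measurable_scaled:
  assumes "m \<noteq> 0"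
  shows "scaled m \<in> measurable path_space path_space"
proof (rule measurable_path_spaceI)
  note measurable_eval[measurable]
  show "(\<lambda>\<omega>. scaled m \<omega> t) \<in> borel_measurable path_space" for t unfolding scaled_def by measurable
  fix \<omega> assume "\<omega> \<in> space path_space"
  then have c: "continuous_on UNIV \<omega>" by (simp add: space_path_space)
  have "continuous_on UNIV (\<lambda>r. \<omega> (m\<^sup>2 * r))"
    by (rule continuous_on_compose2[OF c]) (auto intro!: continuous_intros)
  then show "continuous_on UNIV (scaled m \<omega>)"
    unfolding scaled_def by (intro continuous_on_divide continuous_on_const) (use assms in auto)
qed

lemma distr_scaled: "0 < m \<Longrightarrow> distr P0 path_space (scaled m) = P0"
  using BM_law_scaling[OF BM, of m] by (simp add: scaled_def[abs_def])

text \<open>Scaling is not among the properties of \<open>K\<close>. It is obtained from uniqueness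
  of densities, since both sides are densities of the occupation measure of the scaled path; this is
  why it holds for almost every level only.\<close>

lemma occ_scaled:
  assumes m: "0 < m" and \<omega>: "\<omega> \<in> space path_space"
    and o1: "\<forall>f\<in>borel_measurable (borel \<Otimes>\<^sub>M borel).
      (\<integral>\<^sup>+ s. f (\<omega> s, s) \<partial>lborel) = (\<integral>\<^sup>+ x. \<integral>\<^sup>+ s. f (x, s) \<partial>K (raise (- x) \<omega>) \<partial>lborel)"
    and o2: "\<forall>f\<in>borel_measurable (borel \<Otimes>\<^sub>M borel).
      (\<integral>\<^sup>+ s. f (scaled m \<omega> s, s) \<partial>lborel) = (\<integral>\<^sup>+ x. \<integral>\<^sup>+ s. f (x, s) \<partial>K (raise (- x) (scaled m \<omega>)) \<partial>lborel)"
  shows "AE y in lborel. occ 1 (scaled m \<omega>) y = occ (m\<^sup>2) \<omega> (m * y) / m"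
proof -
  have S: "scaled m \<omega> \<in> space path_space"
    using measurable_space[OF measurable_scaled \<omega>] m by simp
  have wm[measurable]: "\<omega> \<in> borel_measurable borel"
    using path_continuous[OF \<omega>, of UNIV] by (intro borel_measurable_continuous_onI)
  have om: "(\<lambda>z. occ n \<omega>' z) \<in> borel_measurable borel" if "\<omega>' \<in> space path_space" for \<omega>' n
    using that by (intro measurable_occ) auto
  note om[OF \<omega>, measurable] om[OF S, measurable]
  have eq: "(\<integral>\<^sup>+ y. h y * ennreal (occ 1 (scaled m \<omega>) y) \<partial>lborel)
    = (\<integral>\<^sup>+ y. h y * ennreal (occ (m\<^sup>2) \<omega> (m * y) / m) \<partial>lborel)"
    if h[measurable]: "h \<in> borel_measurable borel" for h
  proof -
    let ?A = "\<integral>\<^sup>+ y. h y * ennreal (occ 1 (scaled m \<omega>) y) \<partial>lborel"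
    let ?B = "\<integral>\<^sup>+ y. h y * ennreal (occ (m\<^sup>2) \<omega> (m * y)) \<partial>lborel"
    have "ennreal (m\<^sup>2) * ?A = ennreal (m\<^sup>2) * (\<integral>\<^sup>+ s. h (scaled m \<omega> s) * indicator {0..1} s \<partial>lborel)"
      by (simp add: occ_density[OF S o2 h])
    also have "\<dots> = ennreal (m\<^sup>2) * (\<integral>\<^sup>+ s. h (\<omega> (0 + m\<^sup>2 * s) / m) * indicator {0..m\<^sup>2} (0 + m\<^sup>2 * s) \<partial>lborel)"
      using m by (intro arg_cong2[where f="(*)"] nn_integral_cong refl)
        (auto simp: scaled_def indicator_def mult_le_cancel_left2 zero_le_mult_iff)
    also have "\<dots> = (\<integral>\<^sup>+ s. h (\<omega> s / m) * indicator {0..m\<^sup>2} s \<partial>lborel)"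
      using nn_integral_real_affine[of "\<lambda>s. h (\<omega> s / m) * indicator {0..m\<^sup>2} s" "m\<^sup>2" 0] m by simp
    also have "\<dots> = (\<integral>\<^sup>+ z. h (z / m) * ennreal (occ (m\<^sup>2) \<omega> z) \<partial>lborel)"
      using occ_density[OF \<omega> o1, of "\<lambda>z. h (z / m)"] by simp
    also have "\<dots> = ennreal m * ?B"
      using nn_integral_real_affine[of "\<lambda>z. h (z / m) * ennreal (occ (m\<^sup>2) \<omega> z)" m 0] m by simp
    finally have AB: "ennreal (m\<^sup>2) * ?A = ennreal m * ?B" .
    have "?A = ennreal (1 / m\<^sup>2) * (ennreal (m\<^sup>2) * ?A)"
      using m by (simp add: mult.assoc[symmetric] ennreal_mult[symmetric])
    also have "\<dots> = ennreal (1 / m\<^sup>2) * (ennreal m * ?B)" by (simp only: AB)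
    also have "\<dots> = ennreal (1 / m) * ?B"
      using m by (simp add: mult.assoc[symmetric] ennreal_mult[symmetric] power2_eq_square)
    also have "\<dots> = (\<integral>\<^sup>+ y. ennreal (1 / m) * (h y * ennreal (occ (m\<^sup>2) \<omega> (m * y))) \<partial>lborel)"
      by (rule nn_integral_cmult[symmetric]) measurable
    also have "\<dots> = (\<integral>\<^sup>+ y. h y * ennreal (occ (m\<^sup>2) \<omega> (m * y) / m) \<partial>lborel)"
    proof (rule nn_integral_cong)
      fix y
      have "ennreal (1 / m) * ennreal (occ (m\<^sup>2) \<omega> (m * y)) = ennreal (occ (m\<^sup>2) \<omega> (m * y) / m)"
        using m by (subst ennreal_mult[symmetric]) auto
      then show "ennreal (1 / m) * (h y * ennreal (occ (m\<^sup>2) \<omega> (m * y))) = h y * ennreal (occ (m\<^sup>2) \<omega> (m * y) / m)"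
        by (metis mult.left_commute)
    qed
    finally show ?thesis .
  qed
  have "AE y in lborel. ennreal (occ 1 (scaled m \<omega>) y) = ennreal (occ (m\<^sup>2) \<omega> (m * y) / m)"
  proof (rule finite_density_unique[THEN iffD1])
    show "(\<integral>\<^sup>+ y. ennreal (occ 1 (scaled m \<omega>) y) \<partial>lborel) \<noteq> \<infinity>"
      using occ_total[OF S _ o2, of 1] by simp
    show "density lborel (\<lambda>y. ennreal (occ 1 (scaled m \<omega>) y)) = density lborel (\<lambda>y. ennreal (occ (m\<^sup>2) \<omega> (m * y) / m))"
    proof (rule measure_eqI)
      fix A :: "real set" assume "A \<in> sets (density lborel (\<lambda>y. ennreal (occ 1 (scaled m \<omega>) y)))"
      then have A[measurable]: "A \<in> sets borel" by simp
      show "emeasure (density lborel (\<lambda>y. ennreal (occ 1 (scaled m \<omega>) y))) A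
        = emeasure (density lborel (\<lambda>y. ennreal (occ (m\<^sup>2) \<omega> (m * y) / m))) A"
        using eq[of "indicator A"] by (simp add: emeasure_density mult.commute[of _ "indicator A _"])
    qed simp
  qed auto
  then show ?thesis
    by eventually_elim (use m in simp)
qed

text \<open>The L^1 distance between the occupation density and its translate by
  \<open>h\<close>.\<close>

definition occ_diff :: "real \<Rightarrow> (real \<Rightarrow> real) \<Rightarrow> real \<Rightarrow> ennreal" where
  "occ_diff n \<omega> h = (\<integral>\<^sup>+ z. ennreal \<bar>occ n \<omega> (z + h) - occ n \<omega> z\<bar> \<partial>lborel)"

lemma measurable_occ_diff [measurable]: "(\<lambda>\<omega>. occ_diff n \<omega> h) \<in> borel_measurable path_space"
  unfolding occ_diff_def
proof (rule sigma_finite_measure.borel_measurable_nn_integral[OF sigma_finite_lborel])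
  have [measurable]: "(\<lambda>p. occ n (fst p) (snd p + h)) \<in> borel_measurable (path_space \<Otimes>\<^sub>M lborel)"
    "(\<lambda>p. occ n (fst p) (snd p)) \<in> borel_measurable (path_space \<Otimes>\<^sub>M lborel)"
    by (intro measurable_occ; measurable)+
  show "(\<lambda>(\<omega>, z). ennreal \<bar>occ n \<omega> (z + h) - occ n \<omega> z\<bar>) \<in> borel_measurable (path_space \<Otimes>\<^sub>M lborel)"
    unfolding case_prod_unfold by measurable
qed

lemma occ_diff_scaled:
  assumes m: "0 < m"
  shows "AE \<omega> in P0. occ_diff (m\<^sup>2) \<omega> x = ennreal (m\<^sup>2) * occ_diff 1 (scaled m \<omega>) (x / m)"
proof -
  have "AE \<omega> in distr P0 path_space (scaled m). \<forall>f\<in>borel_measurable (borel \<Otimes>\<^sub>M borel).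
      (\<integral>\<^sup>+ s. f (\<omega> s, s) \<partial>lborel) = (\<integral>\<^sup>+ x. \<integral>\<^sup>+ s. f (x, s) \<partial>K (raise (- x) \<omega>) \<partial>lborel)"
    by (subst distr_scaled[OF m]) (rule occupation)
  then have "AE \<omega> in P0. \<forall>f\<in>borel_measurable (borel \<Otimes>\<^sub>M borel).
      (\<integral>\<^sup>+ s. f (scaled m \<omega> s, s) \<partial>lborel) = (\<integral>\<^sup>+ x. \<integral>\<^sup>+ s. f (x, s) \<partial>K (raise (- x) (scaled m \<omega>)) \<partial>lborel)"
    by (rule AE_distrD[rotated]) (use measurable_scaled[of m] m in simp)
  with occupation AE_space show ?thesis
  proof eventually_elim
    case (elim \<omega>)
    then have \<omega>: "\<omega> \<in> space path_space" by simp
    have S: "scaled m \<omega> \<in> space path_space"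
      using measurable_space[OF measurable_scaled \<omega>] m by simp
    have om: "(\<lambda>z. occ n \<omega>' z) \<in> borel_measurable borel" if "\<omega>' \<in> space path_space" for \<omega>' n
      using that by (intro measurable_occ) auto
    note om[OF \<omega>, measurable] om[OF S, measurable]
    have ae: "AE y in lborel. occ 1 (scaled m \<omega>) y = occ (m\<^sup>2) \<omega> (m * y) / m"
      by (rule occ_scaled[OF m \<omega> elim(1,3)])
    have pr: "Measurable.pred borel (\<lambda>y. occ 1 (scaled m \<omega>) y = occ (m\<^sup>2) \<omega> (m * y) / m)" by measurable
    have "AE y in lborel. occ 1 (scaled m \<omega>) (x / m + 1 * y) = occ (m\<^sup>2) \<omega> (m * (x / m + 1 * y)) / m"
      by (rule AE_borel_affine[OF _ pr ae]) simp
    then have ae': "AE y in lborel. occ 1 (scaled m \<omega>) (y + x / m) = occ (m\<^sup>2) \<omega> (m * y + x) / m"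
      using m by (simp add: distrib_left add.commute)
    have "occ_diff (m\<^sup>2) \<omega> x = ennreal m * (\<integral>\<^sup>+ y. ennreal \<bar>occ (m\<^sup>2) \<omega> (m * y + x) - occ (m\<^sup>2) \<omega> (m * y)\<bar> \<partial>lborel)"
      unfolding occ_diff_def
      using nn_integral_real_affine[of "\<lambda>z. ennreal \<bar>occ (m\<^sup>2) \<omega> (z + x) - occ (m\<^sup>2) \<omega> z\<bar>" m 0] m by simp
    also have "\<dots> = ennreal m * (\<integral>\<^sup>+ y. ennreal m * ennreal \<bar>occ 1 (scaled m \<omega>) (y + x / m) - occ 1 (scaled m \<omega>) y\<bar> \<partial>lborel)"
    proof (intro arg_cong2[where f="(*)"] refl nn_integral_cong_AE)
      show "AE y in lborel. ennreal \<bar>occ (m\<^sup>2) \<omega> (m * y + x) - occ (m\<^sup>2) \<omega> (m * y)\<bar>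
        = ennreal m * ennreal \<bar>occ 1 (scaled m \<omega>) (y + x / m) - occ 1 (scaled m \<omega>) y\<bar>"
        using ae ae'
      proof eventually_elim
        case (elim y)
        have "\<bar>occ (m\<^sup>2) \<omega> (m * y + x) - occ (m\<^sup>2) \<omega> (m * y)\<bar>
          = m * \<bar>occ 1 (scaled m \<omega>) (y + x / m) - occ 1 (scaled m \<omega>) y\<bar>"
          using m by (simp add: elim abs_divide flip: diff_divide_distrib)
        then show ?case using m by (simp add: ennreal_mult)
      qed
    qed
    also have "\<dots> = ennreal m * (ennreal m * occ_diff 1 (scaled m \<omega>) (x / m))"
      unfolding occ_diff_def by (subst nn_integral_cmult) auto
    finally show ?case using m by (simp add: mult.assoc[symmetric] ennreal_mult[symmetric] power2_eq_square)
  qed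
qed

lemma nn_integral_occ_diff_scaled:
  assumes m: "0 < m"
  shows "(\<integral>\<^sup>+ \<omega>. occ_diff (m\<^sup>2) \<omega> x \<partial>P0) = ennreal (m\<^sup>2) * (\<integral>\<^sup>+ \<omega>. occ_diff 1 \<omega> (x / m) \<partial>P0)"
proof -
  have [measurable]: "scaled m \<in> measurable path_space path_space" using measurable_scaled m by simp
  have "(\<integral>\<^sup>+ \<omega>. occ_diff (m\<^sup>2) \<omega> x \<partial>P0) = (\<integral>\<^sup>+ \<omega>. ennreal (m\<^sup>2) * occ_diff 1 (scaled m \<omega>) (x / m) \<partial>P0)"
    by (rule nn_integral_cong_AE[OF occ_diff_scaled[OF m]])
  also have "\<dots> = ennreal (m\<^sup>2) * (\<integral>\<^sup>+ \<omega>. occ_diff 1 (scaled m \<omega>) (x / m) \<partial>P0)"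
    by (rule nn_integral_cmult) simp
  also have "(\<integral>\<^sup>+ \<omega>. occ_diff 1 (scaled m \<omega>) (x / m) \<partial>P0) = (\<integral>\<^sup>+ \<omega>. occ_diff 1 \<omega> (x / m) \<partial>distr P0 path_space (scaled m))"
    by (subst nn_integral_distr) auto
  finally show ?thesis by (simp add: distr_scaled m)
qed

lemma occ_diff_limit: "(\<lambda>m. \<integral>\<^sup>+ \<omega>. occ_diff 1 \<omega> (x / real (Suc m)) \<partial>P0) \<longlonglongrightarrow> 0"
proof -
  have "(\<lambda>m. \<integral>\<^sup>+ \<omega>. occ_diff 1 \<omega> (x / real (Suc m)) \<partial>P0) \<longlonglongrightarrow> (\<integral>\<^sup>+ \<omega>. 0 \<partial>P0)"
  \<comment> \<open>The bound 2 is the total mass of the density for time 1 plus that of its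
    translate.\<close>
  proof (rule nn_integral_dominated_convergence[where w="\<lambda>_. 2"])
    have om: "(\<lambda>z. occ 1 \<omega> z) \<in> borel_measurable borel" if "\<omega> \<in> space path_space" for \<omega>
      using that by (intro measurable_occ) auto
    show "AE \<omega> in P0. occ_diff 1 \<omega> (x / real (Suc m)) \<le> 2" for m
      using occupation AE_space
    proof eventually_elim
      case (elim \<omega>)
      then have \<omega>: "\<omega> \<in> space path_space" by simp
      note om[OF \<omega>, measurable]
      let ?h = "x / real (Suc m)"
      have "occ_diff 1 \<omega> ?h \<le> (\<integral>\<^sup>+ z. ennreal (occ 1 \<omega> (z + ?h)) + ennreal (occ 1 \<omega> z) \<partial>lborel)"
        unfolding occ_diff_def
        by (intro nn_integral_mono, subst ennreal_plus[symmetric])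
          (auto intro!: ennreal_leI simp: abs_le_iff add_increasing add_increasing2 simp del: ennreal_plus of_nat_Suc)
      also have "\<dots> = (\<integral>\<^sup>+ z. ennreal (occ 1 \<omega> (z + ?h)) \<partial>lborel) + (\<integral>\<^sup>+ z. ennreal (occ 1 \<omega> z) \<partial>lborel)"
        by (rule nn_integral_add) measurable
      also have "\<dots> = 1 + 1"
        using nn_integral_lborel_shift[of "\<lambda>z. ennreal (occ 1 \<omega> z)" ?h] occ_total[OF \<omega> _ elim(1), of 1] by simp
      finally show ?case by simp
    qed
    show "AE \<omega> in P0. (\<lambda>m. occ_diff 1 \<omega> (x / real (Suc m))) \<longlonglongrightarrow> 0"
      using occupation AE_space
    proof eventually_elim
      case (elim \<omega>)
      then have \<omega>: "\<omega> \<in> space path_space" by simp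
      note om[OF \<omega>, measurable]
      have "integrable lborel (occ 1 \<omega>)"
        using occ_total[OF \<omega> _ elim(1), of 1] om[OF \<omega>] by (intro integrableI_bounded) auto
      moreover have "(\<lambda>m. x / real (Suc m)) \<longlonglongrightarrow> 0"
        using LIMSEQ_Suc[OF lim_const_over_n[of x]] by simp
      ultimately show ?case unfolding occ_diff_def by (rule translate_L1_tendsto)
    qed
  qed (use P0.emeasure_space_1 in auto)
  then show ?thesis by simp
qed

text \<open>For an invariant event the Palm formula gives \<open>n * p x\<close> as an integral of
  \<open>occ n \<omega> x\<close> over the event. Replacing \<open>x\<close> by \<open>y\<close>
  costs the mean of \<open>occ_diff n \<omega> (x - y)\<close>. For \<open>n = m\<^sup>2\<close>,
  scaling turns this into \<open>m\<^sup>2\<close> times the mean L^1 distance at time 1 for the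
  translation \<open>(x - y) / m\<close>; after division by \<open>m\<^sup>2\<close> it tends to
  0.\<close>

lemma invariant_le:
  assumes J[measurable]: "Measurable.pred path_space J"
    and inv: "\<And>x. AE \<omega> in P_leb. AE s in K (raise (- x) \<omega>). J (shift_path s \<omega>) \<longleftrightarrow> J \<omega>"
  shows "(\<integral>\<^sup>+ \<omega>. indicator {\<omega>. J \<omega>} (raise x \<omega>) \<partial>P0) \<le> (\<integral>\<^sup>+ \<omega>. indicator {\<omega>. J \<omega>} (raise y \<omega>) \<partial>P0)"
proof -
  define p where "p x = (\<integral>\<^sup>+ \<omega>. indicator {\<omega>. J \<omega>} (raise x \<omega>) \<partial>P0)" for x :: real
  have oc: "(\<lambda>\<omega>. occ n \<omega> x) \<in> borel_measurable path_space" for n x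
    by (intro measurable_occ) auto
  note oc[measurable]
  have np: "ennreal n * p x = (\<integral>\<^sup>+ \<omega>. indicator {\<omega>. J \<omega>} \<omega> * ennreal (occ n \<omega> x) \<partial>P_leb)" if n: "0 \<le> n" for n x
  proof -
    define g where "g \<omega> s = (indicator {\<omega>. J \<omega>} \<omega> * indicator {0..n} s :: ennreal)" for \<omega> s
    have g: "(\<lambda>p. g (fst p) (snd p)) \<in> borel_measurable (path_space \<Otimes>\<^sub>M borel)"
      unfolding g_def by measurable
    have A: "(\<integral>\<^sup>+ \<omega>. \<integral>\<^sup>+ s. g (shift_path s \<omega>) s \<partial>K (raise (- x) \<omega>) \<partial>P_leb)
      = (\<integral>\<^sup>+ \<omega>. indicator {\<omega>. J \<omega>} \<omega> * ennreal (occ n \<omega> x) \<partial>P_leb)"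
    proof (rule nn_integral_cong_AE)
      show "AE \<omega> in P_leb. (\<integral>\<^sup>+ s. g (shift_path s \<omega>) s \<partial>K (raise (- x) \<omega>)) = indicator {\<omega>. J \<omega>} \<omega> * ennreal (occ n \<omega> x)"
        using inv[of x] AE_space
      proof eventually_elim
        case (elim \<omega>)
        then have \<omega>: "\<omega> \<in> space path_space" by simp
        have "(\<integral>\<^sup>+ s. g (shift_path s \<omega>) s \<partial>K (raise (- x) \<omega>))
          = (\<integral>\<^sup>+ s. indicator {\<omega>. J \<omega>} \<omega> * indicator {0..n} s \<partial>K (raise (- x) \<omega>))"
          using elim(1) by (intro nn_integral_cong_AE) (auto elim!: eventually_mono simp: g_def indicator_def)
        also have "\<dots> = indicator {\<omega>. J \<omega>} \<omega> * emeasure (K (raise (- x) \<omega>)) {0..n}"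
          using \<omega> by (subst nn_integral_cmult) (auto simp: kernel_measurable kernelD)
        finally show ?case by (simp add: occ_eq[OF \<omega>])
      qed
    qed
    have B: "(\<integral>\<^sup>+ s. \<integral>\<^sup>+ \<omega>. g (raise x \<omega>) s \<partial>P0 \<partial>lborel) = (\<integral>\<^sup>+ s. p x * indicator {0..n} s \<partial>lborel)"
      unfolding g_def p_def by (intro nn_integral_cong nn_integral_multc) measurable
    have C: "(\<integral>\<^sup>+ s. p x * indicator {0..n} s \<partial>lborel) = p x * ennreal n"
      using n by (subst nn_integral_cmult) auto
    show ?thesis by (simp only: A[symmetric] palm[OF g] B C mult.commute[of "ennreal n"])
  qed
  have diff: "(\<integral>\<^sup>+ \<omega>. ennreal \<bar>occ n \<omega> x - occ n \<omega> y\<bar> \<partial>P_leb) = (\<integral>\<^sup>+ \<omega>. occ_diff n \<omega> (x - y) \<partial>P0)" for n x y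
  proof -
    interpret pair_sigma_finite lborel P0 ..
    have [measurable]: "(\<lambda>p. occ n (snd p) (c - fst p)) \<in> borel_measurable (lborel \<Otimes>\<^sub>M P0)" for c
      by (intro measurable_occ) measurable
    have "(\<integral>\<^sup>+ \<omega>. ennreal \<bar>occ n \<omega> x - occ n \<omega> y\<bar> \<partial>P_leb)
      = (\<integral>\<^sup>+ z. \<integral>\<^sup>+ \<omega>. ennreal \<bar>occ n \<omega> (x - z) - occ n \<omega> (y - z)\<bar> \<partial>P0 \<partial>lborel)"
      by (subst nn_integral_P_leb) (auto simp: occ_raise)
    also have "\<dots> = (\<integral>\<^sup>+ \<omega>. \<integral>\<^sup>+ z. ennreal \<bar>occ n \<omega> (x - z) - occ n \<omega> (y - z)\<bar> \<partial>lborel \<partial>P0)"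
      by (intro Fubini'[symmetric]) (simp add: case_prod_unfold)
    also have "\<dots> = (\<integral>\<^sup>+ \<omega>. occ_diff n \<omega> (x - y) \<partial>P0)"
    proof (rule nn_integral_cong)
      fix \<omega> assume "\<omega> \<in> space P0"
      then have [measurable]: "(\<lambda>z. occ n \<omega> z) \<in> borel_measurable borel"
        by (intro measurable_occ) auto
      have "(\<lambda>z. ennreal \<bar>occ n \<omega> (z + (x - y)) - occ n \<omega> z\<bar>) \<in> borel_measurable borel" by measurable
      from nn_integral_lborel_reflect[OF this, of y]
      show "(\<integral>\<^sup>+ z. ennreal \<bar>occ n \<omega> (x - z) - occ n \<omega> (y - z)\<bar> \<partial>lborel) = occ_diff n \<omega> (x - y)"
        by (simp add: occ_diff_def algebra_simps)
    qed
    finally show ?thesis .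
  qed
  have le: "p x \<le> p y + (\<integral>\<^sup>+ \<omega>. occ_diff 1 \<omega> ((x - y) / m) \<partial>P0)" if m: "0 < m" for m
  proof -
    have "ennreal (m\<^sup>2) * p x = (\<integral>\<^sup>+ \<omega>. indicator {\<omega>. J \<omega>} \<omega> * ennreal (occ (m\<^sup>2) \<omega> x) \<partial>P_leb)" by (simp add: np)
    also have "\<dots> \<le> (\<integral>\<^sup>+ \<omega>. indicator {\<omega>. J \<omega>} \<omega> * ennreal (occ (m\<^sup>2) \<omega> y) + ennreal \<bar>occ (m\<^sup>2) \<omega> x - occ (m\<^sup>2) \<omega> y\<bar> \<partial>P_leb)"
      by (intro nn_integral_mono) (auto simp: indicator_def ennreal_plus[symmetric] simp del: ennreal_plus)
    also have "\<dots> = (\<integral>\<^sup>+ \<omega>. indicator {\<omega>. J \<omega>} \<omega> * ennreal (occ (m\<^sup>2) \<omega> y) \<partial>P_leb) + (\<integral>\<^sup>+ \<omega>. ennreal \<bar>occ (m\<^sup>2) \<omega> x - occ (m\<^sup>2) \<omega> y\<bar> \<partial>P_leb)"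
      by (intro nn_integral_add) simp_all
    also have "\<dots> = ennreal (m\<^sup>2) * (p y + (\<integral>\<^sup>+ \<omega>. occ_diff 1 \<omega> ((x - y) / m) \<partial>P0))"
      by (simp add: np[symmetric] diff nn_integral_occ_diff_scaled m distrib_left)
    finally have *: "ennreal (m\<^sup>2) * p x \<le> ennreal (m\<^sup>2) * (p y + (\<integral>\<^sup>+ \<omega>. occ_diff 1 \<omega> ((x - y) / m) \<partial>P0))" .
    have c: "ennreal (1 / m\<^sup>2) * (ennreal (m\<^sup>2) * u) = u" for u
      using m by (simp add: mult.assoc[symmetric] ennreal_mult[symmetric])
    show ?thesis using mult_left_mono[OF *, of "ennreal (1 / m\<^sup>2)"] by (simp add: c)
  qed
  have "p x \<le> p y + 0"
  proof (rule LIMSEQ_le_const)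
    show "(\<lambda>m. p y + (\<integral>\<^sup>+ \<omega>. occ_diff 1 \<omega> ((x - y) / real (Suc m)) \<partial>P0)) \<longlonglongrightarrow> p y + 0"
      by (intro tendsto_add tendsto_const occ_diff_limit)
    show "\<exists>N. \<forall>m\<ge>N. p x \<le> p y + (\<integral>\<^sup>+ \<omega>. occ_diff 1 \<omega> ((x - y) / real (Suc m)) \<partial>P0)"
      using le by (auto simp del: of_nat_Suc)
  qed
  then show ?thesis by (simp add: p_def)
qed

end

section \<open>The mixed local time\<close>

lemma pred_Rats [measurable (raw)]:
  fixes P :: "'a \<Rightarrow> real \<Rightarrow> bool"
  assumes [measurable]: "\<And>q. Measurable.pred M (\<lambda>x. P x q)"
  shows "Measurable.pred M (\<lambda>x. \<forall>q\<in>\<rat>. P x q)" "Measurable.pred M (\<lambda>x. \<exists>q\<in>\<rat>. P x q)"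
proof -
  have "Measurable.pred M (\<lambda>x. \<forall>r::rat. P x (of_rat r))" "Measurable.pred M (\<lambda>x. \<exists>r::rat. P x (of_rat r))"
    by measurable
  then show "Measurable.pred M (\<lambda>x. \<forall>q\<in>\<rat>. P x q)" "Measurable.pred M (\<lambda>x. \<exists>q\<in>\<rat>. P x q)"
    by (simp_all add: Rats_def)
qed

locale bm_target = bm_local_time +
  fixes \<nu> :: "real measure"
  assumes nu_prob: "prob_space \<nu>" and nu_sets [measurable_cong, simp]: "sets \<nu> = sets borel"
    and nu_zero: "emeasure \<nu> {0} = 0"
begin

sublocale \<nu>: prob_space \<nu> by (rule nu_prob)

lemma space_nu [simp]: "space \<nu> = UNIV"
  using sets_eq_imp_space_eq[OF nu_sets] by simp

lemma measurable_nu [simp]: "measurable \<nu> = measurable borel"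
  by (intro ext measurable_cong_sets) auto

lemmas nn_integral_start_nu = nn_integral_start[OF \<nu>.sigma_finite_measure nu_sets]

definition \<eta> :: "(real \<Rightarrow> real) \<Rightarrow> real measure" where
  "\<eta> \<omega> = mixture \<nu> (\<lambda>x. K (raise (- x) \<omega>)) borel"

lemma sets_eta [simp, measurable_cong]: "sets (\<eta> \<omega>) = sets borel"
  and space_eta [simp]: "space (\<eta> \<omega>) = UNIV"
  by (simp_all add: \<eta>_def)

lemma measurable_eta [simp]: "measurable (\<eta> \<omega>) = measurable borel"
  by (intro ext measurable_cong_sets) auto

lemma kernel_level: "\<omega> \<in> space path_space \<Longrightarrow> lf_kernel borel (\<lambda>x. K (raise (- x) \<omega>))"
  by (rule lf_kernel_compose[OF kernel]) measurable

lemma emeasure_eta: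
  assumes "\<omega> \<in> space path_space" "C \<in> sets borel"
  shows "emeasure (\<eta> \<omega>) C = (\<integral>\<^sup>+ x. emeasure (K (raise (- x) \<omega>)) C \<partial>\<nu>)"
  unfolding \<eta>_def using assms kernelD(1) lf_kernelD(3)[OF kernel_level[OF assms(1)]]
  by (intro emeasure_mixture) auto

lemma nn_integral_eta:
  assumes "\<omega> \<in> space path_space" "f \<in> borel_measurable borel"
  shows "(\<integral>\<^sup>+ s. f s \<partial>\<eta> \<omega>) = (\<integral>\<^sup>+ x. \<integral>\<^sup>+ s. f s \<partial>K (raise (- x) \<omega>) \<partial>\<nu>)"
  unfolding \<eta>_def using assms kernelD(1) lf_kernelD(3)[OF kernel_level[OF assms(1)]]
  by (intro nn_integral_mixture) auto

lemma measurable_eta_integral: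
  fixes f :: "'a \<Rightarrow> real \<Rightarrow> ennreal"
  assumes h[measurable]: "h \<in> measurable M path_space"
    and f[measurable]: "(\<lambda>p. f (fst p) (snd p)) \<in> borel_measurable (M \<Otimes>\<^sub>M borel)"
  shows "(\<lambda>x. \<integral>\<^sup>+ s. f x s \<partial>\<eta> (h x)) \<in> borel_measurable M"
proof -
  have mf: "(\<lambda>y. f (u y) (v y)) \<in> borel_measurable N"
    if "u \<in> measurable N M" "v \<in> borel_measurable N" for u v and N :: "'c measure"
    using measurable_compose[OF measurable_Pair[OF that] f] by simp
  have "(\<lambda>x. \<integral>\<^sup>+ y. \<integral>\<^sup>+ s. f x s \<partial>K (raise (- y) (h x)) \<partial>\<nu>) \<in> borel_measurable M"
  proof (rule \<nu>.borel_measurable_nn_integral)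
    show "(\<lambda>(x, y). \<integral>\<^sup>+ s. f x s \<partial>K (raise (- y) (h x))) \<in> borel_measurable (M \<Otimes>\<^sub>M \<nu>)"
      unfolding case_prod_unfold by (intro measurable_kernel_integral mf) measurable
  qed
  also have "?this \<longleftrightarrow> ?thesis"
  proof (rule measurable_cong)
    fix x assume x: "x \<in> space M"
    have "(\<lambda>s. f x s) \<in> borel_measurable borel" using x by (intro mf) auto
    then show "(\<integral>\<^sup>+ y. \<integral>\<^sup>+ s. f x s \<partial>K (raise (- y) (h x)) \<partial>\<nu>) = (\<integral>\<^sup>+ s. f x s \<partial>\<eta> (h x))"
      using measurable_space[OF h x] by (simp add: nn_integral_eta)
  qed
  finally show ?thesis .
qed

lemma measurable_Icc:
  assumes [measurable]: "h \<in> measurable M path_space" "a \<in> borel_measurable M" "b \<in> borel_measurable M"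
  shows "(\<lambda>x. emeasure (K (h x)) {a x..b x}) \<in> borel_measurable M"
    "(\<lambda>x. emeasure (\<eta> (h x)) {a x..b x}) \<in> borel_measurable M"
proof -
  have m: "(\<lambda>p. indicator {a (fst p)..b (fst p)} (snd p) :: ennreal) \<in> borel_measurable (M \<Otimes>\<^sub>M borel)"
  proof -
    have "(\<lambda>p. indicator {p. a (fst p) \<le> snd p \<and> snd p \<le> b (fst p)} p :: ennreal) \<in> borel_measurable (M \<Otimes>\<^sub>M borel)"
      by measurable
    then show ?thesis by (simp add: indicator_def)
  qed
  have "(\<lambda>x. \<integral>\<^sup>+ s. indicator {a x..b x} s \<partial>K (h x)) \<in> borel_measurable M"
    using m by (intro measurable_kernel_integral) auto
  also have "?this \<longleftrightarrow> (\<lambda>x. emeasure (K (h x)) {a x..b x}) \<in> borel_measurable M"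
    by (intro measurable_cong nn_integral_indicator) (use kernelD(1) measurable_space[OF assms(1)] in auto)
  finally show "(\<lambda>x. emeasure (K (h x)) {a x..b x}) \<in> borel_measurable M" .
  have "(\<lambda>x. \<integral>\<^sup>+ s. indicator {a x..b x} s \<partial>\<eta> (h x)) \<in> borel_measurable M"
    using m by (intro measurable_eta_integral) auto
  then show "(\<lambda>x. emeasure (\<eta> (h x)) {a x..b x}) \<in> borel_measurable M" by simp
qed

lemma P_leb_nu_swap:
  assumes [measurable]: "(\<lambda>p. G (fst p) (snd p)) \<in> borel_measurable (path_space \<Otimes>\<^sub>M borel)"
  shows "(\<integral>\<^sup>+ \<omega>. \<integral>\<^sup>+ x. G \<omega> x \<partial>\<nu> \<partial>P_leb) = (\<integral>\<^sup>+ x. \<integral>\<^sup>+ \<omega>. G \<omega> x \<partial>P_leb \<partial>\<nu>)"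
proof -
  interpret A: pair_sigma_finite P0 \<nu> ..
  interpret B: pair_sigma_finite lborel \<nu> ..
  have mG: "(\<lambda>y. G (u y) (v y)) \<in> borel_measurable N"
    if "u \<in> measurable N path_space" "v \<in> borel_measurable N" for u v and N :: "'c measure"
    using measurable_compose[OF measurable_Pair[OF that] assms] by simp
  have "(\<integral>\<^sup>+ \<omega>. \<integral>\<^sup>+ x. G \<omega> x \<partial>\<nu> \<partial>P_leb) = (\<integral>\<^sup>+ z. \<integral>\<^sup>+ \<omega>. \<integral>\<^sup>+ x. G (raise z \<omega>) x \<partial>\<nu> \<partial>P0 \<partial>lborel)"
  proof (rule nn_integral_P_leb)
    show "(\<lambda>\<omega>. \<integral>\<^sup>+ x. G \<omega> x \<partial>\<nu>) \<in> borel_measurable path_space"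
      by (rule \<nu>.borel_measurable_nn_integral) (unfold case_prod_unfold, intro mG, measurable)
  qed
  also have "\<dots> = (\<integral>\<^sup>+ z. \<integral>\<^sup>+ x. \<integral>\<^sup>+ \<omega>. G (raise z \<omega>) x \<partial>P0 \<partial>\<nu> \<partial>lborel)"
  proof (rule nn_integral_cong)
    fix z :: real
    show "(\<integral>\<^sup>+ \<omega>. \<integral>\<^sup>+ x. G (raise z \<omega>) x \<partial>\<nu> \<partial>P0) = (\<integral>\<^sup>+ x. \<integral>\<^sup>+ \<omega>. G (raise z \<omega>) x \<partial>P0 \<partial>\<nu>)"
      by (intro A.Fubini'[symmetric]) (unfold case_prod_unfold, intro mG, measurable)
  qed
  also have "\<dots> = (\<integral>\<^sup>+ x. \<integral>\<^sup>+ z. \<integral>\<^sup>+ \<omega>. G (raise z \<omega>) x \<partial>P0 \<partial>lborel \<partial>\<nu>)"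
  proof (rule B.Fubini'[symmetric])
    show "(\<lambda>(z, x). \<integral>\<^sup>+ \<omega>. G (raise z \<omega>) x \<partial>P0) \<in> borel_measurable (lborel \<Otimes>\<^sub>M \<nu>)"
      unfolding case_prod_unfold
      by (rule P0.borel_measurable_nn_integral) (unfold case_prod_unfold, intro mG, measurable)
  qed
  also have "\<dots> = (\<integral>\<^sup>+ x. \<integral>\<^sup>+ \<omega>. G \<omega> x \<partial>P_leb \<partial>\<nu>)"
    by (intro nn_integral_cong nn_integral_P_leb[symmetric] mG) auto
  finally show ?thesis .
qed

text \<open>The Palm formula at level \<open>x\<close>, integrated over \<open>x\<close> against
  \<nu>.\<close>

theorem palm_eta:
  fixes g :: "(real \<Rightarrow> real) \<Rightarrow> real \<Rightarrow> ennreal"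
  assumes g: "(\<lambda>p. g (fst p) (snd p)) \<in> borel_measurable (path_space \<Otimes>\<^sub>M borel)"
  shows "(\<integral>\<^sup>+ \<omega>. \<integral>\<^sup>+ r. g (shift_path r \<omega>) r \<partial>\<eta> \<omega> \<partial>P_leb) = (\<integral>\<^sup>+ r. \<integral>\<^sup>+ \<omega>. g \<omega> r \<partial>start \<nu> \<partial>lborel)"
proof -
  interpret B: pair_sigma_finite lborel \<nu> ..
  have mg: "(\<lambda>y. g (u y) (v y)) \<in> borel_measurable N"
    if "u \<in> measurable N path_space" "v \<in> borel_measurable N" for u v and N :: "'c measure"
    using measurable_compose[OF measurable_Pair[OF that] g] by simp
  have "(\<integral>\<^sup>+ \<omega>. \<integral>\<^sup>+ r. g (shift_path r \<omega>) r \<partial>\<eta> \<omega> \<partial>P_leb)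
    = (\<integral>\<^sup>+ \<omega>. \<integral>\<^sup>+ x. \<integral>\<^sup>+ r. g (shift_path r \<omega>) r \<partial>K (raise (- x) \<omega>) \<partial>\<nu> \<partial>P_leb)"
    by (intro nn_integral_cong nn_integral_eta mg measurable_shift_path) auto
  also have "\<dots> = (\<integral>\<^sup>+ x. \<integral>\<^sup>+ \<omega>. \<integral>\<^sup>+ r. g (shift_path r \<omega>) r \<partial>K (raise (- x) \<omega>) \<partial>P_leb \<partial>\<nu>)"
    by (intro P_leb_nu_swap measurable_kernel_integral mg) measurable
  also have "\<dots> = (\<integral>\<^sup>+ x. \<integral>\<^sup>+ r. \<integral>\<^sup>+ \<omega>. g (raise x \<omega>) r \<partial>P0 \<partial>lborel \<partial>\<nu>)"
    by (simp only: palm[OF g])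
  also have "\<dots> = (\<integral>\<^sup>+ r. \<integral>\<^sup>+ x. \<integral>\<^sup>+ \<omega>. g (raise x \<omega>) r \<partial>P0 \<partial>\<nu> \<partial>lborel)"
  proof (rule B.Fubini')
    show "(\<lambda>(r, x). \<integral>\<^sup>+ \<omega>. g (raise x \<omega>) r \<partial>P0) \<in> borel_measurable (lborel \<Otimes>\<^sub>M \<nu>)"
      unfolding case_prod_unfold
      by (rule P0.borel_measurable_nn_integral) (unfold case_prod_unfold, intro mg, measurable)
  qed
  also have "\<dots> = (\<integral>\<^sup>+ r. \<integral>\<^sup>+ \<omega>. g \<omega> r \<partial>start \<nu> \<partial>lborel)"
    by (intro nn_integral_cong nn_integral_start_nu[symmetric] mg) auto
  finally show ?thesis .
qed

lemma palm_eta_AE_up: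
  assumes Q[measurable]: "Measurable.pred (path_space \<Otimes>\<^sub>M borel) (\<lambda>p. Q (fst p) (snd p))"
    and ae: "\<And>x s. AE \<omega> in P0. Q (raise x \<omega>) s"
  shows "AE \<omega> in P_leb. AE s in \<eta> \<omega>. Q (shift_path s \<omega>) s"
proof -
  define g where "g \<omega> s = (indicator {p. \<not> Q (fst p) (snd p)} (\<omega>, s) :: ennreal)" for \<omega> s
  have g: "(\<lambda>p. g (fst p) (snd p)) \<in> borel_measurable (path_space \<Otimes>\<^sub>M borel)"
    unfolding g_def by measurable
  have gs: "(\<lambda>p. g (shift_path (snd p) (fst p)) (snd p)) \<in> borel_measurable (path_space \<Otimes>\<^sub>M borel)"
  proof -
    have "(\<lambda>p. (shift_path (snd p) (fst p), snd p)) \<in> measurable (path_space \<Otimes>\<^sub>M borel) (path_space \<Otimes>\<^sub>M borel)"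
      by measurable
    from measurable_compose[OF this g] show ?thesis by simp
  qed
  have m: "(\<lambda>\<omega>. \<integral>\<^sup>+ s. g (shift_path s \<omega>) s \<partial>\<eta> \<omega>) \<in> borel_measurable path_space"
    using gs by (intro measurable_eta_integral) auto
  have "(\<integral>\<^sup>+ \<omega>. g (raise x \<omega>) s \<partial>P0) = 0" for s x
  proof -
    have "(\<integral>\<^sup>+ \<omega>. g (raise x \<omega>) s \<partial>P0) = (\<integral>\<^sup>+ \<omega>. 0 \<partial>P0)"
      using ae[of x s] by (intro nn_integral_cong_AE) (auto simp: g_def)
    then show ?thesis by simp
  qed
  moreover have "(\<lambda>\<omega>. g \<omega> s) \<in> borel_measurable path_space" for s
    using measurable_compose[OF measurable_Pair2'[of s borel path_space] g] by simp
  ultimately have "(\<integral>\<^sup>+ \<omega>. g \<omega> s \<partial>start \<nu>) = 0" for s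
    by (simp add: nn_integral_start_nu)
  then have "(\<integral>\<^sup>+ \<omega>. \<integral>\<^sup>+ s. g (shift_path s \<omega>) s \<partial>\<eta> \<omega> \<partial>P_leb) = 0"
    by (subst palm_eta[OF g]) simp
  then have "AE \<omega> in P_leb. (\<integral>\<^sup>+ s. g (shift_path s \<omega>) s \<partial>\<eta> \<omega>) = 0"
    using m by (subst (asm) nn_integral_0_iff_AE) auto
  then show ?thesis
    using AE_space
  proof eventually_elim
    fix \<omega> assume 0: "(\<integral>\<^sup>+ s. g (shift_path s \<omega>) s \<partial>\<eta> \<omega>) = 0" and "\<omega> \<in> space P_leb"
    then have \<omega>: "\<omega> \<in> space path_space" by simp
    have "(\<lambda>s. g (shift_path s \<omega>) s) \<in> borel_measurable borel"
      using measurable_compose[OF measurable_Pair1'[OF \<omega>] gs] by simp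
    then have "AE s in \<eta> \<omega>. g (shift_path s \<omega>) s = 0"
      using 0 by (subst (asm) nn_integral_0_iff_AE) auto
    then show "AE s in \<eta> \<omega>. Q (shift_path s \<omega>) s"
      by eventually_elim (auto simp: g_def indicator_def split: if_splits)
  qed
qed

text \<open>Shift invariance at the time \<open>s\<close> for both local times. Rational intervals
  keep this a countable family of conditions, so that it can hold at almost all random times; at all
  other intervals nothing is claimed.\<close>

definition covariant :: "(real \<Rightarrow> real) \<Rightarrow> real \<Rightarrow> bool" where
  "covariant \<omega> s \<longleftrightarrow> (\<forall>p\<in>\<rat>. \<forall>q\<in>\<rat>.
     emeasure (K (shift_path s \<omega>)) {p..q} = emeasure (K \<omega>) {p + s..q + s} \<and>
     emeasure (\<eta> (shift_path s \<omega>)) {p..q} = emeasure (\<eta> \<omega>) {p + s..q + s})"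

lemma shift_Icc:
  "AE \<omega> in P0. emeasure (K (raise x \<omega>)) {p..q} = emeasure (K (shift_path (- s) (raise x \<omega>))) {p + s..q + s}"
proof -
  have "{r. r + - s \<in> {p..q}} = {p + s..q + s}" by auto
  then show ?thesis
    using shift_inv[where C="{p..q}" and x=x and t="- s"] by (auto elim!: eventually_mono)
qed

lemma shift_Icc_eta:
  "AE \<omega> in P0. emeasure (\<eta> (raise x \<omega>)) {p..q} = emeasure (\<eta> (shift_path (- s) (raise x \<omega>))) {p + s..q + s}"
proof -
  interpret A: pair_sigma_finite P0 \<nu> ..
  have [measurable]: "(\<lambda>u. emeasure (K (raise (x - snd u) (fst u))) {p..q}) \<in> borel_measurable (path_space \<Otimes>\<^sub>M borel)"
    "(\<lambda>u. emeasure (K (raise (x - snd u) (shift_path (- s) (fst u)))) {p + s..q + s}) \<in> borel_measurable (path_space \<Otimes>\<^sub>M borel)"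
    by (intro measurable_Icc; measurable)+
  have "AE y in \<nu>. AE \<omega> in P0. emeasure (K (raise (x - y) \<omega>)) {p..q}
      = emeasure (K (raise (x - y) (shift_path (- s) \<omega>))) {p + s..q + s}"
    using shift_Icc[of "x - _" p q s] by simp
  then have "AE \<omega> in P0. AE y in \<nu>. emeasure (K (raise (x - y) \<omega>)) {p..q}
      = emeasure (K (raise (x - y) (shift_path (- s) \<omega>))) {p + s..q + s}"
  proof (subst A.AE_commute)
    show "{u \<in> space (P0 \<Otimes>\<^sub>M \<nu>). emeasure (K (raise (x - snd u) (fst u))) {p..q}
      = emeasure (K (raise (x - snd u) (shift_path (- s) (fst u)))) {p + s..q + s}} \<in> sets (P0 \<Otimes>\<^sub>M \<nu>)"
      by measurable
  qed
  then show ?thesis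
    using AE_space
  proof eventually_elim
    case (elim \<omega>)
    then have "\<omega> \<in> space path_space" by simp
    then show ?case
      using elim(1) by (auto simp: emeasure_eta intro!: nn_integral_cong_AE elim!: eventually_mono)
  qed
qed

text \<open>The same condition expressed through the shifted path, because the Palm formula
  evaluates its integrand at \<open>shift_path s \<omega>\<close>.\<close>

definition covariant_back :: "(real \<Rightarrow> real) \<Rightarrow> real \<Rightarrow> bool" where
  "covariant_back \<omega> s \<longleftrightarrow> (\<forall>p\<in>\<rat>. \<forall>q\<in>\<rat>.
     emeasure (K \<omega>) {p..q} = emeasure (K (shift_path (- s) \<omega>)) {p + s..q + s} \<and>
     emeasure (\<eta> \<omega>) {p..q} = emeasure (\<eta> (shift_path (- s) \<omega>)) {p + s..q + s})"

lemma covariant_back_shift: "covariant_back (shift_path s \<omega>) s \<longleftrightarrow> covariant \<omega> s"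
  by (simp add: covariant_back_def covariant_def)

lemma measurable_covariant_back:
  "Measurable.pred (path_space \<Otimes>\<^sub>M borel) (\<lambda>u. covariant_back (fst u) (snd u))"
proof -
  have [measurable]: "(\<lambda>u. emeasure (K (fst u)) {p..q}) \<in> borel_measurable (path_space \<Otimes>\<^sub>M borel)"
    "(\<lambda>u. emeasure (\<eta> (fst u)) {p..q}) \<in> borel_measurable (path_space \<Otimes>\<^sub>M borel)"
    "(\<lambda>u. emeasure (K (shift_path (- snd u) (fst u))) {p + snd u..q + snd u}) \<in> borel_measurable (path_space \<Otimes>\<^sub>M borel)"
    "(\<lambda>u. emeasure (\<eta> (shift_path (- snd u) (fst u))) {p + snd u..q + snd u}) \<in> borel_measurable (path_space \<Otimes>\<^sub>M borel)"
    for p q :: real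
    by (intro measurable_Icc; measurable)+
  show ?thesis
    unfolding covariant_back_def
    by measurable
qed

lemma AE_covariant:
  "AE \<omega> in P_leb. AE s in K (raise (- x) \<omega>). covariant \<omega> s" "AE \<omega> in P_leb. AE s in \<eta> \<omega>. covariant \<omega> s"
proof -
  have ae: "AE \<omega> in P0. covariant_back (raise x \<omega>) s" for x s
    unfolding covariant_back_def
    by (intro AE_ball_countable' countable_rat AE_conjI shift_Icc shift_Icc_eta)
  show "AE \<omega> in P_leb. AE s in K (raise (- x) \<omega>). covariant \<omega> s" "AE \<omega> in P_leb. AE s in \<eta> \<omega>. covariant \<omega> s"
    using palm_AE_up[OF measurable_covariant_back ae, of x] palm_eta_AE_up[OF measurable_covariant_back ae]
    by (simp_all only: covariant_back_shift)
qed

end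

lemma measure_Icc_add:
  fixes N :: "real measure"
  assumes N: "sets N = sets borel" "\<And>a b. emeasure N {a..b} < \<infinity>" "\<And>s. emeasure N {s} = 0"
    and le: "u \<le> v" "v \<le> w"
  shows "measure N {u..w} = measure N {u..v} + measure N {v..w}"
proof -
  have fin: "{a..b} \<in> fmeasurable N" for a b using N by (simp add: fmeasurable_def)
  have "measure N {u..w} = measure N ({u..v} \<union> {v..w})"
    using le by (simp add: ivl_disj_un_two_touch)
  also have "\<dots> = measure N {u..v} + measure N {v..w} - measure N ({u..v} \<inter> {v..w})"
    by (rule measure_Un3[OF fin fin])
  also have "{u..v} \<inter> {v..w} = {v}" using le by auto
  finally show ?thesis using N(3)[of v] by (simp add: measure_def)
qed

section \<open>The difference function and the good paths\<close>

context bm_target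
begin

lemma prob_start_nu: "prob_space (start \<nu>)"
proof -
  interpret A: pair_prob_space \<nu> P0 ..
  show ?thesis unfolding start_def by (rule A.prob_space_distr) measurable
qed

definition F :: "(real \<Rightarrow> real) \<Rightarrow> real \<Rightarrow> real" where
  "F \<omega> t = (if 0 \<le> t then measure (K \<omega>) {0..t} - measure (\<eta> \<omega>) {0..t}
    else measure (\<eta> \<omega>) {t..0} - measure (K \<omega>) {t..0})"

lemma measurable_F:
  assumes [measurable]: "h \<in> measurable M path_space" "k \<in> borel_measurable M"
  shows "(\<lambda>x. F (h x) (k x)) \<in> borel_measurable M"
proof -
  have [measurable]: "(\<lambda>x. emeasure (K (h x)) {0..k x}) \<in> borel_measurable M"
    "(\<lambda>x. emeasure (\<eta> (h x)) {0..k x}) \<in> borel_measurable M"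
    "(\<lambda>x. emeasure (K (h x)) {k x..0}) \<in> borel_measurable M"
    "(\<lambda>x. emeasure (\<eta> (h x)) {k x..0}) \<in> borel_measurable M"
    by (intro measurable_Icc; measurable)+
  show ?thesis unfolding F_def measure_def by measurable
qed

lemma measurable_F_const [measurable]: "(\<lambda>\<omega>. F \<omega> t) \<in> borel_measurable path_space"
  by (rule measurable_F) auto

definition good :: "(real \<Rightarrow> real) \<Rightarrow> bool" where
  "good \<omega> \<longleftrightarrow> \<omega> \<in> space path_space \<and> (\<forall>n::nat. emeasure (\<eta> \<omega>) {- real n..real n} < \<infinity>) \<and>
     (\<forall>s. emeasure (K \<omega>) {s} = 0) \<and> (\<forall>s. emeasure (\<eta> \<omega>) {s} = 0)"

lemma finite_eta:
  assumes "\<forall>n::nat. emeasure (\<eta> \<omega>) {- real n..real n} < \<infinity>"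
  shows "emeasure (\<eta> \<omega>) {a..b} < \<infinity>"
proof -
  obtain n :: nat where n: "max \<bar>a\<bar> \<bar>b\<bar> \<le> real n"
    using real_arch_simple by blast
  have "emeasure (\<eta> \<omega>) {a..b} \<le> emeasure (\<eta> \<omega>) {- real n..real n}"
    using n by (intro emeasure_mono) auto
  then show ?thesis using assms[rule_format, of n] by (rule le_less_trans)
qed

lemma good_pair:
  assumes "good \<omega>"
  shows "diffuse_pair (K \<omega>) (\<eta> \<omega>) (F \<omega>)"
proof
  have \<omega>: "\<omega> \<in> space path_space" using assms by (simp add: good_def)
  show 1: "sets (K \<omega>) = sets borel" "sets (\<eta> \<omega>) = sets borel" using kernelD(1)[OF \<omega>] by auto
  show 2: "emeasure (K \<omega>) {a..b} < \<infinity>" "emeasure (\<eta> \<omega>) {a..b} < \<infinity>" for a b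
    using kernelD(3)[OF \<omega>] finite_eta assms by (auto simp: good_def)
  show 3: "emeasure (K \<omega>) {s} = 0" "emeasure (\<eta> \<omega>) {s} = 0" for s
    using assms by (auto simp: good_def)
  show "F \<omega> b - F \<omega> a = measure (K \<omega>) {a..b} - measure (\<eta> \<omega>) {a..b}" if ab: "a \<le> b" for a b
  proof -
    note add = measure_Icc_add[OF 1(1) 2(1) 3(1)] measure_Icc_add[OF 1(2) 2(2) 3(2)]
    consider "0 \<le> a" | "a < 0" "0 \<le> b" | "b < 0" by linarith
    then show ?thesis
    proof cases
      case 1
      then show ?thesis using ab add(1)[of 0 a b] add(2)[of 0 a b] by (simp add: F_def)
    next
      case 2
      then show ?thesis using add(1)[of a 0 b] add(2)[of a 0 b] by (simp add: F_def)
    next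
      case 3
      then show ?thesis using ab add(1)[of a b 0] add(2)[of a b 0] by (simp add: F_def)
    qed
  qed
  \<comment> \<open>The zero set of the path carries \<open>K \<omega>\<close>. A local time at a
    level other than 0 does not charge it, and \<nu> gives no mass to the level 0; so \<eta> does
    not charge it either.\<close>
  have "closed {t. \<omega> t = 0}"
    using path_continuous[OF \<omega>] by (intro closed_Collect_eq continuous_intros) auto
  then have Z: "{t. \<omega> t = 0} \<in> sets borel" by (rule borel_closed)
  have "emeasure (K (raise (- x) \<omega>)) {t. \<omega> t = 0} = 0" if "x \<noteq> 0" for x
  proof -
    have r: "raise (- x) \<omega> \<in> space path_space" using \<omega> by simp
    have "{t. raise (- x) \<omega> t \<noteq> 0} \<in> sets borel"
      using path_continuous[OF r, of UNIV] by (intro borel_open open_Collect_neq continuous_intros)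
    then have "emeasure (K (raise (- x) \<omega>)) {t. \<omega> t = 0} \<le> emeasure (K (raise (- x) \<omega>)) {t. raise (- x) \<omega> t \<noteq> 0}"
      using that kernelD(1)[OF r] by (intro emeasure_mono) auto
    then show ?thesis using support[OF r] by simp
  qed
  moreover have "AE x in \<nu>. x \<noteq> 0"
    using nu_zero by (intro AE_I[of _ _ "{0}"]) auto
  ultimately have "AE x in \<nu>. emeasure (K (raise (- x) \<omega>)) {t. \<omega> t = 0} = 0"
    by (auto elim!: eventually_mono)
  then have "(\<integral>\<^sup>+ x. emeasure (K (raise (- x) \<omega>)) {t. \<omega> t = 0} \<partial>\<nu>) = (\<integral>\<^sup>+ x. 0 \<partial>\<nu>)"
    by (rule nn_integral_cong_AE)
  then have "emeasure (\<eta> \<omega>) {t. \<omega> t = 0} = 0"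
    by (simp add: emeasure_eta[OF \<omega> Z])
  moreover have "emeasure (K \<omega>) (UNIV - {t. \<omega> t = 0}) = 0"
    using support[OF \<omega>] by (simp add: set_diff_eq)
  ultimately show "\<exists>Z\<in>sets borel. emeasure (K \<omega>) (UNIV - Z) = 0 \<and> emeasure (\<eta> \<omega>) Z = 0"
    using Z by blast
qed

lemma F_covariant:
  assumes "good \<omega>" "covariant \<omega> s" "q \<in> \<rat>"
  shows "F (shift_path s \<omega>) q = F \<omega> (s + q) - F \<omega> s"
proof -
  interpret diffuse_pair "K \<omega>" "\<eta> \<omega>" "F \<omega>" by (rule good_pair) fact
  have c: "measure (K (shift_path s \<omega>)) {a..b} = measure (K \<omega>) {a + s..b + s}"
    "measure (\<eta> (shift_path s \<omega>)) {a..b} = measure (\<eta> \<omega>) {a + s..b + s}" if "a \<in> \<rat>" "b \<in> \<rat>" for a b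
    using assms(2) that by (auto simp: covariant_def measure_def)
  show ?thesis
  proof (cases "0 \<le> q")
    case True
    then show ?thesis using f[of s "s + q"] c[of 0 q] assms(3) by (simp add: F_def[of "shift_path s \<omega>"] add.commute)
  next
    case False
    then show ?thesis using f[of "s + q" s] c[of q 0] assms(3) by (simp add: F_def[of "shift_path s \<omega>"] add.commute)
  qed
qed

text \<open>The sum of the squared masses of the atoms. Absence of atoms is a condition on
  uncountably many points; this turns it into the vanishing of a single measurable quantity.\<close>

definition atoms :: "(real \<Rightarrow> real) \<Rightarrow> ennreal" where
  "atoms \<omega> = (\<integral>\<^sup>+ s. emeasure (K \<omega>) {s..s} \<partial>K \<omega>)"

lemma measurable_atoms:
  assumes [measurable]: "h \<in> measurable M path_space"
  shows "(\<lambda>x. atoms (h x)) \<in> borel_measurable M"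
  unfolding atoms_def by (intro measurable_kernel_integral measurable_Icc) measurable

lemma atoms_eq_0_iff:
  assumes \<omega>: "\<omega> \<in> space path_space"
  shows "atoms \<omega> = 0 \<longleftrightarrow> (\<forall>s. emeasure (K \<omega>) {s} = 0)"
proof
  assume 0: "atoms \<omega> = 0"
  show "\<forall>s. emeasure (K \<omega>) {s} = 0"
  proof
    fix s
    have "emeasure (K \<omega>) {s} * emeasure (K \<omega>) {s} = (\<integral>\<^sup>+ r. emeasure (K \<omega>) {s} * indicator {s} r \<partial>K \<omega>)"
      using kernelD(1)[OF \<omega>] by (subst nn_integral_cmult) (auto simp: kernel_measurable[OF \<omega>])
    also have "\<dots> \<le> atoms \<omega>"
      unfolding atoms_def by (intro nn_integral_mono) (auto simp: indicator_def)
    finally show "emeasure (K \<omega>) {s} = 0" using 0 by simp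
  qed
qed (simp add: atoms_def)

lemma AE_P_leb_good: "AE \<omega> in P_leb. good \<omega>"
proof -
  \<comment> \<open>By the Palm formula the mean \<eta>-mass of an interval is its length, so the
    mass is almost everywhere finite.\<close>
  have "AE \<omega> in P_leb. emeasure (\<eta> \<omega>) {- real n..real n} \<noteq> \<infinity>" for n
  proof (rule nn_integral_PInf_AE)
    have m: "(\<lambda>p. indicator {- real n..real n} (snd p)) \<in> borel_measurable (path_space \<Otimes>\<^sub>M borel)"
      by measurable
    have "(\<integral>\<^sup>+ \<omega>. emeasure (\<eta> \<omega>) {- real n..real n} \<partial>P_leb)
      = (\<integral>\<^sup>+ \<omega>. \<integral>\<^sup>+ r. indicator {- real n..real n} r \<partial>\<eta> \<omega> \<partial>P_leb)" by simp
    also have "\<dots> = (\<integral>\<^sup>+ r. \<integral>\<^sup>+ \<omega>. indicator {- real n..real n} r \<partial>start \<nu> \<partial>lborel)"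
      using palm_eta[of "\<lambda>_ r. indicator {- real n..real n} r", OF m] .
    also have "\<dots> = (\<integral>\<^sup>+ r. indicator {- real n..real n} r \<partial>lborel)"
      by (intro nn_integral_cong) (simp add: prob_space.emeasure_space_1[OF prob_start_nu, simplified])
    finally show "(\<integral>\<^sup>+ \<omega>. emeasure (\<eta> \<omega>) {- real n..real n} \<partial>P_leb) \<noteq> \<infinity>" by simp
  qed (use measurable_Icc(2)[of "\<lambda>\<omega>. \<omega>" path_space] in auto)
  then have 1: "AE \<omega> in P_leb. \<forall>n::nat. emeasure (\<eta> \<omega>) {- real n..real n} \<noteq> \<infinity>"
    unfolding AE_all_countable by blast
  have a0: "AE \<omega> in P0. atoms (raise x \<omega>) = 0" for x
    using diffuse[of x] AE_space by eventually_elim (simp add: atoms_eq_0_iff)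
  have am: "(\<lambda>\<omega>. atoms \<omega>) \<in> borel_measurable path_space" by (rule measurable_atoms) simp
  have 2: "AE \<omega> in P_leb. atoms \<omega> = 0"
    by (rule AE_P_leb_I) (use a0 am in auto)
  define E where "E \<omega> = (\<integral>\<^sup>+ y. atoms (raise (- y) \<omega>) \<partial>\<nu>)" for \<omega>
  have mE: "(\<lambda>x. E (h x)) \<in> borel_measurable M" if [measurable]: "h \<in> measurable M path_space" for h and M :: "'c measure"
    unfolding E_def
    by (rule \<nu>.borel_measurable_nn_integral) (unfold case_prod_unfold, intro measurable_atoms, measurable)
  have "AE \<omega> in P0. E (raise x \<omega>) = 0" for x
  proof -
    interpret A: pair_sigma_finite P0 \<nu> ..
    have "(\<integral>\<^sup>+ \<omega>. E (raise x \<omega>) \<partial>P0) = (\<integral>\<^sup>+ y. \<integral>\<^sup>+ \<omega>. atoms (raise (x - y) \<omega>) \<partial>P0 \<partial>\<nu>)"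
      unfolding E_def raise_simps(2) add.commute[of "- _" x] diff_conv_add_uminus
      by (rule A.Fubini'[symmetric]) (unfold case_prod_unfold, intro measurable_atoms, measurable)
    also have "\<dots> = (\<integral>\<^sup>+ y. \<integral>\<^sup>+ \<omega>. 0 \<partial>P0 \<partial>\<nu>)"
      by (intro nn_integral_cong nn_integral_cong_AE a0)
    finally show ?thesis
      using mE[of "raise x" path_space] by (subst nn_integral_0_iff_AE[symmetric]) auto
  qed
  then have 3: "AE \<omega> in P_leb. E \<omega> = 0"
    by (intro AE_P_leb_I) (use mE[of "\<lambda>\<omega>. \<omega>" path_space] in auto)
  show ?thesis
    using 1 2 3 AE_space
  proof eventually_elim
    case (elim \<omega>)
    then have \<omega>: "\<omega> \<in> space path_space" by simp
    have "(\<lambda>y. atoms (raise (- y) \<omega>)) \<in> borel_measurable \<nu>" using \<omega> by (intro measurable_atoms) auto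
    then have "AE y in \<nu>. atoms (raise (- y) \<omega>) = 0"
      using elim(3) unfolding E_def by (subst (asm) nn_integral_0_iff_AE) auto
    then have "AE y in \<nu>. emeasure (K (raise (- y) \<omega>)) {s} = 0" for s
      by eventually_elim (use \<omega> in \<open>simp add: atoms_eq_0_iff\<close>)
    then have "(\<integral>\<^sup>+ y. emeasure (K (raise (- y) \<omega>)) {s} \<partial>\<nu>) = (\<integral>\<^sup>+ y. 0 \<partial>\<nu>)" for s
      by (intro nn_integral_cong_AE)
    then have "emeasure (\<eta> \<omega>) {s} = 0" for s by (simp add: emeasure_eta \<omega>)
    then show "good \<omega>" using elim \<omega> by (auto simp: good_def atoms_eq_0_iff less_top[symmetric])
  qed
qed

lemma AE_P_leb_covariant: "AE \<omega> in P_leb. AE s in K \<omega>. covariant \<omega> s"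
  using AE_covariant(1)[of 0] unfolding minus_zero raise_simps(3) .

lemma P0_AE_down:
  assumes "Measurable.pred path_space Q" "AE \<omega> in P_leb. AE s in K \<omega>. Q (shift_path s \<omega>)"
  shows "AE \<omega> in P0. Q \<omega>"
  using palm_AE_down[of Q 0] assms unfolding minus_zero raise_simps(3) by blast

text \<open>A single starting level is negligible for \<open>P_leb\<close>, so local finiteness of
  \<eta> cannot simply be specialised. It holds for the path shifted to almost every point of
  \<open>K\<close> by covariance, and the Palm formula then carries it to \<open>P0\<close>.
  Diffuseness follows by exchanging the integrals over \<nu> and \<open>P0\<close>.\<close>

lemma AE_P0_good: "AE \<omega> in P0. good \<omega>"
proof -
  have "AE \<omega> in P0. emeasure (\<eta> \<omega>) {- real n..real n} < \<infinity>" for n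
  proof (rule P0_AE_down)
    have [measurable]: "(\<lambda>\<omega>. emeasure (\<eta> \<omega>) {- real n..real n}) \<in> borel_measurable path_space"
      by (intro measurable_Icc) auto
    show "Measurable.pred path_space (\<lambda>\<omega>. emeasure (\<eta> \<omega>) {- real n..real n} < \<infinity>)" by measurable
    show "AE \<omega> in P_leb. AE s in K \<omega>. emeasure (\<eta> (shift_path s \<omega>)) {- real n..real n} < \<infinity>"
      using AE_P_leb_covariant AE_P_leb_good
    proof eventually_elim
      case (elim \<omega>)
      show ?case
        using elim(1)
      proof eventually_elim
        case (elim s)
        have "emeasure (\<eta> (shift_path s \<omega>)) {- real n..real n} = emeasure (\<eta> \<omega>) {- real n + s..real n + s}"
          using elim by (simp add: covariant_def)
        then show ?case using \<open>good \<omega>\<close> finite_eta[of \<omega>] by (simp add: good_def)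
      qed
    qed
  qed
  then have 1: "AE \<omega> in P0. \<forall>n::nat. emeasure (\<eta> \<omega>) {- real n..real n} < \<infinity>"
    unfolding AE_all_countable by blast
  have eq: "emeasure (\<eta> \<omega>) {s} = 0" if "\<omega> \<in> space path_space"
    "(\<integral>\<^sup>+ y. atoms (raise (- y) \<omega>) \<partial>\<nu>) = 0" for \<omega> s
  proof -
    have "(\<lambda>y. atoms (raise (- y) \<omega>)) \<in> borel_measurable \<nu>" using that by (intro measurable_atoms) auto
    then have "AE y in \<nu>. atoms (raise (- y) \<omega>) = 0"
      using that(2) by (subst (asm) nn_integral_0_iff_AE) auto
    then have "AE y in \<nu>. emeasure (K (raise (- y) \<omega>)) {s} = 0"
      by eventually_elim (use that in \<open>simp add: atoms_eq_0_iff\<close>)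
    then have "(\<integral>\<^sup>+ y. emeasure (K (raise (- y) \<omega>)) {s} \<partial>\<nu>) = (\<integral>\<^sup>+ y. 0 \<partial>\<nu>)"
      by (intro nn_integral_cong_AE)
    then show ?thesis by (simp add: emeasure_eta that)
  qed
  have "AE \<omega> in P0. (\<integral>\<^sup>+ y. atoms (raise (- y) \<omega>) \<partial>\<nu>) = 0"
  proof -
    interpret A: pair_sigma_finite P0 \<nu> ..
    have a0: "AE \<omega> in P0. atoms (raise x \<omega>) = 0" for x
      using diffuse[of x] AE_space by eventually_elim (simp add: atoms_eq_0_iff)
    have m: "(\<lambda>\<omega>. \<integral>\<^sup>+ y. atoms (raise (- y) \<omega>) \<partial>\<nu>) \<in> borel_measurable P0"
      by (rule \<nu>.borel_measurable_nn_integral) (unfold case_prod_unfold, intro measurable_atoms, measurable)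
    have "(\<integral>\<^sup>+ \<omega>. \<integral>\<^sup>+ y. atoms (raise (- y) \<omega>) \<partial>\<nu> \<partial>P0) = (\<integral>\<^sup>+ y. \<integral>\<^sup>+ \<omega>. atoms (raise (- y) \<omega>) \<partial>P0 \<partial>\<nu>)"
      by (rule A.Fubini'[symmetric]) (unfold case_prod_unfold, intro measurable_atoms, measurable)
    also have "\<dots> = (\<integral>\<^sup>+ y. \<integral>\<^sup>+ \<omega>. 0 \<partial>P0 \<partial>\<nu>)"
      by (intro nn_integral_cong nn_integral_cong_AE a0)
    finally show ?thesis using m by (subst nn_integral_0_iff_AE[symmetric]) auto
  qed
  with 1 diffuse[of 0] AE_space show ?thesis
  proof eventually_elim
    case (elim \<omega>)
    then show ?case using eq[of \<omega>] by (simp add: good_def)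
  qed
qed

end

section \<open>The law of the shifted path\<close>

text \<open>The offset \<open>q\<close> from \<open>s\<close>, rather than the time
  \<open>s + q\<close>, is rational, because \<open>F_covariant\<close> is available at rational
  offsets from a random base point.\<close>

lemma continuous_less_rational:
  fixes f :: "real \<Rightarrow> real"
  assumes f: "continuous_on UNIV f" and t: "f t < c" "s + a < t" "t < s + b"
  shows "\<exists>q\<in>\<rat>. a < q \<and> q < b \<and> f (s + q) < c"
proof -
  have "\<forall>\<^sub>F y in at t. f y < c"
    using f t(1) by (auto simp: continuous_on_eq_continuous_at isCont_def intro: order_tendstoD(2))
  then obtain d where d: "0 < d" "\<And>y. y \<noteq> t \<Longrightarrow> \<bar>y - t\<bar> < d \<Longrightarrow> f y < c"
    by (auto simp: eventually_at dist_real_def)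
  have "max a (t - s - d) < min b (t - s + d)" using d(1) t by auto
  then obtain q where q: "q \<in> \<rat>" "max a (t - s - d) < q" "q < min b (t - s + d)"
    using Rats_dense_in_real by blast
  have "\<bar>(s + q) - t\<bar> < d" using q by auto
  then have "f (s + q) < c" using d(2)[of "s + q"] t(1) by (cases "s + q = t") auto
  then show ?thesis using q by (intro bexI[of _ q]) auto
qed

lemma nn_integral_indicator_Collect:
  assumes "{x\<in>space M. P x} \<in> sets M"
  shows "(\<integral>\<^sup>+ x. indicator {x. P x} x \<partial>M) = emeasure M {x\<in>space M. P x}"
proof -
  have "(\<integral>\<^sup>+ x. indicator {x. P x} x \<partial>M) = (\<integral>\<^sup>+ x. indicator {x\<in>space M. P x} x \<partial>M)"
    by (intro nn_integral_cong) (auto simp: indicator_def)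
  then show ?thesis by (simp only: nn_integral_indicator[OF assms])
qed

context bm_target
begin

text \<open>For a good path this is the match \<tau> of the time 0; rational times make it
  measurable and allow the use of covariance.\<close>

definition first_neg :: "(real \<Rightarrow> real) \<Rightarrow> ereal" where
  "first_neg \<omega> = (INF q\<in>{q\<in>\<rat>. 0 < q \<and> F \<omega> q < 0}. ereal q)"

text \<open>The value is 0 where \<open>first_neg\<close> is infinite, which
  \<open>AE_first_neg_finite\<close> shows to be a null event.\<close>

definition T :: "(real \<Rightarrow> real) \<Rightarrow> real" where
  "T \<omega> = real_of_ereal (first_neg \<omega>)"

text \<open>The condition of being reached by the matching, seen from the point that is
  reached.\<close>

definition neg_before :: "(real \<Rightarrow> real) \<Rightarrow> bool" where
  "neg_before \<omega> \<longleftrightarrow> (\<exists>q\<in>\<rat>. q < 0 \<and> F \<omega> q < 0)"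

lemma first_neg_less_iff: "first_neg \<omega> < y \<longleftrightarrow> (\<exists>q\<in>\<rat>. 0 < q \<and> F \<omega> q < 0 \<and> ereal q < y)"
  by (auto simp: first_neg_def Inf_less_iff)

lemma first_neg_nonneg: "0 \<le> first_neg \<omega>"
  unfolding first_neg_def by (rule INF_greatest) auto

lemma measurable_first_neg [measurable]: "first_neg \<in> borel_measurable path_space"
  by (rule borel_measurableI_less) (unfold first_neg_less_iff, measurable)

lemma measurable_T [measurable]: "T \<in> borel_measurable path_space"
  unfolding T_def by measurable

lemma measurable_neg_before [measurable]: "Measurable.pred path_space neg_before"
  unfolding neg_before_def by measurable

lemma T_first_neg: "first_neg \<omega> < \<infinity> \<Longrightarrow> first_neg \<omega> = ereal (T \<omega>)"
  using first_neg_nonneg[of \<omega>] unfolding T_def by (cases "first_neg \<omega>") auto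

lemma T_nonneg: "0 \<le> T \<omega>"
  using first_neg_nonneg[of \<omega>] unfolding T_def by (cases "first_neg \<omega>") auto

text \<open>Seen from \<open>s\<close>, a passage below 0 is a passage of \<open>F \<omega>\<close>
  below \<open>F \<omega> s\<close>. Covariance gives this at rational offsets, and continuity
  extends it to all times.\<close>

lemma first_neg_shift_less:
  assumes g: "good \<omega>" and c: "covariant \<omega> s"
  shows "first_neg (shift_path s \<omega>) < ereal y \<longleftrightarrow> diffuse_pair.\<tau> (F \<omega>) s < ereal (s + y)"
proof -
  interpret diffuse_pair "K \<omega>" "\<eta> \<omega>" "F \<omega>" by (rule good_pair) fact
  have "first_neg (shift_path s \<omega>) < ereal y \<longleftrightarrow> (\<exists>q\<in>\<rat>. 0 < q \<and> F \<omega> (s + q) < F \<omega> s \<and> q < y)"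
    unfolding first_neg_less_iff by (intro bex_cong refl) (simp add: F_covariant[OF g c])
  also have "\<dots> \<longleftrightarrow> \<tau> s < ereal (s + y)"
  proof
    assume "\<exists>q\<in>\<rat>. 0 < q \<and> F \<omega> (s + q) < F \<omega> s \<and> q < y"
    then obtain q where "0 < q" "F \<omega> (s + q) < F \<omega> s" "q < y" by auto
    then show "\<tau> s < ereal (s + y)" unfolding tau_less_iff by (intro exI[of _ "s + q"]) auto
  next
    assume "\<tau> s < ereal (s + y)"
    then obtain t where t: "s < t" "F \<omega> t < F \<omega> s" "t < s + y" unfolding tau_less_iff by auto
    then show "\<exists>q\<in>\<rat>. 0 < q \<and> F \<omega> (s + q) < F \<omega> s \<and> q < y"
      using continuous_less_rational[OF f_continuous t(2), of s 0 y] by auto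
  qed
  finally show ?thesis .
qed

lemma first_neg_shift:
  assumes g: "good \<omega>" and c: "covariant \<omega> s"
  shows "first_neg (shift_path s \<omega>) < \<infinity> \<longleftrightarrow> diffuse_pair.\<tau> (F \<omega>) s < \<infinity>"
    and "first_neg (shift_path s \<omega>) < \<infinity> \<Longrightarrow> diffuse_pair.tr (F \<omega>) s = s + T (shift_path s \<omega>)"
proof -
  interpret diffuse_pair "K \<omega>" "\<eta> \<omega>" "F \<omega>" by (rule good_pair) fact
  note less = first_neg_shift_less[OF g c]
  show iff: "first_neg (shift_path s \<omega>) < \<infinity> \<longleftrightarrow> \<tau> s < \<infinity>"
  proof
    assume "first_neg (shift_path s \<omega>) < \<infinity>"
    then have "first_neg (shift_path s \<omega>) < ereal (T (shift_path s \<omega>) + 1)" by (subst T_first_neg) auto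
    then show "\<tau> s < \<infinity>" unfolding less by (rule less_trans) simp
  next
    assume "\<tau> s < \<infinity>"
    then have "\<tau> s < ereal (s + (tr s - s + 1))" by (subst tau_tr) auto
    then show "first_neg (shift_path s \<omega>) < \<infinity>" unfolding less[symmetric] by (rule less_trans) simp
  qed
  show "tr s = s + T (shift_path s \<omega>)" if "first_neg (shift_path s \<omega>) < \<infinity>"
  proof -
    have "T (shift_path s \<omega>) < y \<longleftrightarrow> tr s < s + y" for y
      using less[of y] unfolding T_first_neg[OF that] tau_tr[OF iff[THEN iffD1, OF that]] by simp
    from this[of "tr s - s"] this[of "T (shift_path s \<omega>)"] show ?thesis by auto
  qed
qed

lemma neg_before_shift:
  assumes g: "good \<omega>" and c: "covariant \<omega> r"
  shows "neg_before (shift_path r \<omega>) \<longleftrightarrow> (\<exists>t<r. F \<omega> t < F \<omega> r)"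
proof -
  interpret diffuse_pair "K \<omega>" "\<eta> \<omega>" "F \<omega>" by (rule good_pair) fact
  have "neg_before (shift_path r \<omega>) \<longleftrightarrow> (\<exists>q\<in>\<rat>. q < 0 \<and> F \<omega> (r + q) < F \<omega> r)"
    unfolding neg_before_def by (intro bex_cong refl) (simp add: F_covariant[OF g c])
  also have "\<dots> \<longleftrightarrow> (\<exists>t<r. F \<omega> t < F \<omega> r)"
  proof
    assume "\<exists>q\<in>\<rat>. q < 0 \<and> F \<omega> (r + q) < F \<omega> r"
    then obtain q where "q < 0" "F \<omega> (r + q) < F \<omega> r" by auto
    then show "\<exists>t<r. F \<omega> t < F \<omega> r" by (intro exI[of _ "r + q"]) auto
  next
    assume "\<exists>t<r. F \<omega> t < F \<omega> r"
    then obtain t where t: "t < r" "F \<omega> t < F \<omega> r" by auto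
    then show "\<exists>q\<in>\<rat>. q < 0 \<and> F \<omega> (r + q) < F \<omega> r"
      using continuous_less_rational[OF f_continuous t(2), of r "t - r - 1" 0] by auto
  qed
  finally show ?thesis .
qed

lemma nn_integral_unit_shift: "(\<integral>\<^sup>+ s. indicator {0..1} (s + c :: real) \<partial>lborel) = (1 :: ennreal)"
  by (subst nn_integral_lborel_shift) auto

text \<open>Both sides are Palm expectations of the two ends of the same set of excursions of \<open>F\<close>:
  the left ends charge \<open>K\<close> and the right ends charge \<open>\<eta>\<close>.\<close>

theorem balance_law:
  assumes J[measurable]: "Measurable.pred path_space J"
    and inv: "\<And>\<omega> s. good \<omega> \<Longrightarrow> covariant \<omega> s \<Longrightarrow> J (shift_path s \<omega>) \<longleftrightarrow> J \<omega>"
    and G[measurable]: "G \<in> borel_measurable path_space"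
  shows "(\<integral>\<^sup>+ \<omega>. indicator {\<omega>. first_neg \<omega> < \<infinity> \<and> J \<omega>} \<omega> * G (shift_path (T \<omega>) \<omega>) \<partial>P0)
    = (\<integral>\<^sup>+ \<omega>. indicator {\<omega>. neg_before \<omega> \<and> J \<omega>} \<omega> * G \<omega> \<partial>start \<nu>)"
proof -
  \<comment> \<open>A unit window supplies the time variable of the Palm formula: its integral is 1,
    also after a translation by \<open>T \<omega>\<close>. Placed at the right end
    \<open>s + T \<omega>\<close>, it is the same factor for both ends of an excursion.\<close>
  define w where "w s = (indicator {0..1} s :: ennreal)" for s :: real
  have w[measurable]: "w \<in> borel_measurable borel" unfolding w_def by measurable
  define g where "g \<omega> s = indicator {\<omega>. first_neg \<omega> < \<infinity> \<and> J \<omega>} \<omega> * G (shift_path (T \<omega>) \<omega>) * w (s + T \<omega>)" for \<omega> s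
  define g' where "g' \<omega> r = indicator {\<omega>. neg_before \<omega> \<and> J \<omega>} \<omega> * G \<omega> * w r" for \<omega> r
  have gm: "(\<lambda>p. g (fst p) (snd p)) \<in> borel_measurable (path_space \<Otimes>\<^sub>M borel)"
    unfolding g_def by measurable
  have gm': "(\<lambda>p. g' (fst p) (snd p)) \<in> borel_measurable (path_space \<Otimes>\<^sub>M borel)"
    unfolding g'_def by measurable
  interpret pair_sigma_finite P0 lborel ..
  interpret S: prob_space "start \<nu>" by (rule prob_start_nu)
  interpret SL: pair_sigma_finite "start \<nu>" lborel ..
  have "(\<integral>\<^sup>+ \<omega>. indicator {\<omega>. first_neg \<omega> < \<infinity> \<and> J \<omega>} \<omega> * G (shift_path (T \<omega>) \<omega>) \<partial>P0)
    = (\<integral>\<^sup>+ \<omega>. \<integral>\<^sup>+ s. g \<omega> s \<partial>lborel \<partial>P0)"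
    unfolding g_def
    by (intro nn_integral_cong, subst nn_integral_cmult) (auto simp: w_def nn_integral_unit_shift)
  also have "\<dots> = (\<integral>\<^sup>+ s. \<integral>\<^sup>+ \<omega>. g \<omega> s \<partial>P0 \<partial>lborel)"
    using gm by (intro Fubini'[symmetric]) (simp add: case_prod_unfold cong: measurable_cong_sets)
  also have "\<dots> = (\<integral>\<^sup>+ \<omega>. \<integral>\<^sup>+ s. g (shift_path s \<omega>) s \<partial>K \<omega> \<partial>P_leb)"
    using palm[OF gm, of 0, symmetric] unfolding minus_zero raise_simps(3) .
  also have "\<dots> = (\<integral>\<^sup>+ \<omega>. \<integral>\<^sup>+ r. g' (shift_path r \<omega>) r \<partial>\<eta> \<omega> \<partial>P_leb)"
  proof (rule nn_integral_cong_AE)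
    show "AE \<omega> in P_leb. (\<integral>\<^sup>+ s. g (shift_path s \<omega>) s \<partial>K \<omega>) = (\<integral>\<^sup>+ r. g' (shift_path r \<omega>) r \<partial>\<eta> \<omega>)"
      using AE_P_leb_good AE_P_leb_covariant AE_covariant(2)
    proof eventually_elim
      case (elim \<omega>)
      interpret diffuse_pair "K \<omega>" "\<eta> \<omega>" "F \<omega>" by (rule good_pair) fact
      have \<omega>: "\<omega> \<in> space path_space" using elim(1) by (simp add: good_def)
      define H where "H r = indicator {\<omega>. J \<omega>} \<omega> * G (shift_path r \<omega>) * w r" for r
      have "(\<lambda>r. G (shift_path r \<omega>)) \<in> borel_measurable borel"
        using \<omega> by (intro measurable_compose[OF _ G] measurable_shift_path) auto
      then have H: "H \<in> borel_measurable borel" unfolding H_def by measurable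
      have "(\<integral>\<^sup>+ s. g (shift_path s \<omega>) s \<partial>K \<omega>) = (\<integral>\<^sup>+ s. indicator {s. \<tau> s < \<infinity>} s * H (tr s) \<partial>K \<omega>)"
      proof (rule nn_integral_cong_AE)
        show "AE s in K \<omega>. g (shift_path s \<omega>) s = indicator {s. \<tau> s < \<infinity>} s * H (tr s)"
          using elim(2)
        proof eventually_elim
          case (elim s)
          note first_neg_shift(1)[OF \<open>good \<omega>\<close> elim] first_neg_shift(2)[OF \<open>good \<omega>\<close> elim] inv[OF \<open>good \<omega>\<close> elim]
          then show ?case
            by (cases "first_neg (shift_path s \<omega>) < \<infinity>") (simp_all only: g_def H_def indicator_def mem_Collect_eq
                shift_path_simps(2) of_bool_eq mult_zero_left mult_1_left simp_thms)
        qed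
      qed
      also have "\<dots> = (\<integral>\<^sup>+ r. indicator {r. \<exists>t<r. F \<omega> t < F \<omega> r} r * H r \<partial>\<eta> \<omega>)"
        by (rule balance_integral[OF H])
      also have "\<dots> = (\<integral>\<^sup>+ r. g' (shift_path r \<omega>) r \<partial>\<eta> \<omega>)"
      proof (rule nn_integral_cong_AE)
        show "AE r in \<eta> \<omega>. indicator {r. \<exists>t<r. F \<omega> t < F \<omega> r} r * H r = g' (shift_path r \<omega>) r"
          using elim(3)
        proof eventually_elim
          case (elim r)
          show ?case
            using neg_before_shift[OF \<open>good \<omega>\<close> elim] inv[OF \<open>good \<omega>\<close> elim]
            by (simp add: g'_def H_def indicator_def)
        qed
      qed
      finally show ?case .
    qed
  qed
  also have "\<dots> = (\<integral>\<^sup>+ r. \<integral>\<^sup>+ \<omega>. g' \<omega> r \<partial>start \<nu> \<partial>lborel)"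
    by (rule palm_eta[OF gm'])
  also have "\<dots> = (\<integral>\<^sup>+ \<omega>. \<integral>\<^sup>+ r. g' \<omega> r \<partial>lborel \<partial>start \<nu>)"
    using gm' by (intro SL.Fubini') (simp add: case_prod_unfold cong: measurable_cong_sets)
  also have "\<dots> = (\<integral>\<^sup>+ \<omega>. indicator {\<omega>. neg_before \<omega> \<and> J \<omega>} \<omega> * G \<omega> \<partial>start \<nu>)"
  proof (rule nn_integral_cong)
    fix \<omega>
    have "(\<integral>\<^sup>+ r. w r \<partial>lborel) = 1" unfolding w_def by simp
    then show "(\<integral>\<^sup>+ r. g' \<omega> r \<partial>lborel) = indicator {\<omega>. neg_before \<omega> \<and> J \<omega>} \<omega> * G \<omega>"
      unfolding g'_def by (subst nn_integral_cmult) auto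
  qed
  finally show ?thesis .
qed

section \<open>Almost sure finiteness of the first passage\<close>

definition bounded_below :: "(real \<Rightarrow> real) \<Rightarrow> bool" where
  "bounded_below \<omega> \<longleftrightarrow> (\<exists>h::nat. \<forall>q\<in>\<rat>. 0 \<le> q \<longrightarrow> - real h \<le> F \<omega> q)"

lemma measurable_bounded_below [measurable]: "Measurable.pred path_space bounded_below"
  unfolding bounded_below_def by measurable

text \<open>A continuous function is bounded on the compact stretch between 0 and \<open>s\<close>,
  so neither the starting time nor a constant offset affects boundedness from below.\<close>

lemma bounded_below_iff:
  fixes f :: "real \<Rightarrow> real"
  assumes c: "continuous_on UNIV f"
  shows "(\<exists>h::nat. \<forall>q\<in>\<rat>. 0 \<le> q \<longrightarrow> - real h \<le> f (s + q) - c) \<longleftrightarrow> (\<exists>b. \<forall>t\<ge>0. b \<le> f t)"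
proof
  assume "\<exists>h::nat. \<forall>q\<in>\<rat>. 0 \<le> q \<longrightarrow> - real h \<le> f (s + q) - c"
  then obtain h :: nat where h: "\<And>q. q \<in> \<rat> \<Longrightarrow> 0 \<le> q \<Longrightarrow> - real h \<le> f (s + q) - c" by blast
  have 1: "c - real h \<le> f t" if "s < t" for t
  proof (rule ccontr)
    assume "\<not> c - real h \<le> f t"
    then have "f t < c - real h" by simp
    from continuous_less_rational[OF c this, of s 0 "t - s + 1"] that
    obtain q where "q \<in> \<rat>" "0 < q" "f (s + q) < c - real h" by auto
    then show False using h[of q] by simp
  qed
  have "compact (f ` {0..max 0 s})" using c by (intro compact_continuous_image) (auto intro: continuous_on_subset)
  then obtain b where b: "\<And>t. t \<in> {0..max 0 s} \<Longrightarrow> b \<le> f t"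
    using bounded_imp_bdd_below[OF compact_imp_bounded] unfolding bdd_below_def by (metis imageI)
  have "min b (c - real h) \<le> f t" if "0 \<le> t" for t
    using 1[of t] b[of t] that by (cases "s < t") auto
  then show "\<exists>b. \<forall>t\<ge>0. b \<le> f t" by blast
next
  assume "\<exists>b. \<forall>t\<ge>0. b \<le> f t"
  then obtain b where b: "\<And>t. 0 \<le> t \<Longrightarrow> b \<le> f t" by blast
  have "compact (f ` {s..max 0 s})" using c by (intro compact_continuous_image) (auto intro: continuous_on_subset)
  then obtain b' where b': "\<And>t. t \<in> {s..max 0 s} \<Longrightarrow> b' \<le> f t"
    using bounded_imp_bdd_below[OF compact_imp_bounded] unfolding bdd_below_def by (metis imageI)
  obtain h :: nat where h: "c - min b b' \<le> real h" using real_arch_simple by blast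
  have "- real h \<le> f (s + q) - c" if "0 \<le> q" for q
    using h b[of "s + q"] b'[of "s + q"] that by (cases "0 \<le> s + q") auto
  then show "\<exists>h::nat. \<forall>q\<in>\<rat>. 0 \<le> q \<longrightarrow> - real h \<le> f (s + q) - c" by blast
qed

lemma bounded_below_shift:
  assumes g: "good \<omega>" and c: "covariant \<omega> s"
  shows "bounded_below (shift_path s \<omega>) \<longleftrightarrow> (\<exists>b. \<forall>t\<ge>0. b \<le> F \<omega> t)"
proof -
  interpret diffuse_pair "K \<omega>" "\<eta> \<omega>" "F \<omega>" by (rule good_pair) fact
  have "bounded_below (shift_path s \<omega>) \<longleftrightarrow> (\<exists>h::nat. \<forall>q\<in>\<rat>. 0 \<le> q \<longrightarrow> - real h \<le> F \<omega> (s + q) - F \<omega> s)"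
    unfolding bounded_below_def by (intro ex_cong1 ball_cong refl) (simp add: F_covariant[OF g c])
  then show ?thesis using bounded_below_iff[OF f_continuous, of s] by simp
qed

lemma bounded_below_good: "good \<omega> \<Longrightarrow> bounded_below \<omega> \<longleftrightarrow> (\<exists>b. \<forall>t\<ge>0. b \<le> F \<omega> t)"
  using bounded_below_iff[OF diffuse_pair.f_continuous[OF good_pair], of \<omega> 0 0] by (simp add: bounded_below_def)

lemma bounded_below_invariant: "good \<omega> \<Longrightarrow> covariant \<omega> s \<Longrightarrow> bounded_below (shift_path s \<omega>) \<longleftrightarrow> bounded_below \<omega>"
  by (simp add: bounded_below_shift bounded_below_good)

lemma first_neg_finite_of_not_bounded_below:
  assumes g: "good \<omega>" and b: "\<not> bounded_below \<omega>"
  shows "first_neg \<omega> < \<infinity>"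
proof -
  have "\<exists>q\<in>\<rat>. 0 \<le> q \<and> F \<omega> q < - real 0" using b unfolding bounded_below_def by (meson not_le)
  then obtain q where q: "q \<in> \<rat>" "0 \<le> q" "F \<omega> q < 0" by auto
  have "F \<omega> 0 = 0" using g by (simp add: F_def good_def measure_def)
  then have "0 < q" using q by (cases "q = 0") auto
  then show ?thesis unfolding first_neg_less_iff using q by auto
qed

text \<open>Seen from a point that is not reached by the matching, with \<open>F\<close> staying
  above level \<open>- h\<close> afterwards. Every path that is bounded below and not reached
  satisfies this for some \<open>h\<close>.\<close>

definition unmatched :: "nat \<Rightarrow> (real \<Rightarrow> real) \<Rightarrow> bool" where
  "unmatched h \<omega> \<longleftrightarrow> (\<forall>q\<in>\<rat>. (q < 0 \<longrightarrow> 0 \<le> F \<omega> q) \<and> (0 \<le> q \<longrightarrow> - real h \<le> F \<omega> q))"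

lemma measurable_unmatched [measurable]: "Measurable.pred path_space (unmatched h)"
  unfolding unmatched_def by measurable

text \<open>Unmatched points of \<open>\<eta>\<close> carry total mass at most \<open>h\<close>, while by conservativity the
  Palm formula would give them infinite weight.\<close>

lemma unmatched_null: "AE \<omega> in start \<nu>. \<not> unmatched h \<omega>"
proof -
  \<comment> \<open>This weight is integrable over the starting level, yet its integral along the
    path is infinite by conservativity. It is evaluated at time \<open>- r\<close>, which after the
    shift by \<open>r\<close> becomes time 0, so it is constant in the integral against
    \<eta>.\<close>
  define w where "w y = ennreal (1 / (1 + y\<^sup>2))" for y :: real
  have w[measurable]: "w \<in> borel_measurable borel" unfolding w_def by measurable
  define g where "g \<omega> r = indicator {\<omega>. unmatched h \<omega>} \<omega> * w (\<omega> (- r))" for \<omega> r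
  have [measurable]: "(\<lambda>p. fst p (- snd p)) \<in> borel_measurable (path_space \<Otimes>\<^sub>M borel)"
    by (rule measurable_eval_at[where f=fst and g="\<lambda>p. - snd p"]) measurable
  have gm: "(\<lambda>p. g (fst p) (snd p)) \<in> borel_measurable (path_space \<Otimes>\<^sub>M borel)"
    unfolding g_def by measurable
  interpret S: prob_space "start \<nu>" by (rule prob_start_nu)
  interpret SL: pair_sigma_finite "start \<nu>" lborel ..
  note measurable_eval[measurable]
  have "(\<integral>\<^sup>+ \<omega>. indicator {\<omega>. unmatched h \<omega>} \<omega> * \<infinity> \<partial>start \<nu>) = (\<integral>\<^sup>+ \<omega>. \<integral>\<^sup>+ r. g \<omega> r \<partial>lborel \<partial>start \<nu>)"
  proof (rule nn_integral_cong_AE)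
    have m: "Measurable.pred path_space (\<lambda>\<omega>. (\<integral>\<^sup>+ r. w (\<omega> (- r)) \<partial>lborel) = \<infinity>)"
    proof -
      have [measurable]: "(\<lambda>\<omega>. \<integral>\<^sup>+ r. w (\<omega> (- r)) \<partial>lborel) \<in> borel_measurable path_space"
        by (rule sigma_finite_measure.borel_measurable_nn_integral[OF sigma_finite_lborel])
          (unfold case_prod_unfold, measurable)
      show ?thesis by measurable
    qed
    have "AE \<omega> in start \<nu>. (\<integral>\<^sup>+ r. w (\<omega> (- r)) \<partial>lborel) = \<infinity>"
      by (rule AE_startI[OF \<nu>.sigma_finite_measure nu_sets m]) (use conservative in \<open>simp add: w_def\<close>)
    then show "AE \<omega> in start \<nu>. indicator {\<omega>. unmatched h \<omega>} \<omega> * \<infinity> = (\<integral>\<^sup>+ r. g \<omega> r \<partial>lborel)"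
      using AE_space
    proof eventually_elim
      case (elim \<omega>)
      then have [measurable]: "\<omega> \<in> borel_measurable borel"
        using path_continuous[of \<omega> UNIV] by (intro borel_measurable_continuous_onI) simp
      show ?case unfolding g_def by (subst nn_integral_cmult) (auto simp: elim)
    qed
  qed
  also have "\<dots> = (\<integral>\<^sup>+ r. \<integral>\<^sup>+ \<omega>. g \<omega> r \<partial>start \<nu> \<partial>lborel)"
    using gm by (intro SL.Fubini'[symmetric]) (simp add: case_prod_unfold cong: measurable_cong_sets)
  also have "\<dots> = (\<integral>\<^sup>+ \<omega>. \<integral>\<^sup>+ r. g (shift_path r \<omega>) r \<partial>\<eta> \<omega> \<partial>P_leb)"
    by (rule palm_eta[OF gm, symmetric])
  also have "\<dots> \<le> (\<integral>\<^sup>+ \<omega>. w (\<omega> 0) * ennreal (real h) \<partial>P_leb)"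
  proof (rule nn_integral_mono_AE)
    show "AE \<omega> in P_leb. (\<integral>\<^sup>+ r. g (shift_path r \<omega>) r \<partial>\<eta> \<omega>) \<le> w (\<omega> 0) * ennreal (real h)"
      using AE_P_leb_good AE_covariant(2)
    proof eventually_elim
      case (elim \<omega>)
      interpret diffuse_pair "K \<omega>" "\<eta> \<omega>" "F \<omega>" by (rule good_pair) fact
      let ?D = "{r. (\<forall>t\<le>r. F \<omega> r \<le> F \<omega> t) \<and> (\<forall>t\<ge>r. F \<omega> r - real h \<le> F \<omega> t)}"
      let ?Dq = "{r. \<forall>q\<in>\<rat>. (q < 0 \<longrightarrow> F \<omega> r \<le> F \<omega> (r + q)) \<and> (0 \<le> q \<longrightarrow> F \<omega> r - real h \<le> F \<omega> (r + q))}"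
      have fm[measurable]: "F \<omega> \<in> borel_measurable borel"
        using f_continuous[of UNIV] by (rule borel_measurable_continuous_onI)
      have Dm: "?Dq \<in> sets borel" by measurable
      have "?Dq \<subseteq> ?D"
      proof safe
        fix r t assume r: "\<forall>q\<in>\<rat>. (q < 0 \<longrightarrow> F \<omega> r \<le> F \<omega> (r + q)) \<and> (0 \<le> q \<longrightarrow> F \<omega> r - real h \<le> F \<omega> (r + q))"
        show "F \<omega> r \<le> F \<omega> t" if "t \<le> r"
        proof (rule ccontr)
          assume *: "\<not> F \<omega> r \<le> F \<omega> t"
          then have "F \<omega> t < F \<omega> r" "t < r" using that by (auto simp: less_le)
          from continuous_less_rational[OF f_continuous this(1), of r "t - r - 1" 0] this(2)
          obtain q where "q \<in> \<rat>" "q < 0" "F \<omega> (r + q) < F \<omega> r" by auto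
          then show False using r[rule_format, of q] by simp
        qed
        show "F \<omega> r - real h \<le> F \<omega> t" if "r \<le> t"
        proof (rule ccontr)
          assume *: "\<not> F \<omega> r - real h \<le> F \<omega> t"
          then have "F \<omega> t < F \<omega> r - real h" "r < t" using that by (auto simp: less_le)
          from continuous_less_rational[OF f_continuous this(1), of r 0 "t - r + 1"] this(2)
          obtain q where "q \<in> \<rat>" "0 < q" "F \<omega> (r + q) < F \<omega> r - real h" by auto
          then show False using r[rule_format, of q] by simp
        qed
      qed
      moreover have "?D \<subseteq> ?Dq" by auto
      ultimately have Deq: "?Dq = ?D" by blast
      have "(\<integral>\<^sup>+ r. g (shift_path r \<omega>) r \<partial>\<eta> \<omega>) = (\<integral>\<^sup>+ r. w (\<omega> 0) * indicator ?Dq r \<partial>\<eta> \<omega>)"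
      proof (rule nn_integral_cong_AE)
        show "AE r in \<eta> \<omega>. g (shift_path r \<omega>) r = w (\<omega> 0) * indicator ?Dq r"
          using elim(2)
        proof eventually_elim
          case (elim r)
          have "unmatched h (shift_path r \<omega>) \<longleftrightarrow> r \<in> ?Dq"
            unfolding unmatched_def mem_Collect_eq
            by (intro ball_cong refl) (auto simp: F_covariant[OF \<open>good \<omega>\<close> elim] algebra_simps)
          then show ?case by (simp add: g_def indicator_def)
        qed
      qed
      also have "\<dots> = w (\<omega> 0) * emeasure (\<eta> \<omega>) ?Dq"
        using Dm by (subst nn_integral_cmult) auto
      also have "\<dots> \<le> w (\<omega> 0) * ennreal (real h)"
        unfolding Deq by (intro mult_left_mono eta_unmatched_le) auto
      finally show ?case .
    qed
  qed
  also have "\<dots> = (\<integral>\<^sup>+ z. \<integral>\<^sup>+ \<omega>. w (\<omega> 0 + z) * ennreal (real h) \<partial>P0 \<partial>lborel)"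
    by (subst nn_integral_P_leb) auto
  also have "\<dots> = (\<integral>\<^sup>+ z. w z * ennreal (real h) \<partial>lborel)"
  proof (rule nn_integral_cong)
    fix z
    have "(\<integral>\<^sup>+ \<omega>. w (\<omega> 0 + z) * ennreal (real h) \<partial>P0) = (\<integral>\<^sup>+ \<omega>. w z * ennreal (real h) \<partial>P0)"
      using AE_zero by (intro nn_integral_cong_AE) (auto elim!: eventually_mono)
    then show "(\<integral>\<^sup>+ \<omega>. w (\<omega> 0 + z) * ennreal (real h) \<partial>P0) = w z * ennreal (real h)"
      using P0.emeasure_space_1 by simp
  qed
  also have "\<dots> = (\<integral>\<^sup>+ z. w z \<partial>lborel) * ennreal (real h)"
    by (rule nn_integral_multc) simp
  also have "\<dots> < \<infinity>"
  proof -
    have "integrable lborel (\<lambda>y::real. 1 / (1 + y\<^sup>2))"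
      using integrable_inverse_1_plus_square by (simp add: set_integrable_def inverse_eq_divide einterval_eq)
    then have "(\<integral>\<^sup>+ z. w z \<partial>lborel) < \<infinity>"
      unfolding w_def by (auto simp: integrable_iff_bounded)
    then show ?thesis by (simp add: ennreal_mult_less_top)
  qed
  finally have "(\<integral>\<^sup>+ \<omega>. indicator {\<omega>. unmatched h \<omega>} \<omega> * \<infinity> \<partial>start \<nu>) \<noteq> \<infinity>" by simp
  then have "AE \<omega> in start \<nu>. indicator {\<omega>. unmatched h \<omega>} \<omega> * \<infinity> \<noteq> (\<infinity> :: ennreal)"
    by (intro nn_integral_PInf_AE) auto
  then show ?thesis by eventually_elim (auto simp: indicator_def)
qed

lemma AE_start_neg_before_of_bounded_below: "AE \<omega> in start \<nu>. bounded_below \<omega> \<longrightarrow> neg_before \<omega>"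
proof -
  have "AE \<omega> in start \<nu>. \<forall>h. \<not> unmatched h \<omega>"
    unfolding AE_all_countable using unmatched_null by blast
  then show ?thesis
  proof eventually_elim
    case (elim \<omega>)
    show ?case
    proof (intro impI, rule ccontr)
      assume "bounded_below \<omega>" and nM: "\<not> neg_before \<omega>"
      then obtain h :: nat where h: "\<forall>q\<in>\<rat>. 0 \<le> q \<longrightarrow> - real h \<le> F \<omega> q" unfolding bounded_below_def by blast
      have "unmatched h \<omega>"
        using h nM unfolding unmatched_def neg_before_def by (auto simp: not_less)
      then show False using elim by blast
    qed
  qed
qed

text \<open>Invariance under shifts makes the probability the same for all starting levels, so
  averaging over \<nu> does not change it.\<close>

lemma bounded_below_prob: "(\<integral>\<^sup>+ \<omega>. indicator {\<omega>. bounded_below \<omega>} \<omega> \<partial>start \<nu>) = (\<integral>\<^sup>+ \<omega>. indicator {\<omega>. bounded_below \<omega>} \<omega> \<partial>P0)"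
proof -
  have inv: "AE \<omega> in P_leb. AE s in K (raise (- x) \<omega>). bounded_below (shift_path s \<omega>) \<longleftrightarrow> bounded_below \<omega>" for x
    using AE_P_leb_good AE_covariant(1)[of x]
    by eventually_elim (auto elim!: eventually_mono simp: bounded_below_invariant)
  have "(\<integral>\<^sup>+ \<omega>. indicator {\<omega>. bounded_below \<omega>} (raise x \<omega>) \<partial>P0) = (\<integral>\<^sup>+ \<omega>. indicator {\<omega>. bounded_below \<omega>} (raise 0 \<omega>) \<partial>P0)" for x
    by (intro antisym invariant_le measurable_bounded_below inv)
  then show ?thesis
    unfolding raise_simps(3) by (simp add: nn_integral_start_nu \<nu>.emeasure_space_1[simplified])
qed

text \<open>Restricted to \<open>bounded_below\<close>, \<open>balance_law\<close> equates the
  probability of a finite passage with that of being reached from below; the latter has full mass in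
  the event, whose probability is the same for both starting laws. Outside
  \<open>bounded_below\<close> the passage is finite for good paths.\<close>

lemma AE_first_neg_finite: "AE \<omega> in P0. first_neg \<omega> < \<infinity>"
proof -
  have eq: "(\<integral>\<^sup>+ \<omega>. indicator {\<omega>. first_neg \<omega> < \<infinity> \<and> bounded_below \<omega>} \<omega> \<partial>P0) = (\<integral>\<^sup>+ \<omega>. indicator {\<omega>. bounded_below \<omega>} \<omega> \<partial>P0)"
  proof -
    have "(\<integral>\<^sup>+ \<omega>. indicator {\<omega>. first_neg \<omega> < \<infinity> \<and> bounded_below \<omega>} \<omega> \<partial>P0) = (\<integral>\<^sup>+ \<omega>. indicator {\<omega>. neg_before \<omega> \<and> bounded_below \<omega>} \<omega> \<partial>start \<nu>)"
      using balance_law[OF measurable_bounded_below bounded_below_invariant, of "\<lambda>_. 1"] by simp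
    also have "\<dots> = (\<integral>\<^sup>+ \<omega>. indicator {\<omega>. bounded_below \<omega>} \<omega> \<partial>start \<nu>)"
      using AE_start_neg_before_of_bounded_below by (intro nn_integral_cong_AE) (auto elim!: eventually_mono simp: indicator_def)
    finally show ?thesis by (simp only: bounded_below_prob)
  qed
  define A where "A = {\<omega>\<in>space P0. bounded_below \<omega>}"
  define B where "B = {\<omega>\<in>space P0. first_neg \<omega> < \<infinity> \<and> bounded_below \<omega>}"
  have sets: "A \<in> sets P0" "B \<in> sets P0" unfolding A_def B_def by measurable
  have "(\<integral>\<^sup>+ \<omega>. indicator {\<omega>. first_neg \<omega> < \<infinity> \<and> bounded_below \<omega>} \<omega> \<partial>P0) = emeasure P0 B"
    using nn_integral_indicator_Collect[OF sets(2)[unfolded B_def]] by (simp only: B_def)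
  moreover have "(\<integral>\<^sup>+ \<omega>. indicator {\<omega>. bounded_below \<omega>} \<omega> \<partial>P0) = emeasure P0 A"
    using nn_integral_indicator_Collect[OF sets(1)[unfolded A_def]] by (simp only: A_def)
  ultimately have "emeasure P0 B = emeasure P0 A" using eq by simp
  then have "emeasure P0 (A - B) = 0"
    using sets by (subst emeasure_Diff) (auto simp: A_def B_def P0.emeasure_eq_measure)
  then have "A - B \<in> null_sets P0" using sets by auto
  from AE_not_in[OF this] AE_P0_good AE_space show ?thesis
  proof eventually_elim
    case (elim \<omega>)
    then show ?case using first_neg_finite_of_not_bounded_below[of \<omega>] by (cases "bounded_below \<omega>") (auto simp: A_def B_def)
  qed
qed

text \<open>With \<open>T\<close> finite, the left side of \<open>balance_law\<close> has total mass
  1; so must the right side, which forces \<open>neg_before\<close> to hold almost surely under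
  \<open>start \<nu>\<close>.\<close>

theorem law_shift_T:
  assumes G[measurable]: "G \<in> borel_measurable path_space"
  shows "(\<integral>\<^sup>+ \<omega>. G (shift_path (T \<omega>) \<omega>) \<partial>P0) = (\<integral>\<^sup>+ \<omega>. G \<omega> \<partial>start \<nu>)"
proof -
  interpret S: prob_space "start \<nu>" by (rule prob_start_nu)
  have bal: "(\<integral>\<^sup>+ \<omega>. H (shift_path (T \<omega>) \<omega>) \<partial>P0) = (\<integral>\<^sup>+ \<omega>. indicator {\<omega>. neg_before \<omega>} \<omega> * H \<omega> \<partial>start \<nu>)"
    if "H \<in> borel_measurable path_space" for H
  proof -
    have "(\<integral>\<^sup>+ \<omega>. H (shift_path (T \<omega>) \<omega>) \<partial>P0)
      = (\<integral>\<^sup>+ \<omega>. indicator {\<omega>. first_neg \<omega> < \<infinity> \<and> True} \<omega> * H (shift_path (T \<omega>) \<omega>) \<partial>P0)"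
      using AE_first_neg_finite by (intro nn_integral_cong_AE) (auto elim!: eventually_mono simp: indicator_def)
    also have "\<dots> = (\<integral>\<^sup>+ \<omega>. indicator {\<omega>. neg_before \<omega> \<and> True} \<omega> * H \<omega> \<partial>start \<nu>)"
      using that by (intro balance_law) auto
    finally show ?thesis by simp
  qed
  have [measurable]: "{\<omega>\<in>space path_space. neg_before \<omega>} \<in> sets path_space" by measurable
  have "1 = (\<integral>\<^sup>+ \<omega>. indicator {\<omega>. neg_before \<omega>} \<omega> \<partial>start \<nu>)"
    using bal[of "\<lambda>_. 1"] P0.emeasure_space_1 by simp
  also have "\<dots> = (\<integral>\<^sup>+ \<omega>. indicator {\<omega>\<in>space path_space. neg_before \<omega>} \<omega> \<partial>start \<nu>)"
    by (intro nn_integral_cong) (auto simp: indicator_def)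
  also have "\<dots> = emeasure (start \<nu>) {\<omega>\<in>space path_space. neg_before \<omega>}"
    by simp
  finally have "S.prob {\<omega>\<in>space path_space. neg_before \<omega>} = 1"
    by (simp add: S.emeasure_eq_measure)
  then have "AE \<omega> in start \<nu>. neg_before \<omega>"
    by (subst (asm) S.prob_eq_1) auto
  then show ?thesis
    unfolding bal[OF G] by (intro nn_integral_cong_AE) (auto elim!: eventually_mono)
qed

text \<open>If \<open>T \<omega> = 0\<close> then the path is at 0 at time
  \<open>T \<omega>\<close>, but its position at that time has law \<nu>, which does not charge
  0.\<close>

lemma AE_T_pos: "AE \<omega> in P0. 0 < T \<omega>"
proof -
  note measurable_eval[measurable]
  have "(\<integral>\<^sup>+ \<omega>. indicator {\<omega>. \<omega> 0 = 0} (shift_path (T \<omega>) \<omega>) \<partial>P0) = (\<integral>\<^sup>+ \<omega>. indicator {\<omega>. \<omega> 0 = 0} \<omega> \<partial>start \<nu>)"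
    by (rule law_shift_T) measurable
  also have "\<dots> = (\<integral>\<^sup>+ x. \<integral>\<^sup>+ \<omega>. indicator {\<omega>. \<omega> 0 = 0} (raise x \<omega>) \<partial>P0 \<partial>\<nu>)"
    by (rule nn_integral_start_nu) measurable
  also have "\<dots> = (\<integral>\<^sup>+ x. indicator {0} x \<partial>\<nu>)"
  proof (rule nn_integral_cong)
    fix x
    have "(\<integral>\<^sup>+ \<omega>. indicator {\<omega>. \<omega> 0 = 0} (raise x \<omega>) \<partial>P0) = (\<integral>\<^sup>+ \<omega>. indicator {0} x \<partial>P0)"
      using AE_zero by (intro nn_integral_cong_AE) (auto elim!: eventually_mono simp: indicator_def)
    then show "(\<integral>\<^sup>+ \<omega>. indicator {\<omega>. \<omega> 0 = 0} (raise x \<omega>) \<partial>P0) = indicator {0} x"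
      using P0.emeasure_space_1 by simp
  qed
  also have "\<dots> = 0" by (simp add: nu_zero)
  finally have z: "(\<integral>\<^sup>+ \<omega>. indicator {\<omega>. \<omega> 0 = 0} (shift_path (T \<omega>) \<omega>) \<partial>P0) = 0" .
  have "(\<lambda>\<omega>. shift_path (T \<omega>) \<omega>) \<in> measurable path_space path_space" by measurable
  from measurable_compose[OF this, of "indicator {\<omega>. \<omega> 0 = 0} :: _ \<Rightarrow> ennreal" borel]
  have "(\<lambda>\<omega>. indicator {\<omega>. \<omega> 0 = 0} (shift_path (T \<omega>) \<omega>) :: ennreal) \<in> borel_measurable path_space"
    by measurable
  with z have "AE \<omega> in P0. indicator {\<omega>. \<omega> 0 = 0} (shift_path (T \<omega>) \<omega>) = (0 :: ennreal)"
    by (subst (asm) nn_integral_0_iff_AE) auto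
  with AE_zero show ?thesis
  proof eventually_elim
    case (elim \<omega>)
    then show ?case using T_nonneg[of \<omega>] by (cases "T \<omega> = 0") (auto simp: indicator_def split: if_splits)
  qed
qed

end

section \<open>Unbiased shifts and minimality\<close>

lemma borel_Ioc_rat: "sets borel = sigma_sets UNIV {{a<..b} | a b :: real. a \<in> \<rat> \<and> b \<in> \<rat>}" (is "_ = sigma_sets UNIV ?E")
proof
  have lt: "{..<x} \<in> sigma_sets UNIV ?E" for x :: real
  proof -
    have "{..<x} = (\<Union>I\<in>{I\<in>(\<lambda>(a, b). {a<..b}) ` (\<rat> \<times> \<rat>). I \<subseteq> {..<x}}. I)"
    proof (intro set_eqI iffI)
      fix y assume "y \<in> {..<x}"
      then obtain b where b: "b \<in> \<rat>" "y < b" "b < x" using Rats_dense_in_real[of y x] by auto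
      obtain a where a: "a \<in> \<rat>" "a < y" using Rats_dense_in_real[of "y - 1" y] by auto
      have "{a<..b} \<in> {I\<in>(\<lambda>(a, b). {a<..b}) ` (\<rat> \<times> \<rat>). I \<subseteq> {..<x}}"
        using a b by (auto intro!: image_eqI[of _ _ "(a, b)"])
      then show "y \<in> (\<Union>I\<in>{I\<in>(\<lambda>(a, b). {a<..b}) ` (\<rat> \<times> \<rat>). I \<subseteq> {..<x}}. I)"
        using a b by (intro UN_I[of "{a<..b}"]) auto
    qed blast
    also have "\<dots> \<in> sigma_sets UNIV ?E"
      by (rule sigma_sets_UNION) (auto intro!: countable_Collect countable_image countable_SIGMA countable_rat sigma_sets.Basic)
    finally show ?thesis .
  qed
  have "sets borel = sigma_sets UNIV (range (lessThan :: real \<Rightarrow> _))" by (simp add: borel_Iio)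
  also have "\<dots> \<subseteq> sigma_sets UNIV ?E" by (rule sigma_sets_mono) (use lt in auto)
  finally show "sets borel \<subseteq> sigma_sets UNIV ?E" .
  show "sigma_sets UNIV ?E \<subseteq> sets borel"
  proof -
    have "?E \<subseteq> sets borel" by auto
    then have "sigma_sets (space borel) ?E \<subseteq> sets borel" by (rule sets.sigma_sets_subset)
    then show ?thesis by simp
  qed
qed

lemma Int_stable_vimage: "Int_stable {X -` A \<inter> S | A. A \<in> sets N}"
proof (rule Int_stableI)
  fix a b assume "a \<in> {X -` A \<inter> S | A. A \<in> sets N}" "b \<in> {X -` A \<inter> S | A. A \<in> sets N}"
  then obtain A B where "A \<in> sets N" "a = X -` A \<inter> S" "B \<in> sets N" "b = X -` B \<inter> S" by auto
  then show "a \<inter> b \<in> {X -` A \<inter> S | A. A \<in> sets N}"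
    by (intro CollectI exI[of _ "A \<inter> B"]) auto
qed

lemma measure_eqI_Ioc_rat:
  fixes \<mu> \<kappa> :: "real measure"
  assumes sets: "sets \<mu> = sets borel" "sets \<kappa> = sets borel"
    and eq: "\<And>u v. u \<in> \<rat> \<Longrightarrow> v \<in> \<rat> \<Longrightarrow> emeasure \<mu> {u<..v} = emeasure \<kappa> {u<..v}"
    and fin: "\<And>u v. emeasure \<mu> {u<..v} < \<infinity>"
  shows "\<mu> = \<kappa>"
proof (rule measure_eqI_generator_eq[where E="{{a<..b} | a b :: real. a \<in> \<rat> \<and> b \<in> \<rat>}" and \<Omega>=UNIV
      and A="\<lambda>n::nat. {- real n<..real n}"])
  show "Int_stable {{a<..b} | a b :: real. a \<in> \<rat> \<and> b \<in> \<rat>}"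
  proof (rule Int_stableI, clarsimp)
    fix a b c d :: real assume "a \<in> \<rat>" "b \<in> \<rat>" "c \<in> \<rat>" "d \<in> \<rat>"
    then show "\<exists>x y. {max a c<..min b d} = {x<..y} \<and> x \<in> \<rat> \<and> y \<in> \<rat>"
      by (intro exI[of _ "max a c"] exI[of _ "min b d"]) (auto simp: max_def min_def)
  qed
  show "emeasure \<mu> X = emeasure \<kappa> X" if "X \<in> {{a<..b} | a b. a \<in> \<rat> \<and> b \<in> \<rat>}" for X
    using that eq by auto
  show "sets \<mu> = sigma_sets UNIV {{a<..b} | a b. a \<in> \<rat> \<and> b \<in> \<rat>}" "sets \<kappa> = sigma_sets UNIV {{a<..b} | a b. a \<in> \<rat> \<and> b \<in> \<rat>}"
    using sets by (simp_all add: borel_Ioc_rat)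
  show "range (\<lambda>n::nat. {- real n<..real n}) \<subseteq> {{a<..b} | a b. a \<in> \<rat> \<and> b \<in> \<rat>}"
    by (auto intro!: exI)
  show "(\<Union>n::nat. {- real n<..real n}) = UNIV"
    by (auto simp: minus_less_iff) (metis le_less_trans reals_Archimedean2 less_imp_le linear max_less_iff_conj)
  show "emeasure \<mu> {- real n<..real n} \<noteq> \<infinity>" for n :: nat
    using fin[of "- real n" "real n"] by auto
qed auto

section \<open>The first zero is the first passage\<close>

context bm_target
begin

text \<open>For a good path: \<open>F\<close> has a zero in \<open>{p..q}\<close> although it is
  nonnegative up to \<open>q'\<close>. The bounds \<open>1 / (k + 1)\<close> express the zero
  through rational times.\<close>

definition touch :: "real \<Rightarrow> real \<Rightarrow> real \<Rightarrow> (real \<Rightarrow> real) \<Rightarrow> bool" where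
  "touch p q q' \<omega> \<longleftrightarrow> (\<forall>r\<in>\<rat>. 0 < r \<and> r < q' \<longrightarrow> 0 \<le> F \<omega> r) \<and>
     (\<forall>k::nat. \<exists>r\<in>\<rat>. p \<le> r \<and> r \<le> q \<and> F \<omega> r < 1 / real (Suc k))"

lemma measurable_touch [measurable]: "Measurable.pred path_space (touch p q q')"
  unfolding touch_def by measurable

text \<open>After a shift to a point \<open>s\<close> of \<open>K\<close>, a touch would mean that
  \<open>F\<close> comes back to the level \<open>F s\<close> before the match of \<open>s\<close>.
  By \<open>AE_strict_before_tau\<close> its minimum over the compact interval is strictly larger,
  hence larger by some 1/(k+1).\<close>

lemma AE_not_touch:
  assumes pq: "0 < p" "p < q" "q < q'"
  shows "AE \<omega> in P0. \<not> touch p q q' \<omega>"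
proof (rule P0_AE_down)
  show "Measurable.pred path_space (\<lambda>\<omega>. \<not> touch p q q' \<omega>)" by measurable
  show "AE \<omega> in P_leb. AE s in K \<omega>. \<not> touch p q q' (shift_path s \<omega>)"
    using AE_P_leb_good AE_P_leb_covariant
  proof eventually_elim
    case (elim \<omega>)
    interpret diffuse_pair "K \<omega>" "\<eta> \<omega>" "F \<omega>" by (rule good_pair) fact
    show ?case
      using elim(2) AE_strict_before_tau
    proof eventually_elim
      case (elim s)
      note cov = F_covariant[OF \<open>good \<omega>\<close> elim(1)]
      show ?case
      proof
        assume t: "touch p q q' (shift_path s \<omega>)"
        have ge: "F \<omega> s \<le> F \<omega> (s + r)" if "r \<in> \<rat>" "0 < r" "r < q'" for r
          using t that cov[of r] unfolding touch_def by auto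
        have nless: "\<not> F \<omega> t < F \<omega> s" if "s < t" "t < s + q'" for t
        proof
          assume "F \<omega> t < F \<omega> s"
          from continuous_less_rational[OF f_continuous this, of s 0 q'] that
          obtain r where "r \<in> \<rat>" "0 < r" "r < q'" "F \<omega> (s + r) < F \<omega> s" by auto
          then show False using ge[of r] by simp
        qed
        have "\<not> \<tau> s < ereal (s + q')"
          unfolding tau_less_iff using nless by auto
        then have tau: "ereal (s + q') \<le> \<tau> s" by simp
        obtain t where t': "t \<in> {s + p..s + q}" "\<And>y. y \<in> {s + p..s + q} \<Longrightarrow> F \<omega> t \<le> F \<omega> y"
          using continuous_attains_inf[of "{s + p..s + q}" "F \<omega>"] f_continuous pq by auto
        have "ereal t < \<tau> s"
          by (rule less_le_trans[OF _ tau]) (use t'(1) pq in simp)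
        moreover have "s < t" using t'(1) pq by simp
        ultimately have pos: "F \<omega> s < F \<omega> t" using elim(2) by blast
        then obtain k where k: "1 / real (Suc k) < F \<omega> t - F \<omega> s"
          using nat_approx_posE[of "F \<omega> t - F \<omega> s"] by auto
        obtain r where r: "r \<in> \<rat>" "p \<le> r" "r \<le> q" "F (shift_path s \<omega>) r < 1 / real (Suc k)"
          using t unfolding touch_def by blast
        have "F \<omega> t \<le> F \<omega> (s + r)" using r by (intro t'(2)) auto
        then show False using r(4) k cov[OF r(1)] by linarith
      qed
    qed
  qed
qed

lemma covariant_0: "covariant \<omega> 0"
  by (simp add: covariant_def)

text \<open>\<open>F\<close> vanishes at \<open>T\<close> by \<open>tau_return\<close>. A zero
  \<open>t\<close> in the open interval from 0 to \<open>T\<close> would be a touch for rationals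
  \<open>p < t < q < q' < T\<close>.\<close>

lemma AE_first_zero:
  "AE \<omega> in P0. Inf {ereal t | t. 0 < t \<and> emeasure (K \<omega>) {0..t} = emeasure (\<eta> \<omega>) {0..t}} = ereal (T \<omega>)"
proof -
  have "AE \<omega> in P0. \<forall>p\<in>\<rat>. \<forall>q\<in>\<rat>. \<forall>q'\<in>\<rat>. 0 < p \<longrightarrow> p < q \<longrightarrow> q < q' \<longrightarrow> \<not> touch p q q' \<omega>"
    by (intro AE_ball_countable' countable_rat) (use AE_not_touch in auto)
  then show ?thesis
    using AE_P0_good AE_first_neg_finite AE_T_pos
  proof eventually_elim
    case (elim \<omega>)
    interpret diffuse_pair "K \<omega>" "\<eta> \<omega>" "F \<omega>" by (rule good_pair) fact
    have F0: "F \<omega> 0 = 0" using diffuse_xi diffuse_eta by (simp add: F_def measure_def)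
    have zero_iff: "emeasure (K \<omega>) {0..t} = emeasure (\<eta> \<omega>) {0..t} \<longleftrightarrow> F \<omega> t = 0" if "0 < t" for t
      using that by (simp add: emeasure_Icc F_def)
    have tau: "\<tau> 0 < \<infinity>" "tr 0 = T \<omega>"
      using first_neg_shift[OF elim(2) covariant_0, unfolded shift_path_simps(3)] elim(3) by simp_all
    have FT: "F \<omega> (T \<omega>) = 0" using tau_return(2)[OF tau(1)] tau(2) F0 by simp
    have first_neg: "first_neg \<omega> = ereal (T \<omega>)" by (rule T_first_neg[OF elim(3)])
    have npos: "F \<omega> t \<noteq> 0" if t: "0 < t" "t < T \<omega>" for t
    proof
      assume Ft: "F \<omega> t = 0"
      obtain p where p: "p \<in> \<rat>" "0 < p" "p < t" using Rats_dense_in_real[OF t(1)] by auto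
      obtain q where q: "q \<in> \<rat>" "t < q" "q < T \<omega>" using Rats_dense_in_real[OF t(2)] by auto
      obtain q' where q': "q' \<in> \<rat>" "q < q'" "q' < T \<omega>" using Rats_dense_in_real[OF q(3)] by auto
      have "0 \<le> F \<omega> r" if "r \<in> \<rat>" "0 < r" "r < q'" for r
      proof (rule ccontr)
        assume "\<not> 0 \<le> F \<omega> r"
        then have "first_neg \<omega> < ereal q'" unfolding first_neg_less_iff using that by (intro bexI[of _ r]) auto
        then show False using q' by (simp add: first_neg)
      qed
      moreover have "\<exists>r\<in>\<rat>. p \<le> r \<and> r \<le> q \<and> F \<omega> r < 1 / real (Suc k)" for k
      proof -
        have "F \<omega> t < 1 / real (Suc k)" by (simp add: Ft)
        from continuous_less_rational[OF f_continuous this, of 0 p q] p q show ?thesis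
          by (auto intro: less_imp_le)
      qed
      ultimately have "touch p q q' \<omega>" by (auto simp: touch_def)
      then show False using elim(1) p q q' by (meson less_trans)
    qed
    show ?case
    proof (rule antisym)
      show "Inf {ereal t | t. 0 < t \<and> emeasure (K \<omega>) {0..t} = emeasure (\<eta> \<omega>) {0..t}} \<le> ereal (T \<omega>)"
        using zero_iff[OF elim(4)] FT elim(4) by (intro Inf_lower) auto
      show "ereal (T \<omega>) \<le> Inf {ereal t | t. 0 < t \<and> emeasure (K \<omega>) {0..t} = emeasure (\<eta> \<omega>) {0..t}}"
      proof (rule Inf_greatest, clarify)
        fix t :: real assume t: "0 < t" "emeasure (K \<omega>) {0..t} = emeasure (\<eta> \<omega>) {0..t}"
        then have "F \<omega> t = 0" using zero_iff by blast
        then show "ereal (T \<omega>) \<le> ereal t" using npos[of t] t(1) by (cases "t < T \<omega>") auto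
      qed
    qed
  qed
qed

text \<open>Equivalent to being an unbiased shift with position of law \<nu> at the time
  \<open>S\<close>, as the lemmas on \<open>unbiased_shift\<close> below show; an identity of
  integrals is the form that combines with the Palm formulas.\<close>

definition shift_law :: "((real \<Rightarrow> real) \<Rightarrow> real) \<Rightarrow> bool" where
  "shift_law S \<longleftrightarrow> S \<in> borel_measurable path_space \<and>
     (\<forall>G\<in>borel_measurable path_space. (\<integral>\<^sup>+ \<omega>. G (shift_path (S \<omega>) \<omega>) \<partial>P0) = (\<integral>\<^sup>+ \<omega>. G \<omega> \<partial>start \<nu>))"

lemma shift_lawD:
  assumes "shift_law S" "G \<in> borel_measurable path_space"
  shows "(\<integral>\<^sup>+ \<omega>. G (shift_path (S \<omega>) \<omega>) \<partial>P0) = (\<integral>\<^sup>+ \<omega>. G \<omega> \<partial>start \<nu>)"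
  using assms unfolding shift_law_def by blast

lemma shift_law_T: "shift_law T"
  by (simp add: shift_law_def law_shift_T)

lemma shift_law_cong:
  assumes "shift_law S" "S' \<in> borel_measurable path_space" "AE \<omega> in P0. S \<omega> = S' \<omega>"
  shows "shift_law S'"
proof -
  have "(\<integral>\<^sup>+ \<omega>. G (shift_path (S' \<omega>) \<omega>) \<partial>P0) = (\<integral>\<^sup>+ \<omega>. G (shift_path (S \<omega>) \<omega>) \<partial>P0)" for G
    using assms(3) by (intro nn_integral_cong_AE) (auto elim!: eventually_mono)
  then show ?thesis using assms by (simp add: shift_law_def)
qed

definition recentre :: "((real \<Rightarrow> real) \<Rightarrow> real) \<Rightarrow> (real \<Rightarrow> real) \<Rightarrow> real \<Rightarrow> real" where
  "recentre S \<omega> = (\<lambda>t. \<omega> (S \<omega> + t) - \<omega> (S \<omega>))"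

lemma recentre_eq: "recentre S \<omega> = raise (- \<omega> (S \<omega>)) (shift_path (S \<omega>) \<omega>)"
  by (auto simp: recentre_def raise_def shift_path_def)

lemma raise_recentre: "raise (\<omega> (S \<omega>)) (recentre S \<omega>) = shift_path (S \<omega>) \<omega>"
  by (auto simp: recentre_def raise_def shift_path_def)

lemma measurable_recentre:
  assumes [measurable]: "S \<in> borel_measurable path_space"
  shows "recentre S \<in> measurable path_space path_space" "(\<lambda>\<omega>. \<omega> (S \<omega>)) \<in> borel_measurable path_space"
proof -
  show [measurable]: "(\<lambda>\<omega>. \<omega> (S \<omega>)) \<in> borel_measurable path_space"
    by (rule measurable_eval_at[where f="\<lambda>\<omega>. \<omega>"]) measurable
  show "recentre S \<in> measurable path_space path_space"
    unfolding recentre_eq[abs_def] by measurable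
qed

text \<open>Under \<open>start \<nu>\<close> the initial value and the path recentred at time 0 are
  by construction independent with laws \<nu> and \<open>P0\<close>; the shift law is tested with a
  product of functions of these two.\<close>

lemma shift_law_joint:
  assumes S: "shift_law S" and A[measurable]: "A \<in> sets path_space" and C[measurable]: "C \<in> sets borel"
  shows "emeasure P0 {\<omega>\<in>space path_space. recentre S \<omega> \<in> A \<and> \<omega> (S \<omega>) \<in> C} = emeasure P0 A * emeasure \<nu> C"
proof -
  have Sm[measurable]: "S \<in> borel_measurable path_space" using S by (simp add: shift_law_def)
  note measurable_recentre[OF Sm, measurable] measurable_eval[measurable]
  have m: "{\<omega>\<in>space P0. recentre S \<omega> \<in> A \<and> \<omega> (S \<omega>) \<in> C} \<in> sets P0" by simp measurable
  have G: "(\<lambda>\<omega>. indicator A (raise (- \<omega> 0) \<omega>) * indicator C (\<omega> 0) :: ennreal) \<in> borel_measurable path_space"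
    by measurable
  have "emeasure P0 {\<omega>\<in>space path_space. recentre S \<omega> \<in> A \<and> \<omega> (S \<omega>) \<in> C}
    = (\<integral>\<^sup>+ \<omega>. indicator {\<omega>. recentre S \<omega> \<in> A \<and> \<omega> (S \<omega>) \<in> C} \<omega> \<partial>P0)"
    using nn_integral_indicator_Collect[OF m] by simp
  also have "\<dots> = (\<integral>\<^sup>+ \<omega>. indicator A (raise (- shift_path (S \<omega>) \<omega> 0) (shift_path (S \<omega>) \<omega>)) * indicator C (shift_path (S \<omega>) \<omega> 0) \<partial>P0)"
    by (intro nn_integral_cong) (auto simp: recentre_eq indicator_def)
  also have "\<dots> = (\<integral>\<^sup>+ \<omega>. indicator A (raise (- \<omega> 0) \<omega>) * indicator C (\<omega> 0) \<partial>start \<nu>)"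
    by (rule shift_lawD[OF S G])
  also have "\<dots> = (\<integral>\<^sup>+ x. \<integral>\<^sup>+ \<omega>. indicator A (raise (- (raise x \<omega> 0)) (raise x \<omega>)) * indicator C (raise x \<omega> 0) \<partial>P0 \<partial>\<nu>)"
    by (rule nn_integral_start_nu[OF G])
  also have "\<dots> = (\<integral>\<^sup>+ x. emeasure P0 A * indicator C x \<partial>\<nu>)"
  proof (rule nn_integral_cong)
    fix x
    have "(\<integral>\<^sup>+ \<omega>. indicator A (raise (- (raise x \<omega> 0)) (raise x \<omega>)) * indicator C (raise x \<omega> 0) \<partial>P0)
      = (\<integral>\<^sup>+ \<omega>. indicator A \<omega> * indicator C x \<partial>P0)"
    proof (rule nn_integral_cong_AE)
      show "AE \<omega> in P0. indicator A (raise (- (raise x \<omega> 0)) (raise x \<omega>)) * indicator C (raise x \<omega> 0)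
        = (indicator A \<omega> * indicator C x :: ennreal)"
        using AE_zero
      proof eventually_elim
        case (elim \<omega>)
        then have "raise x \<omega> 0 = x" by simp
        moreover have "raise (- x) (raise x \<omega>) = \<omega>" unfolding raise_simps(2) by (simp add: raise_def)
        ultimately show ?case by simp
      qed
    qed
    also have "\<dots> = emeasure P0 A * indicator C x"
      by (subst nn_integral_multc) auto
    finally show "(\<integral>\<^sup>+ \<omega>. indicator A (raise (- (raise x \<omega> 0)) (raise x \<omega>)) * indicator C (raise x \<omega> 0) \<partial>P0)
      = emeasure P0 A * indicator C x" .
  qed
  also have "\<dots> = emeasure P0 A * emeasure \<nu> C"
    by (subst nn_integral_cmult) auto
  finally show ?thesis .
qed

lemma unbiased_of_shift_law:
  assumes S: "shift_law S"
  shows "unbiased_shift P0 S" "distr P0 borel (\<lambda>\<omega>. \<omega> (S \<omega>)) = \<nu>"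
proof -
  have Sm[measurable]: "S \<in> borel_measurable path_space" using S by (simp add: shift_law_def)
  note rm[measurable] = measurable_recentre[OF Sm]
  have Y: "recentre S \<in> measurable P0 path_space" and W: "(\<lambda>\<omega>. \<omega> (S \<omega>)) \<in> measurable P0 borel" by simp_all
  have sp: "space path_space \<in> sets path_space" by simp
  have lawY: "distr P0 path_space (recentre S) = P0"
  proof (rule measure_eqI)
    fix A assume "A \<in> sets (distr P0 path_space (recentre S))"
    then have A: "A \<in> sets path_space" by simp
    have "emeasure (distr P0 path_space (recentre S)) A = emeasure P0 (recentre S -` A \<inter> space P0)"
      by (rule emeasure_distr[OF Y A])
    also have "recentre S -` A \<inter> space P0 = {\<omega>\<in>space path_space. recentre S \<omega> \<in> A \<and> \<omega> (S \<omega>) \<in> UNIV}" by auto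
    also have "emeasure P0 \<dots> = emeasure P0 A * emeasure \<nu> UNIV" by (rule shift_law_joint[OF S A]) simp
    finally show "emeasure (distr P0 path_space (recentre S)) A = emeasure P0 A"
      using \<nu>.emeasure_space_1 by simp
  qed simp
  show lawW: "distr P0 borel (\<lambda>\<omega>. \<omega> (S \<omega>)) = \<nu>"
  proof (rule measure_eqI)
    fix C :: "real set" assume "C \<in> sets (distr P0 borel (\<lambda>\<omega>. \<omega> (S \<omega>)))"
    then have C: "C \<in> sets borel" by simp
    have "emeasure (distr P0 borel (\<lambda>\<omega>. \<omega> (S \<omega>))) C = emeasure P0 ((\<lambda>\<omega>. \<omega> (S \<omega>)) -` C \<inter> space P0)"
      by (rule emeasure_distr[OF W C])
    also have "(\<lambda>\<omega>. \<omega> (S \<omega>)) -` C \<inter> space P0 = {\<omega>\<in>space path_space. recentre S \<omega> \<in> space path_space \<and> \<omega> (S \<omega>) \<in> C}"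
      using measurable_space[OF rm(1)] by auto
    also have "emeasure P0 \<dots> = emeasure P0 (space path_space) * emeasure \<nu> C" by (rule shift_law_joint[OF S sp C])
    finally show "emeasure (distr P0 borel (\<lambda>\<omega>. \<omega> (S \<omega>))) C = emeasure \<nu> C"
      using P0.emeasure_space_1 by simp
  qed simp
  have eY: "emeasure P0 (recentre S -` A \<inter> space P0) = emeasure P0 A" if "A \<in> sets path_space" for A
    using emeasure_distr[OF Y that] by (simp add: lawY)
  have eW: "emeasure P0 ((\<lambda>\<omega>. \<omega> (S \<omega>)) -` C \<inter> space P0) = emeasure \<nu> C" if "C \<in> sets borel" for C
    using emeasure_distr[OF W that] by (simp add: lawW)
  have "P0.indep_set {recentre S -` A \<inter> space P0 | A. A \<in> sets path_space} {(\<lambda>\<omega>. \<omega> (S \<omega>)) -` C \<inter> space P0 | C. C \<in> sets borel}"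
  proof (rule P0.indep_setI)
    show "{recentre S -` A \<inter> space P0 | A. A \<in> sets path_space} \<subseteq> P0.events"
      using measurable_sets[OF Y] by auto
    show "{(\<lambda>\<omega>. \<omega> (S \<omega>)) -` C \<inter> space P0 | C. C \<in> sets borel} \<subseteq> P0.events"
      using measurable_sets[OF W] by auto
    fix a b assume "a \<in> {recentre S -` A \<inter> space P0 | A. A \<in> sets path_space}"
      "b \<in> {(\<lambda>\<omega>. \<omega> (S \<omega>)) -` C \<inter> space P0 | C. C \<in> sets borel}"
    then obtain A C where A: "A \<in> sets path_space" "a = recentre S -` A \<inter> space P0"
      and C: "C \<in> sets borel" "b = (\<lambda>\<omega>. \<omega> (S \<omega>)) -` C \<inter> space P0" by auto
    have "a \<inter> b = {\<omega>\<in>space path_space. recentre S \<omega> \<in> A \<and> \<omega> (S \<omega>) \<in> C}" by (auto simp: A C)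
    then have "emeasure P0 (a \<inter> b) = emeasure P0 a * emeasure P0 b"
      using shift_law_joint[OF S A(1) C(1)] eY[OF A(1)] eW[OF C(1)] by (simp only: A(2) C(2))
    then show "P0.prob (a \<inter> b) = P0.prob a * P0.prob b"
      by (simp add: measure_def enn2real_mult)
  qed
  then have "P0.indep_set (sigma_sets (space P0) {recentre S -` A \<inter> space P0 | A. A \<in> sets path_space})
    (sigma_sets (space P0) {(\<lambda>\<omega>. \<omega> (S \<omega>)) -` C \<inter> space P0 | C. C \<in> sets borel})"
    by (rule P0.indep_set_sigma_sets) (rule Int_stable_vimage)+
  moreover have "two_sided_BM P0 (\<lambda>t \<omega>. recentre S \<omega> t)"
    by (rule two_sided_BM_transfer[OF BM P0.prob_space_axioms Y lawY])
  ultimately show "unbiased_shift P0 S"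
    using Y W Sm unfolding unbiased_shift_def indep_rvs_def recentre_def[abs_def] by blast
qed

text \<open>Independence makes the joint law of the position at \<open>S\<close> and of the
  recentred path a product of \<nu> and \<open>P0\<close>. Adding the two components gives back the
  shifted path, and the image of that product under addition is \<open>start \<nu>\<close>.\<close>

lemma shift_law_of_unbiased:
  assumes S: "unbiased_shift P0 S" and dist: "distr P0 borel (\<lambda>\<omega>. \<omega> (S \<omega>)) = \<nu>"
  shows "shift_law S"
proof -
  have Sm[measurable]: "S \<in> borel_measurable path_space" using S by (simp add: unbiased_shift_def)
  note rm[measurable] = measurable_recentre[OF Sm]
  have Y: "recentre S \<in> measurable P0 path_space" and W: "(\<lambda>\<omega>. \<omega> (S \<omega>)) \<in> measurable P0 borel" by simp_all
  have "two_sided_BM P0 (\<lambda>t \<omega>. recentre S \<omega> t)"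
    using S by (simp add: unbiased_shift_def recentre_def)
  from BM_law_unique[OF BM this] have lawY: "distr P0 path_space (recentre S) = P0" by simp
  have ind: "P0.indep_set (sigma_sets (space P0) {recentre S -` A \<inter> space P0 | A. A \<in> sets path_space})
    (sigma_sets (space P0) {(\<lambda>\<omega>. \<omega> (S \<omega>)) -` C \<inter> space P0 | C. C \<in> sets borel})"
    using S unfolding unbiased_shift_def indep_rvs_def recentre_def[abs_def] by blast
  have joint: "\<nu> \<Otimes>\<^sub>M P0 = distr P0 (\<nu> \<Otimes>\<^sub>M path_space) (\<lambda>\<omega>. (\<omega> (S \<omega>), recentre S \<omega>))"
  proof (rule pair_measure_eqI)
    have WY: "(\<lambda>\<omega>. (\<omega> (S \<omega>), recentre S \<omega>)) \<in> measurable P0 (\<nu> \<Otimes>\<^sub>M path_space)" by simp measurable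
    fix C A assume C': "C \<in> sets \<nu>" and A': "A \<in> sets P0"
    then have C: "C \<in> sets borel" and A: "A \<in> sets path_space" by simp_all
    have CA: "C \<times> A \<in> sets (\<nu> \<Otimes>\<^sub>M path_space)" using C A by simp
    have "emeasure (distr P0 (\<nu> \<Otimes>\<^sub>M path_space) (\<lambda>\<omega>. (\<omega> (S \<omega>), recentre S \<omega>))) (C \<times> A)
      = emeasure P0 ((recentre S -` A \<inter> space P0) \<inter> ((\<lambda>\<omega>. \<omega> (S \<omega>)) -` C \<inter> space P0))"
      by (subst emeasure_distr[OF WY CA]) (auto intro!: arg_cong[where f="emeasure P0"])
    also have "\<dots> = emeasure P0 (recentre S -` A \<inter> space P0) * emeasure P0 ((\<lambda>\<omega>. \<omega> (S \<omega>)) -` C \<inter> space P0)"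
    proof -
      have "P0.prob ((recentre S -` A \<inter> space P0) \<inter> ((\<lambda>\<omega>. \<omega> (S \<omega>)) -` C \<inter> space P0))
        = P0.prob (recentre S -` A \<inter> space P0) * P0.prob ((\<lambda>\<omega>. \<omega> (S \<omega>)) -` C \<inter> space P0)"
        by (rule P0.indep_setD[OF ind]) (use A C in \<open>auto intro!: sigma_sets.Basic\<close>)
      then show ?thesis by (simp add: P0.emeasure_eq_measure ennreal_mult)
    qed
    also have "\<dots> = emeasure P0 A * emeasure \<nu> C"
      using emeasure_distr[OF Y A] emeasure_distr[OF W C] by (simp add: lawY dist)
    finally show "emeasure \<nu> C * emeasure P0 A
      = emeasure (distr P0 (\<nu> \<Otimes>\<^sub>M path_space) (\<lambda>\<omega>. (\<omega> (S \<omega>), recentre S \<omega>))) (C \<times> A)" by (simp add: mult.commute)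
  qed (use \<nu>.sigma_finite_measure P0.sigma_finite_measure in \<open>auto cong: sets_pair_measure_cong\<close>)
  show ?thesis
    unfolding shift_law_def
  proof (intro conjI Sm ballI)
    fix G :: "(real \<Rightarrow> real) \<Rightarrow> ennreal" assume G[measurable]: "G \<in> borel_measurable path_space"
    have "(\<integral>\<^sup>+ \<omega>. G \<omega> \<partial>start \<nu>) = (\<integral>\<^sup>+ p. G (raise (fst p) (snd p)) \<partial>(\<nu> \<Otimes>\<^sub>M P0))"
      unfolding start_def by (subst nn_integral_distr) auto
    also have "\<dots> = (\<integral>\<^sup>+ \<omega>. G (raise (\<omega> (S \<omega>)) (recentre S \<omega>)) \<partial>P0)"
      unfolding joint by (subst nn_integral_distr) auto
    finally show "(\<integral>\<^sup>+ \<omega>. G (shift_path (S \<omega>) \<omega>) \<partial>P0) = (\<integral>\<^sup>+ \<omega>. G \<omega> \<partial>start \<nu>)"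
      by (simp only: raise_recentre)
  qed
qed

text \<open>By the Palm formulas both sides become integrals over Lebesgue time, which absorbs the
  translation by \<open>S\<close>; the shift law then replaces the shifted path by one with law
  \<open>start \<nu>\<close>. Shifting back by \<open>- s\<close> lets \<open>G\<close> depend on
  the unshifted path.\<close>

lemma palm_push:
  assumes S: "shift_law S"
    and G: "(\<lambda>p. G (fst p) (snd p)) \<in> borel_measurable (path_space \<Otimes>\<^sub>M borel)"
  shows "(\<integral>\<^sup>+ \<omega>. \<integral>\<^sup>+ s. G \<omega> (s + S (shift_path s \<omega>)) \<partial>K \<omega> \<partial>P_leb) = (\<integral>\<^sup>+ \<omega>. \<integral>\<^sup>+ r. G \<omega> r \<partial>\<eta> \<omega> \<partial>P_leb)"
proof -
  have Sm[measurable]: "S \<in> borel_measurable path_space" using S by (simp add: shift_law_def)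
  have mG: "(\<lambda>y. G (u y) (v y)) \<in> borel_measurable N"
    if "u \<in> measurable N path_space" "v \<in> borel_measurable N" for u v and N :: "'c measure"
    using measurable_compose[OF measurable_Pair[OF that] G] by simp
  interpret pair_sigma_finite P0 lborel ..
  define g where "g \<omega> s = G (shift_path (- s) \<omega>) (s + S \<omega>)" for \<omega> s
  define g' where "g' \<omega> r = G (shift_path (- r) \<omega>) r" for \<omega> r
  have gm: "(\<lambda>p. g (fst p) (snd p)) \<in> borel_measurable (path_space \<Otimes>\<^sub>M borel)"
    unfolding g_def by (intro mG) measurable
  have gm': "(\<lambda>p. g' (fst p) (snd p)) \<in> borel_measurable (path_space \<Otimes>\<^sub>M borel)"
    unfolding g'_def by (intro mG) measurable
  have unshift: "shift_path (- s) (shift_path s \<omega>) = \<omega>" for s \<omega>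
    by (simp add: shift_path_def)
  have "(\<integral>\<^sup>+ \<omega>. \<integral>\<^sup>+ s. G \<omega> (s + S (shift_path s \<omega>)) \<partial>K \<omega> \<partial>P_leb)
    = (\<integral>\<^sup>+ \<omega>. \<integral>\<^sup>+ s. g (shift_path s \<omega>) s \<partial>K (raise (- 0) \<omega>) \<partial>P_leb)"
    unfolding g_def unshift minus_zero raise_simps(3) ..
  also have "\<dots> = (\<integral>\<^sup>+ s. \<integral>\<^sup>+ \<omega>. g (raise 0 \<omega>) s \<partial>P0 \<partial>lborel)"
    by (rule palm[OF gm])
  also have "\<dots> = (\<integral>\<^sup>+ \<omega>. \<integral>\<^sup>+ s. g \<omega> s \<partial>lborel \<partial>P0)"
    unfolding raise_simps(3) using gm by (intro Fubini') (simp add: case_prod_unfold cong: measurable_cong_sets)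
  also have "\<dots> = (\<integral>\<^sup>+ \<omega>. \<integral>\<^sup>+ r. g' (shift_path (S \<omega>) \<omega>) r \<partial>lborel \<partial>P0)"
  proof (rule nn_integral_cong)
    fix \<omega> assume "\<omega> \<in> space P0"
    then have \<omega>: "\<omega> \<in> space path_space" by simp
    have "(\<lambda>s. g' (shift_path (S \<omega>) \<omega>) s) \<in> borel_measurable borel"
      unfolding g'_def using \<omega> by (intro mG measurable_shift_path) auto
    from nn_integral_lborel_shift[OF this, of "S \<omega>"]
    show "(\<integral>\<^sup>+ s. g \<omega> s \<partial>lborel) = (\<integral>\<^sup>+ r. g' (shift_path (S \<omega>) \<omega>) r \<partial>lborel)"
      by (simp add: g_def g'_def shift_path_simps(2) del: shift_path_simps(1))
  qed
  also have "\<dots> = (\<integral>\<^sup>+ r. \<integral>\<^sup>+ \<omega>. g' (shift_path (S \<omega>) \<omega>) r \<partial>P0 \<partial>lborel)"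
  proof (rule Fubini'[symmetric])
    have "(\<lambda>p. g' (shift_path (S (fst p)) (fst p)) (snd p)) \<in> borel_measurable (P0 \<Otimes>\<^sub>M lborel)"
      unfolding g'_def by (intro mG) measurable
    then show "(\<lambda>(\<omega>, r). g' (shift_path (S \<omega>) \<omega>) r) \<in> borel_measurable (P0 \<Otimes>\<^sub>M lborel)"
      by (simp add: case_prod_unfold)
  qed
  also have "\<dots> = (\<integral>\<^sup>+ r. \<integral>\<^sup>+ \<omega>. g' \<omega> r \<partial>start \<nu> \<partial>lborel)"
  proof (rule nn_integral_cong)
    fix r
    have "(\<lambda>\<omega>. g' \<omega> r) \<in> borel_measurable path_space" unfolding g'_def by (intro mG) measurable
    then show "(\<integral>\<^sup>+ \<omega>. g' (shift_path (S \<omega>) \<omega>) r \<partial>P0) = (\<integral>\<^sup>+ \<omega>. g' \<omega> r \<partial>start \<nu>)"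
      by (rule shift_lawD[OF S])
  qed
  also have "\<dots> = (\<integral>\<^sup>+ \<omega>. \<integral>\<^sup>+ r. g' (shift_path r \<omega>) r \<partial>\<eta> \<omega> \<partial>P_leb)"
    by (rule palm_eta[OF gm', symmetric])
  finally show ?thesis unfolding g'_def unshift .
qed

section \<open>Pathwise transport and minimality\<close>

definition push :: "((real \<Rightarrow> real) \<Rightarrow> real) \<Rightarrow> (real \<Rightarrow> real) \<Rightarrow> real \<Rightarrow> real" where
  "push S \<omega> s = s + S (shift_path s \<omega>)"

lemma measurable_push:
  assumes [measurable]: "S \<in> borel_measurable path_space"
  shows "\<omega> \<in> space path_space \<Longrightarrow> push S \<omega> \<in> borel_measurable borel"
    "(\<lambda>p. push S (fst p) (snd p)) \<in> borel_measurable (path_space \<Otimes>\<^sub>M borel)"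
proof -
  show m[measurable]: "(\<lambda>p. push S (fst p) (snd p)) \<in> borel_measurable (path_space \<Otimes>\<^sub>M borel)"
    unfolding push_def by measurable
  show "push S \<omega> \<in> borel_measurable borel" if "\<omega> \<in> space path_space"
    using measurable_compose[OF measurable_Pair1'[OF that] m] by simp
qed

text \<open>\<open>palm_push\<close> is an identity in the mean, but it may be restricted to any
  event \<open>A\<close>. So the two masses of a rational interval are densities of the same finite
  measure on paths and agree almost everywhere; rational intervals then determine the transported
  measure.\<close>

lemma AE_push:
  assumes S: "shift_law S"
  shows "AE \<omega> in P_leb. \<forall>C\<in>sets borel. emeasure (K \<omega>) (push S \<omega> -` C) = emeasure (\<eta> \<omega>) C"
proof -
  have Sm[measurable]: "S \<in> borel_measurable path_space" using S by (simp add: shift_law_def)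
  note measurable_push(2)[OF Sm, measurable]
  have "AE \<omega> in P_leb. (\<integral>\<^sup>+ s. indicator {u<..v} (push S \<omega> s) \<partial>K \<omega>) = (\<integral>\<^sup>+ r. indicator {u<..v} r \<partial>\<eta> \<omega>)" for u v :: real
  proof (rule finite_density_unique[THEN iffD1])
    show m1: "(\<lambda>\<omega>. \<integral>\<^sup>+ s. indicator {u<..v} (push S \<omega> s) \<partial>K \<omega>) \<in> borel_measurable P_leb"
      unfolding measurable_start by (intro measurable_kernel_integral) measurable
    show m2: "(\<lambda>\<omega>. \<integral>\<^sup>+ r. indicator {u<..v} r \<partial>\<eta> \<omega>) \<in> borel_measurable P_leb"
      unfolding measurable_start by (intro measurable_eta_integral) measurable
    have eq: "(\<integral>\<^sup>+ \<omega>. indicator A \<omega> * (\<integral>\<^sup>+ s. indicator {u<..v} (push S \<omega> s) \<partial>K \<omega>) \<partial>P_leb)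
      = (\<integral>\<^sup>+ \<omega>. indicator A \<omega> * (\<integral>\<^sup>+ r. indicator {u<..v} r \<partial>\<eta> \<omega>) \<partial>P_leb)"
      if A[measurable]: "A \<in> sets path_space" for A
    proof -
      have "(\<integral>\<^sup>+ \<omega>. indicator A \<omega> * (\<integral>\<^sup>+ s. indicator {u<..v} (push S \<omega> s) \<partial>K \<omega>) \<partial>P_leb)
        = (\<integral>\<^sup>+ \<omega>. \<integral>\<^sup>+ s. indicator A \<omega> * indicator {u<..v} (s + S (shift_path s \<omega>)) \<partial>K \<omega> \<partial>P_leb)"
      proof (rule nn_integral_cong)
        fix \<omega> assume "\<omega> \<in> space P_leb"
        then have \<omega>: "\<omega> \<in> space path_space" by simp
        note measurable_push(1)[OF Sm \<omega>, measurable]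
        have "(\<lambda>s. indicator {u<..v} (push S \<omega> s) :: ennreal) \<in> borel_measurable (K \<omega>)"
          unfolding kernel_measurable[OF \<omega>] by measurable
        then show "indicator A \<omega> * (\<integral>\<^sup>+ s. indicator {u<..v} (push S \<omega> s) \<partial>K \<omega>)
          = (\<integral>\<^sup>+ s. indicator A \<omega> * indicator {u<..v} (s + S (shift_path s \<omega>)) \<partial>K \<omega>)"
          unfolding push_def by (rule nn_integral_cmult[symmetric])
      qed
      also have "\<dots> = (\<integral>\<^sup>+ \<omega>. \<integral>\<^sup>+ r. indicator A \<omega> * indicator {u<..v} r \<partial>\<eta> \<omega> \<partial>P_leb)"
        by (rule palm_push[OF S]) measurable
      also have "\<dots> = (\<integral>\<^sup>+ \<omega>. indicator A \<omega> * (\<integral>\<^sup>+ r. indicator {u<..v} r \<partial>\<eta> \<omega>) \<partial>P_leb)"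
        by (intro nn_integral_cong nn_integral_cmult) simp
      finally show ?thesis .
    qed
    show "density P_leb (\<lambda>\<omega>. \<integral>\<^sup>+ s. indicator {u<..v} (push S \<omega> s) \<partial>K \<omega>) = density P_leb (\<lambda>\<omega>. \<integral>\<^sup>+ r. indicator {u<..v} r \<partial>\<eta> \<omega>)"
    proof (rule measure_eqI)
      fix A assume "A \<in> sets (density P_leb (\<lambda>\<omega>. \<integral>\<^sup>+ s. indicator {u<..v} (push S \<omega> s) \<partial>K \<omega>))"
      then have A: "A \<in> sets path_space" by simp
      show "emeasure (density P_leb (\<lambda>\<omega>. \<integral>\<^sup>+ s. indicator {u<..v} (push S \<omega> s) \<partial>K \<omega>)) A
        = emeasure (density P_leb (\<lambda>\<omega>. \<integral>\<^sup>+ r. indicator {u<..v} r \<partial>\<eta> \<omega>)) A"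
        using eq[OF A] A m1 m2 by (subst (1 2) emeasure_density) (simp_all only: sets_start mult.commute[of _ "indicator A _"])
    qed simp
    have "(\<integral>\<^sup>+ \<omega>. \<integral>\<^sup>+ s. indicator {u<..v} (push S \<omega> s) \<partial>K \<omega> \<partial>P_leb) = (\<integral>\<^sup>+ \<omega>. \<integral>\<^sup>+ r. indicator {u<..v} r \<partial>\<eta> \<omega> \<partial>P_leb)"
      unfolding push_def by (rule palm_push[OF S]) measurable
    also have "\<dots> = (\<integral>\<^sup>+ r. \<integral>\<^sup>+ \<omega>. indicator {u<..v} r \<partial>start \<nu> \<partial>lborel)"
      by (rule palm_eta) measurable
    also have "\<dots> = (\<integral>\<^sup>+ r. indicator {u<..v} r \<partial>lborel)"
      by (intro nn_integral_cong) (simp add: prob_space.emeasure_space_1[OF prob_start_nu, simplified])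
    also have "\<dots> \<noteq> \<infinity>" by (cases "u \<le> v") auto
    finally show "(\<integral>\<^sup>+ \<omega>. \<integral>\<^sup>+ s. indicator {u<..v} (push S \<omega> s) \<partial>K \<omega> \<partial>P_leb) \<noteq> \<infinity>" .
  qed auto
  then have "AE \<omega> in P_leb. \<forall>u\<in>\<rat>. \<forall>v\<in>\<rat>. (\<integral>\<^sup>+ s. indicator {u<..v} (push S \<omega> s) \<partial>K \<omega>) = (\<integral>\<^sup>+ r. indicator {u<..v} r \<partial>\<eta> \<omega>)"
    by (intro AE_ball_countable' countable_rat)
  then show ?thesis
    using AE_P_leb_good
  proof eventually_elim
    case (elim \<omega>)
    then have \<omega>: "\<omega> \<in> space path_space" by (simp add: good_def)
    note pm = measurable_push(1)[OF Sm \<omega>]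
    have pK: "push S \<omega> \<in> measurable (K \<omega>) borel" using pm by (simp add: kernel_measurable[OF \<omega>])
    have eK: "emeasure (distr (K \<omega>) borel (push S \<omega>)) C = emeasure (K \<omega>) (push S \<omega> -` C)" if "C \<in> sets borel" for C
      using emeasure_distr[OF pK that] by (simp add: kernelD(2)[OF \<omega>])
    have "\<eta> \<omega> = distr (K \<omega>) borel (push S \<omega>)"
    proof (rule measure_eqI_Ioc_rat)
      fix u v :: real assume uv: "u \<in> \<rat>" "v \<in> \<rat>"
      have s: "push S \<omega> -` {u<..v} \<in> sets (K \<omega>)"
        using measurable_sets[OF pK, of "{u<..v}"] by (simp add: kernelD(2)[OF \<omega>])
      have "emeasure (\<eta> \<omega>) {u<..v} = (\<integral>\<^sup>+ r. indicator {u<..v} r \<partial>\<eta> \<omega>)" by simp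
      also have "\<dots> = (\<integral>\<^sup>+ s. indicator {u<..v} (push S \<omega> s) \<partial>K \<omega>)" using elim(1) uv by simp
      also have "\<dots> = (\<integral>\<^sup>+ s. indicator (push S \<omega> -` {u<..v}) s \<partial>K \<omega>)"
        by (intro nn_integral_cong) (simp add: indicator_def)
      also have "\<dots> = emeasure (K \<omega>) (push S \<omega> -` {u<..v})" by (rule nn_integral_indicator[OF s])
      finally show "emeasure (\<eta> \<omega>) {u<..v} = emeasure (distr (K \<omega>) borel (push S \<omega>)) {u<..v}"
        by (simp add: eK)
    next
      fix u v :: real
      have "emeasure (\<eta> \<omega>) {u<..v} \<le> emeasure (\<eta> \<omega>) {u..v}" by (intro emeasure_mono) auto
      also have "\<dots> < \<infinity>" using elim(2) by (intro finite_eta) (simp add: good_def)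
      finally show "emeasure (\<eta> \<omega>) {u<..v} < \<infinity>" .
    qed auto
    then show ?case using eK by metis
  qed
qed

text \<open>The inequalities between 0, \<open>S\<close> and \<open>T\<close> are first carried to
  almost every point of \<open>K\<close> under \<open>P_leb\<close>. There both times transport
  \<open>K\<close> to \<eta>, so the deterministic lemma \<open>minimal\<close> applies path by
  path, and its conclusion is carried back to \<open>P0\<close>.\<close>

lemma shift_law_minimal:
  assumes S: "shift_law S" and le: "AE \<omega> in P0. 0 \<le> S \<omega> \<and> S \<omega> \<le> T \<omega>"
  shows "AE \<omega> in P0. S \<omega> = T \<omega>"
proof (rule P0_AE_down)
  have Sm[measurable]: "S \<in> borel_measurable path_space" using S by (simp add: shift_law_def)
  show "Measurable.pred path_space (\<lambda>\<omega>. S \<omega> = T \<omega>)"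
    unfolding pred_def by (rule borel_measurable_eq[OF Sm measurable_T])
  have "AE \<omega> in P_leb. AE s in K (raise (- 0) \<omega>). (\<lambda>\<omega> s. 0 \<le> S \<omega> \<and> S \<omega> \<le> T \<omega> \<and> first_neg \<omega> < \<infinity>) (shift_path s \<omega>) s"
  proof (rule palm_AE_up)
    show "Measurable.pred (path_space \<Otimes>\<^sub>M borel) (\<lambda>p. 0 \<le> S (fst p) \<and> S (fst p) \<le> T (fst p) \<and> first_neg (fst p) < \<infinity>)"
      by measurable
    show "AE \<omega> in P0. 0 \<le> S (raise 0 \<omega>) \<and> S (raise 0 \<omega>) \<le> T (raise 0 \<omega>) \<and> first_neg (raise 0 \<omega>) < \<infinity>"
      unfolding raise_simps(3) using le AE_first_neg_finite by eventually_elim auto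
  qed
  then have "AE \<omega> in P_leb. AE s in K \<omega>. 0 \<le> S (shift_path s \<omega>) \<and> S (shift_path s \<omega>) \<le> T (shift_path s \<omega>) \<and> first_neg (shift_path s \<omega>) < \<infinity>"
    unfolding minus_zero raise_simps(3) .
  then show "AE \<omega> in P_leb. AE s in K \<omega>. S (shift_path s \<omega>) = T (shift_path s \<omega>)"
    using AE_P_leb_good AE_P_leb_covariant AE_push[OF S] AE_push[OF shift_law_T]
  proof eventually_elim
    case (elim \<omega>)
    interpret diffuse_pair "K \<omega>" "\<eta> \<omega>" "F \<omega>" by (rule good_pair) fact
    have \<omega>: "\<omega> \<in> space path_space" using elim(2) by (simp add: good_def)
    have tr_eq: "AE s in K \<omega>. tr s = push T \<omega> s"
      using elim(1,3)
    proof eventually_elim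
      case (elim s)
      then show ?case using first_neg_shift(2)[OF \<open>good \<omega>\<close>, of s] by (simp add: push_def)
    qed
    have "AE s in K \<omega>. push S \<omega> s = tr s"
    proof (rule minimal)
      show "push S \<omega> \<in> borel_measurable borel" by (rule measurable_push(1)[OF Sm \<omega>])
      show "AE s in K \<omega>. s \<le> push S \<omega> s \<and> push S \<omega> s \<le> tr s"
        using elim(1) tr_eq by eventually_elim (auto simp: push_def)
      show "AE s in K \<omega>. \<tau> s < \<infinity>"
        using elim(1,3) by eventually_elim (use first_neg_shift(1)[OF \<open>good \<omega>\<close>] in blast)
      show "emeasure (K \<omega>) (push S \<omega> -` C) = emeasure (\<eta> \<omega>) C" if "C \<in> sets borel" for C
        using elim(4) that by blast
      show "emeasure (K \<omega>) (tr -` C) = emeasure (\<eta> \<omega>) C" if C: "C \<in> sets borel" for C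
      proof -
        have "emeasure (K \<omega>) (tr -` C) = emeasure (K \<omega>) (push T \<omega> -` C)"
        proof (rule emeasure_eq_AE)
          show "AE s in K \<omega>. s \<in> tr -` C \<longleftrightarrow> s \<in> push T \<omega> -` C"
            using tr_eq by eventually_elim simp
          show "tr -` C \<in> sets (K \<omega>)" "push T \<omega> -` C \<in> sets (K \<omega>)"
            using measurable_sets[OF measurable_tr C] measurable_sets[OF measurable_push(1)[OF measurable_T \<omega>] C]
            by (simp_all add: sets_xi)
        qed
        then show ?thesis using elim(5) C by simp
      qed
    qed
    then show ?case
      using tr_eq by eventually_elim (simp add: push_def)
  qed
qed

theorem minimal_unbiased_shift_T:
  assumes T': "T' \<in> borel_measurable path_space" "AE \<omega> in P0. T' \<omega> = T \<omega>"
  shows "minimal_unbiased_shift P0 T'"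
  unfolding minimal_unbiased_shift_def
proof (intro conjI allI impI)
  have law: "shift_law T'"
    using T' by (intro shift_law_cong[OF shift_law_T]) (auto elim!: eventually_mono)
  show "unbiased_shift P0 T'" by (rule unbiased_of_shift_law[OF law])
  show "AE \<omega> in P0. 0 \<le> T' \<omega>" using T'(2) by eventually_elim (simp add: T_nonneg)
  fix S assume S: "unbiased_shift P0 S \<and> (AE \<omega> in P0. 0 \<le> S \<omega> \<and> S \<omega> \<le> T' \<omega>)
    \<and> distr P0 borel (\<lambda>\<omega>. \<omega> (T' \<omega>)) = distr P0 borel (\<lambda>\<omega>. \<omega> (S \<omega>))"
  then have "shift_law S"
    using unbiased_of_shift_law(2)[OF law] by (intro shift_law_of_unbiased) auto
  moreover have "AE \<omega> in P0. 0 \<le> S \<omega> \<and> S \<omega> \<le> T \<omega>"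
    using conjunct1[OF conjunct2[OF S]] T'(2) by eventually_elim auto
  ultimately have "AE \<omega> in P0. S \<omega> = T \<omega>" by (rule shift_law_minimal)
  then show "AE \<omega> in P0. S \<omega> = T' \<omega>" using T'(2) by eventually_elim simp
qed

end

section \<open>Regularisation of the local time\<close>

lemma measure_eqI_Ioc_rat_pair:
  fixes \<mu> \<kappa> :: "(real \<times> real) measure"
  assumes sets: "sets \<mu> = sets (borel \<Otimes>\<^sub>M borel)" "sets \<kappa> = sets (borel \<Otimes>\<^sub>M borel)"
    and eq: "\<And>a b c d. a \<in> \<rat> \<Longrightarrow> b \<in> \<rat> \<Longrightarrow> c \<in> \<rat> \<Longrightarrow> d \<in> \<rat> \<Longrightarrow>
      emeasure \<mu> ({a<..b} \<times> {c<..d}) = emeasure \<kappa> ({a<..b} \<times> {c<..d})"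
    and fin: "\<And>a b c d. emeasure \<mu> ({a<..b} \<times> {c<..d}) < \<infinity>"
  shows "\<mu> = \<kappa>"
proof -
  let ?E = "{{a<..b} | a b :: real. a \<in> \<rat> \<and> b \<in> \<rat>}"
  let ?P = "{a \<times> b | a b. a \<in> ?E \<and> b \<in> ?E}"
  let ?C = "range (\<lambda>n::nat. {- real n<..real n})"
  have U: "(\<Union>n::nat. {- real n<..real n}) = UNIV"
    by (auto simp: minus_less_iff) (metis le_less_trans reals_Archimedean2 less_imp_le linear max_less_iff_conj)
  have CE: "?C \<subseteq> ?E" by (auto intro!: exI)
  have E: "sets borel = sigma_sets (space borel) ?E"
    by (simp add: borel_Ioc_rat)
  have "sets (borel \<Otimes>\<^sub>M borel) = sets (sigma (space borel \<times> space borel) ?P)"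
  proof (rule sets_pair_eq[where Ca="?C" and Cb="?C"])
    show "?E \<subseteq> Pow (space borel)" by simp
    then show "?E \<subseteq> Pow (space borel)" .
    show "countable ?C" "countable ?C" by simp_all
    show "?C \<subseteq> ?E" "?C \<subseteq> ?E" by (fact CE)+
    show "\<Union>?C = space borel" "\<Union>?C = space borel" using U by simp_all
  qed (rule E)+
  then have gen: "sets (borel \<Otimes>\<^sub>M borel) = sigma_sets UNIV ?P" by (simp add: sets_measure_of)
  show ?thesis
  proof (rule measure_eqI_generator_eq[where E="?P" and \<Omega>=UNIV
        and A="\<lambda>n::nat. {- real n<..real n} \<times> {- real n<..real n}"])
    show "Int_stable ?P"
    proof (rule Int_stableI)
      have E_Int: "I \<inter> J \<in> ?E" if "I \<in> ?E" "J \<in> ?E" for I J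
      proof -
        from that(1) obtain a b :: real where I: "a \<in> \<rat>" "b \<in> \<rat>" "I = {a<..b}" by blast
        from that(2) obtain c d :: real where J: "c \<in> \<rat>" "d \<in> \<rat>" "J = {c<..d}" by blast
        have "I \<inter> J = {max a c<..min b d}" by (auto simp only: I(3) J(3) Int_greaterThanAtMost)
        moreover have "max a c \<in> \<rat>" "min b d \<in> \<rat>" by (simp_all add: max_def min_def I J)
        ultimately show ?thesis by blast
      qed
      fix x y assume "x \<in> ?P" "y \<in> ?P"
      from \<open>x \<in> ?P\<close> obtain I J where x: "x = I \<times> J" "I \<in> ?E" "J \<in> ?E" by blast
      from \<open>y \<in> ?P\<close> obtain I' J' where y: "y = I' \<times> J'" "I' \<in> ?E" "J' \<in> ?E" by blast
      have "x \<inter> y = (I \<inter> I') \<times> (J \<inter> J')" by (simp only: x y Times_Int_Times)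
      with E_Int[OF x(2) y(2)] E_Int[OF x(3) y(3)] show "x \<inter> y \<in> ?P" by blast
    qed
    show "emeasure \<mu> X = emeasure \<kappa> X" if "X \<in> ?P" for X
    proof -
      from that obtain a b c d :: real where "a \<in> \<rat>" "b \<in> \<rat>" "c \<in> \<rat>" "d \<in> \<rat>" "X = {a<..b} \<times> {c<..d}"
        by blast
      then show ?thesis by (simp only: eq)
    qed
    show "sets \<mu> = sigma_sets UNIV ?P" "sets \<kappa> = sigma_sets UNIV ?P"
      using sets gen by simp_all
    show "range (\<lambda>n::nat. {- real n<..real n} \<times> {- real n<..real n}) \<subseteq> ?P"
    proof (rule image_subsetI)
      fix n :: nat
      have "{- real n<..real n} \<in> ?E" using CE by blast
      then show "{- real n<..real n} \<times> {- real n<..real n} \<in> ?P" by blast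
    qed
    show "(\<Union>n::nat. {- real n<..real n} \<times> {- real n<..real n}) = UNIV"
    proof (rule UNIV_eq_I[symmetric])
      fix p :: "real \<times> real"
      obtain n :: nat where "max \<bar>fst p\<bar> \<bar>snd p\<bar> < real n" using reals_Archimedean2 by blast
      then have "p \<in> {- real n<..real n} \<times> {- real n<..real n}"
        by (cases p) (auto simp: abs_less_iff minus_less_iff)
      then show "p \<in> (\<Union>n::nat. {- real n<..real n} \<times> {- real n<..real n})"
        by (rule UN_I[OF UNIV_I])
    qed
    show "emeasure \<mu> ({- real n<..real n} \<times> {- real n<..real n}) \<noteq> \<infinity>" for n :: nat
      using fin[of "- real n" "real n" "- real n" "real n"] by auto
  qed auto
qed

text \<open>Replacing the local time by the null measure wherever it is not locally finite makes it
  a kernel to which Fubini arguments apply.\<close>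

definition locally_finite :: "(real \<Rightarrow> (real \<Rightarrow> real) \<Rightarrow> real measure) \<Rightarrow> (real \<Rightarrow> real) \<Rightarrow> bool" where
  "locally_finite L \<omega> \<longleftrightarrow> (\<forall>n::nat. emeasure (L 0 \<omega>) {- real n..real n} < \<infinity>)"

definition regular :: "(real \<Rightarrow> (real \<Rightarrow> real) \<Rightarrow> real measure) \<Rightarrow> (real \<Rightarrow> real) \<Rightarrow> real measure" where
  "regular L \<omega> = (if locally_finite L \<omega> then L 0 \<omega> else null_measure borel)"

lemma AE_BM_fromD:
  assumes "BM_law P0" "AE \<omega> in BM_from P0 x. Q \<omega>"
  shows "AE \<omega> in P0. Q (raise x \<omega>)"
proof -
  have sets: "sets P0 = sets path_space" using assms(1) by (simp add: BM_law_def)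
  have "raise x \<in> measurable path_space path_space"
    by (rule measurable_raise[of "\<lambda>\<omega>. \<omega>" _ "\<lambda>_. x"]) simp_all
  then have "raise x \<in> measurable P0 path_space"
    unfolding measurable_cong_sets[OF sets refl] .
  moreover have "AE \<omega> in distr P0 path_space (raise x). Q \<omega>"
    using assms(2) unfolding BM_from_def raise_def[abs_def] .
  ultimately show ?thesis by (rule AE_distrD)
qed

context
  fixes P0 L
  assumes P0: "BM_law P0" and L: "local_time P0 L"
begin

lemmas local_time_parts =
  L[unfolded local_time_def, THEN conjunct1, rule_format, unfolded random_measure_def]
  L[unfolded local_time_def, THEN conjunct2, THEN conjunct1]
  L[unfolded local_time_def, THEN conjunct2, THEN conjunct2, THEN conjunct1, rule_format]
  L[unfolded local_time_def, THEN conjunct2, THEN conjunct2, THEN conjunct2, THEN conjunct1]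
  L[unfolded local_time_def, THEN conjunct2, THEN conjunct2, THEN conjunct2, THEN conjunct2, THEN conjunct1]
  L[unfolded local_time_def, THEN conjunct2, THEN conjunct2, THEN conjunct2, THEN conjunct2, THEN conjunct2]

lemma local_timeD:
  shows "\<omega> \<in> space path_space \<Longrightarrow> sets (L 0 \<omega>) = sets borel"
    "C \<in> sets borel \<Longrightarrow> (\<lambda>\<omega>. emeasure (L 0 \<omega>) C) \<in> borel_measurable path_space"
    "AE \<omega> in BM_from P0 x. \<forall>C. compact C \<longrightarrow> emeasure (L 0 \<omega>) C < \<infinity>"
    "AE \<omega> in BM_from P0 x. \<forall>s. emeasure (L 0 \<omega>) {s} = 0"
  using local_time_parts(1)[of 0] local_time_parts(3)[of x] by blast+

lemma L_eq_L_0: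
  assumes "\<omega> \<in> space path_space"
  shows "L y \<omega> = L 0 (raise (- y) \<omega>)"
proof -
  have "raise (- y) \<omega> = (\<lambda>s. \<omega> s - y)" by (simp add: raise_def)
  then show ?thesis using local_time_parts(5) assms by simp
qed

lemma sets_P0': "sets P0 = sets path_space" "space P0 = space path_space"
  using P0 by (auto simp: BM_law_def)

lemma measurable_locally_finite [measurable]: "Measurable.pred path_space (locally_finite L)"
proof -
  have [measurable]: "(\<lambda>\<omega>. emeasure (L 0 \<omega>) {- real n..real n}) \<in> borel_measurable path_space" for n
    by (rule local_timeD(2)) simp
  show ?thesis unfolding locally_finite_def by measurable
qed

lemma AE_locally_finite: "AE \<omega> in P0. locally_finite L (raise x \<omega>)"
proof -
  have "AE \<omega> in P0. \<forall>C. compact C \<longrightarrow> emeasure (L 0 (raise x \<omega>)) C < \<infinity>"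
    by (rule AE_BM_fromD[OF P0 local_timeD(3)])
  then show ?thesis by eventually_elim (simp add: locally_finite_def)
qed

lemma AE_locally_finite_0: "AE \<omega> in P0. locally_finite L \<omega>"
  using AE_locally_finite[of 0] unfolding raise_simps(3) .

lemma regular_kernel: "lf_kernel path_space (regular L)"
  unfolding lf_kernel_def
proof (intro conjI ballI allI)
  fix \<omega> assume \<omega>: "\<omega> \<in> space path_space"
  show "sets (regular L \<omega>) = sets borel" using local_timeD(1)[OF \<omega>] by (simp add: regular_def)
  show "emeasure (regular L \<omega>) {- real n..real n} < \<infinity>" for n
    by (simp add: regular_def locally_finite_def)
next
  fix C :: "real set" assume C: "C \<in> sets borel"
  note local_timeD(2)[OF C, measurable]
  have "(\<lambda>\<omega>. if locally_finite L \<omega> then emeasure (L 0 \<omega>) C else 0) \<in> borel_measurable path_space" by measurable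
  also have "(\<lambda>\<omega>. if locally_finite L \<omega> then emeasure (L 0 \<omega>) C else 0) = (\<lambda>\<omega>. emeasure (regular L \<omega>) C)"
    by (auto simp: regular_def)
  finally show "(\<lambda>\<omega>. emeasure (regular L \<omega>) C) \<in> borel_measurable path_space" .
qed

text \<open>The null set of non-regular paths depends on the level. Exchanging the almost everywhere
  quantifiers gives almost every level for almost every path, enough for integrals over levels
  against Lebesgue measure and against \<nu>.\<close>

lemma AE_levels_regular:
  assumes \<mu>: "sigma_finite_measure \<mu>" "sets \<mu> = sets borel"
  shows "AE \<omega> in P0. AE x in \<mu>. L x \<omega> = regular L (raise (- x) \<omega>)"
proof -
  interpret P: prob_space P0 using P0 by (simp add: BM_law_def two_sided_BM_def)
  interpret \<mu>: sigma_finite_measure \<mu> by fact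
  interpret pair_sigma_finite P0 \<mu> ..
  note sets_P0'(1)[measurable_cong] \<mu>(2)[measurable_cong]
  have "AE x in \<mu>. AE \<omega> in P0. locally_finite L (raise (- x) \<omega>)"
    using AE_locally_finite by simp
  then have "AE \<omega> in P0. AE x in \<mu>. locally_finite L (raise (- x) \<omega>)"
  proof (subst AE_commute)
    show "{p \<in> space (P0 \<Otimes>\<^sub>M \<mu>). locally_finite L (raise (- snd p) (fst p))} \<in> sets (P0 \<Otimes>\<^sub>M \<mu>)"
      by measurable
  qed
  then show ?thesis
    using AE_space
  proof eventually_elim
    case (elim \<omega>)
    then have "\<omega> \<in> space path_space" by (simp add: sets_P0')
    from elim(1) show ?case
      by eventually_elim (simp add: regular_def L_eq_L_0[OF \<open>\<omega> \<in> space path_space\<close>])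
  qed
qed

text \<open>The local time at level \<open>x\<close> is pushed to the line over \<open>x\<close> in
  the plane, so that the occupation formula becomes an identity between measures of boxes.\<close>

lemma occupation_box:
  assumes "A \<in> sets borel" "C \<in> sets borel"
  shows "AE \<omega> in P0. (\<integral>\<^sup>+ s. indicator (A \<times> C) (\<omega> s, s) \<partial>lborel)
    = (\<integral>\<^sup>+ x. emeasure (distr (regular L (raise (- x) \<omega>)) (borel \<Otimes>\<^sub>M borel) (\<lambda>s. (x, s))) (A \<times> C) \<partial>lborel)"
proof -
  define f where "f z = (indicator (A \<times> C) z :: real)" for z :: "real \<times> real"
  have AC: "A \<times> C \<in> sets (borel \<Otimes>\<^sub>M borel)" using assms by simp
  have "(\<lambda>z. ennreal (f z)) \<in> borel_measurable borel" unfolding f_def borel_prod[symmetric] using AC by measurable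
  then have "AE \<omega> in P0. (\<integral>\<^sup>+ s. f (\<omega> s, s) \<partial>lborel) = (\<integral>\<^sup>+ x. (\<integral>\<^sup>+ s. f (x, s) \<partial>L x \<omega>) \<partial>lborel)"
    by (intro local_time_parts(2)[rule_format]) simp
  then show ?thesis
    using AE_levels_regular[OF sigma_finite_lborel sets_lborel] AE_space
  proof eventually_elim
    case (elim \<omega>)
    then have \<omega>: "\<omega> \<in> space path_space" by (simp add: sets_P0')
    have "(\<integral>\<^sup>+ s. indicator (A \<times> C) (\<omega> s, s) \<partial>lborel) = (\<integral>\<^sup>+ s. f (\<omega> s, s) \<partial>lborel)"
      by (intro nn_integral_cong) (simp add: f_def indicator_def)
    also have "\<dots> = (\<integral>\<^sup>+ x. (\<integral>\<^sup>+ s. f (x, s) \<partial>L x \<omega>) \<partial>lborel)" by (rule elim(1))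
    also have "\<dots> = (\<integral>\<^sup>+ x. emeasure (distr (regular L (raise (- x) \<omega>)) (borel \<Otimes>\<^sub>M borel) (\<lambda>s. (x, s))) (A \<times> C) \<partial>lborel)"
    proof (rule nn_integral_cong_AE)
      show "AE x in lborel. (\<integral>\<^sup>+ s. f (x, s) \<partial>L x \<omega>)
        = emeasure (distr (regular L (raise (- x) \<omega>)) (borel \<Otimes>\<^sub>M borel) (\<lambda>s. (x, s))) (A \<times> C)"
        using elim(2)
      proof eventually_elim
        case (elim x)
        have r: "raise (- x) \<omega> \<in> space path_space" using \<omega> by simp
        have sr: "sets (regular L (raise (- x) \<omega>)) = sets borel" using lf_kernelD(1)[OF regular_kernel r] .
        have m: "(\<lambda>s. (x, s)) \<in> measurable (regular L (raise (- x) \<omega>)) (borel \<Otimes>\<^sub>M borel)"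
          by (simp add: measurable_cong_sets[OF sr refl])
        have "emeasure (distr (regular L (raise (- x) \<omega>)) (borel \<Otimes>\<^sub>M borel) (\<lambda>s. (x, s))) (A \<times> C)
          = (\<integral>\<^sup>+ p. indicator (A \<times> C) p \<partial>distr (regular L (raise (- x) \<omega>)) (borel \<Otimes>\<^sub>M borel) (\<lambda>s. (x, s)))"
          using AC by simp
        also have "\<dots> = (\<integral>\<^sup>+ s. indicator (A \<times> C) (x, s) \<partial>regular L (raise (- x) \<omega>))"
          by (rule nn_integral_distr[OF m]) (use AC in simp)
        also have "\<dots> = (\<integral>\<^sup>+ s. f (x, s) \<partial>L x \<omega>)"
          unfolding elim by (intro nn_integral_cong) (simp add: f_def indicator_def)
        finally show ?case ..
      qed
    qed
    finally show ?case .
  qed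
qed

text \<open>Rational boxes are countably many, so one null set serves for all of them. They
  determine the image of Lebesgue time under \<open>s \<mapsto> (\<omega> s, s)\<close>, which is
  finite on boxes because these are bounded in time; all integrands follow at once.\<close>

lemma regular_occupation:
  "AE \<omega> in P0. \<forall>f\<in>borel_measurable (borel \<Otimes>\<^sub>M borel).
      (\<integral>\<^sup>+ s. f (\<omega> s, s) \<partial>lborel) = (\<integral>\<^sup>+ x. \<integral>\<^sup>+ s. f (x, s) \<partial>regular L (raise (- x) \<omega>) \<partial>lborel)"
proof -
  have "AE \<omega> in P0. \<forall>a\<in>\<rat>. \<forall>b\<in>\<rat>. \<forall>c\<in>\<rat>. \<forall>d\<in>\<rat>. (\<integral>\<^sup>+ s. indicator ({a<..b} \<times> {c<..d}) (\<omega> s, s) \<partial>lborel)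
    = (\<integral>\<^sup>+ x. emeasure (distr (regular L (raise (- x) \<omega>)) (borel \<Otimes>\<^sub>M borel) (\<lambda>s. (x, s))) ({a<..b} \<times> {c<..d}) \<partial>lborel)"
    by (intro AE_ball_countable' countable_rat occupation_box) auto
  then show ?thesis
    using AE_space
  proof eventually_elim
    case (elim \<omega>)
    then have \<omega>: "\<omega> \<in> space path_space" by (simp add: sets_P0')
    have wm: "\<omega> \<in> borel_measurable borel"
      using path_continuous[OF \<omega>, of UNIV] by (intro borel_measurable_continuous_onI)
    define \<kappa> where "\<kappa> x = distr (regular L (raise (- x) \<omega>)) (borel \<Otimes>\<^sub>M borel) (\<lambda>s. (x, s))" for x :: real
    have lf: "lf_kernel lborel (\<lambda>x. regular L (raise (- x) \<omega>))"
      by (rule lf_kernel_compose[OF regular_kernel]) (use \<omega> in measurable)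
    have rm: "measurable (regular L (raise (- x) \<omega>)) N = measurable borel N" for x and N :: "'c measure"
      using lf_kernelD(1)[OF lf, of x] by (intro measurable_cong_sets) auto
    have rs: "space (regular L (raise (- x) \<omega>)) = UNIV" for x
      using sets_eq_imp_space_eq[OF lf_kernelD(1)[OF lf, of x]] by simp
    have \<kappa>m: "(\<lambda>x. emeasure (\<kappa> x) Q) \<in> borel_measurable lborel" if Q: "Q \<in> sets (borel \<Otimes>\<^sub>M borel)" for Q
    proof -
      have "(\<lambda>x. emeasure (regular L (raise (- x) \<omega>)) {s. (x, s) \<in> Q}) \<in> borel_measurable lborel"
        by (rule lf_kernel_emeasure_section[OF lf]) (use Q in \<open>simp cong: sets_pair_measure_cong\<close>)
      moreover have "emeasure (\<kappa> x) Q = emeasure (regular L (raise (- x) \<omega>)) {s. (x, s) \<in> Q}" for x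
        unfolding \<kappa>_def using Q by (subst emeasure_distr) (auto simp: rm rs vimage_def)
      ultimately show ?thesis by simp
    qed
    define \<mu>1 where "\<mu>1 = distr lborel (borel \<Otimes>\<^sub>M borel) (\<lambda>s. (\<omega> s, s))"
    define \<mu>2 where "\<mu>2 = mixture lborel \<kappa> (borel \<Otimes>\<^sub>M borel)"
    have m1: "(\<lambda>s. (\<omega> s, s)) \<in> measurable lborel (borel \<Otimes>\<^sub>M borel)" using wm by simp
    have box: "{a<..b} \<times> {c<..d} \<in> sets (borel \<Otimes>\<^sub>M borel)" for a b c d :: real by simp
    have e1: "emeasure \<mu>1 ({a<..b} \<times> {c<..d}) = (\<integral>\<^sup>+ s. indicator ({a<..b} \<times> {c<..d}) (\<omega> s, s) \<partial>lborel)" for a b c d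
    proof -
      have "emeasure \<mu>1 ({a<..b} \<times> {c<..d}) = (\<integral>\<^sup>+ p. indicator ({a<..b} \<times> {c<..d}) p \<partial>\<mu>1)"
        using box by (simp add: \<mu>1_def)
      also have "\<dots> = (\<integral>\<^sup>+ s. indicator ({a<..b} \<times> {c<..d}) (\<omega> s, s) \<partial>lborel)"
        unfolding \<mu>1_def by (rule nn_integral_distr[OF m1]) (use box in simp)
      finally show ?thesis .
    qed
    have "\<mu>1 = \<mu>2"
    proof (rule measure_eqI_Ioc_rat_pair)
      show "sets \<mu>1 = sets (borel \<Otimes>\<^sub>M borel)" "sets \<mu>2 = sets (borel \<Otimes>\<^sub>M borel)"
        by (simp_all add: \<mu>1_def \<mu>2_def)
      fix a b c d :: real
      show "emeasure \<mu>1 ({a<..b} \<times> {c<..d}) < \<infinity>"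
      proof -
        have "emeasure \<mu>1 ({a<..b} \<times> {c<..d}) \<le> (\<integral>\<^sup>+ s. indicator {c<..d} s \<partial>lborel)"
          unfolding e1 by (intro nn_integral_mono) (auto simp: indicator_def)
        also have "\<dots> < \<infinity>" by (cases "c \<le> d") auto
        finally show ?thesis .
      qed
      assume r: "a \<in> \<rat>" "b \<in> \<rat>" "c \<in> \<rat>" "d \<in> \<rat>"
      have "emeasure \<mu>2 ({a<..b} \<times> {c<..d}) = (\<integral>\<^sup>+ x. emeasure (\<kappa> x) ({a<..b} \<times> {c<..d}) \<partial>lborel)"
        unfolding \<mu>2_def by (rule emeasure_mixture[OF _ \<kappa>m box]) (simp_all add: \<kappa>_def)
      then show "emeasure \<mu>1 ({a<..b} \<times> {c<..d}) = emeasure \<mu>2 ({a<..b} \<times> {c<..d})"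
        using elim(1) r by (simp add: e1 \<kappa>_def)
    qed
    show ?case
    proof
      fix f :: "real \<times> real \<Rightarrow> ennreal" assume f: "f \<in> borel_measurable (borel \<Otimes>\<^sub>M borel)"
      have "(\<integral>\<^sup>+ s. f (\<omega> s, s) \<partial>lborel) = (\<integral>\<^sup>+ p. f p \<partial>\<mu>1)"
        unfolding \<mu>1_def using f by (subst nn_integral_distr[OF m1]) auto
      also have "\<dots> = (\<integral>\<^sup>+ p. f p \<partial>\<mu>2)" by (simp only: \<open>\<mu>1 = \<mu>2\<close>)
      also have "\<dots> = (\<integral>\<^sup>+ x. \<integral>\<^sup>+ p. f p \<partial>\<kappa> x \<partial>lborel)"
        unfolding \<mu>2_def by (rule nn_integral_mixture[OF _ \<kappa>m f]) (simp_all add: \<kappa>_def)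
      also have "\<dots> = (\<integral>\<^sup>+ x. \<integral>\<^sup>+ s. f (x, s) \<partial>regular L (raise (- x) \<omega>) \<partial>lborel)"
        unfolding \<kappa>_def using f by (intro nn_integral_cong nn_integral_distr) (auto simp: rm)
      finally show "(\<integral>\<^sup>+ s. f (\<omega> s, s) \<partial>lborel) = (\<integral>\<^sup>+ x. \<integral>\<^sup>+ s. f (x, s) \<partial>regular L (raise (- x) \<omega>) \<partial>lborel)" .
    qed
  qed
qed

lemma regular_bm_local_time: "bm_local_time P0 (regular L)"
proof
  show "BM_law P0" by (rule P0)
  show "lf_kernel path_space (regular L)" by (rule regular_kernel)
  show "AE \<omega> in P0. \<forall>s. emeasure (regular L (raise x \<omega>)) {s} = 0" for x
    using AE_BM_fromD[OF P0 local_timeD(4)[of x]] by eventually_elim (simp add: regular_def)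
  show "AE \<omega> in P0. emeasure (regular L (shift_path t (raise x \<omega>))) {s. s + t \<in> C} = emeasure (regular L (raise x \<omega>)) C"
    if C: "C \<in> sets borel" for t x C
  proof -
    have inv: "AE \<omega> in P0. emeasure (L 0 (shift_path t (raise x \<omega>))) {s. s + t \<in> B} = emeasure (L 0 (raise x \<omega>)) B"
      if "B \<in> sets borel" for B
      by (rule AE_BM_fromD[OF P0]) (rule local_time_parts(4)[rule_format, OF that])
    \<comment> \<open>The regularisation could become the null measure at the shifted path. Shift
      invariance on countably many intervals carries local finiteness from the path to its shift and
      excludes this.\<close>
    have "AE \<omega> in P0. \<forall>n::nat. emeasure (L 0 (shift_path t (raise x \<omega>))) {s. s + t \<in> {- real n + t..real n + t}}
      = emeasure (L 0 (raise x \<omega>)) {- real n + t..real n + t}"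
      unfolding AE_all_countable by (intro allI inv atLeastAtMost_borel)
    then show ?thesis
      using inv[OF C] AE_locally_finite[of x] AE_space
    proof eventually_elim
      case (elim \<omega>)
      then have "raise x \<omega> \<in> space path_space" by (simp add: sets_P0')
      then have fin: "emeasure (L 0 (raise x \<omega>)) {a..b} < \<infinity>" for a b
        using lf_kernel_finite_Icc[OF regular_kernel, of "raise x \<omega>" a b] elim(3) by (simp only: regular_def if_True)
      have "{s. s + t \<in> {- real n + t..real n + t}} = {- real n..real n}" for n by auto
      then have "locally_finite L (shift_path t (raise x \<omega>))"
        unfolding locally_finite_def using elim(1) fin by metis
      then show ?case using elim(2,3) by (simp only: regular_def if_True)
    qed
  qed
  show "emeasure (regular L \<omega>) {t. \<omega> t \<noteq> 0} = 0" if \<omega>: "\<omega> \<in> space path_space" for \<omega>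
  proof -
    have "{t. \<omega> t \<noteq> 0} \<in> sets borel"
      using path_continuous[OF \<omega>, of UNIV] by (intro borel_open open_Collect_neq continuous_intros)
    then show ?thesis
      using local_time_parts(6)[rule_format, OF \<omega>, of 0] local_timeD(1)[OF \<omega>] by (simp add: regular_def)
  qed
  show "AE \<omega> in P0. \<forall>f\<in>borel_measurable (borel \<Otimes>\<^sub>M borel).
      (\<integral>\<^sup>+ s. f (\<omega> s, s) \<partial>lborel) = (\<integral>\<^sup>+ x. \<integral>\<^sup>+ s. f (x, s) \<partial>regular L (raise (- x) \<omega>) \<partial>lborel)"
    by (rule regular_occupation)
qed

end

theorem theorem7p6:
  fixes P0 :: "(real \<Rightarrow> real) measure"
    and L :: "real \<Rightarrow> (real \<Rightarrow> real) \<Rightarrow> real measure"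
    and \<nu> :: "real measure"
  assumes "BM_law P0"
    and "local_time P0 L"
    and "prob_space \<nu>" and "sets \<nu> = sets borel"
    and "emeasure \<nu> {0} = 0"
  shows "minimal_unbiased_shift_AE P0 (T_nu L \<nu>)"
proof -
  interpret bm_local_time P0 "regular L"
    by (rule regular_bm_local_time) fact+
  interpret bm_target P0 "regular L" \<nu>
    by (intro bm_target.intro bm_target_axioms.intro bm_local_time_axioms assms(3-5))
  \<comment> \<open>For almost every path the given and the regularised local times agree at level 0
    and at \<nu>-almost every level, so the two infima are the same.\<close>
  have "AE \<omega> in P0. T_nu L \<nu> \<omega> = ereal (T \<omega>)"
    using AE_first_zero AE_locally_finite_0[OF assms(1,2)]
      AE_levels_regular[OF assms(1,2) \<nu>.sigma_finite_measure assms(4)] AE_space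
  proof eventually_elim
    case (elim \<omega>)
    then have \<omega>: "\<omega> \<in> space path_space" by simp
    have "mixed_local_time L \<nu> \<omega> {0..t} = emeasure (\<eta> \<omega>) {0..t}" for t
      unfolding mixed_local_time_def emeasure_eta[OF \<omega> atLeastAtMost_borel]
      using elim(3) by (intro nn_integral_cong_AE) (auto elim!: eventually_mono)
    then show ?case
      using elim(1,2) by (simp add: T_nu_def regular_def)
  qed
  moreover from this have "minimal_unbiased_shift P0 T'"
    if "T' \<in> borel_measurable path_space" "AE \<omega> in P0. T_nu L \<nu> \<omega> = ereal (T' \<omega>)" for T'
    using that(2) by (intro minimal_unbiased_shift_T that(1)) (auto elim: eventually_elim2)
  ultimately show ?thesis
    unfolding minimal_unbiased_shift_AE_def using measurable_T by blast
qed

end
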